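(* Let $f,g\in F$, where $F$ is Thompson's group. Then $f$ and $g$ are conjugate in $F$ if and only if $$(\Sigma_f,\Delta_f)=(\Sigma_g,\Delta_g),$$ where $\Sigma$ and $\Delta$ are the quantities defined in the context.
   Context: **Groups.** For an open interval $(a,b)$, $\mathrm{PL}^+(a,b)$ is the group (under composition) of piecewise linear order-preserving homeomorphisms of $(a,b)$ with finitely many nodes, where a node of $f$ is a point at which $f$ is not locally affine. Thompson's group $F$ is the subgroup of $\mathrm{PL}^+(0,1)$ of those $f$ all of whose nodes lie in $\mathbb{Z}[\frac12]$ and for which $f'(x)$ is an integer power of $2$ whenever $x$ is not a node. Dyadic means lying in $\mathbb{Z}[\frac12]$. For a piecewise linear map $k$ from one interval $(a,b)$ to another, the initial slope of $k$ is its derivative at any point between $a$ and the first node, and the final slope is its derivative at any point between the last node and $b$. **Intervals.** For $f\in\mathrm{PL}^+(0,1)$ let $\epsilon_f(x)=1,0,-1$ according as $f(x)>x$, $f(x)=x$, $f(x)<x$, and let $\mathrm{fix}(f)$ be the set of fixed points of $f$ in $(0,1)$. Let $I_1,\dots,I_m$, with $I_j=(p_{j-1},p_j)$, $p_0=0$, $p_m=1$, be the connected components, from left to right, of $(0,1)$ minus the topological boundary of $\mathrm{fix}(f)$ in $(0,1)$; $\epsilon_f$ is constant on each $I_j$. $I_j$ is a bump domain of $f$ if $\epsilon_f\ne0$ on $I_j$. **The quantity $\Sigma_f=(\Sigma_1,\Sigma_2,\Sigma_3)$.** * $\Sigma_1=(\epsilon_f(x_1),\dots,\epsilon_f(x_m))$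 with $x_i\in I_i$. * $\Sigma_2$ is the ordered list, with one entry per bump domain $I_j$, of the initial slope of $f$ in $I_j$. * $\Sigma_3$ is the ordered list, with one entry per bump domain, of equivalence classes of finite functions. A finite function is a function $[0,1)\to\mathbb{R}^+$ equal to $1$ at all but finitely many points; $c_1,c_2$ are equivalent if $c_1=c_2\circ\rho$ for some translation $\rho$ of $[0,1)$ modulo $1$. Suppose first that $f(x)>x$ on $I_j$. For $x\in I_j$ put $f^*(x)=f'_+(x)/f'_-(x)$ (ratio of right to left derivative) and $\phi_{f,j}(x)=\prod_{n=-\infty}^{\infty}f^*(f^n(x))$ (only finitely many factors differ from $1$). Let $p$ be the smallest node of $f$ in $I_j$ and $p_*$ the smallest node of $f$ in $I_j$ with $\phi_{f,j}(p_* )\neq1$ (such a node exists). For $s\in[0,1)$ put $\psi_{f,j}(s)=\phi_{f,j}(\lambda^s(r-p_{j-1})+p_{j-1})$, where $\lambda$ is the initial slope of $f$ in $I_j$ and $r$ is any point of $(p_{j-1},p)$ of the form $r=f^n(p_* )$ with $n$ a negative integer. The entry of $\Sigma_3$ for $I_j$ is the class $[\psi_{f,j}]$. If $f(x)<x$ on $I_j$, the entry is $[\psi_{f^{-1},j}]$ (with $\lambda$, $p$, $p_*$ taken for $f^{-1}$). **Minimum cornered function.** Let $D=(a,b)$ be a bump domain of $f$. A cornered function in $\mathrm{PL}^+(a,b)$ is an $l\in\mathrm{PL}^+(a,b)$ such that either $l(y)>y$ for all $y\in(a,b)$ and there is $x\in(a,b)$ with all nodes of $l$ in $(x,l(x))$,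 or $l(y)<y$ for all $y\in(a,b)$ and there is $x\in(a,b)$ with all nodes of $l$ in $(l(x),x)$. Such an $l$ corresponds to the finite function $c$ if $\psi_l=c$, where $\psi_l$ is defined as follows. If $l(y)>y$ on $(a,b)$, put $l^*(x)=l'_+(x)/l'_-(x)$ and $\phi_l(x)=\prod_{n=-\infty}^{\infty}l^*(l^n(x))$ for $x\in(a,b)$, let $q$ be the smallest node of $l$ in $(a,b)$ and $q_*$ the smallest node of $l$ in $(a,b)$ with $\phi_l(q_* )\ne1$, and put $\psi_l(s)=\phi_l(\lambda^s(r-a)+a)$ for $s\in[0,1)$, where $\lambda$ is the initial slope of $l$ and $r$ is any point of $(a,q)$ of the form $r=l^n(q_* )$ with $n$ a negative integer. If $l(y)<y$ on $(a,b)$, put $\psi_l=\psi_{l^{-1}}$. For a given initial slope there is a unique cornered function in $\mathrm{PL}^+(a,b)$ corresponding to a given such $c$. Let $[c]$ be the entry of $\Sigma_3$ for $D$ and let $C=\{c_1\in[c]: c_1(0)\ne1\}$. For distinct $c_1,c_2\in C$, let $x$ be the smallest value with $c_1(x)\ne c_2(x)$, and write $c_1<c_2$ if $c_1(x)<c_2(x)$. Let $c_m$ be the minimum of $C$. The minimum cornered function associated with $f$ over $D$ is the cornered function in $\mathrm{PL}^+(a,b)$ that corresponds to $c_m$ and whose initial slope is the entry of $\Sigma_2$ for $D$. **The quantity $\Delta_f$ (for $f\in F$).** A bump chain of $f$ is a run of consecutive intervals $I_t,I_{t+1},\dots,I_u$, all bump domains, such that of the points $p_{t-1},p_t,\dots,p_u$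 exactly $p_{t-1}$ and $p_u$ are dyadic. Let $D_1,\dots,D_s$ be a bump chain, $D_j=(a_j,b_j)$, $w_j=b_j-a_j$, $f_j=f|_{D_j}$. It is known (Brin and Squier) that the centralizer of $f_j$ in $\mathrm{PL}^+(a_j,b_j)$ is infinite cyclic, generated by a root $\widehat{f_j}$ of $f_j$; let $\lambda_j$ and $\mu_j$ be the initial and final slopes of $\widehat{f_j}$. Let $k_j\in\mathrm{PL}^+(a_j,b_j)$ be any element such that $k_jf_jk_j^{-1}$ is the minimum cornered function associated with $f$ over $D_j$, and let $\alpha_j$ and $\beta_j$ be the initial and final slopes of $k_j$. Define an equivalence relation on $\mathbb{R}^s$ by $(x_1,\dots,x_s)\sim(y_1,\dots,y_s)$ if and only if there are integers $m,n_1,\dots,n_s$ with $$2^mx_1=\lambda_1^{n_1}y_1,\qquad \mu_{i-1}^{n_{i-1}}x_i=\lambda_i^{n_i}y_i\quad(i=2,\dots,s).$$ Assign to the chain the equivalence class of $$\left(\frac{\alpha_1}{w_1},\ \frac{\alpha_2}{w_2}\frac{w_1}{\beta_1},\ \dots,\ \frac{\alpha_s}{w_s}\frac{w_{s-1}}{\beta_{s-1}}\right).$$ $\Delta_f$ is the ordered list (left to right) of these equivalence classes, one per bump chain of $f$. *)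

theory Defs
  imports "HOL-Analysis.Analysis" "HOL-Library.Groups_Big_Fun"
begin

section \<open>The groups\<close>

text \<open>
  A homeomorphism of the open interval \<open>(a,b)\<close> is represented by its extension by the identity to
  all of \<open>\<real>\<close>. Distinct homeomorphisms thus are distinct functions, and the group
  operations are \<open>\<circ>\<close> and \<open>inv\<close>.
\<close>

definition nodes :: "real \<Rightarrow> real \<Rightarrow> (real \<Rightarrow> real) \<Rightarrow> real set" where
  "nodes a b f = {x \<in> {a<..<b}. \<not> (\<exists>c d. \<forall>\<^sub>F y in nhds x. f y = c * y + d)}"

definition PL :: "real \<Rightarrow> real \<Rightarrow> (real \<Rightarrow> real) set" where
  "PL a b = {f. (\<exists>g. homeomorphism {a<..<b} {a<..<b} f g) \<and> strict_mono_on {a<..<b} f \<and>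
                finite (nodes a b f) \<and> (\<forall>x. x \<notin> {a<..<b} \<longrightarrow> f x = x)}"

definition dyadic :: "real set" where
  "dyadic = {x. \<exists>(k::int) (n::nat). x = real_of_int k / 2 ^ n}"

definition thompson_F :: "(real \<Rightarrow> real) set" where
  "thompson_F = {f \<in> PL 0 1. nodes 0 1 f \<subseteq> dyadic \<and>
     (\<forall>x \<in> {0<..<1} - nodes 0 1 f. \<exists>k::int. (f has_real_derivative 2 powi k) (at x))}"

definition zpow :: "(real \<Rightarrow> real) \<Rightarrow> int \<Rightarrow> (real \<Rightarrow> real)" where
  "zpow f n = (if 0 \<le> n then f ^^ nat n else inv f ^^ nat (- n))"

definition initial_slope :: "real \<Rightarrow> real \<Rightarrow> (real \<Rightarrow> real) \<Rightarrow> real" where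
  "initial_slope a b k =
     (THE d. \<forall>x \<in> {a<..<b}. (\<forall>p \<in> nodes a b k. x < p) \<longrightarrow> (k has_real_derivative d) (at x))"

definition final_slope :: "real \<Rightarrow> real \<Rightarrow> (real \<Rightarrow> real) \<Rightarrow> real" where
  "final_slope a b k =
     (THE d. \<forall>x \<in> {a<..<b}. (\<forall>p \<in> nodes a b k. p < x) \<longrightarrow> (k has_real_derivative d) (at x))"


section \<open>The intervals \<open>I\<^sub>j\<close>\<close>

definition eps :: "(real \<Rightarrow> real) \<Rightarrow> real \<Rightarrow> int" where
  "eps f x = (if f x > x then 1 else if f x = x then 0 else - 1)"

definition fixset :: "(real \<Rightarrow> real) \<Rightarrow> real set" where
  "fixset f = {x \<in> {0<..<1}. f x = x}"

text \<open>The interval \<open>I\<^sub>j = (p\<^bsub>j-1\<^esub>, p\<^sub>j)\<close> is represented by the pair of its end points.\<close>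

definition intervals :: "(real \<Rightarrow> real) \<Rightarrow> (real \<times> real) list" where
  "intervals f = map (\<lambda>I. (Inf I, Sup I))
     (sorted_key_list_of_set Inf
       (components ({0<..<1} - top_of_set {0<..<1} frontier_of fixset f)))"

definition bump_domain :: "(real \<Rightarrow> real) \<Rightarrow> real \<times> real \<Rightarrow> bool" where
  "bump_domain f = (\<lambda>(a, b). \<forall>x \<in> {a<..<b}. eps f x \<noteq> 0)"

definition bump_domains :: "(real \<Rightarrow> real) \<Rightarrow> (real \<times> real) list" where
  "bump_domains f = filter (bump_domain f) (intervals f)"


section \<open>Finite functions\<close>

definition finite_functions :: "(real \<Rightarrow> real) set" where
  "finite_functions = {c \<in> {0..<1} \<rightarrow>\<^sub>E {0<..}. finite {s \<in> {0..<1}. c s \<noteq> 1}}"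

definition ff_equiv :: "((real \<Rightarrow> real) \<times> (real \<Rightarrow> real)) set" where
  "ff_equiv = {(c1, c2). c1 \<in> finite_functions \<and> c2 \<in> finite_functions \<and>
     (\<exists>t::real. c1 = (\<lambda>s\<in>{0..<1}. c2 (frac (s + t))))}"

definition ff_less :: "(real \<Rightarrow> real) \<Rightarrow> (real \<Rightarrow> real) \<Rightarrow> bool" where
  "ff_less c1 c2 \<longleftrightarrow> (\<exists>x \<in> {0..<1}. (\<forall>y \<in> {0..<x}. c1 y = c2 y) \<and> c1 x < c2 x)"


section \<open>The quantity \<open>\<Sigma>\<close>\<close>

definition right_deriv :: "(real \<Rightarrow> real) \<Rightarrow> real \<Rightarrow> real" where
  "right_deriv f x = (THE d. (f has_real_derivative d) (at_right x))"

definition left_deriv :: "(real \<Rightarrow> real) \<Rightarrow> real \<Rightarrow> real" where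
  "left_deriv f x = (THE d. (f has_real_derivative d) (at_left x))"

definition slope_ratio :: "(real \<Rightarrow> real) \<Rightarrow> real \<Rightarrow> real" where
  "slope_ratio f x = right_deriv f x / left_deriv f x"

definition phi :: "(real \<Rightarrow> real) \<Rightarrow> real \<Rightarrow> real" where
  "phi f x = Prod_any (\<lambda>n::int. slope_ratio f (zpow f n x))"

text \<open>
  \<open>psi_up\<close> is for maps above the diagonal on \<open>(a,b)\<close>. Its value does not depend on
  the choice of \<open>r\<close>: near \<open>a\<close> the map \<open>f\<close> is \<open>x \<mapsto> l * (x - a) + a\<close>, and \<open>phi f\<close> is
  \<open>f\<close>-invariant.
\<close>

definition psi_up :: "real \<Rightarrow> real \<Rightarrow> (real \<Rightarrow> real) \<Rightarrow> (real \<Rightarrow> real)" where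
  "psi_up a b f =
     (let l = initial_slope a b f;
          p = Min (nodes a b f);
          p' = Min {x \<in> nodes a b f. phi f x \<noteq> 1};
          r = (SOME r. r \<in> {a<..<p} \<and> (\<exists>n<0. r = zpow f n p'))
      in (\<lambda>s\<in>{0..<1}. phi f (l powr s * (r - a) + a)))"

definition psi :: "real \<Rightarrow> real \<Rightarrow> (real \<Rightarrow> real) \<Rightarrow> (real \<Rightarrow> real)" where
  "psi a b f = (if \<forall>x \<in> {a<..<b}. f x > x then psi_up a b f else psi_up a b (inv f))"

definition psi_class :: "real \<Rightarrow> real \<Rightarrow> (real \<Rightarrow> real) \<Rightarrow> (real \<Rightarrow> real) set" where
  "psi_class a b f = ff_equiv `` {psi a b f}"

text \<open>\<open>eps f\<close> is constant on each interval, so any sample point, here the midpoint, gives the same value.\<close>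

definition Sigma1 :: "(real \<Rightarrow> real) \<Rightarrow> int list" where
  "Sigma1 f = map (\<lambda>(a, b). eps f ((a + b) / 2)) (intervals f)"

definition Sigma2 :: "(real \<Rightarrow> real) \<Rightarrow> real list" where
  "Sigma2 f = map (\<lambda>(a, b). initial_slope a b f) (bump_domains f)"

definition Sigma3 :: "(real \<Rightarrow> real) \<Rightarrow> (real \<Rightarrow> real) set list" where
  "Sigma3 f = map (\<lambda>(a, b). psi_class a b f) (bump_domains f)"

definition Sigma_inv ::
  "(real \<Rightarrow> real) \<Rightarrow> int list \<times> real list \<times> (real \<Rightarrow> real) set list" where
  "Sigma_inv f = (Sigma1 f, Sigma2 f, Sigma3 f)"


section \<open>The minimum cornered function\<close>

definition cornered :: "real \<Rightarrow> real \<Rightarrow> (real \<Rightarrow> real) \<Rightarrow> bool" where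
  "cornered a b l \<longleftrightarrow> l \<in> PL a b \<and>
     ((\<forall>y \<in> {a<..<b}. l y > y) \<and> (\<exists>x \<in> {a<..<b}. nodes a b l \<subseteq> {x<..<l x}) \<or>
      (\<forall>y \<in> {a<..<b}. l y < y) \<and> (\<exists>x \<in> {a<..<b}. nodes a b l \<subseteq> {l x<..<x}))"

definition min_finite_function :: "(real \<Rightarrow> real) set \<Rightarrow> (real \<Rightarrow> real)" where
  "min_finite_function A =
     (let C = {c \<in> A. c 0 \<noteq> 1} in THE c. c \<in> C \<and> (\<forall>d \<in> C. d \<noteq> c \<longrightarrow> ff_less c d))"

definition min_cornered :: "real \<Rightarrow> real \<Rightarrow> (real \<Rightarrow> real) \<Rightarrow> (real \<Rightarrow> real)" where
  "min_cornered a b f =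
     (THE l. cornered a b l \<and> psi a b l = min_finite_function (psi_class a b f) \<and>
             initial_slope a b l = initial_slope a b f)"


section \<open>The quantity \<open>\<Delta>\<close>\<close>

definition bump_chain :: "(real \<Rightarrow> real) \<Rightarrow> (real \<times> real) list \<Rightarrow> bool" where
  "bump_chain f Ds \<longleftrightarrow> Ds \<noteq> [] \<and> (\<forall>D \<in> set Ds. bump_domain f D) \<and>
     fst (hd Ds) \<in> dyadic \<and> snd (last Ds) \<in> dyadic \<and>
     (\<forall>D \<in> set (butlast Ds). snd D \<notin> dyadic)"

text \<open>
  Since no interior end point of a chain is dyadic, a chain is determined by its first interval, so
  that listing the runs \<open>t..u\<close> lexicographically lists the chains from left to right.
\<close>

definition bump_chains :: "(real \<Rightarrow> real) \<Rightarrow> (real \<times> real) list list" where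
  "bump_chains f = filter (bump_chain f)
     [map ((!) (intervals f)) [t..<Suc u].
        t \<leftarrow> [0..<length (intervals f)], u \<leftarrow> [t..<length (intervals f)]]"

definition centralizer :: "real \<Rightarrow> real \<Rightarrow> (real \<Rightarrow> real) \<Rightarrow> (real \<Rightarrow> real) set" where
  "centralizer a b f = {h \<in> PL a b. h \<circ> f = f \<circ> h}"

definition restr :: "(real \<Rightarrow> real) \<Rightarrow> real \<Rightarrow> real \<Rightarrow> (real \<Rightarrow> real)" where
  "restr f a b = override_on id f {a<..<b}"

definition root_gen :: "real \<Rightarrow> real \<Rightarrow> (real \<Rightarrow> real) \<Rightarrow> (real \<Rightarrow> real)" where
  "root_gen a b f =
     (SOME h. h \<in> PL a b \<and> centralizer a b (restr f a b) = range (zpow h) \<and>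
              (\<exists>n>0. h ^^ n = restr f a b))"

definition conjugator :: "real \<Rightarrow> real \<Rightarrow> (real \<Rightarrow> real) \<Rightarrow> (real \<Rightarrow> real)" where
  "conjugator a b f =
     (SOME k. k \<in> PL a b \<and> k \<circ> restr f a b \<circ> inv k = min_cornered a b f)"

text \<open>
  \<open>\<real>\<^sup>s\<close> is modelled by the lists of length \<open>s\<close>, indexed from \<open>0\<close>, where \<open>s\<close> is the length of the
  chain \<open>Ds\<close>; the length of the members of a class thus records \<open>s\<close>.
\<close>

definition chain_rel ::
  "(real \<Rightarrow> real) \<Rightarrow> (real \<times> real) list \<Rightarrow> (real list \<times> real list) set" where
  "chain_rel f Ds =
     (let s = length Ds;
          l = (\<lambda>i. case Ds ! i of (a, b) \<Rightarrow> initial_slope a b (root_gen a b f));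
          u = (\<lambda>i. case Ds ! i of (a, b) \<Rightarrow> final_slope a b (root_gen a b f))
      in {(x, y). length x = s \<and> length y = s \<and>
            (\<exists>(m::int) (n :: nat \<Rightarrow> int).
               2 powi m * x ! 0 = l 0 powi n 0 * y ! 0 \<and>
               (\<forall>i \<in> {1..<s}. u (i - 1) powi n (i - 1) * x ! i = l i powi n i * y ! i))})"

definition chain_vec :: "(real \<Rightarrow> real) \<Rightarrow> (real \<times> real) list \<Rightarrow> real list" where
  "chain_vec f Ds =
     (let w = (\<lambda>i. case Ds ! i of (a, b) \<Rightarrow> b - a);
          al = (\<lambda>i. case Ds ! i of (a, b) \<Rightarrow> initial_slope a b (conjugator a b f));
          be = (\<lambda>i. case Ds ! i of (a, b) \<Rightarrow> final_slope a b (conjugator a b f))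
      in map (\<lambda>i. if i = 0 then al 0 / w 0 else (al i / w i) * (w (i - 1) / be (i - 1)))
           [0..<length Ds])"

definition Delta_inv :: "(real \<Rightarrow> real) \<Rightarrow> real list set list" where
  "Delta_inv f = map (\<lambda>Ds. chain_rel f Ds `` {chain_vec f Ds}) (bump_chains f)"

end

theory Submission
  imports Defs
begin

text \<open>
  The conjugacy class of a bump is controlled by a normal form. Conjugating \<open>f\<close> above the diagonal by
  a piecewise linear map whose slope ratio at \<open>y\<close> is the product of the slope ratios of \<open>f\<close> along the
  forward orbit of \<open>y\<close> pushes all nodes into one fundamental domain, where the slope ratios become the
  values of \<open>phi f\<close>. The result is cornered, and a cornered map is recovered from its initial slope and
  its finite function, since a piecewise linear map is determined by its germ at one point and its
  slope ratios. Hence two bumps are conjugate if and only if they have the same slope and the same class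
  of finite functions, and the conjugating maps between them form a single coset of the centralizer.
  The centralizer is cyclic: in a logarithmic coordinate at the left end point it acts by rotations
  that preserve the finite set where the finite function differs from \<open>1\<close>.

  A conjugating map \<open>h\<close> of a bump satisfies \<open>h = g\<^sup>n h f\<^sup>-\<^sup>n\<close>, so it has dyadic nodes and slopes that
  are powers of \<open>2\<close> as soon as it does so near the left end point. An end point that is not dyadic
  cannot be a node of an element of \<open>F\<close>, so there the slopes of the two adjacent pieces have to
  agree, while at a dyadic end point they only have to be powers of \<open>2\<close>. These slope conditions along a bump
  chain say exactly that the vectors in \<open>\<Delta>\<close> are equivalent.
\<close>

section \<open>Piecewise linear germs\<close>

text \<open>The finite function of a bump is defined only up to rotation, because it depends on
  where the fundamental domain starts. Its least rotation singles out one cornered map in the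
  conjugacy class, and with it a conjugator \<open>k\<close> that is fixed up to the centralizer.
  Normal forms with equal data on intervals of lengths \<open>w\<close> and \<open>w'\<close> differ
  by the affine rescaling \<open>A\<close>, so every conjugating map of the bump is
  \<open>inv k' \<circ> A \<circ> k \<circ> r\<close> with \<open>r\<close> a power of the root. Its
  end slopes are \<open>\<alpha>/\<alpha>' * (w'/w) * \<lambda> powi n\<close> and
  \<open>\<beta>/\<beta>' * (w'/w) * \<mu> powi n\<close>. This is the origin of the factors in
  \<Delta>; the exponents are the only freedom left for matching slopes. An obstacle is arithmetic:
  a slope that is a power of 2 does not make an affine piece preserve dyadic numbers. Its offset has
  to be controlled too, and handed from interval to interval across nondyadic points. Intervals of
  fixed points have dyadic ends, so they interrupt the chains. Since \<Delta> lists only the chains,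
  their positions have to be recovered from their lengths.\<close>

text \<open>
  The value \<open>v\<close> is the one-sided limit at \<open>x\<close> and may differ from \<open>h x\<close>: at the end points of its
  domain the value of a map is arbitrary.
\<close>

definition rgerm :: "(real \<Rightarrow> real) \<Rightarrow> real \<Rightarrow> real \<Rightarrow> real \<Rightarrow> bool" where
  "rgerm h x v d \<longleftrightarrow> 0 < d \<and> (\<forall>\<^sub>F y in at_right x. h y = v + d * (y - x))"

definition lgerm :: "(real \<Rightarrow> real) \<Rightarrow> real \<Rightarrow> real \<Rightarrow> real \<Rightarrow> bool" where
  "lgerm h x v c \<longleftrightarrow> 0 < c \<and> (\<forall>\<^sub>F y in at_left x. h y = v + c * (y - x))"

text \<open>Anchoring both germs at \<open>h x\<close> makes \<open>h\<close> continuous at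
  \<open>x\<close>. The left slope comes first, and \<open>x\<close> is a node exactly when the two
  slopes differ.\<close>

definition pl_at :: "(real \<Rightarrow> real) \<Rightarrow> real \<Rightarrow> real \<Rightarrow> real \<Rightarrow> bool" where
  "pl_at h x c d \<longleftrightarrow> lgerm h x (h x) c \<and> rgerm h x (h x) d"

lemma rgerm_pos: "rgerm h x v d \<Longrightarrow> 0 < d" and lgerm_pos: "lgerm h x v c \<Longrightarrow> 0 < c"
  by (auto simp: rgerm_def lgerm_def)

lemma pl_at_pos: "pl_at h x c d \<Longrightarrow> 0 < c \<and> 0 < d"
  by (auto simp: pl_at_def rgerm_pos lgerm_pos)

lemma rgermE:
  assumes "rgerm h x v d"
  obtains e where "e > 0" "\<And>y. x < y \<Longrightarrow> y < x + e \<Longrightarrow> h y = v + d * (y - x)"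
proof -
  from assms obtain b where "b > x" "\<And>y. y > x \<Longrightarrow> y < b \<Longrightarrow> h y = v + d * (y - x)"
    unfolding rgerm_def eventually_at_right_field by blast
  then show thesis by (intro that[of "b - x"]) auto
qed

lemma lgermE:
  assumes "lgerm h x v c"
  obtains e where "e > 0" "\<And>y. x - e < y \<Longrightarrow> y < x \<Longrightarrow> h y = v + c * (y - x)"
proof -
  from assms obtain b where "b < x" "\<And>y. y > b \<Longrightarrow> y < x \<Longrightarrow> h y = v + c * (y - x)"
    unfolding lgerm_def eventually_at_left_field by blast
  then show thesis by (intro that[of "x - b"]) auto
qed

lemma rgermI:
  assumes "0 < d" "x < u" "\<And>y. x < y \<Longrightarrow> y < u \<Longrightarrow> h y = v + d * (y - x)"
  shows "rgerm h x v d"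
  using assms unfolding rgerm_def eventually_at_right_field by blast

lemma lgermI:
  assumes "0 < c" "u < x" "\<And>y. u < y \<Longrightarrow> y < x \<Longrightarrow> h y = v + c * (y - x)"
  shows "lgerm h x v c"
  using assms unfolding lgerm_def eventually_at_left_field by blast

lemma rgerm_cong: "(\<forall>\<^sub>F y in at_right x. h y = k y) \<Longrightarrow> rgerm h x v d \<longleftrightarrow> rgerm k x v d"
  unfolding rgerm_def by (auto elim: eventually_elim2)

lemma lgerm_cong: "(\<forall>\<^sub>F y in at_left x. h y = k y) \<Longrightarrow> lgerm h x v d \<longleftrightarrow> lgerm k x v d"
  unfolding lgerm_def by (auto elim: eventually_elim2)

lemma pl_at_cong:
  assumes "\<forall>\<^sub>F y in nhds x. h y = k y"
  shows "pl_at h x c d \<longleftrightarrow> pl_at k x c d"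
proof -
  have "h x = k x" "\<forall>\<^sub>F y in at_right x. h y = k y" "\<forall>\<^sub>F y in at_left x. h y = k y"
    using assms by (auto simp: eventually_nhds_conv_at eventually_at_split)
  then show ?thesis by (auto simp: pl_at_def rgerm_cong lgerm_cong)
qed

lemma pl_at_cong_open:
  assumes "open S" "x \<in> S" "\<And>y. y \<in> S \<Longrightarrow> h y = k y"
  shows "pl_at h x c d \<longleftrightarrow> pl_at k x c d"
  using assms by (intro pl_at_cong) (auto simp: eventually_nhds)

text \<open>Two affine functions that agree at two points coincide; the points at distances
  \<open>t\<close> and \<open>2*t\<close> from \<open>x\<close> lie in the range of both
  germs.\<close>

lemma rgerm_unique:
  assumes "rgerm h x v d" "rgerm h x v' d'" shows "v = v' \<and> d = d'"
proof -
  obtain e where e: "e > 0" "\<And>y. x < y \<Longrightarrow> y < x + e \<Longrightarrow> h y = v + d * (y - x)" using rgermE[OF assms(1)] by blast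
  obtain e' where e': "e' > 0" "\<And>y. x < y \<Longrightarrow> y < x + e' \<Longrightarrow> h y = v' + d' * (y - x)" using rgermE[OF assms(2)] by blast
  define t where "t = min e e' / 4"
  have t: "t > 0" "2*t < e" "2*t < e'" using e(1) e'(1) by (auto simp: t_def min_def)
  have "v + d * t = v' + d' * t" using e(2)[of "x+t"] e'(2)[of "x+t"] t by auto
  moreover have "v + d * (2*t) = v' + d' * (2*t)" using e(2)[of "x+2*t"] e'(2)[of "x+2*t"] t by auto
  ultimately have "d * t = d' * t" by linarith
  then have "d = d'" using t by auto
  with \<open>v + d * t = v' + d' * t\<close> show ?thesis by auto
qed

lemma lgerm_unique:
  assumes "lgerm h x v d" "lgerm h x v' d'" shows "v = v' \<and> d = d'"
proof -
  obtain e where e: "e > 0" "\<And>y. x - e < y \<Longrightarrow> y < x \<Longrightarrow> h y = v + d * (y - x)" using lgermE[OF assms(1)] by blast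
  obtain e' where e': "e' > 0" "\<And>y. x - e' < y \<Longrightarrow> y < x \<Longrightarrow> h y = v' + d' * (y - x)" using lgermE[OF assms(2)] by blast
  define t where "t = min e e' / 4"
  have t: "t > 0" "2*t < e" "2*t < e'" using e(1) e'(1) by (auto simp: t_def min_def)
  have "v - d * t = v' - d' * t" using e(2)[of "x-t"] e'(2)[of "x-t"] t by auto
  moreover have "v - d * (2*t) = v' - d' * (2*t)" using e(2)[of "x-2*t"] e'(2)[of "x-2*t"] t by auto
  ultimately have "d * t = d' * t" by linarith
  then have "d = d'" using t by auto
  with \<open>v - d * t = v' - d' * t\<close> show ?thesis by auto
qed

lemma pl_at_unique: "pl_at h x c d \<Longrightarrow> pl_at h x c' d' \<Longrightarrow> c = c' \<and> d = d'"
  using rgerm_unique lgerm_unique unfolding pl_at_def by blast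

section \<open>Composition and inversion of germs\<close>

lemma rgerm_filterlim:
  assumes "rgerm h x v d" shows "filterlim h (at_right v) (at_right x)"
proof -
  have d: "d > 0" using assms rgerm_pos by auto
  have ev: "\<forall>\<^sub>F y in at_right x. h y = v + d * (y - x)" using assms by (auto simp: rgerm_def)
  have "((\<lambda>y. v + d * (y - x)) \<longlongrightarrow> v + d * (x - x)) (at_right x)" by (intro tendsto_intros)
  then have "(h \<longlongrightarrow> v) (at_right x)" using tendsto_cong[OF ev] by simp
  \<comment> \<open>Positive slope keeps the values strictly to the right of \<open>v\<close>; a
    one-sided limit is what allows a second germ at \<open>v\<close> to be substituted
    later.\<close>
  moreover have "\<forall>\<^sub>F y in at_right x. h y > v"
    using ev eventually_at_right_less[of x] by eventually_elim (use d in auto)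
  ultimately show ?thesis by (intro filterlim_at_withinI) (auto elim: eventually_mono)
qed

lemma lgerm_filterlim:
  assumes "lgerm h x v d" shows "filterlim h (at_left v) (at_left x)"
proof -
  have d: "d > 0" using assms lgerm_pos by auto
  have ev: "\<forall>\<^sub>F y in at_left x. h y = v + d * (y - x)" using assms by (auto simp: lgerm_def)
  have "((\<lambda>y. v + d * (y - x)) \<longlongrightarrow> v + d * (x - x)) (at_left x)" by (intro tendsto_intros)
  then have "(h \<longlongrightarrow> v) (at_left x)" using tendsto_cong[OF ev] by simp
  moreover have "\<forall>\<^sub>F y in at_left x. y < x" by (auto simp: eventually_at_filter)
  then have "\<forall>\<^sub>F y in at_left x. h y < v"
    using ev by eventually_elim (use d in \<open>auto simp: mult_less_0_iff\<close>)
  ultimately show ?thesis by (intro filterlim_at_withinI) (auto elim: eventually_mono)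
qed

lemma rgerm_comp:
  assumes "rgerm h x v d" "rgerm g v w e" shows "rgerm (g \<circ> h) x w (e * d)"
proof -
  have "\<forall>\<^sub>F z in at_right v. g z = w + e * (z - v)" using assms(2) by (auto simp: rgerm_def)
  then have "\<forall>\<^sub>F y in at_right x. g (h y) = w + e * (h y - v)"
    using rgerm_filterlim[OF assms(1)] by (rule eventually_compose_filterlim)
  moreover have "\<forall>\<^sub>F y in at_right x. h y = v + d * (y - x)" using assms by (auto simp: rgerm_def)
  ultimately have "\<forall>\<^sub>F y in at_right x. (g \<circ> h) y = w + e * d * (y - x)"
    by eventually_elim simp
  then show ?thesis using rgerm_pos[OF assms(1)] rgerm_pos[OF assms(2)] by (auto simp: rgerm_def)
qed

lemma lgerm_comp:
  assumes "lgerm h x v d" "lgerm g v w e" shows "lgerm (g \<circ> h) x w (e * d)"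
proof -
  have "\<forall>\<^sub>F z in at_left v. g z = w + e * (z - v)" using assms(2) by (auto simp: lgerm_def)
  then have "\<forall>\<^sub>F y in at_left x. g (h y) = w + e * (h y - v)"
    using lgerm_filterlim[OF assms(1)] by (rule eventually_compose_filterlim)
  moreover have "\<forall>\<^sub>F y in at_left x. h y = v + d * (y - x)" using assms by (auto simp: lgerm_def)
  ultimately have "\<forall>\<^sub>F y in at_left x. (g \<circ> h) y = w + e * d * (y - x)"
    by eventually_elim simp
  then show ?thesis using lgerm_pos[OF assms(1)] lgerm_pos[OF assms(2)] by (auto simp: lgerm_def)
qed

lemma pl_at_comp: "pl_at h x c d \<Longrightarrow> pl_at g (h x) c' d' \<Longrightarrow> pl_at (g \<circ> h) x (c' * c) (d' * d)"
  unfolding pl_at_def by (auto intro: rgerm_comp lgerm_comp)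

text \<open>The affine inverse \<open>j\<close> of the germ tends to \<open>x\<close> from the
  right, so the relations near \<open>x\<close> can be pulled back along it. A left inverse on one
  side suffices, which lets the statement serve at end points of intervals as well.\<close>

lemma rgerm_inv:
  assumes "rgerm h x v d" "\<forall>\<^sub>F y in at_right x. k (h y) = y" shows "rgerm k v x (1 / d)"
proof -
  define j where "j = (\<lambda>z. x + (1/d) * (z - v))"
  have d: "d > 0" using assms rgerm_pos by auto
  have "rgerm j v x (1/d)" by (intro rgermI[of _ _ "v+1"]) (use d in \<open>auto simp: j_def\<close>)
  then have lim: "filterlim j (at_right x) (at_right v)" by (rule rgerm_filterlim)
  have "\<forall>\<^sub>F y in at_right x. h y = v + d * (y - x) \<and> k (h y) = y"
    using assms by (auto simp: rgerm_def intro: eventually_conj)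
  then have "\<forall>\<^sub>F z in at_right v. h (j z) = v + d * (j z - x) \<and> k (h (j z)) = j z"
    using lim by (rule eventually_compose_filterlim)
  then have "\<forall>\<^sub>F z in at_right v. k z = x + (1/d) * (z - v)"
  proof eventually_elim
    case (elim z)
    have "v + d * (j z - x) = z" using d by (simp add: j_def)
    then have "k z = j z" using elim by metis
    then show ?case by (simp add: j_def)
  qed
  then show ?thesis using d by (auto simp: rgerm_def)
qed

lemma lgerm_inv:
  assumes "lgerm h x v d" "\<forall>\<^sub>F y in at_left x. k (h y) = y" shows "lgerm k v x (1 / d)"
proof -
  define j where "j = (\<lambda>z. x + (1/d) * (z - v))"
  have d: "d > 0" using assms lgerm_pos by auto
  have "lgerm j v x (1/d)" by (intro lgermI[of _ "v-1"]) (use d in \<open>auto simp: j_def\<close>)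
  then have lim: "filterlim j (at_left x) (at_left v)" by (rule lgerm_filterlim)
  have "\<forall>\<^sub>F y in at_left x. h y = v + d * (y - x) \<and> k (h y) = y"
    using assms by (auto simp: lgerm_def intro: eventually_conj)
  then have "\<forall>\<^sub>F z in at_left v. h (j z) = v + d * (j z - x) \<and> k (h (j z)) = j z"
    using lim by (rule eventually_compose_filterlim)
  then have "\<forall>\<^sub>F z in at_left v. k z = x + (1/d) * (z - v)"
  proof eventually_elim
    case (elim z)
    have "v + d * (j z - x) = z" using d by (simp add: j_def)
    then have "k z = j z" using elim by metis
    then show ?case by (simp add: j_def)
  qed
  then show ?thesis using d by (auto simp: lgerm_def)
qed

lemma pl_at_inv:
  assumes "pl_at h x c d" "\<forall>\<^sub>F y in nhds x. k (h y) = y" shows "pl_at k (h x) (1 / c) (1 / d)"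
proof -
  have "k (h x) = x" "\<forall>\<^sub>F y in at_left x. k (h y) = y" "\<forall>\<^sub>F y in at_right x. k (h y) = y"
    using assms(2) by (auto simp: eventually_nhds_conv_at eventually_at_split)
  then show ?thesis using assms(1) unfolding pl_at_def by (auto intro: rgerm_inv lgerm_inv)
qed

lemma pl_at_affine:
  assumes "c > 0" "open S" "x \<in> S" "\<And>y. y \<in> S \<Longrightarrow> h y = v + c * (y - u)" shows "pl_at h x c c"
proof -
  obtain e where e: "e > 0" "ball x e \<subseteq> S" using assms openE by blast
  have *: "h y = h x + c * (y - x)" if "x - e < y" "y < x + e" for y
  proof -
    have "y \<in> S" using that e(2) by (auto simp: ball_def dist_real_def subset_eq)
    then show ?thesis using assms(4)[of y] assms(4)[of x] assms(3) by (auto simp: algebra_simps)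
  qed
  show ?thesis unfolding pl_at_def
  proof (intro conjI)
    show "lgerm h x (h x) c"
      by (rule lgermI[of _ "x-e"]) (use assms(1) e(1) in simp_all, rule *, use e(1) in simp_all)
    show "rgerm h x (h x) c"
      by (rule rgermI[of _ _ "x+e"]) (use assms(1) e(1) in simp_all, rule *, use e(1) in simp_all)
  qed
qed

lemma pl_at_ident [simp]: "pl_at (\<lambda>x. x) x 1 1" "pl_at id x 1 1"
  by (auto intro!: pl_at_affine[of 1 UNIV _ _ 0 0])

lemma rgerm_pl_at:
  assumes "rgerm h x v d" obtains e where "e > 0" "\<And>y. x < y \<Longrightarrow> y < x + e \<Longrightarrow> pl_at h y d d"
proof -
  obtain e where e: "e > 0" "\<And>y. x < y \<Longrightarrow> y < x + e \<Longrightarrow> h y = v + d * (y - x)" using rgermE[OF assms(1)] by blast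
  show thesis
    by (rule that[OF e(1)], rule pl_at_affine[of _ "{x<..<x+e}"]) (use e rgerm_pos[OF assms] in auto)
qed

lemma lgerm_pl_at:
  assumes "lgerm h x v d" obtains e where "e > 0" "\<And>y. x - e < y \<Longrightarrow> y < x \<Longrightarrow> pl_at h y d d"
proof -
  obtain e where e: "e > 0" "\<And>y. x - e < y \<Longrightarrow> y < x \<Longrightarrow> h y = v + d * (y - x)" using lgermE[OF assms(1)] by blast
  show thesis
    by (rule that[OF e(1)], rule pl_at_affine[of _ "{x-e<..<x}"]) (use e lgerm_pos[OF assms] in auto)
qed

lemma pl_at_isCont: assumes "pl_at h x c d" shows "isCont h x"
proof -
  have "(h \<longlongrightarrow> h x) (at_left x)" "(h \<longlongrightarrow> h x) (at_right x)"
    using assms rgerm_filterlim lgerm_filterlim unfolding pl_at_def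
    by (metis filterlim_at)+
  then show ?thesis by (simp add: filterlim_at_split isCont_def)
qed

section \<open>Germs, one-sided derivatives and slope ratios\<close>

lemma rgerm_deriv: "rgerm h x (h x) d \<Longrightarrow> (h has_real_derivative d) (at_right x)"
proof -
  assume a: "rgerm h x (h x) d"
  have "((\<lambda>y. h x + d * (y - x)) has_real_derivative d) (at_right x)"
    by (auto intro!: derivative_eq_intros)
  moreover have "\<forall>\<^sub>F y in at_right x. h y = h x + d * (y - x)" using a by (auto simp: rgerm_def)
  ultimately show ?thesis by (subst has_field_derivative_cong_eventually) auto
qed

lemma lgerm_deriv: "lgerm h x (h x) d \<Longrightarrow> (h has_real_derivative d) (at_left x)"
proof -
  assume a: "lgerm h x (h x) d"
  have "((\<lambda>y. h x + d * (y - x)) has_real_derivative d) (at_left x)"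
    by (auto intro!: derivative_eq_intros)
  moreover have "\<forall>\<^sub>F y in at_left x. h y = h x + d * (y - x)" using a by (auto simp: lgerm_def)
  ultimately show ?thesis by (subst has_field_derivative_cong_eventually) auto
qed

lemma real_deriv_unique_within:
  assumes "(h has_real_derivative d) (at x within S)" "(h has_real_derivative d') (at x within S)"
    "at x within S \<noteq> bot"
  shows "d = d'"
  using assms tendsto_unique unfolding has_field_derivative_iff by blast

lemma pl_at_slope_ratio: assumes "pl_at h x c d" shows "slope_ratio h x = d / c"
proof -
  have r: "(h has_real_derivative d) (at_right x)" and l: "(h has_real_derivative c) (at_left x)"
    using assms by (auto simp: pl_at_def rgerm_deriv lgerm_deriv)
  have "right_deriv h x = d" unfolding right_deriv_def
    using r by (intro the_equality) (auto intro: real_deriv_unique_within[OF _ r])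
  moreover have "left_deriv h x = c" unfolding left_deriv_def
    using l by (intro the_equality) (auto intro: real_deriv_unique_within[OF _ l])
  ultimately show ?thesis by (simp add: slope_ratio_def)
qed

lemma pl_at_DERIV: assumes "pl_at h x c c" shows "(h has_real_derivative c) (at x)"
proof -
  have "(h has_real_derivative c) (at_left x)" "(h has_real_derivative c) (at_right x)"
    using assms rgerm_deriv lgerm_deriv unfolding pl_at_def by auto
  then show ?thesis unfolding has_field_derivative_iff by (simp add: filterlim_at_split)
qed

text \<open>Links the topological notion of a node to slopes. An affine neighbourhood gives a
  two-sided derivative, which must equal both one-sided ones.\<close>

lemma pl_at_local_affine_iff:
  assumes "pl_at h x c d" shows "(\<exists>c d. \<forall>\<^sub>F y in nhds x. h y = c * y + d) \<longleftrightarrow> c = d"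
proof
  assume "c = d"
  then have "\<forall>\<^sub>F y in at_left x. h y = c * y + (h x - c * x)" "\<forall>\<^sub>F y in at_right x. h y = c * y + (h x - c * x)"
    using assms by (auto simp: pl_at_def rgerm_def lgerm_def algebra_simps)
  then have "\<forall>\<^sub>F y in nhds x. h y = c * y + (h x - c * x)"
    by (auto simp: eventually_nhds_conv_at eventually_at_split)
  then show "\<exists>c d. \<forall>\<^sub>F y in nhds x. h y = c * y + d" by blast
next
  assume "\<exists>c d. \<forall>\<^sub>F y in nhds x. h y = c * y + d"
  then obtain m b where mb: "\<forall>\<^sub>F y in nhds x. h y = m * y + b" by blast
  then have hx: "h x = m * x + b" by (rule eventually_nhds_x_imp_x)
  have 1: "\<forall>\<^sub>F y in at_right x. h y = m * y + b" "\<forall>\<^sub>F y in at_left x. h y = m * y + b"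
    using mb by (auto simp: eventually_nhds_conv_at eventually_at_split)
  have "(h has_real_derivative m) (at x)"
  proof (subst has_field_derivative_cong_eventually)
    show "\<forall>\<^sub>F y in at x. h y = m * y + b" using mb by (simp add: eventually_nhds_conv_at)
    show "((\<lambda>y. m * y + b) has_real_derivative m) (at x)" by (auto intro!: derivative_eq_intros)
  qed (rule hx)
  then have m: "(h has_real_derivative m) (at_left x)" "(h has_real_derivative m) (at_right x)"
    by (auto intro: has_field_derivative_at_within)
  have "c = m" using real_deriv_unique_within[OF lgerm_deriv m(1)] assms by (auto simp: pl_at_def)
  moreover have "d = m" using real_deriv_unique_within[OF rgerm_deriv m(2)] assms by (auto simp: pl_at_def)
  ultimately show "c = d" by simp
qed

text \<open>The points near which \<open>h\<close> agrees with the affine germ at the midpoint form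
  a set that is open and closed in the interval, so connectedness gives one formula
  throughout.\<close>

lemma local_affine_imp_affine:
  assumes "\<And>x. x \<in> {u<..<v} \<Longrightarrow> \<exists>c d. \<forall>\<^sub>F y in nhds x. h y = c * y + d"
  shows "\<exists>c d. \<forall>x\<in>{u<..<v::real}. h x = c * x + (d::real)"
proof (cases "u < v")
  case True
  define m where "m = (u + v) / 2"
  have m: "m \<in> {u<..<v}" using True by (auto simp: m_def)
  obtain c d where cd: "\<forall>\<^sub>F y in nhds m. h y = c * y + d" using assms m by blast
  define P where "P = (\<lambda>x. \<forall>\<^sub>F y in nhds x. h y = c * y + d)"
  have "P x" if x: "x \<in> {u<..<v}" for x
  proof (rule connected_induction_simple[OF _ m x, of P])
    show "connected {u<..<v}" "P m" using cd by (auto simp: P_def)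
    fix a assume a: "a \<in> {u<..<v}"
    then obtain c' d' where "\<forall>\<^sub>F y in nhds a. h y = c' * y + d'" using assms by blast
    then obtain S where S: "open S" "a \<in> S" "\<And>y. y \<in> S \<Longrightarrow> h y = c' * y + d'" by (auto simp: eventually_nhds)
    \<comment> \<open>Just to the right of \<open>x\<close> the formula valid on \<open>S\<close>
      and the formula of the midpoint both hold. Two points there identify the coefficients, so
      agreement at one point of \<open>S\<close> spreads over \<open>S\<close>.\<close>
    have "P y" if xy: "x \<in> S" "y \<in> S" "P x" for x y
    proof -
      have "\<forall>\<^sub>F z in at_right x. h z = c * z + d" "\<forall>\<^sub>F z in at_right x. h z = c' * z + d'"
        using xy S unfolding P_def by (auto simp: eventually_nhds_conv_at eventually_at_split eventually_nhds)
          (metis (mono_tags, lifting) S eventually_nhds eventually_nhds_conv_at eventually_at_split)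
      then have "\<forall>\<^sub>F z in at_right x. c * z + d = c' * z + d'" by eventually_elim auto
      then obtain b where b: "b > x" "\<And>z. z > x \<Longrightarrow> z < b \<Longrightarrow> c * z + d = c' * z + d'"
        unfolding eventually_at_right_field by blast
      obtain z1 where z1: "x < z1" "z1 < b" using b(1) dense by blast
      obtain z2 where z2: "z1 < z2" "z2 < b" using z1 dense by blast
      have "c * z1 + d = c' * z1 + d'" "c * z2 + d = c' * z2 + d'" using b(2) z1 z2 by auto
      then have "(c - c') * (z1 - z2) = 0" "c = c' \<Longrightarrow> d = d'" by (auto simp: algebra_simps)
      then have "c = c'" "d = d'" using z2 by auto
      then show ?thesis using S xy unfolding P_def eventually_nhds by auto
    qed
    then show "\<exists>T. openin (top_of_set {u<..<v}) T \<and> a \<in> T \<and> (\<forall>x\<in>T. \<forall>y\<in>T. P x \<longrightarrow> P y)"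
      using S a by (intro exI[of _ "{u<..<v} \<inter> S"]) (auto intro: openin_open_Int)
  qed
  then have "\<forall>x\<in>{u<..<v}. h x = c * x + d" unfolding P_def using eventually_nhds_x_imp_x by blast
  then show ?thesis by blast
qed auto

lemma affine_between:
  assumes "\<And>x. x \<in> {u<..<v} \<Longrightarrow> \<exists>c. pl_at h x c c"
  shows "\<exists>c d. \<forall>x\<in>{u<..<v::real}. h x = c * x + (d::real)"
  using assms by (intro local_affine_imp_affine) (metis pl_at_local_affine_iff)

section \<open>Piecewise linear homeomorphisms between open intervals\<close>

text \<open>The germs at the ends are anchored at \<open>a'\<close> and \<open>b'\<close>, whatever
  values \<open>h\<close> has there. This encodes the target interval, and finiteness of the node
  set follows by compactness. Nothing is asked outside \<open>(a,b)\<close>, so one function can be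
  viewed on each of its bumps.\<close>

definition plmap :: "real \<Rightarrow> real \<Rightarrow> real \<Rightarrow> real \<Rightarrow> (real \<Rightarrow> real) \<Rightarrow> bool" where
  "plmap a b a' b' h \<longleftrightarrow> a < b \<and> (\<forall>x\<in>{a<..<b}. \<exists>c d. pl_at h x c d) \<and>
     (\<exists>c. rgerm h a a' c) \<and> (\<exists>d. lgerm h b b' d)"

lemma plmapD:
  assumes "plmap a b a' b' h"
  shows "a < b" "x \<in> {a<..<b} \<Longrightarrow> \<exists>c d. pl_at h x c d" "\<exists>c. rgerm h a a' c" "\<exists>d. lgerm h b b' d"
  using assms by (auto simp: plmap_def)

lemma rgerm_near:
  assumes "rgerm h a a' c" "a < u" "a' < v" shows "\<exists>y. a < y \<and> y < u \<and> a' < h y \<and> h y < v"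
proof -
  have lim: "filterlim h (at_right a') (at_right a)" using assms rgerm_filterlim by blast
  have "\<forall>\<^sub>F y in at_right a'. a' < y \<and> y < v"
    using assms by (auto simp: eventually_at_right_field)
  then have "\<forall>\<^sub>F y in at_right a. a' < h y \<and> h y < v" using lim by (rule eventually_compose_filterlim)
  moreover have "\<forall>\<^sub>F y in at_right a. a < y \<and> y < u"
    using assms by (auto simp: eventually_at_right_field)
  ultimately have "\<forall>\<^sub>F y in at_right a. a < y \<and> y < u \<and> a' < h y \<and> h y < v" by eventually_elim auto
  then show ?thesis using eventually_happens'[OF trivial_limit_at_right_real] by blast
qed

lemma lgerm_near:
  assumes "lgerm h a a' c" "u < a" "v < a'" shows "\<exists>y. u < y \<and> y < a \<and> v < h y \<and> h y < a'"
proof -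
  have lim: "filterlim h (at_left a') (at_left a)" using assms lgerm_filterlim by blast
  have "\<forall>\<^sub>F y in at_left a'. v < y \<and> y < a'"
    using assms by (auto simp: eventually_at_left_field)
  then have "\<forall>\<^sub>F y in at_left a. v < h y \<and> h y < a'" using lim by (rule eventually_compose_filterlim)
  moreover have "\<forall>\<^sub>F y in at_left a. u < y \<and> y < a"
    using assms by (auto simp: eventually_at_left_field)
  ultimately have "\<forall>\<^sub>F y in at_left a. u < y \<and> y < a \<and> v < h y \<and> h y < a'" by eventually_elim auto
  then show ?thesis using eventually_happens'[OF trivial_limit_at_left_real] by blast
qed

text \<open>The maximum of \<open>h\<close> on \<open>[x,y]\<close> cannot be attained before
  \<open>y\<close>, because a positive right slope gives a larger value just to the right.\<close>

lemma pl_at_strict_mono: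
  assumes pl: "\<And>x. x \<in> {a<..<b} \<Longrightarrow> \<exists>c d. pl_at h x c d" and xy: "x \<in> {a<..<b}" "y \<in> {a<..<b}" "x < y"
  shows "h x < h y"
proof -
  have larger: "\<exists>z. m < z \<and> z < y \<and> h m < h z" if m: "x \<le> m" "m < y" for m
  proof -
    obtain c d where "pl_at h m c d" using pl[of m] m xy by auto
    then have "rgerm h m (h m) d" by (simp add: pl_at_def)
    from rgerm_near[OF this m(2), of "h m + 1"] show ?thesis by auto
  qed
  have "continuous_on {x..y} h"
  proof (intro continuous_at_imp_continuous_on ballI)
    fix z assume "z \<in> {x..y}"
    then have "z \<in> {a<..<b}" using xy by auto
    then show "isCont h z" using pl pl_at_isCont by blast
  qed
  then obtain m where m: "m \<in> {x..y}" "\<And>z. z \<in> {x..y} \<Longrightarrow> h z \<le> h m"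
    using continuous_attains_sup[of "{x..y}" h] xy by auto
  have "m = y"
  proof (rule ccontr)
    assume "m \<noteq> y"
    then obtain z where z: "m < z" "z < y" "h m < h z" using larger[of m] m(1) by auto
    then show False using m(2)[of z] m(1) by auto
  qed
  obtain z where "x < z" "z < y" "h x < h z" using larger[of x] xy by auto
  then show ?thesis using m(2)[of z] \<open>m = y\<close> by auto
qed

lemma plmap_less_iff:
  assumes "plmap a b a' b' h" "x \<in> {a<..<b}" "y \<in> {a<..<b}" shows "h x < h y \<longleftrightarrow> x < y"
proof -
  have *: "h x < h y" if "x < y" "x \<in> {a<..<b}" "y \<in> {a<..<b}" for x y
    using pl_at_strict_mono[of a b h x y] that assms(1) by (auto simp: plmap_def)
  show ?thesis using *[of x y] *[of y x] assms(2,3) by (cases x y rule: linorder_cases) auto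
qed

lemma plmap_le_iff:
  assumes "plmap a b a' b' h" "x \<in> {a<..<b}" "y \<in> {a<..<b}" shows "h x \<le> h y \<longleftrightarrow> x \<le> y"
  using plmap_less_iff[OF assms(1,3,2)] by linarith

lemma plmap_eq_iff:
  assumes "plmap a b a' b' h" "x \<in> {a<..<b}" "y \<in> {a<..<b}" shows "h x = h y \<longleftrightarrow> x = y"
  using plmap_le_iff[OF assms] plmap_le_iff[OF assms(1,3,2)] by linarith

lemma plmap_inj_on: "plmap a b a' b' h \<Longrightarrow> inj_on h {a<..<b}"
  by (auto simp: inj_on_def plmap_eq_iff)

lemma plmap_strict_mono_on: "plmap a b a' b' h \<Longrightarrow> strict_mono_on {a<..<b} h"
  by (auto simp: monotone_on_def plmap_less_iff)

lemma plmap_isCont: "plmap a b a' b' h \<Longrightarrow> x \<in> {a<..<b} \<Longrightarrow> isCont h x"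
  using pl_at_isCont plmapD(2) by blast

lemma plmap_continuous_on: "plmap a b a' b' h \<Longrightarrow> continuous_on {a<..<b} h"
  by (intro continuous_at_imp_continuous_on ballI plmap_isCont)

lemma plmap_in:
  assumes h: "plmap a b a' b' h" and x: "x \<in> {a<..<b}" shows "h x \<in> {a'<..<b'}"
proof -
  obtain c d where g: "rgerm h a a' c" "lgerm h b b' d" using plmapD[OF h] by blast
  obtain y where "a < y" "y < x" "a' < h y" using rgerm_near[OF g(1), of x "a'+1"] x by auto
  moreover obtain z where "x < z" "z < b" "h z < b'" using lgerm_near[OF g(2), of x "b'-1"] x by auto
  ultimately show ?thesis using plmap_less_iff[OF h, of y x] plmap_less_iff[OF h, of x z] x by auto
qed

lemma plmap_target: "plmap a b a' b' h \<Longrightarrow> a' < b'"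
  using plmap_in[of a b a' b' h "(a+b)/2"] plmapD(1)[of a b a' b' h] by auto

lemma plmap_image:
  assumes h: "plmap a b a' b' h" shows "h ` {a<..<b} = {a'<..<b'}"
proof
  show "h ` {a<..<b} \<subseteq> {a'<..<b'}" using plmap_in[OF h] by auto
  show "{a'<..<b'} \<subseteq> h ` {a<..<b}"
  proof
    fix v assume v: "v \<in> {a'<..<b'}"
    obtain c d where g: "rgerm h a a' c" "lgerm h b b' d" "a < b" using plmapD[OF h] by blast
    obtain y where y: "a < y" "y < b" "h y < v" using rgerm_near[OF g(1), of b v] v g(3) by auto
    obtain z where z: "a < z" "z < b" "v < h z" using lgerm_near[OF g(2), of a v] v g(3) by auto
    have "y < z" using plmap_less_iff[OF h, of y z] y z by auto
    moreover have "continuous_on {y..z} h"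
      by (rule continuous_on_subset[OF plmap_continuous_on[OF h]]) (use y z in auto)
    ultimately obtain x where "y \<le> x" "x \<le> z" "h x = v" using IVT'[of h y v z] y z by auto
    then show "v \<in> h ` {a<..<b}" using y z by auto
  qed
qed

lemma plmap_surj:
  assumes "plmap a b a' b' h" "y \<in> {a'<..<b'}" obtains x where "x \<in> {a<..<b}" "h x = y"
  using plmap_image[OF assms(1)] assms(2) by (metis imageE)

lemma rgerm_cong_open:
  assumes "\<And>x. x \<in> {a<..<b} \<Longrightarrow> h x = k x" "a < b" shows "rgerm h a v c \<longleftrightarrow> rgerm k a v c"
  by (rule rgerm_cong) (use assms in \<open>auto simp: eventually_at_right_field intro!: exI[of _ b]\<close>)

lemma lgerm_cong_open:
  assumes "\<And>x. x \<in> {a<..<b} \<Longrightarrow> h x = k x" "a < b" shows "lgerm h b v c \<longleftrightarrow> lgerm k b v c"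
  by (rule lgerm_cong) (use assms in \<open>auto simp: eventually_at_left_field intro!: exI[of _ a]\<close>)

lemma plmap_cong:
  assumes "\<And>x. x \<in> {a<..<b} \<Longrightarrow> h x = k x" shows "plmap a b a' b' h \<longleftrightarrow> plmap a b a' b' k"
proof (cases "a < b")
  case True
  have "rgerm h a a' c \<longleftrightarrow> rgerm k a a' c" "lgerm h b b' c \<longleftrightarrow> lgerm k b b' c" for c
    using rgerm_cong_open[of a b h k] lgerm_cong_open[of a b h k] assms True by auto
  moreover have "pl_at h x c d \<longleftrightarrow> pl_at k x c d" if "x \<in> {a<..<b}" for x c d
    using pl_at_cong_open[of "{a<..<b}" x h k] assms that by auto
  ultimately show ?thesis by (auto simp: plmap_def)
qed (auto simp: plmap_def)

lemma plmap_comp: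
  assumes h: "plmap a b a' b' h" and g: "plmap a' b' a'' b'' g" shows "plmap a b a'' b'' (g \<circ> h)"
  unfolding plmap_def
proof (intro conjI ballI)
  fix x assume "x \<in> {a<..<b}"
  then show "\<exists>c d. pl_at (g \<circ> h) x c d"
    using plmapD(2)[OF h] plmapD(2)[OF g plmap_in[OF h]] pl_at_comp by blast
qed (use plmapD[OF h] plmapD[OF g] rgerm_comp lgerm_comp in blast)+

lemma plmap_inverse:
  assumes h: "plmap a b a' b' h" and k: "\<And>x. x \<in> {a<..<b} \<Longrightarrow> k (h x) = x"
  shows "plmap a' b' a b k"
  unfolding plmap_def
proof (intro conjI ballI)
  show "a' < b'" using plmap_target[OF h] .
  fix y assume "y \<in> {a'<..<b'}"
  then obtain x where x: "x \<in> {a<..<b}" "y = h x" using plmap_surj[OF h] by metis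
  obtain c d where "pl_at h x c d" using plmapD(2)[OF h x(1)] by auto
  moreover have "\<forall>\<^sub>F z in nhds x. k (h z) = z"
    using eventually_nhds_in_open[of "{a<..<b}" x] x(1) by (auto elim!: eventually_mono simp: k)
  ultimately show "\<exists>c d. pl_at k y c d" using pl_at_inv x by blast
next
  have "\<forall>\<^sub>F y in at_right a. k (h y) = y" "\<forall>\<^sub>F y in at_left b. k (h y) = y"
    using plmapD(1)[OF h] k by (auto simp: eventually_at_right_field eventually_at_left_field)
  then show "\<exists>c. rgerm k a' a c" "\<exists>c. lgerm k b' b c"
    using plmapD(3,4)[OF h] rgerm_inv lgerm_inv by blast+
qed

lemma plmap_inv_into:
  assumes h: "plmap a b a' b' h"
  shows "plmap a' b' a b (inv_into {a<..<b} h)"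
    and "x \<in> {a<..<b} \<Longrightarrow> inv_into {a<..<b} h (h x) = x"
    and "y \<in> {a'<..<b'} \<Longrightarrow> h (inv_into {a<..<b} h y) = y"
proof -
  have kh: "inv_into {a<..<b} h (h x) = x" if "x \<in> {a<..<b}" for x using that plmap_inj_on[OF h] by simp
  have hk: "h (inv_into {a<..<b} h y) = y" if "y \<in> {a'<..<b'}" for y using plmap_surj[OF h that] kh by metis
  show "plmap a' b' a b (inv_into {a<..<b} h)" by (rule plmap_inverse[OF h kh])
  show "x \<in> {a<..<b} \<Longrightarrow> inv_into {a<..<b} h (h x) = x" by (rule kh)
  show "y \<in> {a'<..<b'} \<Longrightarrow> h (inv_into {a<..<b} h y) = y" by (rule hk)
qed

lemma plmap_affine:
  assumes "a < b" "c > 0" shows "plmap a b (c * a + d) (c * b + d) (\<lambda>x. c * x + d)"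
  unfolding plmap_def using assms
  by (auto intro!: exI[of _ c] rgermI[of _ _ "a+1"] lgermI[of _ "b-1"] pl_at_affine[of _ UNIV _ _ d 0]
       simp: algebra_simps)

lemma rgerm_affine: "c > 0 \<Longrightarrow> rgerm (\<lambda>x. c * x + d) x (c * x + d) c"
  by (auto intro!: rgermI[of _ _ "x+1"] simp: algebra_simps)

lemma lgerm_affine: "c > 0 \<Longrightarrow> lgerm (\<lambda>x. c * x + d) x (c * x + d) c"
  by (auto intro!: lgermI[of _ "x-1"] simp: algebra_simps)

lemma plmap_id: "a < b \<Longrightarrow> plmap a b a b (\<lambda>x. x)"
  using plmap_affine[of a b 1 0] by simp

text \<open>An infinite \<open>S\<close> would accumulate somewhere in \<open>[a,b]\<close>. The
  assumptions exclude every such point, at the ends only from the inside because \<open>S\<close>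
  has no points outside.\<close>

lemma finite_bad_points:
  assumes "\<And>x. x \<in> {a<..<b::real} \<Longrightarrow> eventually (\<lambda>y. y \<notin> S) (at x)"
    "eventually (\<lambda>y. y \<notin> S) (at_right a)" "eventually (\<lambda>y. y \<notin> S) (at_left b)" "S \<subseteq> {a<..<b}"
  shows "finite S"
proof (rule ccontr)
  assume "infinite S"
  then obtain x where x: "x \<in> {a..b}" "x islimpt S"
    using compact_eq_Bolzano_Weierstrass[of "{a..b}"] assms(4)
    by (metis compact_Icc greaterThanLessThan_subseteq_atLeastAtMost_iff order.trans order_refl)
  then have freq: "frequently (\<lambda>y. y \<in> S) (at x)" by (simp add: islimpt_conv_frequently_at)
  have le: "\<forall>\<^sub>F y in at_left a. y \<notin> S" "\<forall>\<^sub>F y in at_right b. y \<notin> S"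
    using assms(4) by (auto simp: eventually_at_filter intro!: always_eventually)
  consider "x = a" | "x = b" | "x \<in> {a<..<b}" using x(1) by fastforce
  then have "eventually (\<lambda>y. y \<notin> S) (at x)"
    by cases (use assms(1)[of x] assms(2,3) le in \<open>simp_all only: eventually_at_split\<close>)
  then show False using freq by (simp add: frequently_def)
qed

lemma slope_ratio_comp:
  assumes "pl_at h x c d" "pl_at g (h x) c' d'"
  shows "slope_ratio (g \<circ> h) x = slope_ratio g (h x) * slope_ratio h x"
  using pl_at_slope_ratio[OF pl_at_comp[OF assms]] pl_at_slope_ratio[OF assms(1)] pl_at_slope_ratio[OF assms(2)]
  by simp

lemma slope_ratio_pos: "pl_at h x c d \<Longrightarrow> slope_ratio h x > 0"
  using pl_at_pos pl_at_slope_ratio by fastforce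

lemma slope_ratio_cong_open:
  assumes "pl_at k x c d" "open S" "x \<in> S" "\<And>y. y \<in> S \<Longrightarrow> h y = k y"
  shows "slope_ratio h x = slope_ratio k x"
  using assms pl_at_cong_open[of S x h k c d] pl_at_slope_ratio by metis

lemma slope_ratio_1_iff: "pl_at h x c d \<Longrightarrow> slope_ratio h x = 1 \<longleftrightarrow> c = d"
  using pl_at_slope_ratio[of h x c d] pl_at_pos[of h x c d] by auto

text \<open>Replaces the local definition of a node by a condition on the slope ratio, which is
  multiplicative under composition.\<close>

lemma plmap_nodes:
  assumes "plmap a b a' b' h" shows "nodes a b h = {x\<in>{a<..<b}. slope_ratio h x \<noteq> 1}"
  using plmapD(2)[OF assms] pl_at_local_affine_iff slope_ratio_1_iff unfolding nodes_def by blast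

lemma plmap_finite_nodes:
  assumes h: "plmap a b a' b' h" shows "finite (nodes a b h)"
proof -
  have 1: "z \<notin> nodes a b h" if "pl_at h z d d" for z d
    using that slope_ratio_1_iff plmap_nodes[OF h] by auto
  have r: "\<forall>\<^sub>F y in at_right x. y \<notin> nodes a b h" if g: "rgerm h x v d" for x v d
  proof -
    obtain e where e: "e > 0" "\<And>y. x < y \<Longrightarrow> y < x + e \<Longrightarrow> pl_at h y d d" using rgerm_pl_at[OF g] by blast
    then show ?thesis using 1 unfolding eventually_at_right_field by (intro exI[of _ "x+e"]) auto
  qed
  have l: "\<forall>\<^sub>F y in at_left x. y \<notin> nodes a b h" if g: "lgerm h x v d" for x v d
  proof -
    obtain e where e: "e > 0" "\<And>y. x - e < y \<Longrightarrow> y < x \<Longrightarrow> pl_at h y d d" using lgerm_pl_at[OF g] by blast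
    then show ?thesis using 1 unfolding eventually_at_left_field by (intro exI[of _ "x-e"]) auto
  qed
  show ?thesis
  proof (rule finite_bad_points[of a b])
    fix x assume "x \<in> {a<..<b}"
    then obtain c d where "pl_at h x c d" using plmapD(2)[OF h] by blast
    then show "\<forall>\<^sub>F y in at x. y \<notin> nodes a b h"
      using r l by (auto simp: eventually_at_split pl_at_def)
  qed (use r l plmapD(3,4)[OF h] in \<open>auto simp: nodes_def\<close>)
qed

text \<open>The affine formula on \<open>(a,p)\<close> must be identified with the given germ. Germs
  have positive slope by definition, so positivity of \<open>m\<close> is first extracted from
  strict monotonicity; then uniqueness of germs applies.\<close>

lemma plmap_affine_init:
  assumes "rgerm h a a' c" "a < p" "\<And>x. x \<in> {a<..<p} \<Longrightarrow> \<exists>c. pl_at h x c c" "y \<in> {a<..<p}"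
  shows "h y = a' + c * (y - a)"
proof -
  obtain m n where mn: "\<And>x. x\<in>{a<..<p} \<Longrightarrow> h x = m * x + n" using affine_between[of a p h] assms(3) by auto
  have "m * y + n < m * z + n" if "y \<in> {a<..<p}" "z \<in> {a<..<p}" "y < z" for y z
    using pl_at_strict_mono[of a p h y z] assms(3) that mn by metis
  moreover obtain y1 where y1: "a < y1" "y1 < p" using assms(2) dense by blast
  moreover obtain y2 where y2: "y1 < y2" "y2 < p" using y1 dense by blast
  ultimately have "m * y1 + n < m * y2 + n" by simp
  then have "m > 0" using y2 mult_less_cancel_left[of m y1 y2] by (auto simp: not_less split: if_splits)
  then have "rgerm h a (m * a + n) m"
    by (intro rgermI[of _ _ p]) (use assms(2) mn in \<open>auto simp: algebra_simps\<close>)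
  then show ?thesis using rgerm_unique[OF assms(1)] mn[OF assms(4)] by (auto simp: algebra_simps)
qed

lemma plmap_affine_final:
  assumes "lgerm h b b' c" "p < b" "\<And>x. x \<in> {p<..<b} \<Longrightarrow> \<exists>c. pl_at h x c c" "y \<in> {p<..<b}"
  shows "h y = b' + c * (y - b)"
proof -
  obtain m n where mn: "\<And>x. x\<in>{p<..<b} \<Longrightarrow> h x = m * x + n" using affine_between[of p b h] assms(3) by auto
  have "m * y + n < m * z + n" if "y \<in> {p<..<b}" "z \<in> {p<..<b}" "y < z" for y z
    using pl_at_strict_mono[of p b h y z] assms(3) that mn by metis
  moreover obtain y1 where y1: "p < y1" "y1 < b" using assms(2) dense by blast
  moreover obtain y2 where y2: "y1 < y2" "y2 < b" using y1 dense by blast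
  ultimately have "m * y1 + n < m * y2 + n" by simp
  then have "m > 0" using y2 mult_less_cancel_left[of m y1 y2] by (auto simp: not_less split: if_splits)
  then have "lgerm h b (m * b + n) m"
    by (intro lgermI[of _ p]) (use assms(2) mn in \<open>auto simp: algebra_simps\<close>)
  then show ?thesis using lgerm_unique[OF assms(1)] mn[OF assms(4)] by (auto simp: algebra_simps)
qed

lemma plmap_pl_at_nonnode:
  assumes "plmap a b a' b' h" "x \<in> {a<..<b}" "slope_ratio h x = 1" shows "\<exists>c. pl_at h x c c"
  using plmapD(2)[OF assms(1,2)] slope_ratio_1_iff assms(3) by blast

lemma plmap_no_nodes:
  assumes h: "plmap a b a' b' h" and "\<And>x. x \<in> {a<..<b} \<Longrightarrow> slope_ratio h x = 1" and y: "y \<in> {a<..<b}"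
  shows "h y = a' + (b' - a') / (b - a) * (y - a)"
proof -
  obtain c where c: "rgerm h a a' c" using plmapD(3)[OF h] by auto
  have ab: "a < b" using plmapD(1)[OF h] .
  have *: "h y = a' + c * (y - a)" if "y \<in> {a<..<b}" for y
    by (rule plmap_affine_init[OF c ab _ that]) (use plmap_pl_at_nonnode[OF h] assms(2) in blast)
  have "lgerm h b (a' + c * (b - a)) c"
    by (rule lgermI[of _ a]) (use ab rgerm_pos[OF c] * in \<open>auto simp: algebra_simps\<close>)
  then have "b' = a' + c * (b - a)" using plmapD(4)[OF h] lgerm_unique by blast
  then have "c = (b' - a') / (b - a)" using ab by (auto simp: field_simps)
  then show ?thesis using *[OF y] by simp
qed

section \<open>Initial and final slopes\<close>

lemma initial_slope_eq:
  assumes h: "plmap a b a' b' h" and g: "rgerm h a a' c" shows "initial_slope a b h = c"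
  unfolding initial_slope_def
proof (rule the_equality)
  \<comment> \<open>Inserting \<open>b\<close> keeps the minimum meaningful when there are no nodes;
    in either case \<open>h\<close> is affine on \<open>(a,p)\<close>.\<close>
  define p where "p = Min (insert b (nodes a b h))"
  have fin: "finite (nodes a b h)" using plmap_finite_nodes[OF h] .
  have ap: "a < p" "p \<le> b" using fin plmapD(1)[OF h] by (auto simp: p_def nodes_def)
  have aff: "h y = a' + c * (y - a)" if "y \<in> {a<..<p}" for y
  proof (rule plmap_affine_init[OF g ap(1) _ that])
    fix x assume "x \<in> {a<..<p}"
    then have "x \<in> {a<..<b}" "x \<notin> nodes a b h" using ap fin by (auto simp: p_def)
    then show "\<exists>c. pl_at h x c c" using plmap_pl_at_nonnode[OF h] plmap_nodes[OF h] by auto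
  qed
  have d: "(h has_real_derivative c) (at x)" if "x \<in> {a<..<p}" for x
    by (rule pl_at_DERIV[OF pl_at_affine[of c "{a<..<p}"]]) (use that aff rgerm_pos[OF g] in auto)
  show "\<forall>x\<in>{a<..<b}. (\<forall>p\<in>nodes a b h. x < p) \<longrightarrow> (h has_real_derivative c) (at x)"
    using d fin by (auto simp: p_def)
  fix d' assume "\<forall>x\<in>{a<..<b}. (\<forall>p\<in>nodes a b h. x < p) \<longrightarrow> (h has_real_derivative d') (at x)"
  moreover have "(a + p)/2 \<in> {a<..<b}" "(a + p)/2 \<in> {a<..<p}" using ap by auto
  moreover have "\<forall>q\<in>nodes a b h. (a + p)/2 < q"
  proof
    fix q assume "q \<in> nodes a b h"
    then have "p \<le> q" using fin by (auto simp: p_def)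
    then show "(a + p)/2 < q" using ap by auto
  qed
  ultimately show "d' = c" using d DERIV_unique by blast
qed

lemma final_slope_eq:
  assumes h: "plmap a b a' b' h" and g: "lgerm h b b' c" shows "final_slope a b h = c"
  unfolding final_slope_def
proof (rule the_equality)
  define p where "p = Max (insert a (nodes a b h))"
  have fin: "finite (nodes a b h)" using plmap_finite_nodes[OF h] .
  have ap: "a \<le> p" "p < b" using fin plmapD(1)[OF h] by (auto simp: p_def nodes_def)
  have aff: "h y = b' + c * (y - b)" if "y \<in> {p<..<b}" for y
  proof (rule plmap_affine_final[OF g ap(2) _ that])
    fix x assume "x \<in> {p<..<b}"
    then have "x \<in> {a<..<b}" "x \<notin> nodes a b h" using ap fin by (auto simp: p_def)
    then show "\<exists>c. pl_at h x c c" using plmap_pl_at_nonnode[OF h] plmap_nodes[OF h] by auto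
  qed
  have d: "(h has_real_derivative c) (at x)" if "x \<in> {p<..<b}" for x
    by (rule pl_at_DERIV[OF pl_at_affine[of c "{p<..<b}"]]) (use that aff lgerm_pos[OF g] in auto)
  show "\<forall>x\<in>{a<..<b}. (\<forall>p\<in>nodes a b h. p < x) \<longrightarrow> (h has_real_derivative c) (at x)"
    using d fin by (auto simp: p_def)
  fix d' assume "\<forall>x\<in>{a<..<b}. (\<forall>p\<in>nodes a b h. p < x) \<longrightarrow> (h has_real_derivative d') (at x)"
  moreover have "(b + p)/2 \<in> {a<..<b}" "(b + p)/2 \<in> {p<..<b}" using ap by auto
  moreover have "\<forall>q\<in>nodes a b h. q < (b + p)/2"
  proof
    fix q assume "q \<in> nodes a b h"
    then have "q \<le> p" using fin by (auto simp: p_def)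
    then show "q < (b + p)/2" using ap by auto
  qed
  ultimately show "d' = c" using d DERIV_unique by blast
qed

lemma plmap_initial: "plmap a b a' b' h \<Longrightarrow> rgerm h a a' (initial_slope a b h)"
  using initial_slope_eq plmapD(3) by metis

lemma plmap_final: "plmap a b a' b' h \<Longrightarrow> lgerm h b b' (final_slope a b h)"
  using final_slope_eq plmapD(4) by metis

lemma initial_slope_pos: "plmap a b a' b' h \<Longrightarrow> initial_slope a b h > 0"
  using plmap_initial rgerm_pos by blast

lemma final_slope_pos: "plmap a b a' b' h \<Longrightarrow> final_slope a b h > 0"
  using plmap_final lgerm_pos by blast

lemma slope_comp:
  assumes "plmap a b a' b' h" "plmap a' b' a'' b'' g"
  shows "initial_slope a b (g \<circ> h) = initial_slope a' b' g * initial_slope a b h"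
    "final_slope a b (g \<circ> h) = final_slope a' b' g * final_slope a b h"
  using initial_slope_eq[OF plmap_comp[OF assms] rgerm_comp[OF plmap_initial[OF assms(1)] plmap_initial[OF assms(2)]]]
    final_slope_eq[OF plmap_comp[OF assms] lgerm_comp[OF plmap_final[OF assms(1)] plmap_final[OF assms(2)]]]
  by auto

lemma slope_cong:
  assumes "\<And>x. x \<in> {a<..<b} \<Longrightarrow> h x = k x" "plmap a b a' b' k"
  shows "initial_slope a b h = initial_slope a b k" "final_slope a b h = final_slope a b k"
proof -
  have ab: "a < b" using plmapD(1)[OF assms(2)] .
  have h: "plmap a b a' b' h" using assms(2) plmap_cong[of a b h k, OF assms(1)] by blast
  have "rgerm h a a' (initial_slope a b k)" "lgerm h b b' (final_slope a b k)"
    using rgerm_cong_open[of a b h k] lgerm_cong_open[of a b h k] assms(1) ab plmap_initial[OF assms(2)] plmap_final[OF assms(2)]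
    by auto
  then show "initial_slope a b h = initial_slope a b k" "final_slope a b h = final_slope a b k"
    using initial_slope_eq[OF h] final_slope_eq[OF h] by blast+
qed

lemma slope_inverse:
  assumes h: "plmap a b a' b' h" and k: "\<And>x. x \<in> {a<..<b} \<Longrightarrow> k (h x) = x"
  shows "initial_slope a' b' k = 1 / initial_slope a b h" "final_slope a' b' k = 1 / final_slope a b h"
proof -
  have k': "plmap a' b' a b k" using plmap_inverse[OF assms] .
  have "\<forall>\<^sub>F y in at_right a. k (h y) = y" "\<forall>\<^sub>F y in at_left b. k (h y) = y"
    using plmapD(1)[OF h] k by (auto simp: eventually_at_right_field eventually_at_left_field)
  then show "initial_slope a' b' k = 1 / initial_slope a b h" "final_slope a' b' k = 1 / final_slope a b h"
    using initial_slope_eq[OF k'] final_slope_eq[OF k'] rgerm_inv[OF plmap_initial[OF h]] lgerm_inv[OF plmap_final[OF h]]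
    by auto
qed

lemma initial_affine:
  assumes h: "plmap a b a' b' h" and p: "\<And>x. x \<in> {a<..<p} \<Longrightarrow> slope_ratio h x = 1" "p \<le> b" and "y \<in> {a<..<p}"
  shows "h y = a' + initial_slope a b h * (y - a)"
proof (rule plmap_affine_init[OF plmap_initial[OF h] _ _ assms(4)])
  show "a < p" using assms(4) by auto
  fix x assume "x \<in> {a<..<p}" then show "\<exists>c. pl_at h x c c"
    using plmap_pl_at_nonnode[OF h, of x] p by auto
qed

lemma affine_eventually_eq:
  assumes "\<forall>\<^sub>F w in nhds y. c * w + p = c' * w + (p'::real)" shows "c = c' \<and> p = p'"
proof -
  obtain e where e: "e > 0" "\<And>w. dist w y < e \<Longrightarrow> c * w + p = c' * w + p'"
    using assms by (auto simp: eventually_nhds_metric)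
  have "c * y + p = c' * y + p'" "c * (y + e/2) + p = c' * (y + e/2) + p'"
    using e(2)[of y] e(2)[of "y + e/2"] e(1) by (auto simp: dist_real_def)
  then have "c * (e/2) = c' * (e/2)" unfolding distrib_left by linarith
  then have "c = c'" using e(1) by auto
  then show ?thesis using \<open>c * y + p = c' * y + p'\<close> by auto
qed

text \<open>Agreement near a point propagates along the interval. At a possible node
  \<open>z\<close>, agreement on one side yields the value and the slope on that side, and the equal
  slope ratios carry it across.\<close>

lemma pl_eq_on:
  assumes "\<And>x. x \<in> {a<..<b} \<Longrightarrow> \<exists>c d. pl_at h x c d" "\<And>x. x \<in> {a<..<b} \<Longrightarrow> \<exists>c d. pl_at k x c d"
    and sr: "\<And>x. x \<in> {a<..<b} \<Longrightarrow> slope_ratio h x = slope_ratio k x"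
    and start: "a < p" "\<And>x. x \<in> {a<..<p} \<Longrightarrow> h x = k x"
    and x: "x \<in> {a<..<b}"
  shows "h x = k x"
proof -
  define P where "P = (\<lambda>x. \<forall>\<^sub>F y in nhds x. h y = k y)"
  have init: "P z" if "z \<in> {a<..<p}" for z using that start(2) eventually_nhds_in_open[of "{a<..<p}" z]
    by (auto simp: P_def elim!: eventually_mono)
  define m where "m = (a + min p x)/2"
  have m: "m \<in> {a<..<b}" "m \<in> {a<..<p}" using start(1) x by (auto simp: m_def min_def)
  have "P x"
  proof (rule connected_induction_simple[OF _ m(1) x, of P])
    fix z assume z: "z \<in> {a<..<b}"
    obtain c d where h: "pl_at h z c d" using assms(1) z by blast
    obtain c' d' where k: "pl_at k z c' d'" using assms(2) z by blast
    have cd: "d / c = d' / c'" using sr[OF z] pl_at_slope_ratio[OF h] pl_at_slope_ratio[OF k] by simp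
    note pos = pl_at_pos[OF h] pl_at_pos[OF k]
    obtain e1 where e1: "e1 > 0" "\<And>y. z - e1 < y \<Longrightarrow> y < z \<Longrightarrow> h y = h z + c * (y - z)"
      using lgermE h unfolding pl_at_def by metis
    obtain e2 where e2: "e2 > 0" "\<And>y. z < y \<Longrightarrow> y < z + e2 \<Longrightarrow> h y = h z + d * (y - z)"
      using rgermE h unfolding pl_at_def by metis
    obtain e3 where e3: "e3 > 0" "\<And>y. z - e3 < y \<Longrightarrow> y < z \<Longrightarrow> k y = k z + c' * (y - z)"
      using lgermE k unfolding pl_at_def by metis
    obtain e4 where e4: "e4 > 0" "\<And>y. z < y \<Longrightarrow> y < z + e4 \<Longrightarrow> k y = k z + d' * (y - z)"
      using rgermE k unfolding pl_at_def by metis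
    define e where "e = min (min e1 e2) (min e3 e4)"
    have e: "e > 0" "e \<le> e1" "e \<le> e2" "e \<le> e3" "e \<le> e4" using e1 e2 e3 e4 by (auto simp: e_def)
    have all: "h z = k z \<and> c = c'" if y: "y \<in> {z-e<..<z+e}" "P y" for y
    proof (cases y z rule: linorder_cases)
      case less
      have "\<forall>\<^sub>F w in nhds y. w \<in> {z-e<..<z}" by (rule eventually_nhds_in_open) (use y less in auto)
      then have "\<forall>\<^sub>F w in nhds y. h z + c * (w - z) = k z + c' * (w - z)"
        using y(2) unfolding P_def by eventually_elim (use e e1 e3 in auto)
      then have "\<forall>\<^sub>F w in nhds y. c * w + (h z - c * z) = c' * w + (k z - c' * z)"
        by eventually_elim (auto simp: algebra_simps)
      from affine_eventually_eq[OF this] have "c = c'" "h z = k z" by auto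
      then show ?thesis by auto
    next
      case greater
      have "\<forall>\<^sub>F w in nhds y. w \<in> {z<..<z+e}" by (rule eventually_nhds_in_open) (use y greater in auto)
      then have "\<forall>\<^sub>F w in nhds y. h z + d * (w - z) = k z + d' * (w - z)"
        using y(2) unfolding P_def by eventually_elim (use e e2 e4 in auto)
      then have "\<forall>\<^sub>F w in nhds y. d * w + (h z - d * z) = d' * w + (k z - d' * z)"
        by eventually_elim (auto simp: algebra_simps)
      from affine_eventually_eq[OF this] have "d = d'" "h z = k z" by auto
      then show ?thesis using cd pos by (auto simp: field_simps)
    next
      case equal
      then have P: "P z" using y by simp
      then have hk: "h z = k z" unfolding P_def by (rule eventually_nhds_x_imp_x)
      have "pl_at k z c d" using pl_at_cong[of h k z c d] P h unfolding P_def by blast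
      then show ?thesis using pl_at_unique[OF k] hk by auto
    qed
    have "P y" if "x \<in> {z-e<..<z+e}" "y \<in> {z-e<..<z+e}" "P x" for x y
    proof -
      have hk: "h z = k z" "c = c'" using all[OF that(1,3)] by auto
      then have "d = d'" using cd pos by auto
      have "h w = k w" if "w \<in> {z-e<..<z+e}" for w
        using that hk \<open>d = d'\<close> e e1(2)[of w] e2(2)[of w] e3(2)[of w] e4(2)[of w]
        by (cases w z rule: linorder_cases) auto
      then show ?thesis unfolding P_def using eventually_nhds_in_open[of "{z-e<..<z+e}" y] that(2)
        by (auto elim!: eventually_mono)
    qed
    moreover have "openin (top_of_set {a<..<b}) ({a<..<b} \<inter> {z-e<..<z+e})"
      by (intro openin_open_Int open_greaterThanLessThan)
    moreover have "z \<in> {a<..<b} \<inter> {z-e<..<z+e}" using z e(1) by auto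
    ultimately show "\<exists>T. openin (top_of_set {a<..<b}) T \<and> z \<in> T \<and> (\<forall>x\<in>T. \<forall>y\<in>T. P x \<longrightarrow> P y)"
      by (meson IntD2)
  next
    show "connected {a<..<b}" by simp
    show "P m" by (rule init) (rule m)
  qed
  then show ?thesis unfolding P_def by (rule eventually_nhds_x_imp_x)
qed

section \<open>The groups and integer powers\<close>

text \<open>\<open>PL\<close> supplies monotonicity and finitely many nodes but no germs. Between
  nodes the map is affine, with positive slope by monotonicity; the anchors of the germs come from
  continuity at interior points and from surjectivity at the two ends.\<close>

lemma PL_plmap:
  assumes f: "f \<in> PL a b" and ab: "a < b" shows "plmap a b a b f"
proof -
  obtain g where hom: "homeomorphism {a<..<b} {a<..<b} f g" using f by (auto simp: PL_def)
  have mono: "f x < f y" if "x \<in> {a<..<b}" "y \<in> {a<..<b}" "x < y" for x y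
    using f that by (auto simp: PL_def monotone_on_def)
  have fin: "finite (nodes a b f)" using f by (auto simp: PL_def)
  have img: "f ` {a<..<b} = {a<..<b}" using hom by (auto simp: homeomorphism_def)
  have cont: "isCont f x" if "x \<in> {a<..<b}" for x
    using hom that by (auto simp: homeomorphism_def continuous_on_eq_continuous_at)
  have right: "\<exists>v d. rgerm f x v d" if x: "a \<le> x" "x < b" for x
  proof -
    define u where "u = Min (insert b (nodes a b f \<inter> {x<..}))"
    have u: "x < u" "u \<le> b" using fin x by (auto simp: u_def nodes_def)
    have nn: "z \<notin> nodes a b f" if "z \<in> {x<..<u}" for z using that fin by (auto simp: u_def)
    have "\<exists>c d. \<forall>\<^sub>F y in nhds z. f y = c * y + d" if "z \<in> {x<..<u}" for z
      using nn[OF that] that u x by (auto simp: nodes_def)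
    then obtain m n where mn: "\<And>z. z \<in> {x<..<u} \<Longrightarrow> f z = m * z + n"
      using local_affine_imp_affine[of x u f] by blast
    obtain y1 where y1: "x < y1" "y1 < u" using u(1) dense by blast
    obtain y2 where y2: "y1 < y2" "y2 < u" using y1 dense by blast
    have "m * y1 + n < m * y2 + n" using mono[of y1 y2] mn[of y1] mn[of y2] y1 y2 u x by auto
    then have m: "m > 0" using y2 mult_less_cancel_left[of m y1 y2] by (auto simp: not_less split: if_splits)
    have "rgerm f x (m * x + n) m" by (rule rgermI[OF m u(1)]) (simp add: mn algebra_simps)
    then show ?thesis by blast
  qed
  have left: "\<exists>v d. lgerm f x v d" if x: "a < x" "x \<le> b" for x
  proof -
    define u where "u = Max (insert a (nodes a b f \<inter> {..<x}))"
    have u: "u < x" "a \<le> u" using fin x by (auto simp: u_def nodes_def)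
    have nn: "z \<notin> nodes a b f" if "z \<in> {u<..<x}" for z using that fin by (auto simp: u_def)
    have "\<exists>c d. \<forall>\<^sub>F y in nhds z. f y = c * y + d" if "z \<in> {u<..<x}" for z
      using nn[OF that] that u x by (auto simp: nodes_def)
    then obtain m n where mn: "\<And>z. z \<in> {u<..<x} \<Longrightarrow> f z = m * z + n"
      using local_affine_imp_affine[of u x f] by blast
    obtain y1 where y1: "u < y1" "y1 < x" using u(1) dense by blast
    obtain y2 where y2: "y1 < y2" "y2 < x" using y1 dense by blast
    have "m * y1 + n < m * y2 + n" using mono[of y1 y2] mn[of y1] mn[of y2] y1 y2 u x by auto
    then have m: "m > 0" using y2 mult_less_cancel_left[of m y1 y2] by (auto simp: not_less split: if_splits)
    have "lgerm f x (m * x + n) m" by (rule lgermI[OF m u(1)]) (simp add: mn algebra_simps)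
    then show ?thesis by blast
  qed
  show ?thesis unfolding plmap_def
  proof (intro conjI ballI)
    fix x assume x: "x \<in> {a<..<b}"
    obtain v d where r: "rgerm f x v d" using right[of x] x by auto
    obtain w c where l: "lgerm f x w c" using left[of x] x by auto
    have lim: "(f \<longlongrightarrow> f x) (at_right x)" "(f \<longlongrightarrow> f x) (at_left x)"
      using cont[OF x] by (auto simp: isCont_def filterlim_at_split)
    have "v = f x" using tendsto_unique[OF trivial_limit_at_right_real _ lim(1)] rgerm_filterlim[OF r]
      by (auto simp: filterlim_at)
    moreover have "w = f x" using tendsto_unique[OF trivial_limit_at_left_real _ lim(2)] lgerm_filterlim[OF l]
      by (auto simp: filterlim_at)
    ultimately show "\<exists>c d. pl_at f x c d" using r l by (auto simp: pl_at_def)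
  next
    obtain v d where r: "rgerm f a v d" using right[of a] ab by auto
    \<comment> \<open>A limit below \<open>a\<close> would produce values outside the interval, and
      a limit above \<open>a\<close> would leave values just above \<open>a\<close> without a
      preimage.\<close>
    have "v = a"
    proof (rule ccontr)
      assume "v \<noteq> a"
      then consider "v < a" | "v > a" by linarith
      then show False
      proof cases
        case 1
        obtain y where y: "a < y" "y < b" "f y < a" using rgerm_near[OF r ab 1] by auto
        then have "f y \<in> {a<..<b}" using img by (metis greaterThanLessThan_iff imageI)
        then show False using y by auto
      next
        case 2
        have "min v b > a" using 2 ab by auto
        then obtain w where w: "a < w" "w < min v b" using dense by blast
        then have "w \<in> f ` {a<..<b}" using img by auto
        then obtain x where x: "x \<in> {a<..<b}" "f x = w" by auto
        obtain y where "a < y" "y < x" "v < f y" using rgerm_near[OF r, of x "v+1"] x by auto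
        then show False using mono[of y x] x w by auto
      qed
    qed
    then show "\<exists>c. rgerm f a a c" using r by auto
  next
    obtain v d where r: "lgerm f b v d" using left[of b] ab by auto
    have "v = b"
    proof (rule ccontr)
      assume "v \<noteq> b"
      then consider "v > b" | "v < b" by linarith
      then show False
      proof cases
        case 1
        obtain y where y: "a < y" "y < b" "f y > b" using lgerm_near[OF r ab 1] by auto
        then have "f y \<in> {a<..<b}" using img by (metis greaterThanLessThan_iff imageI)
        then show False using y by auto
      next
        case 2
        have "max v a < b" using 2 ab by auto
        then obtain w where w: "w < b" "max v a < w" using dense by blast
        then have "w \<in> f ` {a<..<b}" using img by auto
        then obtain x where x: "x \<in> {a<..<b}" "f x = w" by auto
        obtain y where "x < y" "y < b" "f y < v" using lgerm_near[OF r, of x "v-1"] x by auto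
        then show False using mono[of x y] x w by auto
      qed
    qed
    then show "\<exists>c. lgerm f b b c" using r by auto
  qed (rule ab)
qed

lemma PL_I:
  assumes f: "plmap a b a b f" and id: "\<And>x. x \<notin> {a<..<b} \<Longrightarrow> f x = x" shows "f \<in> PL a b"
proof -
  define g where "g = inv_into {a<..<b} f"
  note g = plmap_inv_into(1)[OF f, folded g_def] and gf = plmap_inv_into(2)[OF f, folded g_def]
    and fg = plmap_inv_into(3)[OF f, folded g_def]
  have "homeomorphism {a<..<b} {a<..<b} f g"
    by (rule homeomorphismI)
      (use plmap_continuous_on[OF f] plmap_continuous_on[OF g] plmap_image[OF f] plmap_image[OF g] gf fg in auto)
  then show ?thesis using plmap_strict_mono_on[OF f] plmap_finite_nodes[OF f] id by (auto simp: PL_def)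
qed

lemma PL_id: "f \<in> PL a b \<Longrightarrow> x \<notin> {a<..<b} \<Longrightarrow> f x = x"
  by (auto simp: PL_def)

lemma bij_plmap_id_outside:
  assumes f: "plmap a b a b f" and id: "\<And>x. x \<notin> {a<..<b} \<Longrightarrow> f x = x" shows "bij f"
proof (rule bijI)
  have *: "f x \<in> {a<..<b} \<longleftrightarrow> x \<in> {a<..<b}" for x
    using plmap_in[OF f] id by metis
  show "inj f"
  proof (rule injI)
    fix x y assume "f x = f y"
    then show "x = y" using *[of x] *[of y] id[of x] id[of y] plmap_eq_iff[OF f, of x y] by metis
  qed
  show "surj f"
    using plmap_surj[OF f] id unfolding surj_def by metis
qed

lemma PL_bij: "f \<in> PL a b \<Longrightarrow> a < b \<Longrightarrow> bij f"
  using bij_plmap_id_outside PL_plmap PL_id by metis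

lemma PL_comp: "f \<in> PL a b \<Longrightarrow> g \<in> PL a b \<Longrightarrow> a < b \<Longrightarrow> g \<circ> f \<in> PL a b"
  by (rule PL_I) (auto intro: plmap_comp[OF PL_plmap PL_plmap] simp: PL_id)

lemma plmap_inv: "bij f \<Longrightarrow> plmap a b a' b' f \<Longrightarrow> plmap a' b' a b (inv f)"
  by (rule plmap_inverse) (auto simp: bij_is_inj)

lemma PL_inv: assumes "f \<in> PL a b" "a < b" shows "inv f \<in> PL a b"
proof (rule PL_I)
  have bij: "bij f" using PL_bij assms by blast
  show "plmap a b a b (inv f)" using plmap_inv[OF bij] PL_plmap assms by blast
  show "inv f x = x" if "x \<notin> {a<..<b}" for x
    using PL_id[OF assms(1) that] bij by (metis bij_is_inj inv_f_f)
qed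

section \<open>Integer powers of a bijection\<close>

lemma zpow_0 [simp]: "zpow f 0 x = x"
  by (simp add: zpow_def)

lemma zpow_1 [simp]: "zpow f 1 = f" and zpow_minus_1 [simp]: "zpow f (- 1) = inv f"
  by (auto simp: zpow_def fun_eq_iff)

lemma zpow_nat [simp]: "zpow f (int n) = f ^^ n"
  by (simp add: zpow_def)

lemma zpow_Suc: assumes "bij f" shows "zpow f (n + 1) x = f (zpow f n x)"
proof (cases "n \<ge> 0")
  case True
  then have "nat (n + 1) = Suc (nat n)" by auto
  then show ?thesis using True by (simp add: zpow_def)
next
  case False
  then have "nat (- n) = Suc (nat (- (n + 1)))" by auto
  then have "zpow f n x = inv f ((inv f ^^ nat (- (n + 1))) x)" using False by (simp add: zpow_def)
  then have "f (zpow f n x) = (inv f ^^ nat (- (n + 1))) x" using assms by (simp add: bij_is_surj surj_f_inv_f)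
  then show ?thesis using False by (auto simp: zpow_def)
qed

lemma zpow_pred: assumes "bij f" shows "zpow f (n - 1) x = inv f (zpow f n x)"
  using zpow_Suc[OF assms, of "n - 1" x] assms by (simp add: bij_is_inj)

lemma zpow_add: assumes "bij f" shows "zpow f (m + n) x = zpow f m (zpow f n x)"
proof (induction m rule: int_induct[of _ 0])
  case (step1 i)
  then show ?case using zpow_Suc[OF assms, of "i + n"] zpow_Suc[OF assms, of i] by (simp add: algebra_simps)
next
  case (step2 i)
  then show ?case using zpow_pred[OF assms, of "i + n"] zpow_pred[OF assms, of i] by (simp add: algebra_simps)
qed simp

lemma zpow_commute: "bij f \<Longrightarrow> zpow f n (f x) = f (zpow f n x)"
  using zpow_add[of f n 1 x] zpow_Suc[of f n x] by simp

lemma zpow_inv: "bij f \<Longrightarrow> zpow (inv f) n = zpow f (- n)"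
  by (auto simp: zpow_def inv_inv_eq)

text \<open>The intertwining relation is known only on \<open>S\<close>, in practice one bump, so
  the induction carries along that the orbit stays in \<open>S\<close>.\<close>

lemma zpow_conj:
  assumes "bij f" "bij g" "\<And>x. x \<in> S \<Longrightarrow> f x \<in> S \<and> inv f x \<in> S"
    "\<And>x. x \<in> S \<Longrightarrow> h (f x) = g (h x)" "x \<in> S"
  shows "zpow f n x \<in> S \<and> h (zpow f n x) = zpow g n (h x)"
proof (induction n rule: int_induct[of _ 0])
  case (step1 i)
  then show ?case using assms by (simp add: zpow_Suc)
next
  case (step2 i)
  let ?y = "zpow f i x"
  have "h (f (inv f ?y)) = g (h (inv f ?y))" using assms(3,4) step2 by blast
  then have "h (inv f ?y) = inv g (h ?y)" using assms(1,2)
    by (metis bij_inv_eq_iff)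
  then show ?case using step2 assms by (simp add: zpow_pred)
qed (use assms in simp)

lemma plmap_zpow: assumes "bij f" "plmap a b a b f" shows "plmap a b a b (zpow f n)"
proof (induction n rule: int_induct[of _ 0])
  case base
  have "zpow f 0 = (\<lambda>x. x)" by auto
  then show ?case using plmap_id plmapD(1)[OF assms(2)] by simp
next
  case (step1 i)
  have "zpow f (i + 1) = f \<circ> zpow f i" using zpow_Suc[OF assms(1)] by auto
  then show ?case using plmap_comp[OF step1(2) assms(2)] by (simp only:)
next
  case (step2 i)
  have "zpow f (i - 1) = inv f \<circ> zpow f i" using zpow_pred[OF assms(1)] by auto
  then show ?case using plmap_comp[OF step2(2) plmap_inv[OF assms]] by (simp only:)
qed

lemma bij_zpow: assumes "bij f" shows "bij (zpow f n)"
proof (rule o_bij)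
  show "zpow f (-n) \<circ> zpow f n = id" "zpow f n \<circ> zpow f (-n) = id"
    using zpow_add[OF assms, of "-n" n] zpow_add[OF assms, of n "-n"] by (auto simp: fun_eq_iff)
qed

lemma slope_zpow:
  assumes f: "bij f" "plmap a b a b f"
  shows "initial_slope a b (zpow f n) = initial_slope a b f powi n"
    "final_slope a b (zpow f n) = final_slope a b f powi n"
proof -
  note pm = plmap_zpow[OF f]
  note pos = initial_slope_pos[OF f(2)] final_slope_pos[OF f(2)]
  have "rgerm (zpow f 0) a a 1" "lgerm (zpow f 0) b b 1"
    by (auto intro!: rgermI[of _ _ "a+1"] lgermI[of _ "b-1"])
  then have i: "initial_slope a b (zpow f 0) = 1" "final_slope a b (zpow f 0) = 1"
    using initial_slope_eq[OF pm[of 0], of 1] final_slope_eq[OF pm[of 0], of 1] by blast+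
  have s: "initial_slope a b (zpow f (i + 1)) = initial_slope a b f * initial_slope a b (zpow f i)"
    "final_slope a b (zpow f (i + 1)) = final_slope a b f * final_slope a b (zpow f i)" for i
  proof -
    have "zpow f (i + 1) = f \<circ> zpow f i" using zpow_Suc[OF f(1)] by auto
    then show "initial_slope a b (zpow f (i + 1)) = initial_slope a b f * initial_slope a b (zpow f i)"
      "final_slope a b (zpow f (i + 1)) = final_slope a b f * final_slope a b (zpow f i)"
      using slope_comp[OF pm f(2)] by auto
  qed
  show "initial_slope a b (zpow f n) = initial_slope a b f powi n"
  proof (induction n rule: int_induct[of _ 0])
    case (step1 i) then show ?case using s(1)[of i] pos by (simp add: power_int_add)
  next
    case (step2 i) then show ?case using s(1)[of "i-1"] pos by (simp add: power_int_diff field_simps)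
  qed (simp only: i power_int_0_right)
  show "final_slope a b (zpow f n) = final_slope a b f powi n"
  proof (induction n rule: int_induct[of _ 0])
    case (step1 i) then show ?case using s(2)[of i] pos by (simp add: power_int_add)
  next
    case (step2 i) then show ?case using s(2)[of "i-1"] pos by (simp add: power_int_diff field_simps)
  qed (simp only: i power_int_0_right)
qed

section \<open>Bumps above the diagonal\<close>

text \<open>\<open>f\<close> is not tied to the identity outside \<open>(a,b)\<close>: an element of
  the group is used directly on each of its bumps, while bijectivity on the whole line keeps
  \<open>inv f\<close> and \<open>zpow f\<close> meaningful.\<close>

locale up_bump =
  fixes a b :: real and f :: "real \<Rightarrow> real"
  assumes bij: "bij f" and pl: "plmap a b a b f" and up: "\<And>x. x \<in> {a<..<b} \<Longrightarrow> x < f x"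
begin

lemma ab: "a < b" using plmapD(1)[OF pl] .

lemma pl_at_ex: "x \<in> {a<..<b} \<Longrightarrow> \<exists>c d. pl_at f x c d" using plmapD(2)[OF pl] .

lemma in_zpow: "x \<in> {a<..<b} \<Longrightarrow> zpow f n x \<in> {a<..<b}"
  using plmap_in[OF plmap_zpow[OF bij pl]] .

lemma in_f: "x \<in> {a<..<b} \<Longrightarrow> f x \<in> {a<..<b}" using plmap_in[OF pl] .

lemma in_inv: "x \<in> {a<..<b} \<Longrightarrow> inv f x \<in> {a<..<b}" using in_zpow[of x "-1"] by simp

lemma zpow_less_iff: "x \<in> {a<..<b} \<Longrightarrow> y \<in> {a<..<b} \<Longrightarrow> zpow f n x < zpow f n y \<longleftrightarrow> x < y"
  using plmap_less_iff[OF plmap_zpow[OF bij pl]] .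

lemma zpow_le_iff: "x \<in> {a<..<b} \<Longrightarrow> y \<in> {a<..<b} \<Longrightarrow> zpow f n x \<le> zpow f n y \<longleftrightarrow> x \<le> y"
  using plmap_le_iff[OF plmap_zpow[OF bij pl]] .

lemma zpow_strict: assumes x: "x \<in> {a<..<b}" and "m < n" shows "zpow f m x < zpow f n x"
  using assms(2)
proof (induction n rule: int_gr_induct)
  case base then show ?case using up[OF in_zpow[OF x]] by (simp add: zpow_Suc[OF bij])
next
  case (step i) then show ?case using up[OF in_zpow[OF x], of i] by (simp add: zpow_Suc[OF bij])
qed

lemma zpow_inj: "x \<in> {a<..<b} \<Longrightarrow> inj (\<lambda>n. zpow f n x)"
proof (rule injI)
  fix m n assume "x \<in> {a<..<b}" "zpow f m x = zpow f n x"
  then show "m = n" using zpow_strict[of x m n] zpow_strict[of x n m] by (cases m n rule: linorder_cases) auto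
qed

text \<open>A bounded increasing orbit would converge to a fixed point of \<open>f\<close> inside
  \<open>(a,b)\<close>.\<close>

lemma unbounded_above:
  assumes x: "x \<in> {a<..<b}" and y: "y < b" obtains n :: nat where "y < zpow f (int n) x"
proof (rule ccontr)
  assume "\<not> thesis"
  then have le: "(f ^^ n) x \<le> y" for n using that by (metis not_less zpow_nat)
  have inc: "incseq (\<lambda>n. (f ^^ n) x)"
  proof (rule incseq_SucI)
    fix n show "(f ^^ n) x \<le> (f ^^ Suc n) x" using zpow_strict[OF x, of "int n" "int (Suc n)"]
      unfolding zpow_nat by simp
  qed
  obtain L where L: "(\<lambda>n. (f ^^ n) x) \<longlonglongrightarrow> L" "\<And>n. (f ^^ n) x \<le> L"
    using incseq_convergent[OF inc] le by blast
  have "L \<le> y" using LIMSEQ_le_const2[OF L(1)] le by auto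
  moreover have "x \<le> L" using L(2)[of 0] by simp
  ultimately have Lin: "L \<in> {a<..<b}" using x y by auto
  have "(\<lambda>n. f ((f ^^ n) x)) \<longlonglongrightarrow> f L"
    using isCont_tendsto_compose[OF plmap_isCont[OF pl Lin] L(1)] .
  moreover have "(\<lambda>n. f ((f ^^ n) x)) \<longlonglongrightarrow> L" using LIMSEQ_Suc[OF L(1)] by simp
  ultimately have "f L = L" using LIMSEQ_unique by blast
  then show False using up[OF Lin] by simp
qed

lemma unbounded_below:
  assumes x: "x \<in> {a<..<b}" and y: "a < y" obtains n :: nat where "zpow f (- int n) x < y"
proof -
  define y' where "y' = min y x"
  have y': "y' \<in> {a<..<b}" "y' \<le> y" using x y by (auto simp: y'_def)
  obtain n :: nat where "x < zpow f (int n) y'" using unbounded_above[OF y'(1), of x] x by auto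
  then have "zpow f (- int n) x < zpow f (- int n) (zpow f (int n) y')"
    using zpow_less_iff[OF x in_zpow[OF y'(1)]] by blast
  also have "\<dots> = y'" using zpow_add[OF bij, of "- int n" "int n" y'] by simp
  finally show thesis using that[of n] y' by linarith
qed

lemma nodes_eq: "nodes a b f = {x\<in>{a<..<b}. slope_ratio f x \<noteq> 1}"
  using plmap_nodes[OF pl] .

lemma sr_pos: "x \<in> {a<..<b} \<Longrightarrow> slope_ratio f x > 0"
  using pl_at_ex slope_ratio_pos by blast

lemma finite_nodes: "finite (nodes a b f)" using plmap_finite_nodes[OF pl] .

text \<open>Without nodes the map would be affine with both ends fixed, hence the identity. So the
  minimum of the nodes exists.\<close>

lemma nodes_nonempty: "nodes a b f \<noteq> {}"
proof
  assume "nodes a b f = {}"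
  then have "slope_ratio f x = 1" if "x \<in> {a<..<b}" for x using that nodes_eq by auto
  from plmap_no_nodes[OF pl this, of "(a+b)/2"] have "f ((a+b)/2) = (a+b)/2" using ab by (simp add: field_simps)
  then show False using up[of "(a+b)/2"] ab by auto
qed

abbreviation "lam \<equiv> initial_slope a b f"
abbreviation "fn \<equiv> Min (nodes a b f)"

lemma fn: "fn \<in> nodes a b f" "fn \<in> {a<..<b}" "x \<in> nodes a b f \<Longrightarrow> fn \<le> x"
  using Min_in[OF finite_nodes nodes_nonempty] finite_nodes by (auto simp: nodes_def)

lemma sr_below: "x \<in> {a<..<fn} \<Longrightarrow> slope_ratio f x = 1"
  using fn(2) fn(3)[of x] nodes_eq by force

lemma f_affine_open: "x \<in> {a<..<fn} \<Longrightarrow> f x = a + lam * (x - a)"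
  by (rule initial_affine[OF pl sr_below]) (use fn(2) in auto)

lemma lam_gt_1: "lam > 1"
proof -
  define x where "x = (a + fn)/2"
  have x: "x \<in> {a<..<fn}" "x \<in> {a<..<b}" using fn(2) by (auto simp: x_def)
  have "x - a < lam * (x - a)" using f_affine_open[OF x(1)] up[OF x(2)] by auto
  then show ?thesis using x by auto
qed

text \<open>The formula extends to the first node because the left germ there is anchored at
  \<open>f fn\<close>. The value at \<open>fn\<close> itself matters where a fundamental domain
  starts at the first node.\<close>

lemma f_affine: assumes "x \<in> {a<..fn}" shows "f x = a + lam * (x - a)"
proof (cases "x = fn")
  case True
  obtain c d where "pl_at f fn c d" using pl_at_ex fn(2) by blast
  then have "lgerm f fn (f fn) c" by (auto simp: pl_at_def)
  moreover have "lgerm f fn (a + lam * (fn - a)) lam"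
    by (rule lgermI[of _ a]) (use lam_gt_1 fn(2) f_affine_open in \<open>auto simp: algebra_simps\<close>)
  ultimately show ?thesis using True lgerm_unique by blast
qed (use f_affine_open assms in auto)

text \<open>An orbit has no repetitions, so it meets the finite node set of \<open>h\<close>
  finitely often. This makes the products over all integers genuine finite products.\<close>

lemma finite_orbit:
  assumes "plmap a b a' b' h" "x \<in> {a<..<b}"
  shows "finite {n. slope_ratio h (zpow f n x) \<noteq> 1}"
proof (rule finite_imageD)
  show "finite ((\<lambda>n. zpow f n x) ` {n. slope_ratio h (zpow f n x) \<noteq> 1})"
    by (rule finite_subset[OF _ plmap_finite_nodes[OF assms(1)]])
      (use plmap_nodes[OF assms(1)] in_zpow[OF assms(2)] in auto)
  show "inj_on (\<lambda>n. zpow f n x) {n. slope_ratio h (zpow f n x) \<noteq> 1}"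
    using zpow_inj[OF assms(2)] inj_on_subset by blast
qed

lemma Prod_orbit_pos:
  assumes "plmap a b a' b' h" "x \<in> {a<..<b}"
  shows "Prod_any (\<lambda>n. slope_ratio h (zpow f n x)) > 0"
  unfolding Prod_any.expand_set
  using slope_ratio_pos plmapD(2)[OF assms(1)] in_zpow[OF assms(2)] by (intro prod_pos) blast

lemma phi_pos: "x \<in> {a<..<b} \<Longrightarrow> phi f x > 0"
  unfolding phi_def using Prod_orbit_pos[OF pl] .

end

text \<open>The chain rule applied to \<open>h \<circ> f = g \<circ> h\<close> along the orbit gives
  \<open>G n * H n = H (n + 1) * F n\<close>. Multiplied over all integers, the two products of
  slope ratios of \<open>h\<close> differ by a shift of the index and cancel.\<close>

lemma phi_conj:
  assumes "up_bump a b f" "up_bump a' b' g" and h: "plmap a b a' b' h"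
    and conj: "\<And>x. x \<in> {a<..<b} \<Longrightarrow> h (f x) = g (h x)" and x: "x \<in> {a<..<b}"
  shows "phi g (h x) = phi f x"
proof -
  interpret f: up_bump a b f by fact
  interpret g: up_bump a' b' g by fact
  define F where "F = (\<lambda>n. slope_ratio f (zpow f n x))"
  define G where "G = (\<lambda>n. slope_ratio g (zpow g n (h x)))"
  define H where "H = (\<lambda>n. slope_ratio h (zpow f n x))"
  have hx: "h x \<in> {a'<..<b'}" using plmap_in[OF h x] .
  have z: "h (zpow f n x) = zpow g n (h x)" for n
    using zpow_conj[of f g "{a<..<b}" h x n] f.bij g.bij conj x f.in_f f.in_inv by blast
  have GH: "G n * H n = H (n + 1) * F n" for n
  proof -
    let ?y = "zpow f n x"
    have y: "?y \<in> {a<..<b}" using f.in_zpow[OF x] .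
    obtain c d where 1: "pl_at f ?y c d" using f.pl_at_ex[OF y] by blast
    obtain c' d' where 2: "pl_at h ?y c' d'" using plmapD(2)[OF h y] by blast
    obtain c1 d1 where 3: "pl_at h (f ?y) c1 d1" using plmapD(2)[OF h f.in_f[OF y]] by blast
    obtain c2 d2 where 4: "pl_at g (h ?y) c2 d2" using g.pl_at_ex plmap_in[OF h y] by blast
    have "slope_ratio (h \<circ> f) ?y = slope_ratio (g \<circ> h) ?y"
      by (rule slope_ratio_cong_open[OF pl_at_comp[OF 2 4], of "{a<..<b}"]) (use y conj in auto)
    then show ?thesis using slope_ratio_comp[OF 1 3] slope_ratio_comp[OF 2 4]
      by (simp add: F_def G_def H_def z zpow_Suc[OF f.bij])
  qed
  have fF: "finite {n. F n \<noteq> 1}" unfolding F_def by (rule f.finite_orbit[OF f.pl x])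
  have fG: "finite {n. G n \<noteq> 1}" unfolding G_def by (rule g.finite_orbit[OF g.pl hx])
  have fH: "finite {n. H n \<noteq> 1}" unfolding H_def by (rule f.finite_orbit[OF h x])
  have "finite ((\<lambda>n. n - 1) ` {n. H n \<noteq> 1})" using fH by blast
  moreover have "(\<lambda>n. n - 1) ` {n. H n \<noteq> 1} = {n. H (n + 1) \<noteq> 1}" by (force simp: image_iff)
  ultimately have fH': "finite {n. H (n + 1) \<noteq> 1}" by simp
  have "bij (\<lambda>n::int. n + 1)" by (rule o_bij[of "\<lambda>n. n - 1"]) auto
  then have "Prod_any H = Prod_any (\<lambda>n. H (n + 1))" by (rule Prod_any.reindex_cong) auto
  moreover have "Prod_any G * Prod_any H = Prod_any (\<lambda>n. H (n + 1)) * Prod_any F"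
    unfolding Prod_any.distrib[OF fG fH, symmetric] Prod_any.distrib[OF fH' fF, symmetric] GH ..
  moreover have "Prod_any H > 0" unfolding H_def by (rule f.Prod_orbit_pos[OF h x])
  ultimately show ?thesis by (simp add: phi_def F_def G_def)
qed

lemma (in up_bump) phi_f: "x \<in> {a<..<b} \<Longrightarrow> phi f (f x) = phi f x"
  by (rule phi_conj[OF up_bump_axioms up_bump_axioms pl]) auto

lemma (in up_bump) phi_zpow: "x \<in> {a<..<b} \<Longrightarrow> phi f (zpow f n x) = phi f x"
  by (rule phi_conj[OF up_bump_axioms up_bump_axioms plmap_zpow[OF bij pl]])
    (simp_all add: zpow_commute[OF bij])

section \<open>Prescribed slope ratios\<close>

lemma one_node_map:
  assumes v: "v \<in> {a<..<b::real}" and \<rho>: "\<rho> > 0"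
  shows "\<exists>g. plmap a b a b g \<and> (\<forall>y\<in>{a<..<b}. slope_ratio g y = (if y = v then \<rho> else 1))"
proof -
  \<comment> \<open>\<open>s\<close> solves
    \<open>s * (v - a) + \<rho> * s * (b - v) = b - a\<close>, so that pieces of slopes
    \<open>s\<close> and \<open>\<rho> * s\<close> starting from the two ends meet at
    \<open>v\<close>.\<close>
  define s where "s = (b - a) / ((v - a) + \<rho> * (b - v))"
  define g where "g = (\<lambda>y. if y \<le> v then a + s * (y - a) else b + \<rho> * s * (y - b))"
  have den: "(v - a) + \<rho> * (b - v) > 0" using v \<rho> by (auto intro!: add_pos_pos)
  have s: "s > 0" using v den by (auto simp: s_def)
  have "s * ((v - a) + \<rho> * (b - v)) = b - a" using den by (simp add: s_def)
  then have eq: "a + s * (v - a) = b + \<rho> * s * (v - b)" by (simp add: algebra_simps)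
  have l: "pl_at g y s s" if "y < v" for y
    by (rule pl_at_affine[OF s, of "{..<v}" _ _ a a]) (use that in \<open>auto simp: g_def\<close>)
  have r: "pl_at g y (\<rho> * s) (\<rho> * s)" if "v < y" for y
    by (rule pl_at_affine[of _ "{v<..}" _ _ b b]) (use that s \<rho> in \<open>auto simp: g_def\<close>)
  have vv: "pl_at g v s (\<rho> * s)" unfolding pl_at_def
  proof
    show "lgerm g v (g v) s" by (rule lgermI[of _ "v-1"]) (use s in \<open>auto simp: g_def algebra_simps\<close>)
    show "rgerm g v (g v) (\<rho> * s)"
      by (rule rgermI[of _ _ "v+1"]) (use s \<rho> eq in \<open>auto simp: g_def algebra_simps\<close>)
  qed
  have "plmap a b a b g" unfolding plmap_def
  proof (intro conjI ballI)
    fix x show "\<exists>c d. pl_at g x c d" using l[of x] r[of x] vv by (cases x v rule: linorder_cases) auto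
  next
    show "\<exists>c. rgerm g a a c" by (rule exI[of _ s], rule rgermI[of _ _ v]) (use s v in \<open>auto simp: g_def\<close>)
    show "\<exists>c. lgerm g b b c"
      by (rule exI[of _ "\<rho> * s"], rule lgermI[of _ v]) (use s v \<rho> in \<open>auto simp: g_def\<close>)
  qed (use v in auto)
  moreover have "slope_ratio g y = (if y = v then \<rho> else 1)" for y
    using pl_at_slope_ratio[OF l[of y]] pl_at_slope_ratio[OF r[of y]] pl_at_slope_ratio[OF vv] s \<rho>
    by (cases y v rule: linorder_cases) auto
  ultimately show ?thesis by blast
qed

text \<open>Nodes are added one at a time by composing on the left with a map whose only possible
  node is \<open>h x\<close>; this changes the slope ratio at \<open>x\<close> and nowhere
  else.\<close>

lemma prescribed_slope_ratios:
  assumes "finite S" "S \<subseteq> {a<..<b::real}" "\<And>x. x \<in> S \<Longrightarrow> \<rho> x > 0" "a < b"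
  shows "\<exists>h. plmap a b a b h \<and> (\<forall>y\<in>{a<..<b}. slope_ratio h y = (if y \<in> S then \<rho> y else 1))"
  using assms(1-3)
proof (induction S rule: finite_induct)
  case empty
  have "slope_ratio (\<lambda>x. x) y = 1" for y using pl_at_slope_ratio[OF pl_at_ident(1)] by simp
  then show ?case using plmap_id[OF assms(4)] by auto
next
  case (insert x S)
  then obtain h where h: "plmap a b a b h"
    "\<And>y. y\<in>{a<..<b} \<Longrightarrow> slope_ratio h y = (if y \<in> S then \<rho> y else 1)" by auto
  have x: "x \<in> {a<..<b}" using insert by auto
  obtain g where g: "plmap a b a b g"
    "\<And>y. y\<in>{a<..<b} \<Longrightarrow> slope_ratio g y = (if y = h x then \<rho> x else 1)"
    using one_node_map[OF plmap_in[OF h(1) x], of "\<rho> x"] insert by auto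
  have "slope_ratio (g \<circ> h) y = (if y \<in> insert x S then \<rho> y else 1)" if y: "y \<in> {a<..<b}" for y
  proof -
    obtain c d where "pl_at h y c d" using plmapD(2)[OF h(1) y] by blast
    moreover obtain c d where "pl_at g (h y) c d" using plmapD(2)[OF g(1) plmap_in[OF h(1) y]] by blast
    ultimately have "slope_ratio (g \<circ> h) y = slope_ratio g (h y) * slope_ratio h y"
      using slope_ratio_comp by blast
    then show ?thesis using h(2)[OF y] g(2)[OF plmap_in[OF h(1) y]] plmap_eq_iff[OF h(1) y x] insert by auto
  qed
  then show ?case using plmap_comp[OF h(1) g(1)] by blast
qed

lemma Prod_any_Suc:
  fixes g :: "nat \<Rightarrow> 'a::comm_monoid_mult"
  assumes "finite {i. g i \<noteq> 1}" shows "Prod_any g = g 0 * Prod_any (\<lambda>i. g (Suc i))"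
proof -
  obtain N where N: "\<And>i. g i \<noteq> 1 \<Longrightarrow> i < N" using assms finite_nat_set_iff_bounded by auto
  have "Prod_any g = prod g {..<Suc N}" by (rule Prod_any.expand_superset) (use N less_Suc_eq in auto)
  moreover have "Prod_any (\<lambda>i. g (Suc i)) = prod (\<lambda>i. g (Suc i)) {..<N}"
    by (rule Prod_any.expand_superset) (auto dest: N Suc_lessD)
  ultimately show ?thesis by (simp only: prod.lessThan_Suc_shift)
qed

lemma Prod_any_nonneg:
  fixes g :: "int \<Rightarrow> 'a::comm_monoid_mult"
  assumes "\<And>n. n < 0 \<Longrightarrow> g n = 1" shows "Prod_any g = Prod_any (\<lambda>i::nat. g (int i))"
proof -
  have "{n. g n \<noteq> 1} = int ` {i. g (int i) \<noteq> 1}"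
  proof (intro set_eqI iffI)
    fix n assume n: "n \<in> {n. g n \<noteq> 1}"
    then have "n \<ge> 0" using assms by force
    then have "n = int (nat n)" by simp
    then show "n \<in> int ` {i. g (int i) \<noteq> 1}" using n by (metis (mono_tags) imageI mem_Collect_eq)
  qed auto
  then show ?thesis unfolding Prod_any.expand_set by (simp add: prod.reindex)
qed

section \<open>Cornering a bump\<close>

context up_bump
begin

lemma half_orbit_finite:
  assumes "x \<in> {a<..<b}" shows "finite {i::nat. slope_ratio f ((f ^^ i) x) \<noteq> 1}"
proof -
  have "finite (int -` {n. slope_ratio f (zpow f n x) \<noteq> 1})"
    by (rule finite_vimageI[OF finite_orbit[OF pl assms]]) auto
  then show ?thesis by (simp add: vimage_def)
qed

lemma preimage_nodes_finite: "finite {y \<in> {a<..<b}. zpow f n y \<in> nodes a b f}"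
proof -
  have "finite (zpow f n -` nodes a b f \<inter> {a<..<b})"
    by (rule finite_vimage_IntI[OF finite_nodes plmap_inj_on[OF plmap_zpow[OF bij pl]]])
  then show ?thesis by (rule finite_subset[rotated]) auto
qed

text \<open>By monotonicity the iterate that carries \<open>u\<close> past the last node does so for
  all \<open>y\<close> above \<open>u\<close>, which makes the bound uniform in
  \<open>y\<close>.\<close>

lemma eventually_past_nodes:
  assumes u: "u \<in> {a<..<b}"
  obtains N :: nat where "\<And>y n. y \<in> {a<..<b} \<Longrightarrow> u \<le> y \<Longrightarrow> int N \<le> n \<Longrightarrow> zpow f n y \<notin> nodes a b f"
proof -
  define M where "M = Max (nodes a b f)"
  have M: "M < b" "\<And>q. q \<in> nodes a b f \<Longrightarrow> q \<le> M"
    using Max_in[OF finite_nodes nodes_nonempty] finite_nodes by (auto simp: M_def nodes_def)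
  obtain N :: nat where N: "M < zpow f (int N) u" using unbounded_above[OF u M(1)] .
  show thesis
  proof (rule that)
    fix y n assume y: "y \<in> {a<..<b}" "u \<le> y" "int N \<le> n"
    have "zpow f (int N) u \<le> zpow f (int N) y" using zpow_le_iff[OF u y(1)] y(2) by blast
    also have "\<dots> \<le> zpow f n y" using zpow_strict[OF y(1), of "int N" n] y(3) by (cases "int N = n") auto
    finally show "zpow f n y \<notin> nodes a b f" using N M(2) by force
  qed
qed

lemma eventually_before_nodes:
  assumes v: "v \<in> {a<..<b}"
  obtains N :: nat where "\<And>y n. y \<in> {a<..<b} \<Longrightarrow> y \<le> v \<Longrightarrow> n \<le> - int N \<Longrightarrow> zpow f n y \<notin> nodes a b f"
proof -
  obtain N :: nat where N: "zpow f (- int N) v < fn" using unbounded_below[OF v] fn(2) by (metis greaterThanLessThan_iff)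
  show thesis
  proof (rule that)
    fix y n assume y: "y \<in> {a<..<b}" "y \<le> v" "n \<le> - int N"
    have "zpow f n y \<le> zpow f (- int N) y" using zpow_strict[OF y(1), of n "- int N"] y(3) by (cases "n = - int N") auto
    also have "\<dots> \<le> zpow f (- int N) v" using zpow_le_iff[OF y(1) v] y(2) by simp
    finally show "zpow f n y \<notin> nodes a b f" using N fn(3) by force
  qed
qed

text \<open>For \<open>y\<close> between \<open>u\<close> and \<open>v\<close> only a bounded range
  of exponents can lead to a node, and each iterate pulls the finite node set back to a finite
  set.\<close>

lemma finite_phi_neq_1:
  assumes u: "u \<in> {a<..<b}" and v: "v \<in> {a<..<b}" shows "finite {y \<in> {u..v}. phi f y \<noteq> 1}"
proof -
  obtain N where N: "\<And>y n. y \<in> {a<..<b} \<Longrightarrow> u \<le> y \<Longrightarrow> int N \<le> n \<Longrightarrow> zpow f n y \<notin> nodes a b f"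
    using eventually_past_nodes[OF u] by blast
  obtain N' where N': "\<And>y n. y \<in> {a<..<b} \<Longrightarrow> y \<le> v \<Longrightarrow> n \<le> - int N' \<Longrightarrow> zpow f n y \<notin> nodes a b f"
    using eventually_before_nodes[OF v] by blast
  have "{y \<in> {u..v}. phi f y \<noteq> 1} \<subseteq> (\<Union>n\<in>{- int N'..int N}. {y \<in> {a<..<b}. zpow f n y \<in> nodes a b f})"
  proof
    fix y assume y: "y \<in> {y \<in> {u..v}. phi f y \<noteq> 1}"
    then have yi: "y \<in> {a<..<b}" using u v by auto
    have "phi f y \<noteq> 1" using y by simp
    then obtain n where "slope_ratio f (zpow f n y) \<noteq> 1" unfolding phi_def
      by (rule Prod_any.not_neutral_obtains_not_neutral)
    then have n: "zpow f n y \<in> nodes a b f" using nodes_eq in_zpow[OF yi] by auto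
    have "n \<le> int N" using N[OF yi, of n] n y by force
    moreover have "n \<ge> - int N'" using N'[OF yi, of n] n y by force
    ultimately show "y \<in> (\<Union>n\<in>{- int N'..int N}. {y \<in> {a<..<b}. zpow f n y \<in> nodes a b f})" using n yi by auto
  qed
  then show ?thesis by (rule finite_subset) (auto intro: preimage_nodes_finite[simplified])
qed

text \<open>
  The slope ratio of the conjugating map at \<open>y\<close> collects those of \<open>f\<close> along the forward orbit of
  \<open>y\<close>. Conjugation by it thus moves all the nodes into one fundamental domain.
\<close>

lemma cornering_map:
  assumes z: "z \<in> {a<..<b}" and fz: "f z \<le> fn"
  obtains h where "plmap a b a b h" "\<And>y. y \<in> {a<..<f z} \<Longrightarrow> slope_ratio h y = 1"
    "\<And>x. x \<in> {a<..<b} \<Longrightarrow>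
      slope_ratio h (f x) * slope_ratio f x = slope_ratio h x * (if z \<le> x \<and> x < f z then phi f x else 1)"
proof -
  define T where "T = (\<lambda>y. Prod_any (\<lambda>i::nat. slope_ratio f ((f ^^ i) y)))"
  \<comment> \<open>Backward orbits of nodes accumulate at \<open>a\<close>, so prescribing
    \<open>T\<close> everywhere would need infinitely many nodes. Cutting off below
    \<open>f z\<close> leaves a finite set and keeps \<open>h\<close> affine on
    \<open>(a, f z)\<close>.\<close>
  define S where "S = {y\<in>{a<..<b}. f z \<le> y \<and> T y \<noteq> 1}"
  have inn: "(f ^^ i) y \<in> {a<..<b}" if "y \<in> {a<..<b}" for i y using in_zpow[OF that, of "int i"] by simp
  have Tpos: "T y > 0" if "y \<in> {a<..<b}" for y
    unfolding T_def Prod_any.expand_set using sr_pos inn[OF that] by (intro prod_pos) auto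
  have fz_in: "f z \<in> {a<..<b}" using in_f z .
  obtain N where N: "\<And>y n. y \<in> {a<..<b} \<Longrightarrow> f z \<le> y \<Longrightarrow> int N \<le> n \<Longrightarrow> zpow f n y \<notin> nodes a b f"
    using eventually_past_nodes[OF fz_in] by blast
  have "S \<subseteq> (\<Union>n\<in>{0..int N}. {y \<in> {a<..<b}. zpow f n y \<in> nodes a b f})"
  proof
    fix y assume y: "y \<in> S"
    then have yi: "y \<in> {a<..<b}" "f z \<le> y" "T y \<noteq> 1" by (auto simp: S_def)
    from yi(3) obtain i where "slope_ratio f ((f ^^ i) y) \<noteq> 1" unfolding T_def
      by (rule Prod_any.not_neutral_obtains_not_neutral)
    then have n: "zpow f (int i) y \<in> nodes a b f" using nodes_eq inn[OF yi(1)] by auto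
    then have "int i \<le> int N" using N[OF yi(1,2), of "int i"] by force
    then show "y \<in> (\<Union>n\<in>{0..int N}. {y \<in> {a<..<b}. zpow f n y \<in> nodes a b f})" using n yi
      by (intro UN_I[of "int i"]) auto
  qed
  then have "finite S" by (rule finite_subset) (auto intro: preimage_nodes_finite[simplified])
  moreover have "S \<subseteq> {a<..<b}" by (auto simp: S_def)
  ultimately obtain h where h: "plmap a b a b h"
    "\<And>y. y\<in>{a<..<b} \<Longrightarrow> slope_ratio h y = (if y \<in> S then T y else 1)"
    using prescribed_slope_ratios[of S a b T] Tpos ab by blast
  have srh: "slope_ratio h y = (if f z \<le> y then T y else 1)" if "y \<in> {a<..<b}" for y
    using h(2)[OF that] that by (auto simp: S_def)
  \<comment> \<open>Splitting off the factor at \<open>y\<close> makes \<open>T\<close> a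
    multiplicative cocycle over \<open>f\<close>, which is why conjugation by \<open>h\<close>
    cancels nodes of \<open>f\<close>.\<close>
  have Tstep: "T y = slope_ratio f y * T (f y)" if "y \<in> {a<..<b}" for y
    unfolding T_def by (subst Prod_any_Suc[OF half_orbit_finite[OF that]]) (simp add: funpow_swap1)
  show thesis
  proof (rule that[OF h(1)])
    fix y assume "y \<in> {a<..<f z}"
    then show "slope_ratio h y = 1" using srh[of y] fz_in by auto
  next
    fix x assume x: "x \<in> {a<..<b}"
    have fx: "f x \<in> {a<..<b}" using in_f x .
    have le: "f z \<le> f x \<longleftrightarrow> z \<le> x" using plmap_le_iff[OF pl z x] .
    \<comment> \<open>Above the cutoff the two values of \<open>T\<close> cancel against the node of
      \<open>f\<close>; below it \<open>f\<close> has no node. In the one fundamental domain where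
      only \<open>f x\<close> is past the cutoff, the whole orbit product remains.\<close>
    consider "f z \<le> x" | "z \<le> x" "x < f z" | "x < z" by linarith
    then show "slope_ratio h (f x) * slope_ratio f x = slope_ratio h x * (if z \<le> x \<and> x < f z then phi f x else 1)"
    proof cases
      case 1
      then have "z \<le> x" using up[OF z] by linarith
      then show ?thesis using 1 srh[OF x] srh[OF fx] le Tstep[OF x] by auto
    next
      case 2
      \<comment> \<open>The backward orbit of \<open>x\<close> lies below the first node, so the
        product over all integers reduces to the forward product.\<close>
      have "slope_ratio f (zpow f n x) = 1" if "n < 0" for n
      proof -
        have "zpow f n x \<le> zpow f (-1) x" using zpow_strict[OF x, of n "-1"] that by (cases "n = -1") auto
        also have "\<dots> < zpow f (-1) (f z)" using zpow_less_iff[OF x fz_in, of "-1"] 2 by simp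
        also have "\<dots> = z" using bij by (simp add: bij_is_inj)
        also have "z < fn" using up[OF z] fz by linarith
        finally show ?thesis using sr_below in_zpow[OF x, of n] by auto
      qed
      then have "phi f x = T x" unfolding phi_def T_def by (subst Prod_any_nonneg) auto
      then show ?thesis using 2 srh[OF x] srh[OF fx] le Tstep[OF x] by auto
    next
      case 3
      then have "x < fn" using up[OF z] fz by linarith
      then have "slope_ratio f x = 1" using sr_below x by auto
      moreover have "\<not> f z \<le> x" using 3 up[OF z] by linarith
      ultimately show ?thesis using 3 srh[OF x] srh[OF fx] le by auto
    qed
  qed
qed

lemma conj_slope_ratio:
  assumes h: "plmap a b a' b' h" and l: "plmap a' b' a' b' l"
    and conj: "\<And>x. x \<in> {a<..<b} \<Longrightarrow> h (f x) = l (h x)" and x: "x \<in> {a<..<b}"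
  shows "slope_ratio l (h x) * slope_ratio h x = slope_ratio h (f x) * slope_ratio f x"
proof -
  obtain c d where 1: "pl_at f x c d" using pl_at_ex[OF x] by blast
  obtain c' d' where 2: "pl_at h x c' d'" using plmapD(2)[OF h x] by blast
  obtain c1 d1 where 3: "pl_at h (f x) c1 d1" using plmapD(2)[OF h in_f[OF x]] by blast
  obtain c2 d2 where 4: "pl_at l (h x) c2 d2" using plmapD(2)[OF l plmap_in[OF h x]] by blast
  have "slope_ratio (h \<circ> f) x = slope_ratio (l \<circ> h) x"
    by (rule slope_ratio_cong_open[OF pl_at_comp[OF 2 4], of "{a<..<b}"]) (use x conj in auto)
  then show ?thesis using slope_ratio_comp[OF 1 3] slope_ratio_comp[OF 2 4] by simp
qed

lemma conj_up_bump:
  assumes h: "plmap a b a' b' h" and l: "plmap a' b' a' b' l" "bij l"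
    and conj: "\<And>x. x \<in> {a<..<b} \<Longrightarrow> h (f x) = l (h x)"
  shows "up_bump a' b' l"
proof
  fix y assume "y \<in> {a'<..<b'}"
  then obtain x where x: "x \<in> {a<..<b}" "h x = y" using plmap_surj[OF h] by blast
  then show "y < l y" using conj[OF x(1)] plmap_less_iff[OF h x(1) in_f[OF x(1)]] up[OF x(1)] by simp
qed (use l in auto)

lemma restr_PL: "restr f a b \<in> PL a b"
  by (rule PL_I) (use pl plmap_cong[of a b f "restr f a b"] in \<open>auto simp: restr_def override_on_def\<close>)

end

lemma restr_id_PL: assumes "plmap a b a b h" shows "restr h a b \<in> PL a b"
  by (rule PL_I) (use assms plmap_cong[of a b h "restr h a b"] in \<open>auto simp: restr_def override_on_def\<close>)

lemma restr_in [simp]: "x \<in> {a<..<b} \<Longrightarrow> restr f a b x = f x"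
  and restr_out [simp]: "x \<notin> {a<..<b} \<Longrightarrow> restr f a b x = x"
  by (simp_all only: restr_def override_on_def if_True if_False id_apply)

section \<open>Existence of the starred node, and the logarithmic coordinate at the left end\<close>

context up_bump
begin

text \<open>If \<open>phi\<close> were \<open>1\<close> at every node it would be \<open>1\<close>
  everywhere, and cornering would remove all nodes. A conjugate of \<open>f\<close> without nodes is
  the identity, against \<open>x < f x\<close>. So \<open>qs\<close> is well defined.\<close>

lemma phi_neq_1_ex: "\<exists>q \<in> nodes a b f. phi f q \<noteq> 1"
proof (rule ccontr)
  assume "\<not> ?thesis"
  then have all: "phi f q = 1" if "q \<in> nodes a b f" for q using that by auto
  have phi1: "phi f x = 1" if x: "x \<in> {a<..<b}" for x
  proof (rule ccontr)
    assume "phi f x \<noteq> 1"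
    then obtain n where "slope_ratio f (zpow f n x) \<noteq> 1" unfolding phi_def
      by (rule Prod_any.not_neutral_obtains_not_neutral)
    then have "zpow f n x \<in> nodes a b f" using nodes_eq in_zpow[OF x] by auto
    then show False using all phi_zpow[OF x, of n] \<open>phi f x \<noteq> 1\<close> by force
  qed
  define z where "z = inv f fn"
  have z: "z \<in> {a<..<b}" "f z \<le> fn" using in_inv[OF fn(2)] bij by (auto simp: z_def bij_is_surj surj_f_inv_f)
  obtain h where h: "plmap a b a b h"
    "\<And>x. x \<in> {a<..<b} \<Longrightarrow>
      slope_ratio h (f x) * slope_ratio f x = slope_ratio h x * (if z \<le> x \<and> x < f z then phi f x else 1)"
    using cornering_map[OF z] by metis
  define k where "k = inv_into {a<..<b} h"
  note k = plmap_inv_into(1)[OF h(1), folded k_def] and kh = plmap_inv_into(2)[OF h(1), folded k_def]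
  define l where "l = h \<circ> (f \<circ> k)"
  have l: "plmap a b a b l" unfolding l_def using plmap_comp[OF plmap_comp[OF k pl] h(1)] .
  have conj: "h (f x) = l (h x)" if "x \<in> {a<..<b}" for x using kh[OF that] by (simp add: l_def)
  have l1: "slope_ratio l y = 1" if y: "y \<in> {a<..<b}" for y
  proof -
    obtain x where x: "x \<in> {a<..<b}" "h x = y" using plmap_surj[OF h(1) y] by blast
    have "slope_ratio h x > 0" using slope_ratio_pos plmapD(2)[OF h(1) x(1)] by blast
    then show ?thesis using conj_slope_ratio[OF h(1) l conj x(1)] h(2)[OF x(1)] phi1[OF x(1)] x(2)
      by (auto split: if_splits)
  qed
  have "l y = y" if "y \<in> {a<..<b}" for y using plmap_no_nodes[OF l l1 that] ab by simp
  then have "h (f z) = h z" using conj[OF z(1)] plmap_in[OF h(1) z(1)] by simp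
  then show False using plmap_eq_iff[OF h(1) in_f[OF z(1)] z(1)] up[OF z(1)] by simp
qed

abbreviation "qs \<equiv> Min {x \<in> nodes a b f. phi f x \<noteq> 1}"

lemma qs: "qs \<in> nodes a b f" "phi f qs \<noteq> 1" "qs \<in> {a<..<b}"
proof -
  have "qs \<in> {x \<in> nodes a b f. phi f x \<noteq> 1}" by (rule Min_in) (use finite_nodes phi_neq_1_ex in auto)
  then show "qs \<in> nodes a b f" "phi f qs \<noteq> 1" "qs \<in> {a<..<b}" by (auto simp only: nodes_eq mem_Collect_eq)
qed

text \<open>The orbit increases, so a bound on its last point keeps the whole segment where
  \<open>f\<close> is affine.\<close>

lemma zpow_affine_nat:
  "x \<in> {a<..<b} \<Longrightarrow> zpow f (int k) x \<le> fn \<Longrightarrow> zpow f (int k) x = a + lam powi int k * (x - a)"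
proof (induction k)
  case (Suc k)
  have "zpow f (int k) x < zpow f (int (Suc k)) x" by (rule zpow_strict[OF Suc.prems(1)]) simp
  then have le: "zpow f (int k) x \<le> fn" using Suc.prems by linarith
  have eq: "int (Suc k) = int k + 1" by simp
  have "zpow f (int (Suc k)) x = f (zpow f (int k) x)" unfolding eq by (rule zpow_Suc[OF bij])
  also have "\<dots> = a + lam * (zpow f (int k) x - a)"
    by (rule f_affine) (use le in_zpow[OF Suc.prems(1), of "int k"] in auto)
  finally show ?case using Suc.IH[OF Suc.prems(1) le] unfolding eq using lam_gt_1 by (simp add: power_int_add)
qed simp

lemma zpow_affine:
  assumes x: "x \<in> {a<..<b}" "x \<le> fn" "zpow f n x \<le> fn" shows "zpow f n x = a + lam powi n * (x - a)"
proof (cases "n \<ge> 0")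
  case True then show ?thesis using zpow_affine_nat[of x "nat n"] x by simp
next
  case False
  define y where "y = zpow f n x"
  have y: "y \<in> {a<..<b}" using in_zpow x by (simp add: y_def)
  have "zpow f (- n) y = x" using zpow_add[OF bij, of "-n" n x] by (simp add: y_def)
  then have "x = a + lam powi (- n) * (y - a)" using zpow_affine_nat[of y "nat (- n)"] y x False by simp
  then have "lam powi n * (x - a) = lam powi n * lam powi (- n) * (y - a)" by simp
  moreover have "lam powi n * lam powi (- n) = 1" using lam_gt_1 by (simp add: power_int_minus)
  ultimately show ?thesis by (simp add: y_def)
qed

text \<open>In the coordinate \<open>t\<close> with \<open>x = a + lam powr t\<close>, the map \<open>f\<close> is \<open>t \<mapsto> t + 1\<close> near \<open>a\<close>.\<close>

definition logphi :: "real \<Rightarrow> real" where "logphi t = phi f (a + lam powr t)"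

definition tmax :: real where "tmax = log lam (fn - a)"

lemma le_tmax: "t \<le> tmax \<longleftrightarrow> a + lam powr t \<le> fn"
  using fn(2) lam_gt_1 by (auto simp: tmax_def le_log_iff)

lemma coord: assumes "y > a" shows "a + lam powr (log lam (y - a)) = y"
  using assms lam_gt_1 by simp

lemma coord_in: "t \<le> tmax \<Longrightarrow> a + lam powr t \<in> {a<..<b}"
  using le_tmax[of t] fn(2) lam_gt_1 by auto

lemma f_coord: "t \<le> tmax \<Longrightarrow> f (a + lam powr t) = a + lam powr (t + 1)"
  using f_affine[of "a + lam powr t"] le_tmax[of t] lam_gt_1 by (simp add: powr_add algebra_simps)

lemma logphi_step: "t \<le> tmax \<Longrightarrow> logphi (t + 1) = logphi t"
  using phi_f[OF coord_in] f_coord by (simp add: logphi_def)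

lemma logphi_nat: "t + real k \<le> tmax + 1 \<Longrightarrow> logphi (t + real k) = logphi t"
proof (induction k)
  case (Suc k) then show ?case using logphi_step[of "t + real k"] by (simp add: algebra_simps)
qed simp

text \<open>A single step may start at any coordinate up to \<open>tmax\<close> and ends one unit
  further, so the periodicity of \<open>logphi\<close> reaches to \<open>tmax + 1\<close>.\<close>

lemma logphi_int: assumes "t \<le> tmax + 1" "t + of_int k \<le> tmax + 1" shows "logphi (t + of_int k) = logphi t"
proof (cases "k \<ge> 0")
  case True then show ?thesis using logphi_nat[of t "nat k"] assms by simp
next
  case False then show ?thesis using logphi_nat[of "t + of_int k" "nat (- k)"] assms by simp
qed

text \<open>Independence of the base point: two points of the orbit of \<open>qs\<close> below the
  first node have logarithmic coordinates that differ by an integer, and \<open>logphi\<close> has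
  period \<open>1\<close>. The exponent \<open>n\<close> may be any integer that brings
  \<open>qs\<close> below \<open>fn\<close>.\<close>

lemma psi_up_zpow:
  assumes r: "zpow f n qs < fn"
  shows "psi_up a b f = (\<lambda>s\<in>{0..<1}. logphi (log lam (zpow f n qs - a) + s))"
proof -
  have qi: "zpow f m qs \<in> {a<..<b}" for m using in_zpow qs(3) by blast
  define P where "P = (\<lambda>r. r \<in> {a<..<fn} \<and> (\<exists>n<0. r = zpow f n qs))"
  define r' where "r' = (SOME r. P r)"
  obtain N :: nat where N: "zpow f (- int N) qs < fn" using unbounded_below[OF qs(3)] fn(2) by (metis greaterThanLessThan_iff)
  \<comment> \<open>\<open>N\<close> may be \<open>0\<close>; one further step back makes the
    exponent negative, as the choice in \<open>psi_up\<close> demands.\<close>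
  have "zpow f (- int (Suc N)) qs < zpow f (- int N) qs" using zpow_strict[OF qs(3)] by simp
  then have "P (zpow f (- int (Suc N)) qs)" unfolding P_def using N qi[of "- int (Suc N)"]
    by (intro conjI exI[of _ "- int (Suc N)"]) auto
  then have "P r'" unfolding r'_def by (rule someI)
  then obtain m where m: "r' \<in> {a<..<fn}" "r' = zpow f m qs" by (auto simp: P_def)
  define x where "x = zpow f n qs"
  have x: "x \<in> {a<..<b}" "x < fn" using qi r by (auto simp: x_def)
  have "zpow f (m - n) x = r'" using zpow_add[OF bij, of "m - n" n qs] m by (simp add: x_def)
  then have "r' = a + lam powi (m - n) * (x - a)" using zpow_affine[OF x(1), of "m - n"] x m by auto
  then have "r' - a = lam powr (m - n) * (x - a)" using lam_gt_1 powr_real_of_int'[of lam "m - n"] by simp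
  then have log: "log lam (r' - a) = log lam (x - a) + of_int (m - n)"
    using lam_gt_1 x by (simp add: log_mult)
  have "psi_up a b f = (\<lambda>s\<in>{0..<1}. phi f (lam powr s * (r' - a) + a))"
    unfolding psi_up_def Let_def r'_def P_def by simp
  also have "\<dots> = (\<lambda>s\<in>{0..<1}. logphi (log lam (x - a) + s))"
  proof (rule restrict_ext)
    fix s :: real assume s: "s \<in> {0..<1}"
    have "lam powr s * (r' - a) + a = a + lam powr (log lam (r' - a) + s)"
      using lam_gt_1 m by (simp add: powr_add)
    then have 1: "phi f (lam powr s * (r' - a) + a) = logphi (log lam (x - a) + s + of_int (m - n))"
      unfolding logphi_def log by (simp add: algebra_simps)
    have "log lam (r' - a) \<le> tmax" "log lam (x - a) \<le> tmax" using m x le_tmax coord by auto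
    then show "phi f (lam powr s * (r' - a) + a) = logphi (log lam (x - a) + s)"
      unfolding 1 using s log by (intro logphi_int) auto
  qed
  finally show ?thesis by (simp add: x_def)
qed

text \<open>Dictionary between two forms of the invariant: \<open>psi_up\<close> is one period of
  \<open>logphi\<close> read from \<open>\<rho>\<close>, and \<open>logphi\<close> is its periodic
  continuation. Since \<open>\<rho>\<close> is the coordinate of a point on the orbit of the starred
  node, the value at \<open>0\<close> differs from \<open>1\<close>.\<close>

lemma psi_up_coord:
  obtains \<rho> where "\<rho> < tmax" "logphi \<rho> \<noteq> 1" "psi_up a b f = (\<lambda>s\<in>{0..<1}. logphi (\<rho> + s))"
    "\<And>t. t \<le> tmax + 1 \<Longrightarrow> logphi t = psi_up a b f (frac (t - \<rho>))"
proof -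
  obtain N :: nat where N: "zpow f (- int N) qs < fn" using unbounded_below[OF qs(3)] fn(2) by (metis greaterThanLessThan_iff)
  define r where "r = zpow f (- int N) qs"
  have r: "r \<in> {a<..<b}" "r < fn" "phi f r \<noteq> 1"
    using N in_zpow[OF qs(3)] phi_zpow[OF qs(3)] qs(2) by (auto simp: r_def)
  define \<rho> where "\<rho> = log lam (r - a)"
  have 1: "\<rho> < tmax" using r lam_gt_1 by (auto simp: \<rho>_def tmax_def)
  have 2: "logphi \<rho> \<noteq> 1" using r coord[of r] by (simp add: logphi_def \<rho>_def)
  have 3: "psi_up a b f = (\<lambda>s\<in>{0..<1}. logphi (\<rho> + s))" using psi_up_zpow[OF N] by (simp add: \<rho>_def r_def)
  have "logphi t = psi_up a b f (frac (t - \<rho>))" if t: "t \<le> tmax + 1" for t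
  proof -
    have "frac (t - \<rho>) \<in> {0..<1}" by (simp add: frac_ge_0 frac_lt_1)
    then have "psi_up a b f (frac (t - \<rho>)) = logphi (\<rho> + frac (t - \<rho>))" using 3 by simp
    also have "\<dots> = logphi ((\<rho> + frac (t - \<rho>)) + of_int \<lfloor>t - \<rho>\<rfloor>)"
      by (rule logphi_int[symmetric]) (use 1 t frac_lt_1[of "t - \<rho>"] in \<open>auto simp: frac_def\<close>)
    also have "\<dots> = logphi t" by (simp add: frac_def)
    finally show ?thesis ..
  qed
  then show thesis using that 1 2 3 by blast
qed

text \<open>One period of the coordinate stays in a compact part of \<open>(a,b)\<close>, where
  \<open>phi f\<close> differs from \<open>1\<close> only finitely often.\<close>

lemma psi_up_finite_function: "psi_up a b f \<in> finite_functions"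
proof -
  obtain \<rho> where \<rho>: "\<rho> < tmax" "psi_up a b f = (\<lambda>s\<in>{0..<1}. logphi (\<rho> + s))" using psi_up_coord by metis
  have inn: "a + lam powr (\<rho> + s) \<in> {a<..<b}" "a + lam powr (\<rho> + s) \<le> a + lam powr (\<rho> + 1)"
    "a + lam powr \<rho> \<le> a + lam powr (\<rho> + s)" "logphi (\<rho> + s) > 0" if "s \<in> {0..<1}" for s
  proof -
    show le: "a + lam powr (\<rho> + s) \<le> a + lam powr (\<rho> + 1)" "a + lam powr \<rho> \<le> a + lam powr (\<rho> + s)"
      using that lam_gt_1 by auto
    have "a + lam powr (\<rho> + 1) \<in> {a<..<b}" using in_f[OF coord_in] f_coord \<rho>(1) by auto
    then have "a + lam powr (\<rho> + s) < b" using le(1) by auto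
    then show "a + lam powr (\<rho> + s) \<in> {a<..<b}" using lam_gt_1 by auto
    then show "logphi (\<rho> + s) > 0" unfolding logphi_def by (rule phi_pos)
  qed
  have b1: "a + lam powr \<rho> \<in> {a<..<b}" "a + lam powr (\<rho> + 1) \<in> {a<..<b}"
    using coord_in[of \<rho>] in_f[OF coord_in, of \<rho>] f_coord[of \<rho>] \<rho>(1) by auto
  have "finite ((\<lambda>s. a + lam powr (\<rho> + s)) ` {s \<in> {0..<1}. psi_up a b f s \<noteq> 1})"
    by (rule finite_subset[OF _ finite_phi_neq_1[OF b1]]) (use inn \<rho>(2) in \<open>auto simp: logphi_def\<close>)
  moreover have "inj_on (\<lambda>s. a + lam powr (\<rho> + s)) {s \<in> {0..<1}. psi_up a b f s \<noteq> 1}"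
    using lam_gt_1 powr_inj[of lam] by (auto simp: inj_on_def)
  ultimately have "finite {s \<in> {0..<1}. psi_up a b f s \<noteq> 1}" using finite_imageD by blast
  then show ?thesis using inn(4) by (auto simp: finite_functions_def \<rho>(2))
qed

end

section \<open>Finite functions up to rotation\<close>

definition rotate_ff :: "(real \<Rightarrow> real) \<Rightarrow> real \<Rightarrow> (real \<Rightarrow> real)" where
  "rotate_ff c t = (\<lambda>s\<in>{0..<1}. c (frac (s + t)))"

lemma frac_in: "frac (x::real) \<in> {0..<1}"
  by (simp add: frac_ge_0 frac_lt_1)

lemma frac_add_of_int: "frac (x + of_int k) = frac (x::real)"
  by (simp add: frac_def)

lemma frac_frac_add: "frac (frac x + y) = frac (x + y :: real)"
proof -
  have "frac x + y = (x + y) + of_int (- \<lfloor>x\<rfloor>)" by (simp add: frac_def)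
  then show ?thesis by (simp only: frac_add_of_int)
qed

lemma frac_in_eq: "s \<in> {0..<1} \<Longrightarrow> frac (s::real) = s"
  by (simp add: frac_eq)

lemma rotate_rotate: "rotate_ff (rotate_ff c u) t = rotate_ff c (u + t)"
proof -
  have "frac (frac (s + t) + u) = frac (s + (u + t))" for s :: real
    by (simp add: frac_frac_add add.commute add.left_commute)
  then show ?thesis unfolding rotate_ff_def using frac_in by (intro restrict_ext) simp
qed

lemma rotate_0: assumes "c \<in> finite_functions" shows "rotate_ff c 0 = c"
proof
  fix s show "rotate_ff c 0 s = c s" using assms frac_in_eq[of s]
    by (auto simp: rotate_ff_def finite_functions_def PiE_def extensional_def)
qed

lemma ff_equiv_iff:
  "(c1, c2) \<in> ff_equiv \<longleftrightarrow> c1 \<in> finite_functions \<and> c2 \<in> finite_functions \<and> (\<exists>t. c1 = rotate_ff c2 t)"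
  by (simp add: ff_equiv_def rotate_ff_def)

lemma ff_equiv_sym: "(c1, c2) \<in> ff_equiv \<Longrightarrow> (c2, c1) \<in> ff_equiv"
  unfolding ff_equiv_iff by (metis rotate_rotate rotate_0 add.right_inverse)

lemma equiv_ff_equiv: "equiv finite_functions ff_equiv"
proof (rule equivI)
  show "ff_equiv \<subseteq> finite_functions \<times> finite_functions" by (auto simp: ff_equiv_def)
  show "refl_on finite_functions ff_equiv" unfolding refl_on_def ff_equiv_iff by (metis rotate_0)
  show "sym ff_equiv" using ff_equiv_sym by (auto simp: sym_def)
  show "trans ff_equiv" unfolding trans_def ff_equiv_iff by (metis rotate_rotate)
qed

lemma ff_less_asym: "ff_less c d \<Longrightarrow> ff_less d c \<Longrightarrow> False"
proof -
  assume "ff_less c d" "ff_less d c"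
  then obtain x y where "x \<in> {0..<1}" "\<forall>z\<in>{0..<x}. c z = d z" "c x < d x"
    "y \<in> {0..<1}" "\<forall>z\<in>{0..<y}. d z = c z" "d y < c y" by (auto simp: ff_less_def)
  then show False by (cases x y rule: linorder_cases) auto
qed

lemma ff_less_trans: assumes "ff_less c d" "ff_less d e" shows "ff_less c e"
proof -
  obtain x where x: "x \<in> {0..<1}" "\<And>z. z\<in>{0..<x} \<Longrightarrow> c z = d z" "c x < d x" using assms(1) by (auto simp: ff_less_def)
  obtain y where y: "y \<in> {0..<1}" "\<And>z. z\<in>{0..<y} \<Longrightarrow> d z = e z" "d y < e y" using assms(2) by (auto simp: ff_less_def)
  have "c z = e z" if "z \<in> {0..<min x y}" for z using that x(2)[of z] y(2)[of z] by auto
  moreover have "c (min x y) < e (min x y)" using x(1,3) y(1,3) x(2)[of y] y(2)[of x]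
    by (cases x y rule: linorder_cases) (auto simp: min_def)
  moreover have "min x y \<in> {0..<1}" using x y by auto
  ultimately show ?thesis unfolding ff_less_def by blast
qed

text \<open>Both functions are \<open>1\<close> off a finite set, so there is a first place where
  they differ.\<close>

lemma ff_less_total:
  assumes "c \<in> finite_functions" "d \<in> finite_functions" "c \<noteq> d" shows "ff_less c d \<or> ff_less d c"
proof -
  define S where "S = {s \<in> {0..<1}. c s \<noteq> d s}"
  have "finite ({s \<in> {0..<1}. c s \<noteq> 1} \<union> {s \<in> {0..<1}. d s \<noteq> 1})" using assms by (auto simp: finite_functions_def)
  then have fin: "finite S" by (rule finite_subset[rotated]) (auto simp: S_def)
  have ext: "c \<in> extensional {0..<1}" "d \<in> extensional {0..<1}" using assms by (auto simp: finite_functions_def PiE_def)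
  have "S \<noteq> {}" using assms(3) extensionalityI[OF ext] by (auto simp: S_def)
  then have "Min S \<in> S" using fin by simp
  then have x: "Min S \<in> {0..<1}" "c (Min S) \<noteq> d (Min S)" by (auto simp: S_def)
  have "c y = d y" if "y \<in> {0..<Min S}" for y
  proof (rule ccontr)
    assume "c y \<noteq> d y"
    then have "y \<in> S" using that x by (auto simp: S_def)
    then show False using Min_le[OF fin, of y] that by auto
  qed
  then show ?thesis using x unfolding ff_less_def by (metis linorder_neqE)
qed

lemma finite_ff_minimum:
  assumes "finite C" "C \<noteq> {}" "C \<subseteq> finite_functions"
  shows "\<exists>m\<in>C. \<forall>d\<in>C. d \<noteq> m \<longrightarrow> ff_less m d"
  using assms
proof (induction C rule: finite_ne_induct)
  case (insert x F)
  then obtain m where m: "m \<in> F" "\<And>d. d \<in> F \<Longrightarrow> d \<noteq> m \<Longrightarrow> ff_less m d" by auto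
  have "m \<noteq> x" using m insert by auto
  then consider "ff_less m x" | "ff_less x m" using ff_less_total[of m x] m(1) insert by auto
  then show ?case
  proof cases
    case 1 then show ?thesis using m by auto
  next
    case 2
    then have "ff_less x d" if "d \<in> F" for d using m(2)[OF that] ff_less_trans by (cases "d = m") auto
    then show ?thesis by auto
  qed
qed auto

text \<open>The condition at \<open>0\<close> makes the candidates finite in number: only a rotation
  that moves one of the finitely many points with value different from \<open>1\<close> to
  \<open>0\<close> qualifies. A strict linear order then has a unique minimum.\<close>

lemma min_finite_function_in:
  assumes c: "c \<in> finite_functions" "c 0 \<noteq> 1"
  shows "min_finite_function (ff_equiv `` {c}) \<in> ff_equiv `` {c}"
    "min_finite_function (ff_equiv `` {c}) 0 \<noteq> 1"
proof -
  define C where "C = {d \<in> ff_equiv `` {c}. d 0 \<noteq> 1}"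
  have "c \<in> C" using c equiv_ff_equiv by (auto simp: C_def equiv_def refl_on_def)
  have "C \<subseteq> rotate_ff c ` {t \<in> {0..<1}. c t \<noteq> 1}"
  proof
    fix d assume "d \<in> C"
    then have d: "(d, c) \<in> ff_equiv" "d 0 \<noteq> 1" using ff_equiv_sym by (auto simp: C_def)
    then obtain t where t: "d = rotate_ff c t" by (auto simp: ff_equiv_iff)
    have "d = rotate_ff c (frac t)" unfolding t rotate_ff_def
      by (intro restrict_ext) (metis add.commute frac_frac_add)
    moreover have "c (frac t) \<noteq> 1" using d(2) by (simp add: t rotate_ff_def)
    ultimately show "d \<in> rotate_ff c ` {t \<in> {0..<1}. c t \<noteq> 1}" using frac_in by blast
  qed
  moreover have "finite {t \<in> {0..<1}. c t \<noteq> 1}" using c by (auto simp: finite_functions_def)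
  ultimately have "finite C" using finite_subset by blast
  moreover have "C \<subseteq> finite_functions" by (auto simp: C_def ff_equiv_def)
  moreover have "C \<noteq> {}" using \<open>c \<in> C\<close> by blast
  ultimately have "\<exists>m\<in>C. \<forall>d\<in>C. d \<noteq> m \<longrightarrow> ff_less m d" by (intro finite_ff_minimum)
  then obtain m where m: "m \<in> C" "\<forall>d\<in>C. d \<noteq> m \<longrightarrow> ff_less m d" by blast
  have "min_finite_function (ff_equiv `` {c}) = m"
    unfolding min_finite_function_def Let_def C_def[symmetric]
  proof (rule the_equality)
    fix m' assume m': "m' \<in> C \<and> (\<forall>d\<in>C. d \<noteq> m' \<longrightarrow> ff_less m' d)"
    show "m' = m"
    proof (rule ccontr)
      assume "m' \<noteq> m"
      then have "ff_less m m'" "ff_less m' m" using m m' by metis+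
      then show False by (rule ff_less_asym)
    qed
  qed (use m in blast)
  then show "min_finite_function (ff_equiv `` {c}) \<in> ff_equiv `` {c}"
    "min_finite_function (ff_equiv `` {c}) 0 \<noteq> 1" using m(1) by (auto simp: C_def)
qed

section \<open>Conjugacy invariance of the slope and of the finite function\<close>

text \<open>Agreement of the two functions \<open>logphi\<close> up to a shift is demanded only far
  to the left, where germs are under control; periodicity transports it to a full period.\<close>

lemma psi_up_match:
  assumes "up_bump a b f" "up_bump a' b' g" and lam: "initial_slope a b f = initial_slope a' b' g"
    and match: "\<And>t. t \<le> T \<Longrightarrow> up_bump.logphi a' b' g (t + \<tau>) = up_bump.logphi a b f t"
  shows "(psi_up a b f, psi_up a' b' g) \<in> ff_equiv"
proof -
  interpret f: up_bump a b f by fact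
  interpret g: up_bump a' b' g by fact
  obtain \<rho> where \<rho>: "\<rho> < f.tmax" "psi_up a b f = (\<lambda>s\<in>{0..<1}. f.logphi (\<rho> + s))" using f.psi_up_coord by metis
  obtain \<sigma> where \<sigma>: "\<And>t. t \<le> g.tmax + 1 \<Longrightarrow> g.logphi t = psi_up a' b' g (frac (t - \<sigma>))" using g.psi_up_coord by metis
  \<comment> \<open>\<open>K\<close> periods are subtracted: enough to bring
    \<open>\<rho> + s\<close> below \<open>T\<close> for every \<open>s < 1\<close>, and to keep the
    point shifted by \<open>\<tau>\<close> below \<open>g.tmax + 1\<close>.\<close>
  obtain K where K: "real K \<ge> \<rho> + 1 - T" "real K \<ge> \<rho> + \<tau> - g.tmax"
    by (metis real_arch_simple le_max_iff_disj linorder_linear order.trans max.cobounded1 max.cobounded2)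
  have "psi_up a b f = rotate_ff (psi_up a' b' g) (\<rho> + \<tau> - \<sigma>)" unfolding \<rho>(2) rotate_ff_def
  proof (rule restrict_ext)
    fix s :: real assume s: "s \<in> {0..<1}"
    have "f.logphi (\<rho> + s) = f.logphi (\<rho> + s + of_int (- int K))"
      by (rule f.logphi_int[symmetric]) (use s \<rho>(1) in auto)
    also have "\<dots> = g.logphi (\<rho> + s + of_int (- int K) + \<tau>)"
      by (rule match[symmetric]) (use s K in auto)
    also have "\<dots> = psi_up a' b' g (frac (\<rho> + s + of_int (- int K) + \<tau> - \<sigma>))"
      by (rule \<sigma>) (use s K in auto)
    also have "\<rho> + s + of_int (- int K) + \<tau> - \<sigma> = (s + (\<rho> + \<tau> - \<sigma>)) + of_int (- int K)" by simp
    finally show "f.logphi (\<rho> + s) = psi_up a' b' g (frac (s + (\<rho> + \<tau> - \<sigma>)))" by (simp only: frac_add_of_int)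
  qed
  then show ?thesis using f.psi_up_finite_function g.psi_up_finite_function by (auto simp: ff_equiv_iff)
qed

lemma conj_initial_slope:
  assumes f: "plmap a b a b f" and g: "plmap a' b' a' b' g" and h: "plmap a b a' b' h"
    and conj: "\<And>x. x \<in> {a<..<b} \<Longrightarrow> h (f x) = g (h x)"
  shows "initial_slope a b f = initial_slope a' b' g" "final_slope a b f = final_slope a' b' g"
proof -
  have "initial_slope a b (h \<circ> f) = initial_slope a b (g \<circ> h)" "final_slope a b (h \<circ> f) = final_slope a b (g \<circ> h)"
    using slope_cong[of a b "h \<circ> f" "g \<circ> h", OF _ plmap_comp[OF h g]] conj by auto
  then show "initial_slope a b f = initial_slope a' b' g" "final_slope a b f = final_slope a' b' g"
    using slope_comp[OF f h] slope_comp[OF h g] initial_slope_pos[OF h] final_slope_pos[OF h] by auto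
qed

text \<open>Near \<open>a\<close> the map \<open>h\<close> multiplies the distance to the end point
  by its initial slope, which is a translation in the logarithmic coordinate, and \<open>phi\<close>
  is invariant under conjugation. The two coordinates share the base because \<open>f\<close> and
  \<open>g\<close> have the same initial slope.\<close>

lemma logphi_match:
  assumes "up_bump a b f" "up_bump a' b' g" and h: "plmap a b a' b' h"
    and conj: "\<And>x. x \<in> {a<..<b} \<Longrightarrow> h (f x) = g (h x)"
  shows "\<exists>T. \<forall>t\<le>T. up_bump.logphi a' b' g (t + log (initial_slope a b f) (initial_slope a b h)) = up_bump.logphi a b f t"
proof -
  interpret f: up_bump a b f by fact
  interpret g: up_bump a' b' g by fact
  have lam: "f.lam = g.lam" using conj_initial_slope[OF f.pl g.pl h conj] by blast
  define \<alpha> where "\<alpha> = initial_slope a b h"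
  have \<alpha>: "rgerm h a a' \<alpha>" "\<alpha> > 0" using plmap_initial[OF h] initial_slope_pos[OF h] by (auto simp: \<alpha>_def)
  obtain e where e: "e > 0" "\<And>y. a < y \<Longrightarrow> y < a + e \<Longrightarrow> h y = a' + \<alpha> * (y - a)" using rgermE[OF \<alpha>(1)] by blast
  define T where "T = min (log f.lam e - 1) f.tmax"
  have "g.logphi (t + log f.lam \<alpha>) = f.logphi t" if t: "t \<le> T" for t
  proof -
    have "f.lam powr t < f.lam powr (log f.lam e)" using t f.lam_gt_1 by (intro powr_less_mono) (auto simp: T_def)
    then have "h (a + f.lam powr t) = a' + \<alpha> * f.lam powr t" using e(2)[of "a + f.lam powr t"] f.lam_gt_1 e(1) by simp
    then have "h (a + f.lam powr t) = a' + g.lam powr (t + log f.lam \<alpha>)"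
      using \<alpha> f.lam_gt_1 by (simp add: powr_add lam[symmetric] mult.commute)
    moreover have "a + f.lam powr t \<in> {a<..<b}" by (rule f.coord_in) (use t in \<open>simp add: T_def\<close>)
    with phi_conj[OF assms(1,2) h conj] have "phi g (h (a + f.lam powr t)) = phi f (a + f.lam powr t)"
      by blast
    ultimately show ?thesis by (simp add: f.logphi_def g.logphi_def)
  qed
  then show ?thesis unfolding \<alpha>_def by blast
qed

lemma psi_up_conj:
  assumes "up_bump a b f" "up_bump a' b' g" and h: "plmap a b a' b' h"
    and conj: "\<And>x. x \<in> {a<..<b} \<Longrightarrow> h (f x) = g (h x)"
  shows "(psi_up a b f, psi_up a' b' g) \<in> ff_equiv"
proof -
  have "initial_slope a b f = initial_slope a' b' g"
    using conj_initial_slope(1)[OF up_bump.pl[OF assms(1)] up_bump.pl[OF assms(2)] h conj] by blast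
  then show ?thesis using logphi_match[OF assms] psi_up_match[OF assms(1,2)] by blast
qed

section \<open>Cornered maps\<close>

text \<open>The upper half of \<open>cornered\<close>. Maps below the diagonal are treated through
  their inverses.\<close>

definition up_cornered :: "real \<Rightarrow> real \<Rightarrow> (real \<Rightarrow> real) \<Rightarrow> bool" where
  "up_cornered a b l \<longleftrightarrow> l \<in> PL a b \<and> (\<forall>y\<in>{a<..<b}. y < l y) \<and> (\<exists>x\<in>{a<..<b}. nodes a b l \<subseteq> {x<..<l x})"

lemma up_cornered_up_bump: "up_cornered a b l \<Longrightarrow> a < b \<Longrightarrow> up_bump a b l"
  unfolding up_cornered_def up_bump_def using PL_bij PL_plmap by auto

lemma nodes_inv:
  assumes "bij m" "plmap a b a b m" shows "nodes a b (inv m) = m ` nodes a b m"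
proof -
  have inv: "plmap a b a b (inv m)" using plmap_inv[OF assms] .
  have sr: "slope_ratio (inv m) (m x) = 1 \<longleftrightarrow> slope_ratio m x = 1" if x: "x \<in> {a<..<b}" for x
  proof -
    obtain c d where cd: "pl_at m x c d" using plmapD(2)[OF assms(2) x] by blast
    have "pl_at (inv m) (m x) (1/c) (1/d)" by (rule pl_at_inv[OF cd]) (use assms(1) in \<open>auto simp: bij_is_inj\<close>)
    then show ?thesis using slope_ratio_1_iff[OF cd] slope_ratio_1_iff pl_at_pos[OF cd] by auto
  qed
  show ?thesis unfolding plmap_nodes[OF inv] plmap_nodes[OF assms(2)]
  proof (intro set_eqI iffI)
    fix y assume y: "y \<in> {x \<in> {a<..<b}. slope_ratio (inv m) x \<noteq> 1}"
    obtain x where "x \<in> {a<..<b}" "m x = y" using plmap_surj[OF assms(2), of y] y by blast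
    then show "y \<in> m ` {x \<in> {a<..<b}. slope_ratio m x \<noteq> 1}" using sr[of x] y by auto
  next
    fix y assume "y \<in> m ` {x \<in> {a<..<b}. slope_ratio m x \<noteq> 1}"
    then obtain x where x: "x \<in> {a<..<b}" "slope_ratio m x \<noteq> 1" "y = m x" by blast
    then show "y \<in> {x \<in> {a<..<b}. slope_ratio (inv m) x \<noteq> 1}" using sr[OF x(1)] plmap_in[OF assms(2) x(1)] by simp
  qed
qed

text \<open>The nodes of \<open>inv l\<close> are the images under \<open>l\<close> of the nodes of
  \<open>l\<close>. A window \<open>(x, inv l x)\<close> for \<open>inv l\<close> turns into
  \<open>(l w, w)\<close> for \<open>l\<close> with \<open>w = inv l (inv l x)\<close>; conversely
  \<open>(l x, x)\<close> turns into a window for \<open>inv l\<close> that starts at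
  \<open>l (l x)\<close>.\<close>

lemma cornered_iff:
  assumes ab: "a < b" shows "cornered a b l \<longleftrightarrow> up_cornered a b l \<or> (l \<in> PL a b \<and> up_cornered a b (inv l))"
proof -
  have "up_cornered a b (inv l) \<longleftrightarrow>
    (\<forall>y\<in>{a<..<b}. l y < y) \<and> (\<exists>x\<in>{a<..<b}. nodes a b l \<subseteq> {l x<..<x})" (is "?L \<longleftrightarrow> ?R") if l: "l \<in> PL a b"
  proof -
    have bij: "bij l" and pl: "plmap a b a b l" and inv: "plmap a b a b (inv l)" and invPL: "inv l \<in> PL a b"
      using l ab PL_bij PL_plmap PL_inv by blast+
    have il [simp]: "inv l (l x) = x" "l (inv l x) = x" for x using bij by (auto simp: bij_is_inj bij_is_surj surj_f_inv_f)
    have iinv: "inv (inv l) = l" using bij by (rule inv_inv_eq)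
    have iin: "inv l x \<in> {a<..<b}" if "x \<in> {a<..<b}" for x using plmap_in[OF inv that] .
    have lin: "l x \<in> {a<..<b}" if "x \<in> {a<..<b}" for x using plmap_in[OF pl that] .
    have dir: "(\<forall>y\<in>{a<..<b}. y < inv l y) \<longleftrightarrow> (\<forall>y\<in>{a<..<b}. l y < y)"
    proof safe
      fix y assume "\<forall>y\<in>{a<..<b}. y < inv l y" "y \<in> {a<..<b}" then show "l y < y" using lin[of y] by fastforce
    next
      fix y assume "\<forall>y\<in>{a<..<b}. l y < y" "y \<in> {a<..<b}" then show "y < inv l y" using iin[of y] by fastforce
    qed
    have n1: "nodes a b (inv l) = l ` nodes a b l" using nodes_inv[OF bij pl] .
    have n2: "nodes a b l = inv l ` nodes a b (inv l)" unfolding n1 by (auto simp: image_image)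
    have sub: "nodes a b l \<subseteq> {a<..<b}" "nodes a b (inv l) \<subseteq> {a<..<b}" by (auto simp: nodes_def)
    show ?thesis
    proof
      assume ?L
      then obtain x where x: "x \<in> {a<..<b}" "nodes a b (inv l) \<subseteq> {x<..<inv l x}" by (auto simp: up_cornered_def)
      have "nodes a b l \<subseteq> {l (inv l (inv l x))<..<inv l (inv l x)}"
      proof
        fix y assume "y \<in> nodes a b l"
        then obtain z where z: "z \<in> nodes a b (inv l)" "y = inv l z" unfolding n2 by blast
        then have "x < z" "z < inv l x" "z \<in> {a<..<b}" using x sub by auto
        then show "y \<in> {l (inv l (inv l x))<..<inv l (inv l x)}"
          using plmap_less_iff[OF inv x(1), of z] plmap_less_iff[OF inv, of z "inv l x"] iin[OF x(1)] z by auto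
      qed
      then show ?R using dir \<open>?L\<close> iin[OF iin[OF x(1)]] unfolding up_cornered_def by blast
    next
      assume ?R
      then obtain x where x: "x \<in> {a<..<b}" "nodes a b l \<subseteq> {l x<..<x}" by blast
      have "nodes a b (inv l) \<subseteq> {l (l x)<..<inv l (l (l x))}"
      proof
        fix y assume "y \<in> nodes a b (inv l)"
        then obtain z where z: "z \<in> nodes a b l" "y = l z" unfolding n1 by blast
        then have "l x < z" "z < x" "z \<in> {a<..<b}" using x sub by auto
        then show "y \<in> {l (l x)<..<inv l (l (l x))}"
          using plmap_less_iff[OF pl lin[OF x(1)], of z] plmap_less_iff[OF pl, of z x] x(1) z by auto
      qed
      then show ?L using dir \<open>?R\<close> lin[OF lin[OF x(1)]] invPL unfolding up_cornered_def by blast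
    qed
  qed
  then show ?thesis unfolding cornered_def up_cornered_def[of a b l] by blast
qed

text \<open>The fundamental domain may start at any coordinate \<open>t0\<close>:
  \<open>t0 + 1 \<le> tmax\<close> places it before the first node of \<open>f\<close>, and
  \<open>logphi t0 \<noteq> 1\<close> makes its start a node of the cornered map. Since the finite
  function is read from the first node, choosing \<open>t0\<close> chooses the rotation.\<close>

lemma (in up_bump) corner_exists:
  assumes t0: "t0 + 1 \<le> tmax" "logphi t0 \<noteq> 1"
  obtains k where "k \<in> PL a b" "up_cornered a b (k \<circ> restr f a b \<circ> inv k)"
    "initial_slope a b (k \<circ> restr f a b \<circ> inv k) = lam"
    "psi_up a b (k \<circ> restr f a b \<circ> inv k) = (\<lambda>s\<in>{0..<1}. logphi (t0 + s))"
proof -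
  define z where "z = a + lam powr t0"
  have z: "z \<in> {a<..<b}" using coord_in[of t0] t0 by (simp add: z_def)
  have fz: "f z = a + lam powr (t0 + 1)" using f_coord[of t0] t0 by (simp add: z_def)
  have "f z \<le> fn" using le_tmax[of "t0 + 1"] t0 by (simp add: fz)
  then obtain h where h: "plmap a b a b h" "\<And>y. y \<in> {a<..<f z} \<Longrightarrow> slope_ratio h y = 1"
    "\<And>x. x \<in> {a<..<b} \<Longrightarrow>
      slope_ratio h (f x) * slope_ratio f x = slope_ratio h x * (if z \<le> x \<and> x < f z then phi f x else 1)"
    using cornering_map[OF z] by metis
  define k where "k = restr h a b"
  have kPL: "k \<in> PL a b" unfolding k_def by (rule restr_id_PL[OF h(1)])
  have kh: "k x = h x" if "x \<in> {a<..<b}" for x using that by (simp add: k_def)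
  have k: "plmap a b a b k" "bij k" using PL_plmap[OF kPL ab] PL_bij[OF kPL ab] by auto
  have ik [simp]: "inv k (k x) = x" for x using k(2) by (simp add: bij_is_inj)
  define l where "l = k \<circ> restr f a b \<circ> inv k"
  have lPL: "l \<in> PL a b" unfolding l_def by (intro PL_comp PL_inv restr_PL kPL ab)
  have l: "plmap a b a b l" "bij l" using PL_plmap[OF lPL ab] PL_bij[OF lPL ab] by auto
  have conj: "k (f x) = l (k x)" if "x \<in> {a<..<b}" for x using that by (simp add: l_def)
  interpret l: up_bump a b l using conj_up_bump[OF k(1) l conj] .
  have lam: "l.lam = lam" using conj_initial_slope[OF pl l(1) k(1) conj] by simp
  have kin: "k x \<in> {a<..<b}" if "x \<in> {a<..<b}" for x using plmap_in[OF k(1) that] .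
  have srk: "slope_ratio k x = slope_ratio h x" if x: "x \<in> {a<..<b}" for x
  proof -
    obtain c d where "pl_at h x c d" using plmapD(2)[OF h(1) x] by blast
    then show ?thesis by (rule slope_ratio_cong_open[of _ _ _ _ "{a<..<b}"]) (use x kh in auto)
  qed
  have srl: "slope_ratio l (k x) = (if z \<le> x \<and> x < f z then phi f x else 1)" if x: "x \<in> {a<..<b}" for x
  proof -
    have "slope_ratio k x > 0" using slope_ratio_pos plmapD(2)[OF k(1) x] by blast
    moreover have "slope_ratio l (k x) * slope_ratio k x = slope_ratio k x * (if z \<le> x \<and> x < f z then phi f x else 1)"
      using conj_slope_ratio[OF k(1) l(1) conj x] h(3)[OF x] srk[OF x] srk[OF in_f[OF x]] by simp
    ultimately show ?thesis by simp
  qed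
  have phil: "phi l (k x) = phi f x" if "x \<in> {a<..<b}" for x
    by (rule phi_conj[OF up_bump_axioms l.up_bump_axioms k(1) conj that])
  define N where "N = {x \<in> {a<..<b}. z \<le> x \<and> x < f z \<and> phi f x \<noteq> 1}"
  have nodes_l: "nodes a b l = k ` N"
  proof (intro set_eqI iffI)
    fix y assume y: "y \<in> nodes a b l"
    then have "y \<in> {a<..<b}" by (simp add: nodes_def)
    then obtain x where x: "x \<in> {a<..<b}" "y = k x" using plmap_surj[OF k(1)] by metis
    then have "x \<in> N" using y srl[OF x(1)] unfolding l.nodes_eq N_def by (auto split: if_splits)
    then show "y \<in> k ` N" using x by blast
  next
    fix y assume "y \<in> k ` N"
    then obtain x where x: "x \<in> N" "y = k x" by blast
    then have "x \<in> {a<..<b}" by (simp add: N_def)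
    then show "y \<in> nodes a b l" using x srl[of x] kin[of x] unfolding l.nodes_eq N_def by simp
  qed
  have zN: "z \<in> N" using z up[OF z] t0(2) by (simp add: N_def z_def logphi_def)
  have finN: "finite N" by (rule finite_subset[OF _ finite_phi_neq_1[OF z in_f[OF z]]]) (auto simp: N_def)
  have fnl: "l.fn = k z"
    unfolding nodes_l using finN zN plmap_le_iff[OF k(1) z]
    by (intro Min_eqI) (auto simp: N_def)
  have "{x \<in> nodes a b l. phi l x \<noteq> 1} = nodes a b l" unfolding nodes_l using phil by (auto simp: N_def)
  then have qsl: "l.qs = k z" using fnl by simp
  define \<kappa> where "\<kappa> = initial_slope a b h"
  have \<kappa>: "\<kappa> > 0" using initial_slope_pos[OF h(1)] by (simp add: \<kappa>_def)
  \<comment> \<open>Below \<open>f z\<close> the map \<open>k\<close> has no nodes, so it is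
    multiplication by \<open>\<kappa>\<close> about \<open>a\<close>, a translation by
    \<open>log lam \<kappa>\<close> in the coordinate.\<close>
  have kaff: "k (a + lam powr t) = a + lam powr (t + log lam \<kappa>)"
    and logl: "l.logphi (t + log lam \<kappa>) = logphi t" if t: "t < t0 + 1" for t
  proof -
    have lt: "a + lam powr t \<in> {a<..<f z}" using t lam_gt_1 by (simp add: fz)
    have inn: "a + lam powr t \<in> {a<..<b}" using lt in_f[OF z] by auto
    have "h (a + lam powr t) = a + \<kappa> * (a + lam powr t - a)" unfolding \<kappa>_def
      by (rule initial_affine[OF h(1,2) _ lt]) (use in_f[OF z] in auto)
    then show eq: "k (a + lam powr t) = a + lam powr (t + log lam \<kappa>)"
      using kh[OF inn] \<kappa> lam_gt_1 by (simp add: powr_add)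
    show "l.logphi (t + log lam \<kappa>) = logphi t" using phil[OF inn] eq by (simp add: l.logphi_def logphi_def lam)
  qed
  \<comment> \<open>\<open>psi_up\<close> starts at an orbit point strictly below the first node, so
    the computation goes one step back from \<open>k z\<close>; the lost unit is restored by
    periodicity at the end.\<close>
  have m1: "zpow l (-1) l.qs < l.fn" using l.zpow_strict[OF l.qs(3), of "-1" 0] by (simp add: qsl fnl)
  have iz: "inv f z = a + lam powr (t0 - 1)"
  proof -
    have "f (a + lam powr (t0 - 1)) = z" using f_coord[of "t0 - 1"] t0 by (simp add: z_def)
    then show ?thesis using bij by (metis bij_inv_eq_iff)
  qed
  have "l (k (inv f z)) = k z" using conj[OF in_inv[OF z]] bij by (simp add: bij_is_surj surj_f_inv_f)
  then have "zpow l (-1) l.qs = k (inv f z)" unfolding qsl using l(2) by (metis bij_inv_eq_iff zpow_minus_1)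
  also have "\<dots> = a + lam powr (t0 - 1 + log lam \<kappa>)" unfolding iz by (rule kaff) simp
  finally have "log lam (zpow l (-1) l.qs - a) = t0 - 1 + log lam \<kappa>" using lam_gt_1 by simp
  then have "psi_up a b l = (\<lambda>s\<in>{0..<1}. l.logphi (t0 - 1 + log lam \<kappa> + s))"
    using l.psi_up_zpow[OF m1] by (simp add: lam)
  also have "\<dots> = (\<lambda>s\<in>{0..<1}. logphi (t0 + s))"
  proof (rule restrict_ext)
    fix s :: real assume s: "s \<in> {0..<1}"
    have "l.logphi (t0 - 1 + log lam \<kappa> + s) = logphi (t0 - 1 + s)"
      using logl[of "t0 - 1 + s"] s by (simp add: algebra_simps)
    also have "\<dots> = logphi (t0 + s)" using logphi_step[of "t0 - 1 + s"] s t0 by simp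
    finally show "l.logphi (t0 - 1 + log lam \<kappa> + s) = logphi (t0 + s)" .
  qed
  finally have psi: "psi_up a b l = (\<lambda>s\<in>{0..<1}. logphi (t0 + s))" .
  \<comment> \<open>\<open>k z\<close> is itself a node, while \<open>up_cornered\<close> asks for
    an open window. The window therefore starts slightly before \<open>z\<close>, so close to it
    that the largest node stays below the image of the start.\<close>
  define M where "M = Max N"
  have "N \<noteq> {}" using zN by blast
  then have M: "M \<in> N" "\<And>x. x \<in> N \<Longrightarrow> x \<le> M" using finN by (simp_all add: M_def)
  have Mi: "M \<in> {a<..<b}" "M < f z" using M by (auto simp: N_def)
  have iM: "inv f M \<in> {a<..<b}" "f (inv f M) = M" using in_inv[OF Mi(1)] bij by (auto simp: bij_is_surj surj_f_inv_f)
  then have "inv f M < z" using plmap_less_iff[OF pl iM(1) z] Mi by simp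
  then obtain x0 where x0: "inv f M < x0" "x0 < z" using dense by blast
  have x0i: "x0 \<in> {a<..<b}" using x0 iM(1) z by auto
  have "M < f x0" using plmap_less_iff[OF pl iM(1) x0i] x0(1) iM(2) by simp
  have "nodes a b l \<subseteq> {k x0<..<l (k x0)}"
  proof
    fix y assume "y \<in> nodes a b l"
    then obtain x where x: "x \<in> N" "y = k x" unfolding nodes_l by blast
    then have xi: "x \<in> {a<..<b}" "z \<le> x" by (auto simp: N_def)
    have "k x0 < k x" using plmap_less_iff[OF k(1) x0i xi(1)] x0 xi by simp
    moreover have "k x < k (f x0)" using plmap_less_iff[OF k(1) xi(1) in_f[OF x0i]] M(2)[OF x(1)] \<open>M < f x0\<close> by simp
    ultimately show "y \<in> {k x0<..<l (k x0)}" using x conj[OF x0i] by simp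
  qed
  then have "up_cornered a b l" unfolding up_cornered_def using lPL l.up kin[OF x0i] by blast
  then show thesis using that[of k] kPL lam psi unfolding l_def by blast
qed

section \<open>Rigidity of cornered maps above the diagonal\<close>

context up_bump
begin

text \<open>All nodes lie in the one fundamental domain from \<open>fn\<close> to
  \<open>f fn\<close>, so an orbit meets at most one of them. The orbit product is then a single
  slope ratio, the first node is already the starred one, and the finite function lists slope
  ratios.\<close>

lemma corner_facts:
  assumes x0: "x0 \<in> {a<..<b}" "nodes a b f \<subseteq> {x0<..<f x0}"
  shows "y \<in> {a<..<b} \<Longrightarrow> slope_ratio f y \<noteq> 1 \<Longrightarrow> fn \<le> y \<and> y < f fn"
    "psi_up a b f = (\<lambda>s\<in>{0..<1}. slope_ratio f (a + lam powr s * (fn - a)))"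
proof -
  have fnx: "x0 < fn" using fn(1) x0 by auto
  then have f0: "f x0 < f fn" using plmap_less_iff[OF pl x0(1) fn(2)] by simp
  have dom: "fn \<le> y \<and> y < f fn" if "y \<in> {a<..<b}" "slope_ratio f y \<noteq> 1" for y
  proof -
    have "y \<in> nodes a b f" using that nodes_eq by auto
    then show ?thesis using fn(3)[of y] x0(2) f0 by fastforce
  qed
  then show "y \<in> {a<..<b} \<Longrightarrow> slope_ratio f y \<noteq> 1 \<Longrightarrow> fn \<le> y \<and> y < f fn" by blast
  have phi_sr: "phi f y = slope_ratio f y" if y: "fn \<le> y" "y < f fn" for y
  proof -
    have yi: "y \<in> {a<..<b}" using y fn(2) in_f[OF fn(2)] by auto
    have "{n. slope_ratio f (zpow f n y) \<noteq> 1} \<subseteq> {0}"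
    proof
      fix n assume "n \<in> {n. slope_ratio f (zpow f n y) \<noteq> 1}"
      then have n: "fn \<le> zpow f n y" "zpow f n y < f fn" using dom in_zpow[OF yi] by auto
      have "\<not> n > 0"
      proof
        assume "n > 0"
        then have "zpow f 1 y \<le> zpow f n y" using zpow_strict[OF yi, of 1 n] by (cases "n = 1") auto
        moreover have "f fn \<le> f y" using plmap_le_iff[OF pl fn(2) yi] y by simp
        ultimately show False using n by simp
      qed
      moreover have "\<not> n < 0"
      proof
        assume "n < 0"
        then have "zpow f n y \<le> zpow f (-1) y" using zpow_strict[OF yi, of n "-1"] by (cases "n = -1") auto
        also have "\<dots> < zpow f (-1) (f fn)" using zpow_less_iff[OF yi in_f[OF fn(2)]] y by blast
        also have "\<dots> = fn" using bij by (simp add: bij_is_inj)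
        finally show False using n by simp
      qed
      ultimately show "n \<in> {0}" by simp
    qed
    then show ?thesis unfolding phi_def by (subst Prod_any.expand_superset[of "{0}"]) auto
  qed
  have all: "phi f q \<noteq> 1" if "q \<in> nodes a b f" for q
    using that dom[of q] phi_sr[of q] unfolding nodes_eq by auto
  then have "{x \<in> nodes a b f. phi f x \<noteq> 1} = nodes a b f" by blast
  then have qf: "qs = fn" by (simp only:)
  have m1: "zpow f (-1) qs < fn" using zpow_strict[OF fn(2), of "-1" 0] by (simp add: qf)
  have "zpow f (-1) qs = a + lam powi (-1) * (fn - a)" using zpow_affine[OF fn(2), of "-1"] m1 by (simp add: qf)
  also have "\<dots> = a + (fn - a) / lam" by (simp add: power_int_minus divide_inverse)
  finally have "log lam (zpow f (-1) qs - a) = tmax - 1" using lam_gt_1 fn(2) by (simp add: tmax_def log_divide)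
  then have "psi_up a b f = (\<lambda>s\<in>{0..<1}. logphi (tmax - 1 + s))" using psi_up_zpow[OF m1] by simp
  also have "\<dots> = (\<lambda>s\<in>{0..<1}. slope_ratio f (a + lam powr s * (fn - a)))"
  proof (rule restrict_ext)
    fix s :: real assume s: "s \<in> {0..<1}"
    have eq: "lam powr (tmax + s) = lam powr s * (fn - a)"
      using lam_gt_1 fn(2) by (simp add: powr_add tmax_def)
    have "logphi (tmax - 1 + s) = logphi (tmax + s)" using logphi_step[of "tmax - 1 + s"] s by simp
    also have "\<dots> = phi f (a + lam powr s * (fn - a))" by (simp add: logphi_def eq)
    also have "\<dots> = slope_ratio f (a + lam powr s * (fn - a))"
    proof (rule phi_sr)
      have "lam powr 0 \<le> lam powr s" "lam powr s < lam powr 1" using s lam_gt_1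
      by (intro powr_mono powr_less_mono; simp)+
      then have "1 \<le> lam powr s" "lam powr s < lam" using lam_gt_1 by auto
      then have "1 * (fn - a) \<le> lam powr s * (fn - a)" "lam powr s * (fn - a) < lam * (fn - a)"
        using fn(2)
        by (intro mult_right_mono mult_strict_right_mono; simp)+
      moreover have "f fn = a + lam * (fn - a)" using f_affine[of fn] fn(2) by simp
      ultimately show "fn \<le> a + lam powr s * (fn - a)" "a + lam powr s * (fn - a) < f fn" by auto
    qed
    finally show "logphi (tmax - 1 + s) = slope_ratio f (a + lam powr s * (fn - a))" .
  qed
  finally show "psi_up a b f = (\<lambda>s\<in>{0..<1}. slope_ratio f (a + lam powr s * (fn - a)))" .
qed


text \<open>The left end point becomes \<open>0\<close> and the first node \<open>1\<close>, so that
  two cornered maps can be compared before anything is known about the relative position of their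
  right ends.\<close>

definition normalized :: "real \<Rightarrow> real" where
  "normalized u = (f (a + (fn - a) * u) - a) / (fn - a)"

text \<open>The normalized right end point. That \<open>lam\<close> and \<open>psi_up\<close>
  determine it is part of the uniqueness proof.\<close>

definition width :: real where "width = (b - a) / (fn - a)"

lemma normalized_plmap: "plmap 0 width 0 width normalized"
  and normalized_up: "u \<in> {0<..<width} \<Longrightarrow> u < normalized u"
  and normalized_init: "u \<in> {0<..<1} \<Longrightarrow> normalized u = lam * u"
  and normalized_sr: "u \<in> {0<..<width} \<Longrightarrow> slope_ratio normalized u = slope_ratio f (a + (fn - a) * u)"
  and width_gt_1: "width > 1"
  and width_in: "u \<in> {0<..<width} \<longleftrightarrow> a + (fn - a) * u \<in> {a<..<b}"
proof -
  define q where "q = fn - a"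
  have q: "q > 0" using fn(2) by (simp add: q_def)
  have qb: "q * width = b - a" using q by (simp add: width_def q_def)
  show w1: "width > 1" using fn(2) by (simp add: width_def)
  show win: "u \<in> {0<..<width} \<longleftrightarrow> a + (fn - a) * u \<in> {a<..<b}" for u
  proof -
    have "u < width \<longleftrightarrow> q * u < q * width" "0 < u \<longleftrightarrow> q * 0 < q * u"
      using q mult_less_cancel_left_pos by blast+
    then show ?thesis unfolding qb q_def[symmetric] by auto
  qed
  have A: "plmap 0 width a b (\<lambda>u. q * u + a)" using plmap_affine[of 0 width q a] q w1 qb by simp
  have B: "plmap a b 0 width (\<lambda>x. (1/q) * x + (- a/q))"
    using plmap_affine[of a b "1/q" "- a/q"] q ab by (simp add: width_def q_def diff_divide_distrib)
  have eq: "normalized = (\<lambda>x. (1/q) * x + (- a/q)) \<circ> (f \<circ> (\<lambda>u. q * u + a))"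
    by (auto simp: normalized_def fun_eq_iff q_def diff_divide_distrib add.commute)
  show "plmap 0 width 0 width normalized" unfolding eq by (intro plmap_comp[OF plmap_comp[OF A pl] B])
  show "u < normalized u" if "u \<in> {0<..<width}" for u
  proof -
    have "a + q * u < f (a + q * u)" using up win[of u] that by (simp add: q_def)
    then show ?thesis using q by (simp add: normalized_def q_def[symmetric] field_simps)
  qed
  show "normalized u = lam * u" if "u \<in> {0<..<1}" for u
  proof -
    have "q * u < q * 1" using that q by (intro mult_strict_left_mono) auto
    moreover have "q * u > 0" using that q by simp
    ultimately have "a + q * u \<in> {a<..fn}" unfolding q_def by auto
    then have "f (a + q * u) = a + lam * (a + q * u - a)" by (rule f_affine)
    then show ?thesis using q by (simp add: normalized_def q_def[symmetric])
  qed
  show "slope_ratio normalized u = slope_ratio f (a + (fn - a) * u)" if u: "u \<in> {0<..<width}" for u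
  proof -
    have inn: "q * u + a \<in> {a<..<b}" using win[of u] u by (simp add: q_def add.commute)
    obtain c d where cd: "pl_at f (q * u + a) c d" using pl_at_ex[OF inn] by blast
    have "pl_at (\<lambda>u. q * u + a) u q q" by (rule pl_at_affine[of _ UNIV _ _ a 0]) (use q in auto)
    then have "pl_at (f \<circ> (\<lambda>u. q * u + a)) u (c * q) (d * q)" using cd by (rule pl_at_comp)
    moreover have "pl_at (\<lambda>x. (1/q) * x + (- a/q)) x (1/q) (1/q)" for x
      by (rule pl_at_affine[of _ UNIV _ _ "-a/q" 0]) (use q in auto)
    ultimately have "pl_at normalized u (1/q * (c * q)) (1/q * (d * q))" unfolding eq by (rule pl_at_comp)
    then show ?thesis using pl_at_slope_ratio[OF cd] pl_at_slope_ratio q by (simp add: q_def add.commute)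
  qed
qed

end

text \<open>Expresses the slope ratios through \<open>lam\<close> and \<open>psi_up\<close>, without
  \<open>a\<close>, \<open>b\<close> or the position of the first node.\<close>

lemma (in up_bump) corner_normalized_sr:
  assumes x0: "x0 \<in> {a<..<b}" "nodes a b f \<subseteq> {x0<..<f x0}" and u: "u \<in> {0<..<width}"
  shows "slope_ratio normalized u = (if 1 \<le> u \<and> u < lam then psi_up a b f (log lam u) else 1)"
proof (cases "1 \<le> u \<and> u < lam")
  case True
  then have "log lam u \<in> {0..<1}" using lam_gt_1 by auto
  then have "psi_up a b f (log lam u) = slope_ratio f (a + lam powr (log lam u) * (fn - a))"
    using corner_facts(2)[OF x0] by simp
  then show ?thesis using True normalized_sr[OF u] lam_gt_1 by (simp add: mult.commute)
next
  case False
  have f: "f fn = a + lam * (fn - a)" using f_affine[of fn] fn(2) by simp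
  have "\<not> (fn \<le> a + (fn - a) * u \<and> a + (fn - a) * u < f fn)"
  proof
    assume c: "fn \<le> a + (fn - a) * u \<and> a + (fn - a) * u < f fn"
    then have "(fn - a) * 1 \<le> (fn - a) * u" "(fn - a) * u < (fn - a) * lam"
      unfolding f by (auto simp: mult.commute)
    then have "1 \<le> u" "u < lam" using fn(2) by (auto simp: mult_less_cancel_left mult_le_cancel_left)
    then show False using False by simp
  qed
  then have "slope_ratio f (a + (fn - a) * u) = 1" using corner_facts(1)[OF x0] width_in[of u] u by blast
  then show ?thesis using False normalized_sr[OF u] by auto
qed

text \<open>After normalization both maps have the same start and the same slope ratios, hence agree
  as long as both are defined. The right end of the shorter interval would be a fixed point inside
  the longer one, so the widths agree and the normalizations combine to an affine conjugacy.\<close>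

lemma up_cornered_unique:
  assumes "up_cornered a b l" "a < b" "up_cornered a' b' m" "a' < b'"
    and psi: "psi_up a b l = psi_up a' b' m" and slope: "initial_slope a b l = initial_slope a' b' m"
    and y: "y \<in> {a<..<b}"
  shows "m (a' + (b' - a') / (b - a) * (y - a)) = a' + (b' - a') / (b - a) * (l y - a)"
proof -
  interpret l: up_bump a b l using up_cornered_up_bump assms by blast
  interpret m: up_bump a' b' m using up_cornered_up_bump assms by blast
  obtain x1 where x1: "x1 \<in> {a<..<b}" "nodes a b l \<subseteq> {x1<..<l x1}" using assms(1) by (auto simp: up_cornered_def)
  obtain x2 where x2: "x2 \<in> {a'<..<b'}" "nodes a' b' m \<subseteq> {x2<..<m x2}" using assms(3) by (auto simp: up_cornered_def)
  note srl = l.corner_normalized_sr[OF x1] and srm = m.corner_normalized_sr[OF x2]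
  define B where "B = min l.width m.width"
  have B1: "B > 1" using l.width_gt_1 m.width_gt_1 by (simp add: B_def)
  have eq: "l.normalized u = m.normalized u" if u: "u \<in> {0<..<B}" for u
  proof (rule pl_eq_on[of 0 B _ _ 1, OF _ _ _ _ _ u])
    fix x assume x: "x \<in> {0<..<B}"
    then have xx: "x \<in> {0<..<l.width}" "x \<in> {0<..<m.width}" by (auto simp: B_def)
    show "\<exists>c d. pl_at l.normalized x c d" using plmapD(2)[OF l.normalized_plmap xx(1)] .
    show "\<exists>c d. pl_at m.normalized x c d" using plmapD(2)[OF m.normalized_plmap xx(2)] .
    show "slope_ratio l.normalized x = slope_ratio m.normalized x" using srl[OF xx(1)] srm[OF xx(2)] psi slope by simp
  next
    fix x :: real assume "x \<in> {0<..<1}"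
    then show "l.normalized x = m.normalized x" using l.normalized_init m.normalized_init slope by simp
  qed simp
  have contra: False if n: "plmap 0 u 0 u n" and k: "plmap 0 v 0 v k" and "u < v"
    and eq: "\<And>x. x \<in> {0<..<u} \<Longrightarrow> n x = k x" and up: "\<And>x. x \<in> {0<..<v} \<Longrightarrow> x < k x"
    for u v :: real and n k :: "real \<Rightarrow> real"
  proof -
    have u: "0 < u" using plmapD(1)[OF n] .
    obtain d where "lgerm n u u d" using plmapD(4)[OF n] by blast
    then have "lgerm k u u d" using lgerm_cong_open[of 0 u n k] eq u by blast
    moreover obtain d' d'' where "pl_at k u d' d''" using plmapD(2)[OF k, of u] u \<open>u < v\<close> by auto
    then have "lgerm k u (k u) d'" by (simp add: pl_at_def)
    ultimately have "k u = u" using lgerm_unique by blast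
    then show False using up[of u] u \<open>u < v\<close> by simp
  qed
  have w: "l.width = m.width"
  proof (cases l.width m.width rule: linorder_cases)
    case less
    then show ?thesis using contra[OF l.normalized_plmap m.normalized_plmap less] eq m.normalized_up
      by (auto simp: B_def)
  next
    case greater
    then show ?thesis using contra[OF m.normalized_plmap l.normalized_plmap greater] eq l.normalized_up
      by (auto simp: B_def min_def)
  qed
  define u where "u = (y - a) / (l.fn - a)"
  have ql: "l.fn - a > 0" and qm: "m.fn - a' > 0" using l.fn(2) m.fn(2) by auto
  have yu: "y = a + (l.fn - a) * u" using ql by (simp add: u_def)
  have u: "u \<in> {0<..<l.width}" using l.width_in[of u] y yu by simp
  \<comment> \<open>Equal widths turn the ratio of the interval lengths into the ratio of the
    distances to the first nodes.\<close>
  have ratio: "(b' - a') / (b - a) = (m.fn - a') / (l.fn - a)"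
    using w ql qm l.ab m.ab by (simp add: l.width_def m.width_def field_simps)
  have e: "l.normalized u = m.normalized u" using eq[of u] u w by (simp add: B_def)
  have ly: "l y = a + (l.fn - a) * l.normalized u" using ql by (simp add: l.normalized_def yu)
  have my: "m (a' + (m.fn - a') * u) = a' + (m.fn - a') * m.normalized u" using qm by (simp add: m.normalized_def)
  have "(m.fn - a') / (l.fn - a) * (y - a) = (m.fn - a') * u" by (simp add: u_def)
  moreover have "(m.fn - a') / (l.fn - a) * (l y - a) = (m.fn - a') * m.normalized u"
    using ql by (simp add: ly e)
  ultimately show ?thesis using my by (simp only: ratio)
qed

section \<open>Bumps above or below the diagonal\<close>

definition bump :: "real \<Rightarrow> real \<Rightarrow> (real \<Rightarrow> real) \<Rightarrow> bool" where
  "bump a b f \<longleftrightarrow> bij f \<and> plmap a b a b f \<and> ((\<forall>x\<in>{a<..<b}. x < f x) \<or> (\<forall>x\<in>{a<..<b}. f x < x))"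

lemma bumpD:
  assumes "bump a b f" shows "bij f" "plmap a b a b f" "a < b"
  using assms plmapD(1) by (auto simp: bump_def)

lemma inv_gt_iff:
  assumes "bij f" "plmap a b a b f" shows "(\<forall>x\<in>{a<..<b}. x < inv f x) \<longleftrightarrow> (\<forall>x\<in>{a<..<b}. f x < x)"
proof safe
  fix x assume "\<forall>x\<in>{a<..<b}. x < inv f x" "x \<in> {a<..<b}"
  then have "f x < inv f (f x)" using plmap_in[OF assms(2)] by blast
  then show "f x < x" using assms(1) by (simp add: bij_is_inj)
next
  fix x assume "\<forall>x\<in>{a<..<b}. f x < x" "x \<in> {a<..<b}"
  then have "f (inv f x) < inv f x" using plmap_in[OF plmap_inv[OF assms]] by blast
  then show "x < inv f x" using assms(1) by (simp add: bij_is_surj surj_f_inv_f)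
qed

lemma up_bump_inv_iff:
  assumes "bij f" "plmap a b a b f" shows "up_bump a b (inv f) \<longleftrightarrow> (\<forall>x\<in>{a<..<b}. f x < x)"
  using inv_gt_iff[OF assms] plmap_inv[OF assms] assms(1) bij_imp_bij_inv unfolding up_bump_def by blast

lemma bump_cases [consumes 1, case_names up down]:
  assumes "bump a b f"
  obtains "up_bump a b f" "psi a b f = psi_up a b f"
  | "up_bump a b (inv f)" "psi a b f = psi_up a b (inv f)" "\<And>x. x \<in> {a<..<b} \<Longrightarrow> f x < x"
proof -
  note f = bumpD[OF assms]
  show thesis
  proof (cases "\<forall>x\<in>{a<..<b}. x < f x")
    case True
    then have "up_bump a b f" using f by (auto simp: up_bump_def)
    moreover have "psi a b f = psi_up a b f" using True by (simp add: psi_def)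
    ultimately show thesis using that(1) by blast
  next
    case False
    then have lt: "\<forall>x\<in>{a<..<b}. f x < x" using assms by (auto simp: bump_def)
    then have "up_bump a b (inv f)" using up_bump_inv_iff[OF f(1,2)] by blast
    moreover have "psi a b f = psi_up a b (inv f)" unfolding psi_def by (rule if_not_P[OF False])
    ultimately show thesis using that(2) lt by blast
  qed
qed

lemma psi_up_bump: "up_bump a b f \<Longrightarrow> psi a b f = psi_up a b f"
  by (simp add: psi_def up_bump_def)

lemma psi_down_bump: assumes "up_bump a b (inv f)" "bij f" shows "psi a b f = psi_up a b (inv f)"
proof -
  interpret i: up_bump a b "inv f" by fact
  have pl: "plmap a b a b f" using plmap_inv[OF i.bij i.pl] inv_inv_eq[OF assms(2)] by simp
  have "(a+b)/2 \<in> {a<..<b}" using i.ab by auto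
  then have "f ((a+b)/2) < (a+b)/2" using up_bump_inv_iff[OF assms(2) pl] assms(1) by blast
  then have "\<not> (\<forall>x\<in>{a<..<b}. x < f x)" using \<open>(a+b)/2 \<in> {a<..<b}\<close> less_asym by blast
  then show ?thesis unfolding psi_def by (rule if_not_P)
qed

lemma initial_slope_inv:
  assumes "bij f" "plmap a b a' b' f"
  shows "initial_slope a' b' (inv f) = 1 / initial_slope a b f" "final_slope a' b' (inv f) = 1 / final_slope a b f"
  using slope_inverse[OF assms(2), of "inv f"] assms(1) by (auto simp: bij_is_inj)

lemma conj_inv:
  assumes f: "bij f" "plmap a b a b f" and g: "bij g" and conj: "\<And>x. x \<in> {a<..<b} \<Longrightarrow> h (f x) = g (h x)"
    and x: "x \<in> {a<..<b}"
  shows "h (inv f x) = inv g (h x)"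
proof -
  have "h x = g (h (inv f x))"
    using conj[OF plmap_in[OF plmap_inv[OF f] x]] f(1) by (simp add: bij_is_surj surj_f_inv_f)
  then show ?thesis using g by (simp add: bij_is_inj)
qed

lemma restr_inv: assumes "bij f" "plmap a b a b f" shows "restr (inv f) a b = inv (restr f a b)"
proof (rule inv_unique_comp[symmetric])
  have i: "inv f (f x) = x" "f (inv f x) = x" for x using assms(1) by (auto simp: bij_is_inj bij_is_surj surj_f_inv_f)
  have n: "inv f x \<in> {a<..<b}" "f x \<in> {a<..<b}" if "x \<in> {a<..<b}" for x
    using plmap_in[OF plmap_inv[OF assms] that] plmap_in[OF assms(2) that] by auto
  show "restr f a b \<circ> restr (inv f) a b = id"
  proof
    fix x show "(restr f a b \<circ> restr (inv f) a b) x = id x" using i n[of x] by (cases "x \<in> {a<..<b}") simp_all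
  qed
  show "restr (inv f) a b \<circ> restr f a b = id"
  proof
    fix x show "(restr (inv f) a b \<circ> restr f a b) x = id x" using i n[of x] by (cases "x \<in> {a<..<b}") simp_all
  qed
qed

lemma bump_psi:
  assumes "bump a b f" shows "psi a b f \<in> finite_functions" "psi a b f 0 \<noteq> 1"
proof -
  have "psi_up a b g \<in> finite_functions \<and> psi_up a b g 0 \<noteq> 1" if "up_bump a b g" for g
  proof -
    interpret up_bump a b g by fact
    obtain \<rho> where "logphi \<rho> \<noteq> 1" "psi_up a b g = (\<lambda>s\<in>{0..<1}. logphi (\<rho> + s))" using psi_up_coord by metis
    then show ?thesis using psi_up_finite_function by simp
  qed
  with assms have "psi a b f \<in> finite_functions \<and> psi a b f 0 \<noteq> 1" by (cases rule: bump_cases) simp_all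
  then show "psi a b f \<in> finite_functions" "psi a b f 0 \<noteq> 1" by blast+
qed

text \<open>The slope decides on which side of the diagonal the bump lies. Two bumps with equal
  slopes therefore always fall into the same case.\<close>

lemma bump_slope:
  assumes "bump a b f" shows "initial_slope a b f > 1 \<longleftrightarrow> up_bump a b f" "initial_slope a b f \<noteq> 1"
proof -
  have "initial_slope a b f < 1" if "up_bump a b (inv f)"
  proof -
    have "1 / initial_slope a b f > 1"
      using up_bump.lam_gt_1[OF that] initial_slope_inv(1)[OF bumpD(1,2)[OF assms]] by simp
    then show ?thesis using initial_slope_pos[OF bumpD(2)[OF assms]] by (simp add: field_simps)
  qed
  moreover have "initial_slope a b f > 1" if "up_bump a b f" using up_bump.lam_gt_1[OF that] .
  ultimately have "(initial_slope a b f > 1 \<longleftrightarrow> up_bump a b f) \<and> initial_slope a b f \<noteq> 1"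
    by (cases rule: bump_cases[OF assms]) force+
  then show "initial_slope a b f > 1 \<longleftrightarrow> up_bump a b f" "initial_slope a b f \<noteq> 1" by blast+
qed

text \<open>A map that intertwines \<open>f\<close> and \<open>g\<close> also intertwines their
  inverses, which reduces bumps below the diagonal to bumps above it.\<close>

lemma bump_conj_invariants:
  assumes f: "bump a b f" and g: "bump a' b' g" and h: "plmap a b a' b' h"
    and conj: "\<And>x. x \<in> {a<..<b} \<Longrightarrow> h (f x) = g (h x)"
  shows "initial_slope a b f = initial_slope a' b' g" "psi_class a b f = psi_class a' b' g"
proof -
  note F = bumpD[OF f] and G = bumpD[OF g]
  show slope: "initial_slope a b f = initial_slope a' b' g" by (rule conj_initial_slope(1)[OF F(2) G(2) h conj])
  have "(psi a b f, psi a' b' g) \<in> ff_equiv"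
  proof (cases "up_bump a b f")
    case True
    then have "up_bump a' b' g" using bump_slope(1)[OF f] bump_slope(1)[OF g] slope by simp
    from psi_up_conj[OF True this h conj] show ?thesis using psi_up_bump[OF True] psi_up_bump[OF \<open>up_bump a' b' g\<close>] by simp
  next
    case False
    then have "\<not> up_bump a' b' g" using bump_slope(1)[OF f] bump_slope(1)[OF g] slope by simp
    then have i: "up_bump a b (inv f)" "up_bump a' b' (inv g)" using f g False by (blast elim: bump_cases)+
    have "h (inv f x) = inv g (h x)" if "x \<in> {a<..<b}" for x by (rule conj_inv[OF F(1,2) G(1) _ that]) (rule conj)
    then show ?thesis using psi_up_conj[OF i h] psi_down_bump[OF i(1) F(1)] psi_down_bump[OF i(2) G(1)] by simp
  qed
  then show "psi_class a b f = psi_class a' b' g" unfolding psi_class_def using equiv_class_eq[OF equiv_ff_equiv] by blast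
qed

section \<open>The minimum cornered function and the conjugator\<close>

text \<open>A rotation by \<open>t\<close> corresponds to reading \<open>logphi\<close> from
  \<open>\<rho> + t\<close>. Whole periods are subtracted until the window of length
  \<open>1\<close> lies before the first node.\<close>

lemma (in up_bump) corner_exists_class:
  assumes "(psi_up a b f, c) \<in> ff_equiv" "c 0 \<noteq> 1"
  obtains k where "k \<in> PL a b" "up_cornered a b (k \<circ> restr f a b \<circ> inv k)"
    "initial_slope a b (k \<circ> restr f a b \<circ> inv k) = lam"
    "psi_up a b (k \<circ> restr f a b \<circ> inv k) = c"
proof -
  obtain t where t: "c = rotate_ff (psi_up a b f) t" using ff_equiv_sym[OF assms(1)] by (auto simp: ff_equiv_iff)
  obtain \<rho> where \<rho>: "\<And>t. t \<le> tmax + 1 \<Longrightarrow> logphi t = psi_up a b f (frac (t - \<rho>))" using psi_up_coord by metis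
  obtain K :: nat where K: "real K \<ge> \<rho> + t + 1 - tmax" using real_arch_simple by blast
  define t0 where "t0 = \<rho> + t - real K"
  have E: "logphi (t0 + s) = psi_up a b f (frac (s + t))" if "s \<in> {0..<1}" for s
  proof -
    have "logphi (t0 + s) = psi_up a b f (frac (t0 + s - \<rho>))" by (rule \<rho>) (use that K in \<open>auto simp: t0_def\<close>)
    also have "t0 + s - \<rho> = (s + t) + of_int (- int K)" by (simp add: t0_def)
    finally show ?thesis by (simp only: frac_add_of_int)
  qed
  have "logphi t0 \<noteq> 1" using E[of 0] assms(2) by (simp add: t rotate_ff_def)
  moreover have "t0 + 1 \<le> tmax" using K by (simp add: t0_def)
  moreover have "(\<lambda>s\<in>{0..<1}. logphi (t0 + s)) = c" unfolding t rotate_ff_def by (intro restrict_ext) (simp add: E)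
  ultimately show thesis using corner_exists[of t0] that by metis
qed

lemma cornered_exists:
  assumes f: "bump a b f" and c: "c \<in> psi_class a b f" "c 0 \<noteq> 1"
  obtains k where "k \<in> PL a b" "cornered a b (k \<circ> restr f a b \<circ> inv k)" "psi a b (k \<circ> restr f a b \<circ> inv k) = c"
    "initial_slope a b (k \<circ> restr f a b \<circ> inv k) = initial_slope a b f"
  using f
proof (cases rule: bump_cases)
  case up
  then obtain k where "k \<in> PL a b" "up_cornered a b (k \<circ> restr f a b \<circ> inv k)"
    "initial_slope a b (k \<circ> restr f a b \<circ> inv k) = initial_slope a b f"
    "psi_up a b (k \<circ> restr f a b \<circ> inv k) = c"
    using up_bump.corner_exists_class[OF up(1), of c] c by (auto simp: psi_class_def)
  then show thesis using that cornered_iff up_cornered_up_bump psi_up_bump bumpD(3)[OF f] by metis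
next
  case down
  then obtain k where k: "k \<in> PL a b" "up_cornered a b (k \<circ> restr (inv f) a b \<circ> inv k)"
    "initial_slope a b (k \<circ> restr (inv f) a b \<circ> inv k) = initial_slope a b (inv f)"
    "psi_up a b (k \<circ> restr (inv f) a b \<circ> inv k) = c"
    using up_bump.corner_exists_class[OF down(1), of c] c by (auto simp: psi_class_def)
  note F = bumpD[OF f]
  define l where "l = k \<circ> restr f a b \<circ> inv k"
  have bk: "bij k" using PL_bij[OF k(1) F(3)] .
  have rPL: "restr f a b \<in> PL a b" using restr_id_PL[OF F(2)] .
  have br: "bij (restr f a b)" using PL_bij[OF rPL F(3)] .
  have lPL: "l \<in> PL a b" unfolding l_def by (intro PL_comp PL_inv rPL k(1) F(3))
  have bl: "bij l" using PL_bij[OF lPL F(3)] .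
  have il: "inv l = k \<circ> restr (inv f) a b \<circ> inv k"
    unfolding l_def restr_inv[OF F(1,2)] using bk br by (simp add: o_inv_distrib bij_comp bij_imp_bij_inv inv_inv_eq o_assoc)
  have 1: "cornered a b l" using cornered_iff[OF F(3)] lPL k(2) il by simp
  have "up_bump a b (inv l)" using up_cornered_up_bump k(2) il F(3) by simp
  then have 2: "psi a b l = c" using psi_down_bump[OF _ bl] k(4) il by simp
  have "1 / initial_slope a b l = 1 / initial_slope a b f"
    using k(3) il initial_slope_inv(1)[OF bl PL_plmap[OF lPL F(3)]] initial_slope_inv(1)[OF F(1,2)] by simp
  then have 3: "initial_slope a b l = initial_slope a b f" by simp
  show thesis using that k(1) 1 2 3 unfolding l_def by blast
qed

lemma cornered_bump: "cornered a b l \<Longrightarrow> a < b \<Longrightarrow> bump a b l"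
  using PL_bij PL_plmap by (auto simp: cornered_def bump_def)

lemma not_up_both:
  assumes "up_bump a b f" shows "\<not> up_bump a b (inv f)"
proof
  interpret up_bump a b f by fact
  assume "up_bump a b (inv f)"
  moreover have "(a+b)/2 \<in> {a<..<b}" using ab by auto
  moreover from this have "(a+b)/2 < f ((a+b)/2)" by (rule up)
  ultimately show False using up_bump_inv_iff[OF bij pl] less_asym by blast
qed

lemma cornered_unique:
  assumes l: "cornered a b l" "a < b" and m: "cornered a' b' m" "a' < b'"
    and psi: "psi a b l = psi a' b' m" and slope: "initial_slope a b l = initial_slope a' b' m"
    and y: "y \<in> {a<..<b}"
  shows "m (a' + (b' - a') / (b - a) * (y - a)) = a' + (b' - a') / (b - a) * (l y - a)"
proof -
  have bl: "bump a b l" and bm: "bump a' b' m" using cornered_bump assms by blast+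
  show ?thesis
  proof (cases "up_bump a b l")
    case True
    then have up': "up_bump a' b' m" using bump_slope(1)[OF bl] bump_slope(1)[OF bm] slope by simp
    have "\<not> up_cornered a b (inv l)" "\<not> up_cornered a' b' (inv m)"
      using up_cornered_up_bump not_up_both True up' l(2) m(2) by blast+
    then have "up_cornered a b l" "up_cornered a' b' m" using cornered_iff l m by blast+
    then show ?thesis using up_cornered_unique[OF _ l(2) _ m(2) _ slope y] psi psi_up_bump[OF True] psi_up_bump[OF up'] by simp
  next
    case False
    then have nup: "\<not> up_bump a' b' m" using bump_slope(1)[OF bl] bump_slope(1)[OF bm] slope by simp
    then have c: "up_cornered a b (inv l)" "up_cornered a' b' (inv m)"
      using False cornered_iff l m up_cornered_up_bump by blast+
    then have u: "up_bump a b (inv l)" "up_bump a' b' (inv m)" using up_cornered_up_bump l m by blast+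
    note L = bumpD[OF bl] and M = bumpD[OF bm]
    have "psi_up a b (inv l) = psi_up a' b' (inv m)"
      using psi psi_down_bump[OF u(1) L(1)] psi_down_bump[OF u(2) M(1)] by simp
    moreover have "initial_slope a b (inv l) = initial_slope a' b' (inv m)"
      using initial_slope_inv(1)[OF L(1,2)] initial_slope_inv(1)[OF M(1,2)] slope by simp
    ultimately have "inv m (a' + (b' - a') / (b - a) * (l y - a)) = a' + (b' - a') / (b - a) * (inv l (l y) - a)"
      by (rule up_cornered_unique[OF c(1) l(2) c(2) m(2)]) (rule plmap_in[OF L(2) y])
    then show ?thesis using L(1) M(1) by (metis bij_inv_eq_iff)
  qed
qed

text \<open>The definite description is met by cornering \<open>f\<close> at the minimal rotation.
  Uniqueness is the rigidity of cornered maps on one and the same interval, where the rescaling is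
  the identity.\<close>

lemma min_cornered_props:
  assumes f: "bump a b f"
  shows "cornered a b (min_cornered a b f)" "psi a b (min_cornered a b f) = min_finite_function (psi_class a b f)"
    "initial_slope a b (min_cornered a b f) = initial_slope a b f"
    "\<exists>k. k \<in> PL a b \<and> k \<circ> restr f a b \<circ> inv k = min_cornered a b f"
proof -
  have ab: "a < b" using bumpD[OF f] by simp
  define c where "c = min_finite_function (psi_class a b f)"
  have c: "c \<in> psi_class a b f" "c 0 \<noteq> 1" unfolding c_def psi_class_def
    using min_finite_function_in[OF bump_psi[OF f]] by auto
  obtain k where k: "k \<in> PL a b" "cornered a b (k \<circ> restr f a b \<circ> inv k)" "psi a b (k \<circ> restr f a b \<circ> inv k) = c"
    "initial_slope a b (k \<circ> restr f a b \<circ> inv k) = initial_slope a b f" by (rule cornered_exists[OF f c])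
  define l where "l = k \<circ> restr f a b \<circ> inv k"
  have "min_cornered a b f = l" unfolding min_cornered_def
  proof (rule the_equality)
    show "cornered a b l \<and> psi a b l = min_finite_function (psi_class a b f) \<and> initial_slope a b l = initial_slope a b f"
      using k by (simp add: l_def c_def)
    fix m assume m: "cornered a b m \<and> psi a b m = min_finite_function (psi_class a b f) \<and> initial_slope a b m = initial_slope a b f"
    have PL: "l \<in> PL a b" "m \<in> PL a b" using k m by (auto simp: cornered_def l_def)
    show "m = l"
    proof
      fix y show "m y = l y"
      proof (cases "y \<in> {a<..<b}")
        case True
        then show ?thesis using cornered_unique[of a b l a b m y] k m ab by (simp add: l_def c_def)
      next
        case False then show ?thesis using PL_id[OF PL(1)] PL_id[OF PL(2)] by simp
      qed
    qed
  qed
  then show "cornered a b (min_cornered a b f)" "psi a b (min_cornered a b f) = min_finite_function (psi_class a b f)"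
    "initial_slope a b (min_cornered a b f) = initial_slope a b f"
    "\<exists>k. k \<in> PL a b \<and> k \<circ> restr f a b \<circ> inv k = min_cornered a b f" using k by (auto simp: l_def c_def)
qed

lemma conjugator_props:
  assumes f: "bump a b f"
  shows "conjugator a b f \<in> PL a b"
    "x \<in> {a<..<b} \<Longrightarrow> conjugator a b f (f x) = min_cornered a b f (conjugator a b f x)"
proof -
  have *: "conjugator a b f \<in> PL a b \<and> conjugator a b f \<circ> restr f a b \<circ> inv (conjugator a b f) = min_cornered a b f"
    unfolding conjugator_def by (rule someI_ex[OF min_cornered_props(4)[OF f]])
  then show PL: "conjugator a b f \<in> PL a b" by blast
  assume x: "x \<in> {a<..<b}"
  have "bij (conjugator a b f)" using PL_bij[OF PL] bumpD(3)[OF f] .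
  then show "conjugator a b f (f x) = min_cornered a b f (conjugator a b f x)"
    using conjunct2[OF *, symmetric] x by (simp add: bij_is_inj)
qed

section \<open>Roots\<close>

lemma ln_power_int: "x > 0 \<Longrightarrow> ln (x powi n) = of_int n * ln (x::real)"
  using powr_real_of_int'[of x n] ln_powr[of x "of_int n"] by simp

lemma PL_zpow: assumes "r \<in> PL a b" "a < b" shows "zpow r n \<in> PL a b"
proof (rule PL_I)
  note r = PL_bij[OF assms] PL_plmap[OF assms]
  show "plmap a b a b (zpow r n)" using plmap_zpow r by blast
  fix x assume x: "x \<notin> {a<..<b}"
  have "zpow r n x \<in> {x}"
    using zpow_conj[of r r "{x}" id x n] r(1) PL_id[OF assms(1) x] PL_id[OF PL_inv[OF assms] x] by simp
  then show "zpow r n x = x" by simp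
qed

lemma commute_PL:
  assumes "h \<in> PL a b" "a < b" and f: "plmap a b a b f"
  shows "h \<circ> restr f a b = restr f a b \<circ> h \<longleftrightarrow> (\<forall>x\<in>{a<..<b}. h (f x) = f (h x))"
proof -
  have hin: "h x \<in> {a<..<b}" if "x \<in> {a<..<b}" for x using plmap_in[OF PL_plmap[OF assms(1,2)] that] .
  have out: "(h \<circ> restr f a b) x = (restr f a b \<circ> h) x" if "x \<notin> {a<..<b}" for x
    using that PL_id[OF assms(1) that] by simp
  have inn: "(h \<circ> restr f a b) x = (restr f a b \<circ> h) x \<longleftrightarrow> h (f x) = f (h x)" if "x \<in> {a<..<b}" for x
    using that hin[OF that] by simp
  show ?thesis unfolding fun_eq_iff using out inn by blast
qed

context up_bump
begin

text \<open>Slope \<open>1\<close> makes \<open>h\<close> the identity near \<open>a\<close>.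
  Backward iterates of \<open>f\<close> bring every point there, and they commute with
  \<open>h\<close>.\<close>

lemma commuting_trivial:
  assumes h: "plmap a b a b h" and comm: "\<And>x. x \<in> {a<..<b} \<Longrightarrow> h (f x) = f (h x)"
    and one: "initial_slope a b h = 1" and x: "x \<in> {a<..<b}"
  shows "h x = x"
proof -
  have "rgerm h a a 1" using plmap_initial[OF h] one by simp
  then obtain e where e: "e > 0" "\<And>y. a < y \<Longrightarrow> y < a + e \<Longrightarrow> h y = a + 1 * (y - a)" using rgermE by metis
  obtain n :: nat where n: "zpow f (- int n) x < a + e" using unbounded_below[OF x] e(1) by (metis less_add_same_cancel1)
  have y: "zpow f (- int n) x \<in> {a<..<b}" using in_zpow[OF x] .
  have "h (zpow f (- int n) x) = zpow f (- int n) (h x)"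
    using zpow_conj[of f f "{a<..<b}" h x] bij in_f in_inv comm x by blast
  moreover have "h (zpow f (- int n) x) = zpow f (- int n) x" using e(2) n y by simp
  ultimately have "zpow f (- int n) (h x) = zpow f (- int n) x" by simp
  then show ?thesis using bij_is_inj[OF bij_zpow[OF bij]] by (simp add: inj_eq)
qed

text \<open>Near \<open>a\<close> the map \<open>h\<close> is the translation by
  \<open>\<tau>\<close> in the logarithmic coordinate, and \<open>logphi\<close> is invariant under
  it. Translating a coordinate where \<open>logphi\<close> differs from \<open>1\<close> puts
  \<open>\<tau>\<close>, modulo \<open>1\<close>, into a finite set.\<close>

lemma commuting_slope:
  assumes h: "plmap a b a b h" and comm: "\<And>x. x \<in> {a<..<b} \<Longrightarrow> h (f x) = f (h x)"
  shows "psi_up a b f (frac (log lam (initial_slope a b h))) \<noteq> 1"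
proof -
  define \<tau> where "\<tau> = log lam (initial_slope a b h)"
  obtain T where T: "\<And>t. t \<le> T \<Longrightarrow> logphi (t + \<tau>) = logphi t"
    using logphi_match[OF up_bump_axioms up_bump_axioms h comm] by (auto simp: \<tau>_def)
  obtain \<rho> where \<rho>: "\<rho> < tmax" "logphi \<rho> \<noteq> 1"
    "\<And>t. t \<le> tmax + 1 \<Longrightarrow> logphi t = psi_up a b f (frac (t - \<rho>))" using psi_up_coord by metis
  obtain K :: nat where K: "real K \<ge> max (\<rho> - T) (\<rho> + \<tau> - tmax)" using real_arch_simple by blast
  have "logphi (\<rho> + of_int (- int K)) = logphi \<rho>" by (rule logphi_int) (use \<rho>(1) in auto)
  moreover have "logphi (\<rho> + of_int (- int K) + \<tau>) = logphi (\<rho> + of_int (- int K))" by (rule T) (use K in auto)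
  moreover have "logphi (\<rho> + of_int (- int K) + \<tau>) = psi_up a b f (frac (\<rho> + of_int (- int K) + \<tau> - \<rho>))"
    by (rule \<rho>(3)) (use K in auto)
  moreover have "\<rho> + of_int (- int K) + \<tau> - \<rho> = \<tau> + of_int (- int K)" by simp
  ultimately show ?thesis using \<rho>(2) frac_add_of_int[of \<tau> "- int K"] by (simp only: \<tau>_def[symmetric]) simp
qed

text \<open>
  The slopes at \<open>a\<close> of the maps that commute with \<open>f\<close> form a discrete group: in the logarithmic
  coordinate they are rotations that preserve the finite set on which \<open>psi_up\<close> differs from \<open>1\<close>.
\<close>

lemma root_exists:
  "\<exists>r\<in>PL a b. centralizer a b (restr f a b) = range (zpow r) \<and> (\<exists>n>0. r ^^ n = restr f a b)"
proof -
  define Z where "Z = centralizer a b (restr f a b)"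
  have Z_iff: "h \<in> Z \<longleftrightarrow> h \<in> PL a b \<and> (\<forall>x\<in>{a<..<b}. h (f x) = f (h x))" for h
    unfolding Z_def centralizer_def using commute_PL[OF _ ab pl] by blast
  \<comment> \<open>A homomorphism to the reals on the centralizer, normalized so that
    \<open>f\<close> itself goes to \<open>1\<close>. Its kernel is trivial, because slope
    \<open>1\<close> at \<open>a\<close> forces the identity.\<close>
  define L where "L = (\<lambda>h. log lam (initial_slope a b h))"
  have ZPL: "plmap a b a b h" "bij h" if "h \<in> Z" for h using that Z_iff PL_plmap[OF _ ab] PL_bij[OF _ ab] by blast+
  have Zcomp: "g \<circ> h \<in> Z \<and> L (g \<circ> h) = L g + L h" if "g \<in> Z" "h \<in> Z" for g h
  proof
    show "g \<circ> h \<in> Z" using that PL_comp[OF _ _ ab] plmap_in[OF ZPL(1)[OF that(2)]] unfolding Z_iff by auto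
    show "L (g \<circ> h) = L g + L h"
      using slope_comp(1)[OF ZPL(1)[OF that(2)] ZPL(1)[OF that(1)]] initial_slope_pos[OF ZPL(1)[OF that(2)]]
        initial_slope_pos[OF ZPL(1)[OF that(1)]] lam_gt_1 by (simp add: L_def log_mult)
  qed
  have Zzpow: "zpow h n \<in> Z \<and> L (zpow h n) = of_int n * L h" if h: "h \<in> Z" for h n
  proof
    have "f (zpow h n x) = zpow h n (f x)" if "x \<in> {a<..<b}" for x
      using zpow_conj[of h h "{a<..<b}" f x n] ZPL[OF h] h that plmap_in[OF ZPL(1)[OF h]]
        plmap_in[OF plmap_inv[OF ZPL(2,1)[OF h]]] unfolding Z_iff by auto
    then show "zpow h n \<in> Z" using PL_zpow[of h a b n] ab h unfolding Z_iff by auto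
    have "initial_slope a b (zpow h n) = initial_slope a b h powi n" using slope_zpow(1)[OF ZPL(2,1)[OF h]] .
    then show "L (zpow h n) = of_int n * L h" using initial_slope_pos[OF ZPL(1)[OF h]]
      by (simp add: L_def log_def ln_power_int)
  qed
  have Z1: "zpow g n = h" if g: "g \<in> Z" and h: "h \<in> Z" and L: "L h = of_int n * L g" for g h n
  proof -
    have z: "zpow g (- n) \<in> Z" "L (zpow g (-n)) = - of_int n * L g" using Zzpow[OF g, of "-n"] by auto
    have c: "zpow g (- n) \<circ> h \<in> Z" "L (zpow g (- n) \<circ> h) = 0" using Zcomp[OF z(1) h] z(2) L by auto
    have "initial_slope a b (zpow g (- n) \<circ> h) = lam powr (L (zpow g (- n) \<circ> h))"
      using lam_gt_1 initial_slope_pos[OF ZPL(1)[OF c(1)]] by (simp add: L_def)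
    then have "initial_slope a b (zpow g (- n) \<circ> h) = 1" using c(2) lam_gt_1 by simp
    then have eq: "zpow g (- n) (h x) = x" if "x \<in> {a<..<b}" for x
      using commuting_trivial[OF ZPL(1)[OF c(1)] _ _ that] c(1) unfolding Z_iff by auto
    show ?thesis
    proof
      fix x show "zpow g n x = h x"
      proof (cases "x \<in> {a<..<b}")
        case True
        have "zpow g n x = zpow g n (zpow g (- n) (h x))" using eq[OF True] by simp
        also have "\<dots> = h x" using zpow_add[OF ZPL(2)[OF g], of n "-n" "h x"] by simp
        finally show ?thesis .
      next
        case False
        then show ?thesis using PL_id[of h a b x] PL_id[of "zpow g n" a b x] h Zzpow[OF g, of n] unfolding Z_iff by simp
      qed
    qed
  qed
  have FZ: "restr f a b \<in> Z" unfolding Z_iff using restr_PL in_f by auto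
  have LF: "L (restr f a b) = 1"
  proof -
    have "initial_slope a b (restr f a b) = lam" using slope_cong(1)[of a b "restr f a b" f a b] pl by simp
    then show ?thesis using lam_gt_1 by (simp add: L_def)
  qed
  \<comment> \<open>The generator is sought among the values in \<open>(0, 1]\<close>. This set
    contains the value \<open>1\<close> of \<open>f\<close>, and it is finite since a value below
    \<open>1\<close> is its own fractional part.\<close>
  define G where "G = L ` Z \<inter> {0<..1}"
  have "G \<subseteq> insert 1 {s \<in> {0..<1}. psi_up a b f s \<noteq> 1}"
  proof
    fix t assume "t \<in> G"
    then obtain h where h: "h \<in> Z" "t = L h" "0 < t" "t \<le> 1" by (auto simp: G_def)
    have "psi_up a b f (frac t) \<noteq> 1" unfolding h(2) L_def
      by (rule commuting_slope[OF ZPL(1)[OF h(1)]]) (use h(1) Z_iff in blast)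
    then show "t \<in> insert 1 {s \<in> {0..<1}. psi_up a b f s \<noteq> 1}" using h(3,4) by (cases "t = 1") auto
  qed
  moreover have "finite {s \<in> {0..<1}. psi_up a b f s \<noteq> 1}" using psi_up_finite_function by (auto simp: finite_functions_def)
  ultimately have finG: "finite G" using finite_subset by blast
  have "1 \<in> G" using FZ LF by (force simp: G_def)
  then have "Min G \<in> G" using Min_in[OF finG] by blast
  then obtain r where r: "r \<in> Z" "Min G = L r" "L r > 0" "L r \<le> 1" by (auto simp: G_def)
  have pow: "\<exists>n. zpow r n = h" if h: "h \<in> Z" for h
  proof -
    define n where "n = \<lfloor>L h / L r\<rfloor>"
    have "of_int n \<le> L h / L r" "L h / L r < of_int n + 1" by (auto simp: n_def)
    then have d: "0 \<le> L h - of_int n * L r" "L h - of_int n * L r < L r" using r(3) by (auto simp: field_simps)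
    have z: "zpow r (- n) \<in> Z" "L (zpow r (- n)) = - of_int n * L r" using Zzpow[OF r(1), of "-n"] by auto
    then have c: "zpow r (- n) \<circ> h \<in> Z" "L (zpow r (- n) \<circ> h) = L h - of_int n * L r" using Zcomp[OF z(1) h] by auto
    \<comment> \<open>Division with remainder by the least positive value: a nonzero remainder would
      be a smaller element of \<open>G\<close>.\<close>
    have "L h - of_int n * L r = 0"
    proof (rule ccontr)
      assume "L h - of_int n * L r \<noteq> 0"
      then have "L h - of_int n * L r \<in> G" using d c r(4) by (force simp: G_def)
      then show False using Min_le[OF finG] r(2) d(2) by force
    qed
    then show ?thesis using Z1[OF r(1) h, of n] by auto
  qed
  have "Z = range (zpow r)" using pow Zzpow[OF r(1)] by blast
  moreover have "\<exists>n>0. r ^^ n = restr f a b"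
  proof -
    obtain n where n: "zpow r n = restr f a b" using pow[OF FZ] by blast
    then have "of_int n * L r = 1" using Zzpow[OF r(1), of n] LF by simp
    then have "of_int n > (0::real)" using r(3) by (metis zero_less_mult_pos2 zero_less_one)
    then have "n > 0" by simp
    then show ?thesis using n by (intro exI[of _ "nat n"]) (auto simp: zpow_def)
  qed
  ultimately show ?thesis using r(1) Z_iff unfolding Z_def by blast
qed

end

text \<open>A map below the diagonal and its inverse have the same centralizer; the root of the
  inverse is inverted so that a positive power gives \<open>f\<close> back.\<close>

lemma root_gen_props:
  assumes f: "bump a b f"
  shows "root_gen a b f \<in> PL a b" "centralizer a b (restr f a b) = range (zpow (root_gen a b f))"
    "\<exists>n>0. root_gen a b f ^^ n = restr f a b"
proof -
  note F = bumpD[OF f]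
  have "\<exists>r. r \<in> PL a b \<and> centralizer a b (restr f a b) = range (zpow r) \<and> (\<exists>n>0. r ^^ n = restr f a b)"
    using f
  proof (cases rule: bump_cases)
    case up
    then show ?thesis using up_bump.root_exists by blast
  next
    case down
    then obtain r n where r: "r \<in> PL a b" "centralizer a b (restr (inv f) a b) = range (zpow r)"
      "n > 0" "r ^^ n = restr (inv f) a b" using up_bump.root_exists by blast
    have br: "bij r" using PL_bij[OF r(1) F(3)] .
    have rPL: "restr f a b \<in> PL a b" using restr_id_PL[OF F(2)] .
    have bF: "bij (restr f a b)" using PL_bij[OF rPL F(3)] .
    have "h \<circ> inv (restr f a b) = inv (restr f a b) \<circ> h \<longleftrightarrow> h \<circ> restr f a b = restr f a b \<circ> h" for h
      unfolding fun_eq_iff o_apply using bF by (metis bij_inv_eq_iff)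
    then have "centralizer a b (restr f a b) = centralizer a b (restr (inv f) a b)"
      unfolding centralizer_def restr_inv[OF F(1,2)] by blast
    moreover have "range (zpow (inv r)) = range (zpow r)"
    proof -
      have "zpow (inv r) n \<in> range (zpow r)" "zpow r n \<in> range (zpow (inv r))" for n
        using zpow_inv[OF br, of n] zpow_inv[OF br, of "-n"] by (auto intro: range_eqI[of _ _ "-n"])
      then show ?thesis by blast
    qed
    moreover have "inv r ^^ n = restr f a b"
    proof
      fix x
      have "zpow r (- int n) (zpow r (int n) y) = y" for y using zpow_add[OF br, of "- int n" "int n" y] by simp
      then have "(inv r ^^ n) (restr (inv f) a b y) = y" for y using r(3,4) by (simp add: zpow_def split: if_splits)
      from this[of "restr f a b x"] show "(inv r ^^ n) x = restr f a b x"
        unfolding restr_inv[OF F(1,2)] using bF by (simp add: bij_is_inj)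
    qed
    ultimately show ?thesis using PL_inv[OF r(1) F(3)] r(2,3) by (intro exI[of _ "inv r"]) auto
  qed
  then have "root_gen a b f \<in> PL a b \<and> centralizer a b (restr f a b) = range (zpow (root_gen a b f)) \<and>
    (\<exists>n>0. root_gen a b f ^^ n = restr f a b)" unfolding root_gen_def by (rule someI_ex)
  then show "root_gen a b f \<in> PL a b" "centralizer a b (restr f a b) = range (zpow (root_gen a b f))"
    "\<exists>n>0. root_gen a b f ^^ n = restr f a b" by auto
qed

lemma commuting_zpow_root:
  assumes f: "bump a b f" and h: "plmap a b a b h" "\<And>x. x \<in> {a<..<b} \<Longrightarrow> h (f x) = f (h x)"
  shows "\<exists>n. \<forall>x\<in>{a<..<b}. h x = zpow (root_gen a b f) n x"
proof -
  note F = bumpD[OF f]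
  have PL: "restr h a b \<in> PL a b" using restr_id_PL[OF h(1)] .
  have "restr h a b \<in> centralizer a b (restr f a b)" unfolding centralizer_def
    using commute_PL[OF PL F(3,2)] PL h(2) plmap_in[OF F(2)] plmap_in[OF h(1)] by simp
  then obtain n where "restr h a b = zpow (root_gen a b f) n" using root_gen_props(2)[OF f] by auto
  then show ?thesis using restr_in by metis
qed

lemma zpow_root_commutes:
  assumes f: "bump a b f" and x: "x \<in> {a<..<b}"
  shows "zpow (root_gen a b f) n (f x) = f (zpow (root_gen a b f) n x)"
proof -
  note F = bumpD[OF f]
  have PL: "zpow (root_gen a b f) n \<in> PL a b" using PL_zpow[OF root_gen_props(1)[OF f] F(3)] .
  moreover have "zpow (root_gen a b f) n \<in> centralizer a b (restr f a b)" using root_gen_props(2)[OF f] by blast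
  ultimately show ?thesis using commute_PL[OF PL F(3,2)] x unfolding centralizer_def by blast
qed

lemma root_slope:
  assumes f: "bump a b f"
  shows "\<exists>n>0. initial_slope a b (root_gen a b f) ^ n = initial_slope a b f"
proof -
  note F = bumpD[OF f] and R = root_gen_props[OF f]
  obtain n where n: "n > 0" "root_gen a b f ^^ n = restr f a b" using R(3) by blast
  have "initial_slope a b (zpow (root_gen a b f) (int n)) = initial_slope a b (root_gen a b f) powi (int n)"
    by (rule slope_zpow(1)[OF PL_bij[OF R(1) F(3)] PL_plmap[OF R(1) F(3)]])
  moreover have "initial_slope a b (restr f a b) = initial_slope a b f" using slope_cong(1)[of a b "restr f a b" f a b] F by simp
  ultimately show ?thesis using n by (auto simp: power_int_def)
qed

text \<open>The root of \<open>f\<close>, transported by \<open>h\<close>, commutes with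
  \<open>g\<close> and is therefore a power of the root of \<open>g\<close>.\<close>

lemma conj_root:
  assumes f: "bump a b f" and g: "bump a' b' g" and h: "plmap a b a' b' h"
    and conj: "\<And>x. x \<in> {a<..<b} \<Longrightarrow> h (f x) = g (h x)"
  shows "\<exists>n. initial_slope a b (root_gen a b f) = initial_slope a' b' (root_gen a' b' g) powi n \<and>
    final_slope a b (root_gen a b f) = final_slope a' b' (root_gen a' b' g) powi n"
proof -
  note F = bumpD[OF f] and R = root_gen_props[OF f] and G = bumpD[OF g] and S = root_gen_props[OF g]
  define r where "r = root_gen a b f"
  have r: "plmap a b a b r" "bij r" using PL_plmap[OF R(1) F(3)] PL_bij[OF R(1) F(3)] by (auto simp: r_def)
  define k where "k = inv_into {a<..<b} h"
  note k = plmap_inv_into(1)[OF h, folded k_def] and kh = plmap_inv_into(2)[OF h, folded k_def]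
    and hk = plmap_inv_into(3)[OF h, folded k_def]
  define r' where "r' = h \<circ> (r \<circ> k)"
  have r': "plmap a' b' a' b' r'" unfolding r'_def by (rule plmap_comp[OF plmap_comp[OF k r(1)] h])
  have hr: "h (r x) = r' (h x)" if "x \<in> {a<..<b}" for x using kh[OF that] by (simp add: r'_def)
  have "r' (g y) = g (r' y)" if y: "y \<in> {a'<..<b'}" for y
  proof -
    obtain x where x: "x \<in> {a<..<b}" "h x = y" using plmap_surj[OF h y] by blast
    have "r' (g y) = h (r (f x))" using hr[OF plmap_in[OF F(2) x(1)]] conj[OF x(1)] x(2) by simp
    also have "r (f x) = f (r x)" using zpow_root_commutes[OF f x(1), of 1] by (simp add: r_def)
    also have "h (f (r x)) = g (r' y)" using conj[OF plmap_in[OF r(1) x(1)]] hr[OF x(1)] x(2) by simp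
    finally show ?thesis .
  qed
  then obtain n where n: "\<And>x. x \<in> {a'<..<b'} \<Longrightarrow> r' x = zpow (root_gen a' b' g) n x"
    using commuting_zpow_root[OF g r'] by blast
  have z: "plmap a' b' a' b' (zpow (root_gen a' b' g) n)"
    by (rule plmap_zpow[OF PL_bij[OF S(1) G(3)] PL_plmap[OF S(1) G(3)]])
  have "initial_slope a b r = initial_slope a' b' r'" "final_slope a b r = final_slope a' b' r'"
    using conj_initial_slope[OF r(1) r' h hr] by auto
  then show ?thesis
    using slope_cong[OF n z] slope_zpow[OF PL_bij[OF S(1) G(3)] PL_plmap[OF S(1) G(3)], of n] by (auto simp: r_def)
qed

text \<open>By symmetry each initial slope is an integer power of the other, and the exponents
  multiply to \<open>1\<close>. The sign is fixed because positive powers of the two roots give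
  \<open>f\<close> and \<open>g\<close>, whose common initial slope differs from
  \<open>1\<close>.\<close>

lemma root_conj_invariant:
  assumes f: "bump a b f" and g: "bump a' b' g" and h: "plmap a b a' b' h"
    and conj: "\<And>x. x \<in> {a<..<b} \<Longrightarrow> h (f x) = g (h x)"
  shows "initial_slope a b (root_gen a b f) = initial_slope a' b' (root_gen a' b' g)"
    "final_slope a b (root_gen a b f) = final_slope a' b' (root_gen a' b' g)"
proof -
  note F = bumpD[OF f] and R = root_gen_props[OF f] and G = bumpD[OF g] and S = root_gen_props[OF g]
  define k where "k = inv_into {a<..<b} h"
  note k = plmap_inv_into(1)[OF h, folded k_def] and kh = plmap_inv_into(2)[OF h, folded k_def]
    and hk = plmap_inv_into(3)[OF h, folded k_def]
  have kconj: "k (g y) = f (k y)" if "y \<in> {a'<..<b'}" for y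
    using conj[OF plmap_in[OF k that]] hk[OF that] kh[OF plmap_in[OF F(2) plmap_in[OF k that]]] by simp
  define lf where "lf = initial_slope a b (root_gen a b f)"
  define lg where "lg = initial_slope a' b' (root_gen a' b' g)"
  have pos: "lf > 0" "lg > 0" unfolding lf_def lg_def
    using initial_slope_pos PL_plmap[OF R(1) F(3)] PL_plmap[OF S(1) G(3)] by blast+
  obtain m where m: "lf = lg powi m" "final_slope a b (root_gen a b f) = final_slope a' b' (root_gen a' b' g) powi m"
    using conj_root[OF f g h conj] by (auto simp: lf_def lg_def)
  obtain n where n: "lg = lf powi n" using conj_root[OF g f k kconj] by (auto simp: lf_def lg_def)
  obtain N M where NM: "N > 0" "lf ^ N = initial_slope a b f" "M > 0" "lg ^ M = initial_slope a' b' g"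
    using root_slope[OF f] root_slope[OF g] by (auto simp: lf_def lg_def)
  define x where "x = ln lf"
  define y where "y = ln lg"
  have xy: "x = of_int m * y" "y = of_int n * x" unfolding x_def y_def using m(1) n ln_power_int pos by metis+
  have s: "initial_slope a b f = initial_slope a' b' g" by (rule conj_initial_slope(1)[OF F(2) G(2) h conj])
  have "real N * x = real M * y" unfolding x_def y_def using NM s pos by (metis ln_realpow)
  have "x \<noteq> 0" using NM(2) bump_slope(2)[OF f] pos by (auto simp: x_def)
  have "x = of_int m * (of_int n * x)" using xy by metis
  then have "of_int (m * n) * x = 1 * x" by (simp only: of_int_mult mult.assoc mult_1)
  then have "of_int (m * n) = (1::real)" by (rule mult_right_cancel[OF \<open>x \<noteq> 0\<close>, THEN iffD1])
  then have mn: "m * n = 1" by (simp only: of_int_eq_1_iff)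
  have "y \<noteq> 0" using xy(1) \<open>x \<noteq> 0\<close> by (metis mult_zero_right)
  have "real N * of_int m * y = real M * y" using \<open>real N * x = real M * y\<close> by (simp only: xy(1) mult.assoc)
  then have "real N * of_int m = real M" by (rule mult_right_cancel[OF \<open>y \<noteq> 0\<close>, THEN iffD1])
  then have "of_int m > (0::real)" using NM(1,3) by (metis of_nat_0_less_iff zero_less_mult_pos)
  then have "m = 1" using mn zmult_eq_1_iff by force
  then show "initial_slope a b (root_gen a b f) = initial_slope a' b' (root_gen a' b' g)"
    "final_slope a b (root_gen a b f) = final_slope a' b' (root_gen a' b' g)" using m by (auto simp: lf_def lg_def)
qed

section \<open>All conjugating maps between two bumps\<close>

text \<open>\<open>h\<close> conjugates \<open>f\<close> to its minimum cornered function, rescales,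
  and undoes the conjugation of \<open>g\<close>; equal data make the two cornered functions
  affinely conjugate. The factor with exponent \<open>n\<close> comes from a power of the root
  applied beforehand, so \<open>n\<close> runs through the coset of the centralizer.\<close>

lemma bump_conj_exists:
  assumes f: "bump a b f" and g: "bump a' b' g"
    and inv: "initial_slope a b f = initial_slope a' b' g" "psi_class a b f = psi_class a' b' g"
  obtains h where "plmap a b a' b' h" "\<And>x. x \<in> {a<..<b} \<Longrightarrow> h (f x) = g (h x)"
    "initial_slope a b h = initial_slope a b (conjugator a b f) / initial_slope a' b' (conjugator a' b' g) *
        ((b' - a') / (b - a)) * initial_slope a b (root_gen a b f) powi n"
    "final_slope a b h = final_slope a b (conjugator a b f) / final_slope a' b' (conjugator a' b' g) *
        ((b' - a') / (b - a)) * final_slope a b (root_gen a b f) powi n"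
proof -
  note F = bumpD[OF f] and G = bumpD[OF g]
  define w where "w = (b' - a') / (b - a)"
  have w: "w > 0" using F G by (simp add: w_def)
  define A where "A = (\<lambda>y. w * y + (a' - w * a))"
  have "w * (b - a) = b' - a'" using F by (simp add: w_def)
  then have e: "w * b + (a' - w * a) = b'" by (simp add: algebra_simps)
  have A: "plmap a b a' b' A" unfolding A_def using plmap_affine[OF F(3) w, of "a' - w * a"] e by simp
  have As: "initial_slope a b A = w" "final_slope a b A = w"
    using initial_slope_eq[OF A] rgerm_affine[OF w, of "a' - w * a" a] final_slope_eq[OF A] lgerm_affine[OF w, of "a' - w * a" b] e
    by (auto simp: A_def)
  define l where "l = min_cornered a b f"
  define l' where "l' = min_cornered a' b' g"
  define k where "k = conjugator a b f"
  define k' where "k' = conjugator a' b' g"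
  define r where "r = zpow (root_gen a b f) n"
  have kPL: "k \<in> PL a b" "k' \<in> PL a' b'" using conjugator_props(1)[OF f] conjugator_props(1)[OF g] by (auto simp: k_def k'_def)
  have k: "plmap a b a b k" "plmap a' b' a' b' k'" "bij k'"
    using kPL PL_plmap PL_bij F(3) G(3) by blast+
  have kf: "k (f x) = l (k x)" if "x \<in> {a<..<b}" for x using conjugator_props(2)[OF f that] by (simp add: k_def l_def)
  have kg: "k' (g x) = l' (k' x)" if "x \<in> {a'<..<b'}" for x using conjugator_props(2)[OF g that] by (simp add: k'_def l'_def)
  have lA: "l' (A y) = A (l y)" if y: "y \<in> {a<..<b}" for y
  proof -
    have A_eq: "A z = a' + (b' - a') / (b - a) * (z - a)" for z
      unfolding w_def[symmetric] A_def by (simp add: algebra_simps)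
    show ?thesis unfolding A_eq l_def l'_def
      by (rule cornered_unique[OF _ F(3) _ G(3) _ _ y])
        (simp_all add: min_cornered_props[OF f] min_cornered_props[OF g] inv)
  qed
  have r: "plmap a b a b r" unfolding r_def
    by (rule plmap_zpow[OF PL_bij PL_plmap]) (use root_gen_props(1)[OF f] F(3) in auto)
  have ik': "plmap a' b' a' b' (inv k')" using plmap_inv k by blast
  define h where "h = inv k' \<circ> (A \<circ> (k \<circ> r))"
  have kr: "plmap a b a b (k \<circ> r)" using plmap_comp[OF r k(1)] .
  have Akr: "plmap a b a' b' (A \<circ> (k \<circ> r))" using plmap_comp[OF kr A] .
  have h: "plmap a b a' b' h" unfolding h_def using plmap_comp[OF Akr ik'] .
  have "h (f x) = g (h x)" if x: "x \<in> {a<..<b}" for x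
  proof -
    have rx: "r x \<in> {a<..<b}" using plmap_in[OF r x] .
    have krx: "k (r x) \<in> {a<..<b}" using plmap_in[OF k(1) rx] .
    have "k' (g (h x)) = l' (k' (h x))" using kg[OF plmap_in[OF h x]] .
    also have "k' (h x) = A (k (r x))" using k(3) by (simp add: h_def bij_is_surj surj_f_inv_f)
    also have "l' (A (k (r x))) = A (k (f (r x)))" using lA[OF krx] kf[OF rx] by simp
    also have "f (r x) = r (f x)" using zpow_root_commutes[OF f x] by (simp add: r_def)
    finally have "inv k' (k' (g (h x))) = h (f x)" by (simp add: h_def)
    then show ?thesis using k(3) by (simp add: bij_is_inj)
  qed
  moreover have "initial_slope a b h = initial_slope a b k / initial_slope a' b' k' * w * initial_slope a b (root_gen a b f) powi n"
    unfolding h_def using slope_comp(1)[OF Akr ik'] slope_comp(1)[OF kr A] slope_comp(1)[OF r k(1)] As(1)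
      initial_slope_inv(1)[OF k(3,2)] slope_zpow(1)[of "root_gen a b f" a b n] root_gen_props(1)[OF f] PL_bij[of "root_gen a b f" a b]
      PL_plmap[of "root_gen a b f" a b] F(3) by (simp add: r_def)
  moreover have "final_slope a b h = final_slope a b k / final_slope a' b' k' * w * final_slope a b (root_gen a b f) powi n"
    unfolding h_def using slope_comp(2)[OF Akr ik'] slope_comp(2)[OF kr A] slope_comp(2)[OF r k(1)] As(2)
      initial_slope_inv(2)[OF k(3,2)] slope_zpow(2)[of "root_gen a b f" a b n] root_gen_props(1)[OF f] PL_bij[of "root_gen a b f" a b]
      PL_plmap[of "root_gen a b f" a b] F(3) by (simp add: r_def)
  ultimately show thesis using that[OF h] unfolding k_def k'_def w_def by blast
qed

text \<open>Any conjugating map differs from the one for exponent \<open>0\<close> by an element of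
  the centralizer, that is by a power of the root.\<close>

lemma bump_conj_slopes:
  assumes f: "bump a b f" and g: "bump a' b' g" and h: "plmap a b a' b' h"
    and conj: "\<And>x. x \<in> {a<..<b} \<Longrightarrow> h (f x) = g (h x)"
  shows "\<exists>n. initial_slope a b h = initial_slope a b (conjugator a b f) / initial_slope a' b' (conjugator a' b' g) *
        ((b' - a') / (b - a)) * initial_slope a b (root_gen a b f) powi n \<and>
    final_slope a b h = final_slope a b (conjugator a b f) / final_slope a' b' (conjugator a' b' g) *
        ((b' - a') / (b - a)) * final_slope a b (root_gen a b f) powi n"
proof -
  note F = bumpD[OF f] and G = bumpD[OF g]
  obtain h0 where h0: "plmap a b a' b' h0" "\<And>x. x \<in> {a<..<b} \<Longrightarrow> h0 (f x) = g (h0 x)"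
    "initial_slope a b h0 = initial_slope a b (conjugator a b f) / initial_slope a' b' (conjugator a' b' g) *
        ((b' - a') / (b - a)) * initial_slope a b (root_gen a b f) powi 0"
    "final_slope a b h0 = final_slope a b (conjugator a b f) / final_slope a' b' (conjugator a' b' g) *
        ((b' - a') / (b - a)) * final_slope a b (root_gen a b f) powi 0"
    using bump_conj_exists[OF f g bump_conj_invariants[OF f g h conj], of 0] by metis
  define k where "k = inv_into {a<..<b} h0"
  note k = plmap_inv_into(1)[OF h0(1), folded k_def] and kh = plmap_inv_into(2)[OF h0(1), folded k_def]
    and hk = plmap_inv_into(3)[OF h0(1), folded k_def]
  have kconj: "k (g y) = f (k y)" if "y \<in> {a'<..<b'}" for y
    using h0(2)[OF plmap_in[OF k that]] hk[OF that] kh[OF plmap_in[OF F(2) plmap_in[OF k that]]] by simp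
  have kh': "plmap a b a b (k \<circ> h)" using plmap_comp[OF h k] .
  have "(k \<circ> h) (f x) = f ((k \<circ> h) x)" if "x \<in> {a<..<b}" for x
    using conj[OF that] kconj[OF plmap_in[OF h that]] by simp
  then obtain n where n: "\<And>x. x \<in> {a<..<b} \<Longrightarrow> (k \<circ> h) x = zpow (root_gen a b f) n x"
    using commuting_zpow_root[OF f kh'] by blast
  have R: "bij (root_gen a b f)" "plmap a b a b (root_gen a b f)"
    using root_gen_props(1)[OF f] PL_bij PL_plmap F(3) by blast+
  have z: "plmap a b a b (zpow (root_gen a b f) n)" using plmap_zpow[OF R] .
  have "h x = (h0 \<circ> zpow (root_gen a b f) n) x" if "x \<in> {a<..<b}" for x
    using n[OF that] hk[OF plmap_in[OF h that]] by (metis o_apply)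
  then have "initial_slope a b h = initial_slope a b (h0 \<circ> zpow (root_gen a b f) n)"
    "final_slope a b h = final_slope a b (h0 \<circ> zpow (root_gen a b f) n)"
    using slope_cong[of a b h "h0 \<circ> zpow (root_gen a b f) n"] plmap_comp[OF z h0(1)] by auto
  then show ?thesis using slope_comp[OF z h0(1)] slope_zpow[OF R, of n] h0(3,4) by auto
qed

section \<open>Dyadic piecewise linear maps\<close>

lemma dyadic_of_int [simp]: "of_int k \<in> dyadic"
  unfolding dyadic_def by (auto intro!: exI[of _ k] exI[of _ "0::nat"])

lemma dyadic_0 [simp]: "0 \<in> dyadic" and dyadic_1 [simp]: "1 \<in> dyadic"
  using dyadic_of_int[of 0] dyadic_of_int[of 1] by auto

lemma dyadic_add: assumes "x \<in> dyadic" "y \<in> dyadic" shows "x + y \<in> dyadic"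
proof -
  obtain k n l m where "x = of_int k / 2 ^ n" "y = of_int l / 2 ^ m" using assms by (auto simp: dyadic_def)
  then have "x + y = of_int (k * 2 ^ m + l * 2 ^ n) / 2 ^ (n + m)" by (simp add: add_frac_eq power_add)
  then show ?thesis unfolding dyadic_def by blast
qed

lemma dyadic_mult: assumes "x \<in> dyadic" "y \<in> dyadic" shows "x * y \<in> dyadic"
proof -
  obtain k n l m where "x = of_int k / 2 ^ n" "y = of_int l / 2 ^ m" using assms by (auto simp: dyadic_def)
  then have "x * y = of_int (k * l) / 2 ^ (n + m)" by (simp add: power_add)
  then show ?thesis unfolding dyadic_def by blast
qed

lemma dyadic_minus: "x \<in> dyadic \<Longrightarrow> - x \<in> dyadic"
  using dyadic_mult[of "of_int (-1)" x] dyadic_of_int[of "-1"] by simp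

lemma dyadic_diff: "x \<in> dyadic \<Longrightarrow> y \<in> dyadic \<Longrightarrow> x - y \<in> dyadic"
  using dyadic_add[of x "- y"] dyadic_minus by simp

section \<open>Powers of two and dyadic germs\<close>

definition pow2 :: "real \<Rightarrow> bool" where "pow2 c \<longleftrightarrow> (\<exists>k::int. c = 2 powi k)"

lemma pow2_pos: "pow2 c \<Longrightarrow> c > 0"
  by (auto simp: pow2_def)

lemma pow2_mult: "pow2 c \<Longrightarrow> pow2 d \<Longrightarrow> pow2 (c * d)"
  unfolding pow2_def by (metis power_int_add zero_neq_numeral)

lemma pow2_divide: "pow2 c \<Longrightarrow> pow2 (1 / c)"
  unfolding pow2_def by (metis power_int_minus inverse_eq_divide)

lemma pow2_1 [simp]: "pow2 1" and pow2_2 [simp]: "pow2 2" and pow2_power [simp]: "pow2 (2 ^ n)"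
  unfolding pow2_def by (rule exI[of _ 0], simp) (rule exI[of _ 1], simp, rule exI[of _ "int n"], simp)

lemma pow2_dyadic: assumes "pow2 c" shows "c \<in> dyadic"
proof -
  obtain k where k: "c = 2 powi k" using assms by (auto simp: pow2_def)
  show ?thesis
  proof (cases "k \<ge> 0")
    case True
    then have "c = of_int (2 ^ nat k)" by (simp add: k power_int_def)
    then show ?thesis by (simp only: dyadic_of_int)
  next
    case False
    then have "c = inverse 2 ^ nat (- k)" by (simp only: k power_int_def if_False)
    also have "\<dots> = of_int 1 / 2 ^ nat (- k)" by (simp only: inverse_eq_divide power_one_over of_int_1)
    finally have "c = of_int 1 / 2 ^ nat (- k)" .
    then have "\<exists>(j::int) (n::nat). c = of_int j / 2 ^ n" by (intro exI)
    then show ?thesis unfolding dyadic_def by (rule CollectI)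
  qed
qed

lemma dyadic_pow2_mult: assumes "pow2 c" shows "c * x \<in> dyadic \<longleftrightarrow> x \<in> dyadic"
proof
  assume "c * x \<in> dyadic"
  then have "(1 / c) * (c * x) \<in> dyadic" by (rule dyadic_mult[OF pow2_dyadic[OF pow2_divide[OF assms]]])
  then show "x \<in> dyadic" using pow2_pos[OF assms] by simp
qed (rule dyadic_mult[OF pow2_dyadic[OF assms]])

text \<open>The condition on \<open>h x - c * x\<close> makes these germs preserve the dyadic numbers, so that they compose.\<close>

definition F_at :: "(real \<Rightarrow> real) \<Rightarrow> real \<Rightarrow> bool" where
  "F_at h x \<longleftrightarrow> (\<exists>c d. pl_at h x c d \<and> pow2 c \<and> pow2 d \<and> h x - c * x \<in> dyadic \<and> (c = d \<or> x \<in> dyadic))"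

lemma F_at_dyadic: assumes "F_at h x" shows "h x \<in> dyadic \<longleftrightarrow> x \<in> dyadic"
proof -
  obtain c where c: "pow2 c" "h x - c * x \<in> dyadic" using assms by (auto simp: F_at_def)
  have "h x \<in> dyadic \<longleftrightarrow> c * x \<in> dyadic"
    using dyadic_add[OF c(2), of "c * x"] dyadic_diff[OF _ c(2), of "h x"] by auto
  then show ?thesis using dyadic_pow2_mult[OF c(1)] by simp
qed

lemma F_at_comp: assumes h: "F_at h x" and g: "F_at g (h x)" shows "F_at (g \<circ> h) x"
proof -
  obtain c d where c: "pl_at h x c d" "pow2 c" "pow2 d" "h x - c * x \<in> dyadic" "c = d \<or> x \<in> dyadic"
    using h by (auto simp: F_at_def)
  obtain c' d' where c': "pl_at g (h x) c' d'" "pow2 c'" "pow2 d'" "g (h x) - c' * h x \<in> dyadic" "c' = d' \<or> h x \<in> dyadic"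
    using g by (auto simp: F_at_def)
  have "(g (h x) - c' * h x) + c' * (h x - c * x) \<in> dyadic"
    by (rule dyadic_add[OF c'(4) dyadic_mult[OF pow2_dyadic[OF c'(2)] c(4)]])
  then have "(g \<circ> h) x - (c' * c) * x \<in> dyadic" by (simp add: algebra_simps)
  moreover have "c' * c = d' * d \<or> x \<in> dyadic" using c(5) c'(5) F_at_dyadic[OF h] by auto
  ultimately show ?thesis unfolding F_at_def using pl_at_comp[OF c(1) c'(1)] pow2_mult c c' by blast
qed

lemma F_at_inv: assumes h: "F_at h x" and k: "\<forall>\<^sub>F y in nhds x. k (h y) = y" shows "F_at k (h x)"
proof -
  obtain c d where c: "pl_at h x c d" "pow2 c" "pow2 d" "h x - c * x \<in> dyadic" "c = d \<or> x \<in> dyadic"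
    using h by (auto simp: F_at_def)
  have kx: "k (h x) = x" using eventually_nhds_x_imp_x[OF k] .
  have "- ((1 / c) * (h x - c * x)) \<in> dyadic"
    by (rule dyadic_minus[OF dyadic_mult[OF pow2_dyadic[OF pow2_divide[OF c(2)]] c(4)]])
  then have "k (h x) - (1 / c) * h x \<in> dyadic" using pow2_pos[OF c(2)] by (simp add: kx right_diff_distrib)
  moreover have "1 / c = 1 / d \<or> h x \<in> dyadic" using c(5) F_at_dyadic[OF h] by auto
  ultimately show ?thesis unfolding F_at_def using pl_at_inv[OF c(1) k] pow2_divide c by blast
qed

lemma F_at_cong_open:
  assumes "open S" "x \<in> S" "\<And>y. y \<in> S \<Longrightarrow> h y = k y" shows "F_at h x \<longleftrightarrow> F_at k x"
  unfolding F_at_def using pl_at_cong_open[OF assms] assms(2,3) by auto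

lemma F_at_inverse:
  assumes "plmap a b a' b' h" "\<And>x. x \<in> {a<..<b} \<Longrightarrow> F_at h x" "\<And>x. x \<in> {a<..<b} \<Longrightarrow> k (h x) = x" "y \<in> {a'<..<b'}"
  shows "F_at k y"
proof -
  obtain x where x: "x \<in> {a<..<b}" "h x = y" using plmap_surj[OF assms(1,4)] by blast
  have "\<forall>\<^sub>F z in nhds x. k (h z) = z"
    using eventually_nhds_in_open[of "{a<..<b}" x] x(1) assms(3) by (auto elim!: eventually_mono)
  then show ?thesis using F_at_inv assms(2) x by blast
qed

lemma F_at_zpow:
  assumes "bij f" "plmap a b a b f" and F: "\<And>x. x \<in> {a<..<b} \<Longrightarrow> F_at f x" and x: "x \<in> {a<..<b}"
  shows "F_at (zpow f n) x"
proof (induction n rule: int_induct[of _ 0])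
  case base
  have "zpow f 0 = (\<lambda>x. x)" by auto
  moreover have "F_at (\<lambda>x. x) x" unfolding F_at_def by (intro exI[of _ 1]) simp
  ultimately show ?case by simp
next
  case (step1 i)
  have "zpow f (i + 1) = f \<circ> zpow f i" using zpow_Suc[OF assms(1)] by auto
  then show ?case using F_at_comp[OF step1(2) F[OF plmap_in[OF plmap_zpow[OF assms(1,2)] x]]] by (simp only:)
next
  case (step2 i)
  have "zpow f (i - 1) = inv f \<circ> zpow f i" using zpow_pred[OF assms(1)] by auto
  moreover have "F_at (inv f) y" if "y \<in> {a<..<b}" for y
    by (rule F_at_inverse[OF assms(2) F _ that]) (use assms(1) in \<open>auto simp: bij_is_inj\<close>)
  ultimately show ?case using F_at_comp[OF step2(2)] plmap_in[OF plmap_zpow[OF assms(1,2)] x] by (simp only:)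
qed

text \<open>Since \<open>a\<close> may be nondyadic, the condition is put on the affine germ at
  \<open>a\<close>, whose offset is \<open>a' - c * a\<close>, and not on the end points.\<close>

definition F_init :: "(real \<Rightarrow> real) \<Rightarrow> real \<Rightarrow> real \<Rightarrow> bool" where
  "F_init h a a' \<longleftrightarrow> (\<exists>c. rgerm h a a' c \<and> pow2 c \<and> a' - c * a \<in> dyadic)"

lemma F_init_at:
  assumes "F_init h a a'" shows "\<exists>e>0. \<forall>y. a < y \<and> y < a + e \<longrightarrow> F_at h y"
proof -
  obtain c where c: "rgerm h a a' c" "pow2 c" "a' - c * a \<in> dyadic" using assms by (auto simp: F_init_def)
  obtain e1 where e1: "e1 > 0" "\<And>y. a < y \<Longrightarrow> y < a + e1 \<Longrightarrow> h y = a' + c * (y - a)" using rgermE[OF c(1)] by blast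
  obtain e2 where e2: "e2 > 0" "\<And>y. a < y \<Longrightarrow> y < a + e2 \<Longrightarrow> pl_at h y c c" using rgerm_pl_at[OF c(1)] by blast
  have "F_at h y" if "a < y" "y < a + min e1 e2" for y
  proof -
    have lt: "y < a + e1" "y < a + e2" using that(2) by linarith+
    have "h y - c * y = a' - c * a" using e1(2)[OF that(1) lt(1)] by (simp add: algebra_simps)
    then show ?thesis unfolding F_at_def using e2(2)[OF that(1) lt(2)] c by (intro exI[of _ c]) simp
  qed
  then show ?thesis using e1(1) e2(1) by (metis min_less_iff_conj)
qed

text \<open>At the right end the arithmetic of the germ is inherited from points just before it.
  Across a nondyadic end point this supplies the starting condition for the next interval.\<close>

lemma F_at_final:
  assumes g: "lgerm h b b' c" and F: "\<And>y. y \<in> {a<..<b} \<Longrightarrow> F_at h y" and "a < b"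
  shows "pow2 c \<and> b' - c * b \<in> dyadic"
proof -
  obtain e1 where e1: "e1 > 0" "\<And>y. b - e1 < y \<Longrightarrow> y < b \<Longrightarrow> h y = b' + c * (y - b)" using lgermE[OF g] by blast
  obtain e2 where e2: "e2 > 0" "\<And>y. b - e2 < y \<Longrightarrow> y < b \<Longrightarrow> pl_at h y c c" using lgerm_pl_at[OF g] by blast
  have "max a (b - min e1 e2) < b" using assms(3) e1 e2 by auto
  then obtain y where y: "max a (b - min e1 e2) < y" "y < b" using dense by blast
  have lt: "b - e1 < y" "b - e2 < y" "a < y" using y(1) by linarith+
  obtain c' d' where c': "pl_at h y c' d'" "pow2 c'" "h y - c' * y \<in> dyadic" using F[of y] y by (auto simp: F_at_def)
  have "c' = c" using pl_at_unique[OF c'(1) e2(2)[OF lt(2) y(2)]] by auto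
  moreover have "h y - c * y = b' - c * b" using e1(2)[OF lt(1) y(2)] by (simp add: algebra_simps)
  ultimately show ?thesis using c' by auto
qed

lemma pow2_initial_slope:
  assumes "plmap a b a' b' h" "\<And>x. x \<in> {a<..<b} \<Longrightarrow> F_at h x" shows "pow2 (initial_slope a b h)"
proof -
  obtain e where e: "e > 0" "\<And>y. a < y \<Longrightarrow> y < a + e \<Longrightarrow> pl_at h y (initial_slope a b h) (initial_slope a b h)"
    using rgerm_pl_at[OF plmap_initial[OF assms(1)]] by blast
  have "min b (a + e) > a" using plmapD(1)[OF assms(1)] e(1) by auto
  then obtain y where y: "a < y" "y < min b (a + e)" using dense by blast
  obtain c' d' where "pl_at h y c' d'" "pow2 c'" using assms(2)[of y] y by (auto simp: F_at_def)
  then show ?thesis using pl_at_unique e(2)[of y] y by force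
qed

text \<open>Membership in the group restricts nodes and slopes but does not mention the offsets of
  the affine pieces. The offset is \<open>0\<close> near \<open>0\<close> and changes only at nodes;
  these are dyadic, so it stays dyadic, by connectedness of the interval.\<close>

lemma thompson_F_at:
  assumes f: "f \<in> thompson_F" and x: "x \<in> {0<..<1}" shows "F_at f x"
proof -
  have PL: "f \<in> PL 0 1" and der: "\<forall>x\<in>{0<..<1} - nodes 0 1 f. \<exists>k::int. (f has_real_derivative 2 powi k) (at x)"
    and nodes_dyadic: "nodes 0 1 f \<subseteq> dyadic" using f by (simp_all add: thompson_F_def)
  have pl: "plmap 0 1 0 1 f" using PL_plmap[OF PL] by simp
  have nd: "y \<in> dyadic" if "y \<in> {0<..<1}" "pl_at f y c d" "c \<noteq> d" for y c d
    using nodes_dyadic that plmap_nodes[OF pl] slope_ratio_1_iff[OF that(2)] by blast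
  have p0: "pow2 c" if "y \<in> {0<..<1}" "pl_at f y c c" for y c
  proof -
    have "y \<notin> nodes 0 1 f" using that plmap_nodes[OF pl] slope_ratio_1_iff[OF that(2)] by auto
    then have "\<exists>k::int. (f has_real_derivative 2 powi k) (at y)" using bspec[OF der, of y] that(1) by blast
    then show ?thesis using DERIV_unique[OF pl_at_DERIV[OF that(2)]] by (auto simp: pow2_def)
  qed
  \<comment> \<open>The definition gives derivatives away from nodes only; the one-sided slopes at a
    node are those at points close by.\<close>
  have p: "pow2 c \<and> pow2 d" if y: "y \<in> {0<..<1}" "pl_at f y c d" for y c d
  proof
    obtain e where e: "e > 0" "\<And>z. y - e < z \<Longrightarrow> z < y \<Longrightarrow> pl_at f z c c"
      using lgerm_pl_at[of f y "f y" c] y by (auto simp: pl_at_def)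
    have "max 0 (y - e) < y" using e y by auto
    then obtain z where "max 0 (y - e) < z" "z < y" using dense by blast
    then show "pow2 c" using p0[of z c] e(2)[of z] y by auto
    obtain e' where e': "e' > 0" "\<And>z. y < z \<Longrightarrow> z < y + e' \<Longrightarrow> pl_at f z d d"
      using rgerm_pl_at[of f y "f y" d] y by (auto simp: pl_at_def)
    have "min 1 (y + e') > y" using e' y by auto
    then obtain z where "y < z" "z < min 1 (y + e')" using dense by blast
    then show "pow2 d" using p0[of z d] e'(2)[of z] y by auto
  qed
  define P where "P = (\<lambda>y. \<exists>c d. pl_at f y c d \<and> f y - c * y \<in> dyadic)"
  obtain c0 where c0: "rgerm f 0 0 c0" using plmapD(3)[OF pl] by blast
  obtain e1 where e1: "e1 > 0" "\<And>y. 0 < y \<Longrightarrow> y < 0 + e1 \<Longrightarrow> f y = 0 + c0 * (y - 0)" using rgermE[OF c0] by blast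
  obtain e2 where e2: "e2 > 0" "\<And>y. 0 < y \<Longrightarrow> y < 0 + e2 \<Longrightarrow> pl_at f y c0 c0" using rgerm_pl_at[OF c0] by blast
  define y0 where "y0 = min (min e1 e2) 1 / 2"
  have y0: "0 < y0" "y0 < e1" "y0 < e2" "y0 < 1" using e1(1) e2(1) by (auto simp: y0_def min_def)
  have "P y0" unfolding P_def using e2(2)[of y0] e1(2)[of y0] y0 by (intro exI[of _ c0]) auto
  have "P x"
  proof (rule connected_induction_simple[of "{0<..<1}" y0 x P])
    fix z :: real assume z: "z \<in> {0<..<1}"
    obtain c d where cd: "pl_at f z c d" using plmapD(2)[OF pl z] by blast
    then have g: "lgerm f z (f z) c" "rgerm f z (f z) d" by (auto simp: pl_at_def)
    obtain e1 where e1: "e1 > 0" "\<And>y. z - e1 < y \<Longrightarrow> y < z \<Longrightarrow> f y = f z + c * (y - z)" using lgermE[OF g(1)] by blast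
    obtain e2 where e2: "e2 > 0" "\<And>y. z < y \<Longrightarrow> y < z + e2 \<Longrightarrow> f y = f z + d * (y - z)" using rgermE[OF g(2)] by blast
    obtain e3 where e3: "e3 > 0" "\<And>y. z - e3 < y \<Longrightarrow> y < z \<Longrightarrow> pl_at f y c c" using lgerm_pl_at[OF g(1)] by blast
    obtain e4 where e4: "e4 > 0" "\<And>y. z < y \<Longrightarrow> y < z + e4 \<Longrightarrow> pl_at f y d d" using rgerm_pl_at[OF g(2)] by blast
    define e where "e = min (min e1 e2) (min e3 e4)"
    have e: "e > 0" "e \<le> e1" "e \<le> e2" "e \<le> e3" "e \<le> e4" using e1(1) e2(1) e3(1) e4(1) by (auto simp: e_def)
    have Pz: "P z \<longleftrightarrow> f z - c * z \<in> dyadic" unfolding P_def using cd pl_at_unique[OF cd] by blast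
    \<comment> \<open>Passing from the left to the right piece at \<open>z\<close>: for
      \<open>c \<noteq> d\<close> the point is dyadic, so both products with \<open>z\<close> are
      dyadic and the two offsets are dyadic together.\<close>
    have sw: "f z - d * z \<in> dyadic \<longleftrightarrow> f z - c * z \<in> dyadic"
    proof (cases "c = d")
      case False
      then have "z \<in> dyadic" using nd z cd by blast
      then have "c * z \<in> dyadic" "d * z \<in> dyadic" using p[OF z cd] dyadic_pow2_mult by auto
      moreover have "f z - e * z \<in> dyadic \<longleftrightarrow> f z \<in> dyadic" if "e * z \<in> dyadic" for e
        using dyadic_add[of "f z - e * z" "e * z"] dyadic_diff[of "f z" "e * z"] that by (metis diff_add_cancel)
      ultimately show ?thesis by blast
    qed simp
    have PP: "P y \<longleftrightarrow> P z" if y: "y \<in> {z-e<..<z+e}" for y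
    proof (cases y z rule: linorder_cases)
      case less
      have "pl_at f y c c" using e3(2)[of y] e y less by auto
      then have "P y \<longleftrightarrow> f y - c * y \<in> dyadic" unfolding P_def using pl_at_unique by blast
      moreover have "f y - c * y = f z - c * z" using e1(2)[of y] e y less by (simp add: algebra_simps)
      ultimately show ?thesis using Pz by simp
    next
      case greater
      have "pl_at f y d d" using e4(2)[of y] e y greater by auto
      then have "P y \<longleftrightarrow> f y - d * y \<in> dyadic" unfolding P_def using pl_at_unique by blast
      moreover have "f y - d * y = f z - d * z" using e2(2)[of y] e y greater by (simp add: algebra_simps)
      ultimately show ?thesis using Pz sw by simp
    qed simp
    have "openin (top_of_set {0<..<1}) ({0<..<1} \<inter> {z-e<..<z+e})"
      by (intro openin_open_Int open_greaterThanLessThan)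
    moreover have "z \<in> {0<..<1} \<inter> {z-e<..<z+e}" using z e(1) by auto
    ultimately show "\<exists>T. openin (top_of_set {0<..<1}) T \<and> z \<in> T \<and> (\<forall>x\<in>T. \<forall>y\<in>T. P x \<longrightarrow> P y)"
      using PP by (meson IntD2)
  next
    show "connected {0<..<1::real}" by simp
    show "y0 \<in> {0<..<1}" using y0 by simp
  qed (rule x, rule \<open>P y0\<close>)
  then obtain c d where "pl_at f x c d" "f x - c * x \<in> dyadic" by (auto simp: P_def)
  then show ?thesis unfolding F_at_def using p[OF x] nd[OF x] by blast
qed

lemma thompson_F_I:
  assumes PL: "f \<in> PL 0 1" and F: "\<And>x. x \<in> {0<..<1} \<Longrightarrow> F_at f x" shows "f \<in> thompson_F"
proof -
  have pl: "plmap 0 1 0 1 f" using PL_plmap[OF PL] by simp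
  have "x \<in> dyadic" if "x \<in> nodes 0 1 f" for x
  proof -
    have x: "x \<in> {0<..<1}" "slope_ratio f x \<noteq> 1" using that plmap_nodes[OF pl] by auto
    then show ?thesis using F[OF x(1)] slope_ratio_1_iff by (auto simp: F_at_def)
  qed
  moreover have "\<exists>k::int. (f has_real_derivative 2 powi k) (at x)" if x: "x \<in> {0<..<1} - nodes 0 1 f" for x
  proof -
    obtain c d where c: "pl_at f x c d" "pow2 c" using F[of x] x by (auto simp: F_at_def)
    then have "c = d" using x plmap_nodes[OF pl] slope_ratio_1_iff[OF c(1)] by auto
    then show ?thesis using pl_at_DERIV c by (auto simp: pow2_def)
  qed
  ultimately show ?thesis using PL by (auto simp: thompson_F_def)
qed

lemma F_propagate_up:
  assumes "up_bump a b f" "up_bump a' b' g" and h: "plmap a b a' b' h"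
    and conj: "\<And>x. x \<in> {a<..<b} \<Longrightarrow> h (f x) = g (h x)"
    and f: "\<And>x. x \<in> {a<..<b} \<Longrightarrow> F_at f x" and g: "\<And>x. x \<in> {a'<..<b'} \<Longrightarrow> F_at g x"
    and init: "F_init h a a'" and x: "x \<in> {a<..<b}"
  shows "F_at h x"
proof -
  interpret f: up_bump a b f by fact
  interpret g: up_bump a' b' g by fact
  obtain e where e: "e > 0" "\<And>y. a < y \<Longrightarrow> y < a + e \<Longrightarrow> F_at h y" using F_init_at[OF init] by blast
  obtain n :: nat where n: "zpow f (- int n) x < a + e" using f.unbounded_below[OF x] e(1) by (metis less_add_same_cancel1)
  define y where "y = zpow f (- int n) x"
  have y: "y \<in> {a<..<b}" "y < a + e" using f.in_zpow[OF x] n by (auto simp: y_def)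
  have Fy: "F_at h y" using e(2) y by auto
  have 1: "F_at (zpow f (- int n)) x" using F_at_zpow[OF f.bij f.pl f x] .
  have 2: "F_at (zpow g (int n)) (h y)" using F_at_zpow[OF g.bij g.pl g plmap_in[OF h y(1)]] .
  have 3: "F_at (h \<circ> zpow f (- int n)) x" using F_at_comp[OF 1] Fy by (simp add: y_def)
  have 4: "F_at (zpow g (int n) \<circ> (h \<circ> zpow f (- int n))) x" using F_at_comp[OF 3] 2 by (simp add: y_def)
  \<comment> \<open>The identity is required on the whole interval because \<open>F_at\<close>
    depends on the germ of \<open>h\<close> at \<open>x\<close>, not only on its value.\<close>
  have "h z = (zpow g (int n) \<circ> (h \<circ> zpow f (- int n))) z" if z: "z \<in> {a<..<b}" for z
  proof -
    have "h (zpow f (int n) (zpow f (- int n) z)) = zpow g (int n) (h (zpow f (- int n) z))"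
      using zpow_conj[of f g "{a<..<b}" h "zpow f (- int n) z" "int n"] f.bij g.bij f.in_f f.in_inv conj f.in_zpow[OF z] by blast
    then show ?thesis using zpow_add[OF f.bij, of "int n" "- int n" z] by simp
  qed
  then have "F_at h x \<longleftrightarrow> F_at (zpow g (int n) \<circ> (h \<circ> zpow f (- int n))) x"
    using x by (intro F_at_cong_open[of "{a<..<b}"]) auto
  then show ?thesis using 4 by blast
qed

lemma F_propagate:
  assumes f: "bump a b f" and g: "bump a' b' g" and h: "plmap a b a' b' h"
    and conj: "\<And>x. x \<in> {a<..<b} \<Longrightarrow> h (f x) = g (h x)"
    and Ff: "\<And>x. x \<in> {a<..<b} \<Longrightarrow> F_at f x" and Fg: "\<And>x. x \<in> {a'<..<b'} \<Longrightarrow> F_at g x"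
    and init: "F_init h a a'" and x: "x \<in> {a<..<b}"
  shows "F_at h x"
proof -
  note F = bumpD[OF f] and G = bumpD[OF g]
  have slope: "initial_slope a b f = initial_slope a' b' g" by (rule conj_initial_slope(1)[OF F(2) G(2) h conj])
  show ?thesis
  proof (cases "up_bump a b f")
    case True
    then have up': "up_bump a' b' g" using bump_slope(1)[OF f] bump_slope(1)[OF g] slope by simp
    show ?thesis by (rule F_propagate_up[OF True up' h conj Ff Fg init x])
  next
    case False
    then have "\<not> up_bump a' b' g" using bump_slope(1)[OF f] bump_slope(1)[OF g] slope by simp
    then have i: "up_bump a b (inv f)" "up_bump a' b' (inv g)" using f g False by (blast elim: bump_cases)+
    have c: "h (inv f x) = inv g (h x)" if "x \<in> {a<..<b}" for x by (rule conj_inv[OF F(1,2) G(1) _ that]) (rule conj)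
    have Fi: "F_at (inv f) x" if "x \<in> {a<..<b}" for x
      by (rule F_at_inverse[OF F(2) Ff _ that]) (use F(1) in \<open>auto simp: bij_is_inj\<close>)
    have Gi: "F_at (inv g) x" if "x \<in> {a'<..<b'}" for x
      by (rule F_at_inverse[OF G(2) Fg _ that]) (use G(1) in \<open>auto simp: bij_is_inj\<close>)
    show ?thesis by (rule F_propagate_up[OF i h c Fi Gi init x])
  qed
qed

section \<open>Maps between dyadic intervals\<close>

definition F_map :: "real \<Rightarrow> real \<Rightarrow> real \<Rightarrow> real \<Rightarrow> (real \<Rightarrow> real) \<Rightarrow> bool" where
  "F_map a b a' b' h \<longleftrightarrow> plmap a b a' b' h \<and> (\<forall>x\<in>{a<..<b}. F_at h x)"

lemma F_map_comp: "F_map a b a' b' h \<Longrightarrow> F_map a' b' a'' b'' g \<Longrightarrow> F_map a b a'' b'' (g \<circ> h)"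
  unfolding F_map_def using plmap_comp F_at_comp plmap_in by blast

lemma F_map_inverse: assumes "F_map a b a' b' h" shows "\<exists>k. F_map a' b' a b k"
proof -
  have h: "plmap a b a' b' h" "\<And>x. x \<in> {a<..<b} \<Longrightarrow> F_at h x" using assms by (auto simp: F_map_def)
  define k where "k = inv_into {a<..<b} h"
  note k = plmap_inv_into(1)[OF h(1), folded k_def] and kh = plmap_inv_into(2)[OF h(1), folded k_def]
  show ?thesis unfolding F_map_def using k F_at_inverse[OF h kh] by blast
qed

lemma F_at_affine:
  assumes "pow2 c" "d \<in> dyadic" "open S" "x \<in> S" "\<And>y. y \<in> S \<Longrightarrow> h y = c * y + d" shows "F_at h x"
proof -
  have "pl_at h x c c" by (rule pl_at_affine[of c S x h d 0]) (use assms pow2_pos in auto)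
  then show ?thesis unfolding F_at_def using assms by (intro exI[of _ c]) auto
qed

lemma F_map_affine: "a < b \<Longrightarrow> pow2 c \<Longrightarrow> d \<in> dyadic \<Longrightarrow> F_map a b (c * a + d) (c * b + d) (\<lambda>x. c * x + d)"
  unfolding F_map_def using plmap_affine[of a b c d] pow2_pos[of c] F_at_affine[of c d UNIV] by auto

text \<open>Doubling the first unit interval and translating the rest lengthens the interval by one.
  For \<open>n = 1\<close> the rest is empty and the map is the doubling.\<close>

lemma F_map_step: assumes "n \<ge> 1" shows "\<exists>h. F_map 0 (real n) 0 (real (Suc n)) h"
proof (cases "n = 1")
  case True
  then show ?thesis using F_map_affine[of 0 1 2 0] by auto
next
  case False
  then have n: "real n > 1" using assms by simp
  define h where "h = (\<lambda>x::real. if x \<le> 1 then 2 * x else x + 1)"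
  have l: "F_at h x" if "x < 1" for x
    by (rule F_at_affine[of 2 0 "{..<1}"]) (use that in \<open>auto simp: h_def\<close>)
  have r: "F_at h x" if "x > 1" for x
    by (rule F_at_affine[of 1 1 "{1<..}"]) (use that in \<open>auto simp: h_def\<close>)
  have "pl_at h 1 2 1" unfolding pl_at_def
    by (auto simp: h_def algebra_simps intro!: lgermI[of _ 0] rgermI[of _ _ 2])
  then have m: "F_at h 1" unfolding F_at_def by (intro exI[of _ 2] exI[of _ 1]) (auto simp: h_def)
  have F: "F_at h x" for x using l r m by (cases x "1::real" rule: linorder_cases) auto
  have "plmap 0 (real n) 0 (real (Suc n)) h" unfolding plmap_def
  proof (intro conjI ballI)
    show "\<exists>c d. pl_at h x c d" for x using F[of x] by (auto simp: F_at_def)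
    show "\<exists>c. rgerm h 0 0 c" by (rule exI[of _ 2], rule rgermI[of _ _ 1]) (auto simp: h_def)
    show "\<exists>c. lgerm h (real n) (real (Suc n)) c"
      by (rule exI[of _ 1], rule lgermI[of _ 1]) (use n in \<open>auto simp: h_def\<close>)
  qed (use n in auto)
  then show ?thesis using F by (auto simp: F_map_def)
qed

lemma F_map_nat: "n \<ge> 1 \<Longrightarrow> \<exists>h. F_map 0 1 0 (real n) h"
proof (induction n rule: nat_induct_at_least)
  case base then show ?case using F_map_affine[of 0 1 1 0] by auto
next
  case (Suc n) then show ?case using F_map_step[of n] F_map_comp by blast
qed

text \<open>The length is \<open>k / 2 ^ n\<close> with \<open>k > 0\<close>, so scaling by a power
  of two and a dyadic translation reduce it to an integer length.\<close>

lemma F_map_unit: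
  assumes "a \<in> dyadic" "b \<in> dyadic" "a < b" shows "\<exists>h. F_map 0 1 a b h"
proof -
  obtain k n where k: "b - a = of_int k / 2 ^ n" using dyadic_diff[OF assms(2,1)] by (auto simp: dyadic_def)
  have "of_int k / 2 ^ n > (0::real)" using k assms(3) by linarith
  then have k0: "k > 0" by (simp add: zero_less_divide_iff)
  obtain h where h: "F_map 0 1 0 (real (nat k)) h" using F_map_nat[of "nat k"] k0 by fastforce
  have "pow2 (1 / 2 ^ n)" by (rule pow2_divide) simp
  then have "F_map 0 (real (nat k)) (1 / 2 ^ n * 0 + a) (1 / 2 ^ n * real (nat k) + a) (\<lambda>x. 1 / 2 ^ n * x + a)"
    by (intro F_map_affine) (use k0 assms in auto)
  moreover have "1 / 2 ^ n * real (nat k) + a = b" using k k0 by simp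
  ultimately have "F_map 0 (real (nat k)) a b (\<lambda>x. 1 / 2 ^ n * x + a)" by simp
  then show ?thesis using F_map_comp[OF h] by blast
qed

text \<open>Supplies the conjugating map between corresponding intervals of fixed points, where the
  intertwining relation is automatic.\<close>

lemma F_map_exists:
  assumes "a \<in> dyadic" "b \<in> dyadic" "a < b" "a' \<in> dyadic" "b' \<in> dyadic" "a' < b'" shows "\<exists>h. F_map a b a' b' h"
  using F_map_unit[OF assms(1-3)] F_map_unit[OF assms(4-6)] F_map_inverse F_map_comp by blast

section \<open>The intervals of an element of \<open>F\<close>\<close>

definition frontier_pts :: "(real \<Rightarrow> real) \<Rightarrow> real set" where
  "frontier_pts f = top_of_set {0<..<1} frontier_of fixset f"

text \<open>Continuity makes the fixed set closed in the interval, so only its interior points have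
  to be removed.\<close>

lemma frontier_pts_iff:
  assumes f: "plmap 0 1 0 1 f"
  shows "x \<in> frontier_pts f \<longleftrightarrow> x \<in> {0<..<1} \<and> f x = x \<and> \<not> (\<forall>\<^sub>F y in nhds x. f y = y)"
proof -
  have eq: "frontier_pts f = {0<..<1} \<inter> frontier (fixset f)"
    unfolding frontier_pts_def by (subst frontier_of_subtopology_open) auto
  have "x \<in> frontier (fixset f) \<longleftrightarrow> f x = x \<and> \<not> (\<forall>\<^sub>F y in nhds x. f y = y)" if x: "x \<in> {0<..<1}"
  proof -
    have near: "\<forall>\<^sub>F y in nhds x. y \<in> {0<..<1}" using x by (intro eventually_nhds_in_open) auto
    have "x \<in> interior (fixset f) \<longleftrightarrow> (\<forall>\<^sub>F y in nhds x. y \<in> fixset f)"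
      by (auto simp: interior_def eventually_nhds)
    also have "\<dots> \<longleftrightarrow> (\<forall>\<^sub>F y in nhds x. f y = y)"
      using near by (auto simp: fixset_def elim: eventually_elim2)
    finally have i: "x \<in> interior (fixset f) \<longleftrightarrow> (\<forall>\<^sub>F y in nhds x. f y = y)" .
    have "x \<in> closure (fixset f) \<longleftrightarrow> f x = x"
    proof
      assume c: "x \<in> closure (fixset f)"
      show "f x = x"
      proof (rule ccontr)
        assume ne: "f x \<noteq> x"
        have "isCont (\<lambda>y. f y - y) x" using plmap_isCont[OF f x] by (intro continuous_intros)
        then have "((\<lambda>y. f y - y) \<longlongrightarrow> f x - x) (nhds x)"
          unfolding isCont_def tendsto_at_iff_tendsto_nhds[of "\<lambda>y. f y - y" x] .
        then have "\<forall>\<^sub>F y in nhds x. f y - y \<noteq> 0" using ne by (intro tendsto_imp_eventually_ne) auto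
        then obtain T where T: "open T" "x \<in> T" "\<And>y. y \<in> T \<Longrightarrow> f y - y \<noteq> 0" by (auto simp: eventually_nhds)
        then have "T \<inter> fixset f = {}" by (auto simp: fixset_def)
        then have "T \<inter> closure (fixset f) = {}" using open_Int_closure_eq_empty[OF T(1)] by blast
        then show False using c T(2) by blast
      qed
    next
      assume "f x = x"
      then show "x \<in> closure (fixset f)" using x closure_subset by (force simp: fixset_def)
    qed
    then show ?thesis using i by (simp add: frontier_def)
  qed
  then show ?thesis using eq by blast
qed

text \<open>On one affine piece the fixed points are none, one or all. On each side of a point a
  single candidate for a frontier point remains nearby, so frontier points cannot
  accumulate.\<close>

lemma frontier_pts_finite:
  assumes f: "plmap 0 1 0 1 f" shows "finite (frontier_pts f)"
proof -
  \<comment> \<open>The excluded value is the solution of \<open>v + d * (y - x) = y\<close>. For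
    \<open>d = 1\<close> the division by zero yields \<open>0\<close>, a harmless exclusion, since
    the piece is then either free of fixed points or entirely fixed.\<close>
  have aff: "y \<notin> frontier_pts f" if y: "y \<in> {s<..<t}" and e: "\<And>z. z \<in> {s<..<t} \<Longrightarrow> f z = v + d * (z - x)"
    and ne: "y \<noteq> (v - d * x) / (1 - d)" for y s t v d x
  proof
    assume "y \<in> frontier_pts f"
    then have fy: "f y = y" "\<not> (\<forall>\<^sub>F z in nhds y. f z = z)" using frontier_pts_iff[OF f] by auto
    have "(1 - d) * y = v - d * x" using e[OF y] fy by (simp add: algebra_simps)
    moreover have "d = 1"
    proof (rule ccontr)
      assume "d \<noteq> 1"
      then have "y = (v - d * x) / (1 - d)" using \<open>(1 - d) * y = v - d * x\<close> by (simp add: eq_divide_eq mult.commute)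
      then show False using ne by blast
    qed
    ultimately have "d = 1" "v = x" by auto
    then have "f z = z" if "z \<in> {s<..<t}" for z using e[OF that] by simp
    then have "\<forall>\<^sub>F z in nhds y. f z = z"
      using eventually_nhds_in_open[of "{s<..<t}" y] y by (auto elim!: eventually_mono)
    then show False using fy by blast
  qed
  have r: "\<forall>\<^sub>F y in at_right x. y \<notin> frontier_pts f" if g: "rgerm f x v d" for x v d
  proof -
    obtain e where e: "e > 0" "\<And>y. x < y \<Longrightarrow> y < x + e \<Longrightarrow> f y = v + d * (y - x)" using rgermE[OF g] by blast
    have 1: "\<forall>\<^sub>F y in at_right x. y \<in> {x<..<x+e}" using e(1) unfolding eventually_at_right_field by (intro exI[of _ "x+e"]) auto
    have 2: "\<forall>\<^sub>F y in at_right x. y \<noteq> (v - d * x) / (1 - d)" by (rule eventually_neq_at_within)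
    show ?thesis using 1 2 by eventually_elim (rule aff[of _ x "x+e" v d x], use e(2) in auto)
  qed
  have l: "\<forall>\<^sub>F y in at_left x. y \<notin> frontier_pts f" if g: "lgerm f x v d" for x v d
  proof -
    obtain e where e: "e > 0" "\<And>y. x - e < y \<Longrightarrow> y < x \<Longrightarrow> f y = v + d * (y - x)" using lgermE[OF g] by blast
    have 1: "\<forall>\<^sub>F y in at_left x. y \<in> {x-e<..<x}" using e(1) unfolding eventually_at_left_field by (intro exI[of _ "x-e"]) auto
    have 2: "\<forall>\<^sub>F y in at_left x. y \<noteq> (v - d * x) / (1 - d)" by (rule eventually_neq_at_within)
    show ?thesis using 1 2 by eventually_elim (rule aff[of _ "x-e" x v d x], use e(2) in auto)
  qed
  show ?thesis
  proof (rule finite_bad_points[of 0 1])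
    fix x :: real assume "x \<in> {0<..<1}"
    then obtain c d where "pl_at f x c d" using plmapD(2)[OF f] by blast
    then show "\<forall>\<^sub>F y in at x. y \<notin> frontier_pts f" using r l by (auto simp: eventually_at_split pl_at_def)
  qed (use r l plmapD(3,4)[OF f] frontier_pts_iff[OF f] in blast)+
qed

section \<open>The end points of the intervals as a sorted list\<close>

definition pts :: "(real \<Rightarrow> real) \<Rightarrow> real list" where
  "pts f = 0 # sorted_list_of_set (frontier_pts f) @ [1]"

text \<open>The number \<open>m\<close> of intervals. Indices start at \<open>0\<close>, so the
  interval with index \<open>i\<close> is \<open>(pt f i, pt f (Suc i))\<close>.\<close>

definition npts :: "(real \<Rightarrow> real) \<Rightarrow> nat" where "npts f = length (pts f) - 1"

definition pt :: "(real \<Rightarrow> real) \<Rightarrow> nat \<Rightarrow> real" where "pt f i = pts f ! i"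

lemma pts_props:
  assumes f: "plmap 0 1 0 1 f"
  shows "sorted_wrt (<) (pts f)" "set (pts f) = insert 0 (insert 1 (frontier_pts f))"
    "npts f \<ge> 1" "length (pts f) = Suc (npts f)" "pt f 0 = 0" "pt f (npts f) = 1"
proof -
  have fin: "finite (frontier_pts f)" using frontier_pts_finite[OF f] .
  have sub: "frontier_pts f \<subseteq> {0<..<1}" using frontier_pts_iff[OF f] by blast
  show "sorted_wrt (<) (pts f)" using fin sub strict_sorted_list_of_set[of "frontier_pts f"]
    by (auto simp: pts_def sorted_wrt_append)
  show "set (pts f) = insert 0 (insert 1 (frontier_pts f))" using fin by (auto simp: pts_def)
  show "npts f \<ge> 1" "length (pts f) = Suc (npts f)" "pt f 0 = 0" "pt f (npts f) = 1"
    by (auto simp: pts_def npts_def pt_def nth_append)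
qed

lemma pt_less: "plmap 0 1 0 1 f \<Longrightarrow> i < j \<Longrightarrow> j \<le> npts f \<Longrightarrow> pt f i < pt f j"
  unfolding pt_def using sorted_wrt_nth_less[OF pts_props(1), of f i j] pts_props(4)[of f] by simp

lemma pt_le: "plmap 0 1 0 1 f \<Longrightarrow> i \<le> j \<Longrightarrow> j \<le> npts f \<Longrightarrow> pt f i \<le> pt f j"
  using pt_less[of f i j] by (cases "i = j") auto

lemma pt_bounds:
  assumes "plmap 0 1 0 1 f" "i \<le> npts f" shows "0 \<le> pt f i" "pt f i \<le> 1"
  using pt_le[OF assms(1), of 0 i] pt_le[OF assms(1), of i "npts f"] pts_props(5,6)[OF assms(1)] assms(2) by auto

lemma pt_frontier:
  assumes f: "plmap 0 1 0 1 f" and i: "0 < i" "i < npts f" shows "pt f i \<in> frontier_pts f"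
proof -
  have "pt f i \<in> set (pts f)" unfolding pt_def using i pts_props(4)[OF f] by simp
  moreover have "pt f i \<noteq> 0" "pt f i \<noteq> 1"
    using pt_less[OF f, of 0 i] pt_less[OF f, of i "npts f"] pts_props(5,6)[OF f] i by auto
  ultimately show ?thesis using pts_props(2)[OF f] by blast
qed

lemma interval_inside:
  assumes f: "plmap 0 1 0 1 f" and i: "i < npts f" and x: "x \<in> {pt f i<..<pt f (Suc i)}"
  shows "x \<in> {0<..<1}" "x \<notin> frontier_pts f"
proof -
  show "x \<in> {0<..<1}" using pt_bounds[OF f, of i] pt_bounds[OF f, of "Suc i"] i x by auto
  show "x \<notin> frontier_pts f"
  proof
    assume "x \<in> frontier_pts f"
    then have "x \<in> set (pts f)" using pts_props(2)[OF f] by blast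
    then obtain j where j: "j \<le> npts f" "x = pt f j" using pts_props(4)[OF f] by (auto simp: in_set_conv_nth pt_def less_Suc_eq_le)
    show False
    proof (cases "j \<le> i")
      case True then show False using pt_le[OF f True] i j x by auto
    next
      case False then show False using pt_le[OF f, of "Suc i" j] j x by auto
    qed
  qed
qed

lemma point_cases:
  assumes f: "plmap 0 1 0 1 f" and x: "0 \<le> x" "x < 1"
  obtains i where "i < npts f" "pt f i \<le> x" "x < pt f (Suc i)"
proof -
  define i where "i = Max {j. j \<le> npts f \<and> pt f j \<le> x}"
  have fin: "finite {j. j \<le> npts f \<and> pt f j \<le> x}" by simp
  have "0 \<in> {j. j \<le> npts f \<and> pt f j \<le> x}" using x pts_props(5)[OF f] by simp
  then have "{j. j \<le> npts f \<and> pt f j \<le> x} \<noteq> {}" by blast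
  from Max_in[OF fin this] have i: "i \<le> npts f" "pt f i \<le> x" unfolding i_def[symmetric] by auto
  have "i < npts f" using i pts_props(6)[OF f] x by (cases "i = npts f") auto
  moreover have "x < pt f (Suc i)"
  proof (rule ccontr)
    assume "\<not> x < pt f (Suc i)"
    then have "Suc i \<in> {j. j \<le> npts f \<and> pt f j \<le> x}" using \<open>i < npts f\<close> by simp
    from Max_ge[OF fin this] have "Suc i \<le> i" by (simp only: i_def)
    then show False by simp
  qed
  ultimately show thesis using that i by blast
qed

lemma (in linorder) sorted_key_list_of_set_idem:
  assumes "inj_on f (set xs)" "sorted (map f xs)" "distinct xs"
  shows "sorted_key_list_of_set f (set xs) = xs"
proof -
  interpret folding_insort_key "(\<le>)" "(<)" "set xs" f by unfold_locales (rule assms)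
  show ?thesis by (rule idem_if_sorted_distinct) (use assms in auto)
qed

text \<open>The components are identified by uniqueness: the open intervals between consecutive
  points are nonempty, connected, pairwise disjoint, and cover the set.\<close>

lemma intervals_pt:
  assumes f: "plmap 0 1 0 1 f" shows "intervals f = map (\<lambda>i. (pt f i, pt f (Suc i))) [0..<npts f]"
proof -
  define J where "J = (\<lambda>i. {pt f i<..<pt f (Suc i)})"
  define C where "C = components ({0<..<1} - frontier_pts f)"
  define L where "L = map J [0..<npts f]"
  have lt: "pt f i < pt f (Suc i)" if "i < npts f" for i using pt_less[OF f] that by simp
  have InfJ: "Inf (J i) = pt f i" "Sup (J i) = pt f (Suc i)" if "i < npts f" for i
    using lt[OF that] by (auto simp: J_def cInf_greaterThanLessThan cSup_greaterThanLessThan)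
  have "C = set L" unfolding C_def
  proof (rule components_open_unique)
    show "pairwise disjnt (set L)"
    proof (rule pairwiseI)
      fix A B assume "A \<in> set L" "B \<in> set L" "A \<noteq> B"
      then have "A \<in> J ` {..<npts f}" "B \<in> J ` {..<npts f}" by (auto simp: L_def)
      then obtain i j where ij: "i < npts f" "j < npts f" "A = J i" "B = J j" by blast
      then have "i \<noteq> j" using \<open>A \<noteq> B\<close> by blast
      then consider "i < j" | "j < i" by linarith
      then show "disjnt A B"
      proof cases
        case 1 then have "pt f (Suc i) \<le> pt f j" using pt_le[OF f] ij by simp
        then show ?thesis unfolding ij J_def disjnt_def by auto
      next
        case 2 then have "pt f (Suc j) \<le> pt f i" using pt_le[OF f] ij by simp
        then show ?thesis unfolding ij J_def disjnt_def by auto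
      qed
    qed
    show "\<Union> (set L) = {0<..<1} - frontier_pts f"
    proof (intro set_eqI iffI)
      fix x assume "x \<in> \<Union> (set L)"
      then obtain i where "i < npts f" "x \<in> J i" by (auto simp: L_def)
      then show "x \<in> {0<..<1} - frontier_pts f" using interval_inside[OF f] by (simp add: J_def)
    next
      fix x assume x: "x \<in> {0<..<1} - frontier_pts f"
      then obtain i where i: "i < npts f" "pt f i \<le> x" "x < pt f (Suc i)" using point_cases[OF f, of x] by auto
      have "pt f i \<noteq> x" using pt_frontier[OF f, of i] pts_props(5)[OF f] i(1) x by (cases "i = 0") auto
      then have "x \<in> J i" using i by (simp add: J_def)
      then show "x \<in> \<Union> (set L)" using i(1) by (auto simp: L_def intro!: bexI[of _ i])
    qed
    fix A assume "A \<in> set L"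
    then obtain i where "i < npts f" "A = J i" by (auto simp: L_def)
    then show "open A \<and> connected A \<and> A \<noteq> {}" using lt[of i] by (auto simp: J_def)
  qed
  moreover have "sorted_key_list_of_set Inf (set L) = L"
  proof -
    have mapL: "map Inf L = map (pt f) [0..<npts f]" unfolding L_def using InfJ by simp
    have "sorted_wrt (<) (map Inf L)" unfolding mapL sorted_wrt_map
      by (rule sorted_wrt_mono_rel[OF _ sorted_wrt_upt]) (use pt_less[OF f] in auto)
    then have s: "sorted (map Inf L)" "distinct (map Inf L)" by (auto simp: strict_sorted_iff)
    then have "inj_on Inf (set L)" by (simp add: distinct_map)
    then show ?thesis using s by (intro sorted_key_list_of_set_idem) (auto simp: distinct_map)
  qed
  ultimately have "intervals f = map (\<lambda>I. (Inf I, Sup I)) L"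
    unfolding intervals_def frontier_pts_def[symmetric] C_def by simp
  then show ?thesis unfolding L_def using InfJ by simp
qed

text \<open>The values at \<open>0\<close> and \<open>1\<close> are assumed because a germ at an end
  point is anchored at a limit, which says nothing about \<open>h\<close> there.\<close>

lemma plmap_subinterval01:
  assumes h: "plmap 0 1 0 1 h" "h 0 = 0" "h 1 = 1" and uv: "0 \<le> u" "u < v" "v \<le> 1"
  shows "plmap u v (h u) (h v) h"
  unfolding plmap_def
proof (intro conjI ballI)
  show "\<exists>c d. pl_at h x c d" if "x \<in> {u<..<v}" for x using plmapD(2)[OF h(1), of x] that uv by auto
  show "\<exists>c. rgerm h u (h u) c"
    using plmapD(3)[OF h(1)] plmapD(2)[OF h(1), of u] uv h(2) unfolding pl_at_def by (cases "u = 0") auto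
  show "\<exists>c. lgerm h v (h v) c"
    using plmapD(4)[OF h(1)] plmapD(2)[OF h(1), of v] uv h(3) unfolding pl_at_def by (cases "v = 1") auto
qed (rule uv)

lemma thompson_props:
  assumes "f \<in> thompson_F"
  shows "f \<in> PL 0 1" "plmap 0 1 0 1 f" "bij f" "f 0 = 0" "f 1 = 1" "\<And>x. x \<notin> {0<..<1} \<Longrightarrow> f x = x"
proof -
  show PL: "f \<in> PL 0 1" using assms by (simp add: thompson_F_def)
  show "plmap 0 1 0 1 f" "bij f" using PL_plmap[OF PL] PL_bij[OF PL] by auto
  show "f x = x" if "x \<notin> {0<..<1}" for x using PL_id[OF PL that] .
  then show "f 0 = 0" "f 1 = 1" by auto
qed

lemma pt_fixed:
  assumes f: "f \<in> thompson_F" and i: "i \<le> npts f" shows "f (pt f i) = pt f i"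
proof -
  note F = thompson_props[OF f]
  consider "i = 0" | "i = npts f" | "0 < i" "i < npts f" using i by linarith
  then show ?thesis
    by cases (use F pts_props(5,6)[OF F(2)] pt_frontier[OF F(2)] frontier_pts_iff[OF F(2)] in auto)
qed

definition is_bump :: "(real \<Rightarrow> real) \<Rightarrow> nat \<Rightarrow> bool" where
  "is_bump f i \<longleftrightarrow> bump_domain f (pt f i, pt f (Suc i))"

lemma is_bump_iff: "is_bump f i \<longleftrightarrow> (\<forall>x\<in>{pt f i<..<pt f (Suc i)}. f x \<noteq> x)"
  by (auto simp: is_bump_def bump_domain_def eps_def split: if_splits)

text \<open>A connected set that meets a set and its complement meets the frontier, and the open
  intervals avoid the frontier.\<close>

lemma not_bump_fixed:
  assumes f: "f \<in> thompson_F" and i: "i < npts f" and nb: "\<not> is_bump f i" and x: "x \<in> {pt f i<..<pt f (Suc i)}"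
  shows "f x = x"
proof (rule ccontr)
  note F = thompson_props[OF f]
  let ?J = "{pt f i<..<pt f (Suc i)}"
  assume "f x \<noteq> x"
  then have 1: "?J - fixset f \<noteq> {}" using x by (auto simp: fixset_def)
  obtain y where "y \<in> ?J" "f y = y" using nb by (auto simp: is_bump_iff)
  then have 2: "?J \<inter> fixset f \<noteq> {}" using interval_inside(1)[OF F(2) i] by (auto simp: fixset_def)
  have "connectedin (top_of_set {0<..<1}) ?J"
    unfolding connectedin_subtopology connectedin_iff_connected using interval_inside(1)[OF F(2) i] by auto
  then have "?J \<inter> frontier_pts f \<noteq> {}" unfolding frontier_pts_def using connectedin_Int_frontier_of 1 2 by blast
  then show False using interval_inside(2)[OF F(2) i] by blast
qed

text \<open>Without fixed points \<open>f y - y\<close> has no zero on the interval, so by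
  connectedness it keeps its sign.\<close>

lemma is_bump_bump:
  assumes f: "f \<in> thompson_F" and i: "i < npts f" and b: "is_bump f i"
  shows "bump (pt f i) (pt f (Suc i)) f"
proof -
  note F = thompson_props[OF f]
  let ?J = "{pt f i<..<pt f (Suc i)}"
  have "plmap (pt f i) (pt f (Suc i)) (f (pt f i)) (f (pt f (Suc i))) f"
    using plmap_subinterval01[OF F(2,4,5)] pt_bounds[OF F(2)] pt_less[OF F(2)] i by simp
  then have pl: "plmap (pt f i) (pt f (Suc i)) (pt f i) (pt f (Suc i)) f" using pt_fixed[OF f] i by simp
  have "connected ((\<lambda>y. f y - y) ` ?J)"
    by (intro connected_continuous_image continuous_intros plmap_continuous_on[OF pl]) simp
  then have ivt: "0 \<in> (\<lambda>y. f y - y) ` ?J" if "x \<in> ?J" "y \<in> ?J" "f x - x \<le> 0" "0 \<le> f y - y" for x y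
    using that unfolding connected_iff_interval by blast
  have "0 \<notin> (\<lambda>y. f y - y) ` ?J"
  proof
    assume "0 \<in> (\<lambda>y. f y - y) ` ?J"
    then obtain y where "y \<in> ?J" "0 = f y - y" by (rule imageE)
    then show False using b unfolding is_bump_iff by simp
  qed
  then have no: "\<not> (x \<in> ?J \<and> y \<in> ?J \<and> f x - x \<le> 0 \<and> 0 \<le> f y - y)" for x y
    using ivt[of x y] by blast
  have "(\<forall>x\<in>?J. x < f x) \<or> (\<forall>x\<in>?J. f x < x)"
  proof (rule ccontr)
    assume "\<not> ?thesis"
    then obtain x y where "x \<in> ?J" "y \<in> ?J" "\<not> x < f x" "\<not> f y < y" by blast
    then show False using no[of x y] by simp
  qed
  then show ?thesis unfolding bump_def using F(3) pl by blast
qed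

text \<open>At a nondyadic point both slopes of an element of the group agree. Next to an interval
  of fixed points both are \<open>1\<close>, so the point would have a neighbourhood of fixed points
  and could not be a frontier point.\<close>

lemma not_bump_dyadic:
  assumes f: "f \<in> thompson_F" and i: "i < npts f" and nb: "\<not> is_bump f i"
  shows "pt f i \<in> dyadic" "pt f (Suc i) \<in> dyadic"
proof -
  note F = thompson_props[OF f]
  have lt: "pt f i < pt f (Suc i)" using pt_less[OF F(2)] i by simp
  have fx: "f x = x" if "x \<in> {pt f i<..<pt f (Suc i)}" for x using not_bump_fixed[OF f i nb that] .
  have dy: "x \<in> dyadic" if x: "x \<in> frontier_pts f" and one: "rgerm f x x 1 \<or> lgerm f x x 1" for x
  proof (rule ccontr)
    assume "x \<notin> dyadic"
    have x': "x \<in> {0<..<1}" "f x = x" "\<not> (\<forall>\<^sub>F y in nhds x. f y = y)" using x frontier_pts_iff[OF F(2)] by auto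
    obtain c where c: "pl_at f x c c" using thompson_F_at[OF f x'(1)] \<open>x \<notin> dyadic\<close> by (auto simp: F_at_def)
    then have "c = 1" using one rgerm_unique lgerm_unique x'(2) unfolding pl_at_def by metis
    then have "\<forall>\<^sub>F y in nhds x. f y = y" using c x'(2) unfolding pl_at_def rgerm_def lgerm_def
      by (auto simp: eventually_nhds_conv_at eventually_at_split)
    then show False using x'(3) by blast
  qed
  show "pt f i \<in> dyadic"
  proof (cases "i = 0")
    case False
    have "rgerm f (pt f i) (pt f i) 1" by (rule rgermI[OF _ lt]) (use fx in auto)
    then show ?thesis using dy pt_frontier[OF F(2)] False i by blast
  qed (use pts_props(5)[OF F(2)] in simp)
  show "pt f (Suc i) \<in> dyadic"
  proof (cases "Suc i = npts f")
    case False
    have "lgerm f (pt f (Suc i)) (pt f (Suc i)) 1" by (rule lgermI[OF _ lt]) (use fx in auto)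
    then show ?thesis using dy pt_frontier[OF F(2), of "Suc i"] False i by simp
  qed (use pts_props(6)[OF F(2)] in simp)
qed

lemma isCont_eventually:
  assumes "isCont k x" "\<forall>\<^sub>F y in nhds (k x). P y" shows "\<forall>\<^sub>F y in nhds x. P (k y)"
proof -
  have "filterlim k (nhds (k x)) (nhds x)" using assms(1) unfolding isCont_def tendsto_at_iff_tendsto_nhds .
  then show ?thesis using assms(2) eventually_compose_filterlim by blast
qed

text \<open>\<open>h\<close> carries fixed points, and neighbourhoods consisting of them, to the
  same for \<open>g\<close>. Being increasing, it maps one sorted list to the other.\<close>

lemma pt_conj:
  assumes f: "f \<in> thompson_F" and h: "h \<in> thompson_F" and g: "g \<in> thompson_F" "g = h \<circ> f \<circ> inv h"
  shows "npts g = npts f" "i \<le> npts f \<Longrightarrow> pt g i = h (pt f i)"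
proof -
  note F = thompson_props[OF f] and H = thompson_props[OF h] and G = thompson_props[OF g(1)]
  have ih: "inv h (h x) = x" "h (inv h x) = x" for x using H(3) by (auto simp: bij_is_inj bij_is_surj surj_f_inv_f)
  have gh: "g (h x) = h (f x)" for x by (simp add: g(2) ih)
  have loc: "(\<forall>\<^sub>F y in nhds (h x). g y = y) \<longleftrightarrow> (\<forall>\<^sub>F y in nhds x. f y = y)" if x: "x \<in> {0<..<1}" for x
  proof
    assume "\<forall>\<^sub>F y in nhds (h x). g y = y"
    then have "\<forall>\<^sub>F y in nhds x. g (h y) = h y"
      by (rule isCont_eventually[OF plmap_isCont[OF H(2) x]])
    then show "\<forall>\<^sub>F y in nhds x. f y = y" by (rule eventually_mono) (metis gh ih(1))
  next
    assume a: "\<forall>\<^sub>F y in nhds x. f y = y"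
    have "isCont (inv h) (h x)" using plmap_isCont[OF plmap_inv[OF H(3,2)]] plmap_in[OF H(2) x] .
    then have "\<forall>\<^sub>F y in nhds (h x). f (inv h y) = inv h y" by (rule isCont_eventually) (simp add: ih a)
    then show "\<forall>\<^sub>F y in nhds (h x). g y = y" by (rule eventually_mono) (metis gh ih(2))
  qed
  have "frontier_pts g = h ` frontier_pts f"
  proof (intro set_eqI iffI)
    fix y assume "y \<in> frontier_pts g"
    then have y: "y \<in> {0<..<1}" "g y = y" "\<not> (\<forall>\<^sub>F z in nhds y. g z = z)" using frontier_pts_iff[OF G(2)] by auto
    obtain x where x: "x \<in> {0<..<1}" "h x = y" using plmap_surj[OF H(2) y(1)] by blast
    have "f x = x" using y(2) gh[of x] x by (metis ih(1))
    then have "x \<in> frontier_pts f" using frontier_pts_iff[OF F(2)] x loc[OF x(1)] y(3) by simp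
    then show "y \<in> h ` frontier_pts f" using x by blast
  next
    fix y assume "y \<in> h ` frontier_pts f"
    then obtain x where x: "x \<in> frontier_pts f" "y = h x" by blast
    then have "x \<in> {0<..<1}" "f x = x" "\<not> (\<forall>\<^sub>F z in nhds x. f z = z)" using frontier_pts_iff[OF F(2)] by auto
    then show "y \<in> frontier_pts g" using frontier_pts_iff[OF G(2)] loc[of x] x gh[of x] plmap_in[OF H(2), of x] by simp
  qed
  then have set: "set (pts g) = set (map h (pts f))" using pts_props(2)[OF F(2)] pts_props(2)[OF G(2)] H(4,5) by auto
  have mono: "h x < h y" if "x \<in> set (pts f)" "y \<in> set (pts f)" "x < y" for x y
  proof -
    have b: "0 \<le> z \<and> z \<le> 1" if "z \<in> set (pts f)" for z using that pts_props(2)[OF F(2)] frontier_pts_iff[OF F(2)] by auto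
    then have "plmap x y (h x) (h y) h" using plmap_subinterval01[OF H(2,4,5)] that by auto
    then show ?thesis by (rule plmap_target)
  qed
  have "sorted_wrt (<) (map h (pts f))" unfolding sorted_wrt_map
    by (rule sorted_wrt_mono_rel[OF _ pts_props(1)[OF F(2)]]) (use mono in auto)
  then have eq: "pts g = map h (pts f)" using strict_sorted_equal[OF _ pts_props(1)[OF G(2)]] set by metis
  show np: "npts g = npts f" by (simp add: npts_def eq)
  show "pt g i = h (pt f i)" if "i \<le> npts f" using that pts_props(4)[OF F(2)] by (simp add: pt_def eq)
qed

section \<open>Bump chains as index pairs\<close>

text \<open>Combinatorial core of a bump chain: \<open>B i\<close> stands for interval
  \<open>i\<close> being a bump and \<open>D i\<close> for the point with index \<open>i\<close>
  being dyadic; the pair holds the first and the last interval index.\<close>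

definition chain_pair :: "(nat \<Rightarrow> bool) \<Rightarrow> (nat \<Rightarrow> bool) \<Rightarrow> nat \<times> nat \<Rightarrow> bool" where
  "chain_pair B D = (\<lambda>(t, u). t \<le> u \<and> (\<forall>i\<in>{t..u}. B i) \<and> D t \<and> D (Suc u) \<and> (\<forall>i\<in>{t<..u}. \<not> D i))"

definition chain_pairs :: "nat \<Rightarrow> (nat \<Rightarrow> bool) \<Rightarrow> (nat \<Rightarrow> bool) \<Rightarrow> (nat \<times> nat) list" where
  "chain_pairs m B D = filter (chain_pair B D) (concat (map (\<lambda>t. map (Pair t) [t..<m]) [0..<m]))"

lemma chain_pairs_set: "(t, u) \<in> set (chain_pairs m B D) \<longleftrightarrow> u < m \<and> chain_pair B D (t, u)"
proof -
  have "set (concat (map (\<lambda>t. map (Pair t) [t..<m]) [0..<m])) = {(t, u). t \<le> u \<and> u < m}" by (auto simp: image_iff)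
  then show ?thesis by (auto simp: chain_pairs_def chain_pair_def)
qed

lemma chain_pair_unique:
  assumes "chain_pair B D (t, u)" "chain_pair B D (t', u')" "t \<le> i" "i \<le> u" "t' \<le> i" "i \<le> u'"
  shows "t = t' \<and> u = u'"
proof -
  have D: "D t" "D t'" "D (Suc u)" "D (Suc u')" "\<And>i. t < i \<Longrightarrow> i \<le> u \<Longrightarrow> \<not> D i" "\<And>i. t' < i \<Longrightarrow> i \<le> u' \<Longrightarrow> \<not> D i"
    using assms(1,2) by (auto simp: chain_pair_def)
  have "t = t'" using D(5)[of t'] D(6)[of t] D(1,2) assms(3-6) by (cases t t' rule: linorder_cases) auto
  moreover have "u = u'" using D(5)[of "Suc u'"] D(6)[of "Suc u"] D(3,4) assms(3-6) by (cases u u' rule: linorder_cases) auto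
  ultimately show ?thesis by blast
qed

text \<open>\<open>t\<close> and \<open>u\<close> are found by walking from \<open>i\<close> to the
  nearest dyadic points on both sides. An interval on the way that is not a bump would contribute a
  nearer dyadic point.\<close>

lemma chain_pair_cover:
  assumes D: "\<And>i. i < m \<Longrightarrow> \<not> B i \<Longrightarrow> D i \<and> D (Suc i)" "D 0" "D m" and i: "i < m" "B i"
  obtains t u where "(t, u) \<in> set (chain_pairs m B D)" "t \<le> i" "i \<le> u"
proof -
  define t where "t = (GREATEST j. j \<le> i \<and> D j)"
  have t: "t \<le> i" "D t" using GreatestI_nat[of "\<lambda>j. j \<le> i \<and> D j" 0 i] D(2) by (auto simp: t_def)
  have tg: "j \<le> t" if "j \<le> i" "D j" for j unfolding t_def using that by (intro Greatest_le_nat[of _ _ i]) auto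
  define u where "u = (LEAST j. i \<le> j \<and> D (Suc j))"
  have ex: "i \<le> m - 1 \<and> D (Suc (m - 1))" using i D(3) by simp
  have u: "i \<le> u" "D (Suc u)" using LeastI[of "\<lambda>j. i \<le> j \<and> D (Suc j)", OF ex] by (auto simp: u_def)
  have ul: "u \<le> j" if "i \<le> j" "D (Suc j)" for j unfolding u_def using that by (intro Least_le) auto
  have um: "u < m" using ul[of "m - 1"] ex i by auto
  have nD: "\<not> D k" if k: "t < k" "k \<le> u" for k
  proof (cases "k \<le> i")
    case True then show ?thesis using tg[of k] k by auto
  next
    case False
    show ?thesis
    proof
      assume "D k"
      then have "u \<le> k - 1" using ul[of "k - 1"] False by simp
      then show False using False k by simp
    qed
  qed
  have "B j" if j: "t \<le> j" "j \<le> u" for j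
  proof (rule ccontr)
    assume nb: "\<not> B j"
    then have Dj: "D j" "D (Suc j)" using D(1)[of j] j um by auto
    have "j \<noteq> i" using nb i by auto
    then consider "j < i" | "i < j" by linarith
    then show False
    proof cases
      case 1 then show False using tg[of "Suc j"] Dj j by simp
    next
      case 2 then show False using nD[of j] Dj j t by simp
    qed
  qed
  then have "chain_pair B D (t, u)" using t u nD by (auto simp: chain_pair_def)
  then show thesis using that um t u chain_pairs_set by blast
qed

lemma sorted_wrt_concat:
  assumes "sorted_wrt (\<lambda>xs ys. \<forall>x\<in>set xs. \<forall>y\<in>set ys. R x y) xss" "\<And>xs. xs \<in> set xss \<Longrightarrow> sorted_wrt R xs"
  shows "sorted_wrt R (concat xss)"
  using assms by (induction xss) (auto simp: sorted_wrt_append)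

lemma chain_pairs_sorted:
  "sorted_wrt (\<lambda>p q. snd p < fst q) (chain_pairs m B D)"
proof -
  define lex where "lex = (\<lambda>p q :: nat \<times> nat. fst p < fst q \<or> fst p = fst q \<and> snd p < snd q)"
  have "sorted_wrt lex (concat (map (\<lambda>t. map (Pair t) [t..<m]) [0..<m]))"
  proof (rule sorted_wrt_concat)
    show "sorted_wrt (\<lambda>xs ys. \<forall>x\<in>set xs. \<forall>y\<in>set ys. lex x y) (map (\<lambda>t. map (Pair t) [t..<m]) [0..<m])"
      unfolding sorted_wrt_map by (rule sorted_wrt_mono_rel[OF _ sorted_wrt_upt]) (auto simp: lex_def)
    fix xs assume "xs \<in> set (map (\<lambda>t. map (Pair t) [t..<m]) [0..<m])"
    then obtain t where "xs = map (Pair t) [t..<m]" by auto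
    then show "sorted_wrt lex xs" by (simp add: sorted_wrt_map lex_def)
  qed
  then have "sorted_wrt lex (chain_pairs m B D)" unfolding chain_pairs_def by (rule sorted_wrt_filter)
  then show ?thesis
  proof (rule sorted_wrt_mono_rel[rotated])
    fix p q assume pq: "p \<in> set (chain_pairs m B D)" "q \<in> set (chain_pairs m B D)" "lex p q"
    obtain t u t' u' where e: "p = (t, u)" "q = (t', u')" by (cases p, cases q)
    have c: "chain_pair B D (t, u)" "chain_pair B D (t', u')" using pq e chain_pairs_set by auto
    show "snd p < fst q"
    proof (rule ccontr)
      assume "\<not> snd p < fst q"
      then have "t' \<le> u" using e by simp
      moreover have "t \<le> t'" "t' \<le> u'" using pq(3) e c by (auto simp: lex_def chain_pair_def)
      ultimately have "t = t' \<and> u = u'" using chain_pair_unique[OF c, of t'] by simp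
      then show False using pq(3) e by (simp add: lex_def)
    qed
  qed
qed

text \<open>Every bump lies in exactly one chain and the chains are ordered, so joining them lists
  the bumps in order.\<close>

lemma chain_pairs_concat:
  assumes D: "\<And>i. i < m \<Longrightarrow> \<not> B i \<Longrightarrow> D i \<and> D (Suc i)" "D 0" "D m"
  shows "concat (map (\<lambda>(t, u). [t..<Suc u]) (chain_pairs m B D)) = filter B [0..<m]"
proof (rule strict_sorted_equal)
  show "sorted_wrt (<) (filter B [0..<m])" by (rule sorted_wrt_filter) simp
  show "sorted_wrt (<) (concat (map (\<lambda>(t, u). [t..<Suc u]) (chain_pairs m B D)))"
  proof (rule sorted_wrt_concat)
    show "sorted_wrt (\<lambda>xs ys. \<forall>x\<in>set xs. \<forall>y\<in>set ys. x < y) (map (\<lambda>(t, u). [t..<Suc u]) (chain_pairs m B D))"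
      unfolding sorted_wrt_map by (rule sorted_wrt_mono_rel[OF _ chain_pairs_sorted]) auto
  qed (auto simp del: upt_Suc)
  show "set (concat (map (\<lambda>(t, u). [t..<Suc u]) (chain_pairs m B D))) = set (filter B [0..<m])"
  proof (intro set_eqI iffI)
    fix i assume "i \<in> set (concat (map (\<lambda>(t, u). [t..<Suc u]) (chain_pairs m B D)))"
    then obtain t u where "(t, u) \<in> set (chain_pairs m B D)" "t \<le> i" "i \<le> u" by force
    then show "i \<in> set (filter B [0..<m])" using chain_pairs_set[of t u m B D] by (auto simp: chain_pair_def)
  next
    fix i assume "i \<in> set (filter B [0..<m])"
    then have i: "i < m" "B i" by auto
    obtain t u where tu: "(t, u) \<in> set (chain_pairs m B D)" "t \<le> i" "i \<le> u"
      by (rule chain_pair_cover[of m B D i]) (use D i in auto)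
    have "i \<in> set ((\<lambda>(t, u). [t..<Suc u]) (t, u))" using tu by (simp del: upt_Suc)
    then show "i \<in> set (concat (map (\<lambda>(t, u). [t..<Suc u]) (chain_pairs m B D)))"
      unfolding set_concat set_map image_image using tu(1) by blast
  qed
qed

text \<open>The list of bumps is cut into consecutive blocks, and the block lengths determine the
  cuts. The dyadic points follow: the left end of a bump is dyadic exactly when a chain starts
  there, and the left end of any other interval always is.\<close>

lemma chain_pairs_determined:
  assumes D: "\<And>i. i < m \<Longrightarrow> \<not> B i \<Longrightarrow> D i \<and> D (Suc i)" "D 0" "D m"
    and E: "\<And>i. i < m \<Longrightarrow> \<not> B i \<Longrightarrow> E i \<and> E (Suc i)" "E 0" "E m"
    and len: "map (\<lambda>(t, u). u - t) (chain_pairs m B D) = map (\<lambda>(t, u). u - t) (chain_pairs m B E)"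
  shows "chain_pairs m B D = chain_pairs m B E" "i \<le> m \<Longrightarrow> D i \<longleftrightarrow> E i"
proof -
  let ?F = "\<lambda>(t, u). [t..<Suc u] :: nat list"
  have le: "t \<le> u" if "(t, u) \<in> set (chain_pairs m B X)" for t u X using that chain_pairs_set[of t u m B X] by (auto simp: chain_pair_def)
  have l: "length (chain_pairs m B D) = length (chain_pairs m B E)" using len by (rule map_eq_imp_length_eq)
  have "map ?F (chain_pairs m B D) = map ?F (chain_pairs m B E)"
  proof (rule concat_injective)
    show "concat (map ?F (chain_pairs m B D)) = concat (map ?F (chain_pairs m B E))"
      using chain_pairs_concat[OF D] chain_pairs_concat[OF E] by simp
    show "length (map ?F (chain_pairs m B D)) = length (map ?F (chain_pairs m B E))" using l by simp
    show "\<forall>(x, y)\<in>set (zip (map ?F (chain_pairs m B D)) (map ?F (chain_pairs m B E))). length x = length y"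
    proof
      fix z assume "z \<in> set (zip (map ?F (chain_pairs m B D)) (map ?F (chain_pairs m B E)))"
      then obtain k where k: "k < length (chain_pairs m B D)"
        "z = (?F (chain_pairs m B D ! k), ?F (chain_pairs m B E ! k))" using l by (auto simp: set_zip)
      obtain t u where p: "chain_pairs m B D ! k = (t, u)" by (cases "chain_pairs m B D ! k")
      obtain t' u' where q: "chain_pairs m B E ! k = (t', u')" by (cases "chain_pairs m B E ! k")
      have "t \<le> u" "t' \<le> u'" using le nth_mem[OF k(1)] nth_mem[of k "chain_pairs m B E"] k(1) l p q by auto
      moreover have "u - t = u' - t'" using arg_cong[OF len, of "\<lambda>xs. xs ! k"] k(1) l p q by simp
      ultimately show "case z of (x, y) \<Rightarrow> length x = length y" using k(2) p q by simp
    qed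
  qed
  moreover have "inj_on ?F (set (chain_pairs m B D) \<union> set (chain_pairs m B E))"
  proof (rule inj_onI)
    fix p q assume pq: "p \<in> set (chain_pairs m B D) \<union> set (chain_pairs m B E)"
      "q \<in> set (chain_pairs m B D) \<union> set (chain_pairs m B E)" "?F p = ?F q"
    obtain t u t' u' where e: "p = (t, u)" "q = (t', u')" by (cases p, cases q)
    have "t \<le> u" "t' \<le> u'" using le pq e by auto
    moreover have "[t..<Suc u] = [t'..<Suc u']" using pq(3) e by simp
    from arg_cong[OF this, of hd] arg_cong[OF this, of last] have "t = t'" "u = u'"
      using \<open>t \<le> u\<close> \<open>t' \<le> u'\<close> by (simp_all add: hd_upt del: upt_Suc)
    ultimately show "p = q" using e by simp
  qed
  ultimately show eq: "chain_pairs m B D = chain_pairs m B E" by (rule map_inj_on)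
  have start: "X i \<longleftrightarrow> (\<exists>u. (i, u) \<in> set (chain_pairs m B X))"
    if X: "\<And>i. i < m \<Longrightarrow> \<not> B i \<Longrightarrow> X i \<and> X (Suc i)" "X 0" "X m" and i: "i < m" "B i" for X i
  proof
    assume "X i"
    obtain t u where tu: "(t, u) \<in> set (chain_pairs m B X)" "t \<le> i" "i \<le> u"
      by (rule chain_pair_cover[of m B X i]) (use X i in auto)
    then have "t = i" using \<open>X i\<close> chain_pairs_set[of t u m B X] by (force simp: chain_pair_def)
    then show "\<exists>u. (i, u) \<in> set (chain_pairs m B X)" using tu by blast
  next
    assume "\<exists>u. (i, u) \<in> set (chain_pairs m B X)"
    then show "X i" using chain_pairs_set[of i _ m B X] by (auto simp: chain_pair_def)
  qed
  assume "i \<le> m"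
  then consider "i = m" | "i < m" "\<not> B i" | "i < m" "B i" by linarith
  then show "D i \<longleftrightarrow> E i"
  proof cases
    case 3 then show ?thesis using start[OF D 3] start[OF E 3] eq by simp
  qed (use D E in auto)
qed

definition bump_runs :: "(real \<Rightarrow> real) \<Rightarrow> (nat \<times> nat) list" where
  "bump_runs f = chain_pairs (npts f) (is_bump f) (\<lambda>i. pt f i \<in> dyadic)"

lemma bump_chains_eq:
  assumes f: "f \<in> thompson_F"
  shows "bump_chains f = map (\<lambda>(t, u). map (\<lambda>i. (pt f i, pt f (Suc i))) [t..<Suc u]) (bump_runs f)"
proof -
  note F = thompson_props[OF f]
  define m where "m = npts f"
  define I where "I = (\<lambda>i. (pt f i, pt f (Suc i)))"
  define K where "K = (\<lambda>(t, u). map I [t..<Suc u])"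
  define ps where "ps = concat (map (\<lambda>t. map (Pair t) [t..<m]) [0..<m])"
  have int: "intervals f = map I [0..<m]" using intervals_pt[OF F(2)] by (simp add: I_def m_def)
  have nth: "map ((!) (intervals f)) [t..<Suc u] = K (t, u)" if "u < m" for t u
    unfolding K_def int using that by (auto simp del: upt_Suc)
  have "bump_chains f = filter (bump_chain f) (concat (map (\<lambda>t. map (\<lambda>u. K (t, u)) [t..<m]) [0..<m]))"
    unfolding bump_chains_def int[symmetric] using nth
    by (intro arg_cong[where f = "filter (bump_chain f)"] arg_cong[where f = concat] map_cong)
      (auto simp: int simp del: upt_Suc)
  also have "concat (map (\<lambda>t. map (\<lambda>u. K (t, u)) [t..<m]) [0..<m]) = map K ps"
    unfolding ps_def map_concat by (simp add: o_def)
  also have "filter (bump_chain f) (map K ps) = map K (filter (bump_chain f \<circ> K) ps)" by (simp add: filter_map)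
  also have "filter (bump_chain f \<circ> K) ps = filter (chain_pair (is_bump f) (\<lambda>i. pt f i \<in> dyadic)) ps"
  proof (rule filter_cong[OF refl])
    fix p assume "p \<in> set ps"
    then obtain t u where p: "p = (t, u)" "t \<le> u" "u < m" by (auto simp: ps_def)
    have "hd (K p) = I t" "last (K p) = I u" "K p \<noteq> []" unfolding K_def p using p(2) by (simp_all add: hd_map last_map hd_upt del: upt_Suc)
    moreover have "set (K p) = I ` {t..u}" unfolding K_def p by (auto simp del: upt_Suc)
    moreover have "set (butlast (K p)) = I ` {t..<u}" unfolding K_def p using p(2) by (simp add: map_butlast[symmetric])
    moreover have "(\<forall>i\<in>{t..<u}. pt f (Suc i) \<notin> dyadic) \<longleftrightarrow> (\<forall>i\<in>{t<..u}. pt f i \<notin> dyadic)"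
    proof -
      have eq: "{t<..u} = Suc ` {t..<u}" by (simp add: image_Suc_atLeastLessThan atLeastLessThanSuc_atLeastAtMost atLeastSucAtMost_greaterThanAtMost)
      show ?thesis unfolding eq by blast
    qed
    ultimately show "(bump_chain f \<circ> K) p \<longleftrightarrow> chain_pair (is_bump f) (\<lambda>i. pt f i \<in> dyadic) p"
      using p(2) unfolding o_def bump_chain_def chain_pair_def p by (auto simp: I_def is_bump_def)
  qed
  finally show ?thesis unfolding bump_runs_def chain_pairs_def ps_def m_def K_def I_def .
qed

section \<open>Comparing the invariants\<close>

lemma bump_domains_eq:
  assumes "f \<in> thompson_F"
  shows "bump_domains f = map (\<lambda>i. (pt f i, pt f (Suc i))) (filter (is_bump f) [0..<npts f])"
  unfolding bump_domains_def intervals_pt[OF thompson_props(2)[OF assms]] filter_map is_bump_def o_def ..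

text \<open>The sign is expressed by the initial slope, so that \<open>Sigma1\<close> can be
  compared through the positions of the bumps and \<open>Sigma2\<close>.\<close>

lemma eps_midpoint:
  assumes f: "f \<in> thompson_F" and i: "i < npts f"
  shows "eps f ((pt f i + pt f (Suc i)) / 2) =
    (if is_bump f i then if initial_slope (pt f i) (pt f (Suc i)) f > 1 then 1 else - 1 else 0)"
proof -
  let ?x = "(pt f i + pt f (Suc i)) / 2"
  have x: "?x \<in> {pt f i<..<pt f (Suc i)}" using pt_less[OF thompson_props(2)[OF f], of i "Suc i"] i by auto
  show ?thesis
  proof (cases "is_bump f i")
    case False
    then show ?thesis using not_bump_fixed[OF f i False x] by (simp add: eps_def)
  next
    case True
    have b: "bump (pt f i) (pt f (Suc i)) f" using is_bump_bump[OF f i True] .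
    then show ?thesis
    proof (cases rule: bump_cases)
      case up
      then show ?thesis using True bump_slope(1)[OF b] up_bump.up[OF up(1) x] by (simp add: eps_def)
    next
      case down
      have "\<not> up_bump (pt f i) (pt f (Suc i)) f" using not_up_both down(1) by blast
      then show ?thesis using True bump_slope(1)[OF b] down(3)[OF x] by (simp add: eps_def)
    qed
  qed
qed

text \<open>\<open>Sigma1\<close> shows which intervals are bumps. Hence the lists in
  \<open>Sigma2\<close> and \<open>Sigma3\<close>, which skip the other intervals, belong to the
  same positions and can be compared entry by entry.\<close>

lemma Sigma_eq_iff:
  assumes f: "f \<in> thompson_F" and g: "g \<in> thompson_F"
  shows "Sigma_inv f = Sigma_inv g \<longleftrightarrow> npts f = npts g \<and> (\<forall>i<npts f. (is_bump f i \<longleftrightarrow> is_bump g i) \<and>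
    (is_bump f i \<longrightarrow> initial_slope (pt f i) (pt f (Suc i)) f = initial_slope (pt g i) (pt g (Suc i)) g \<and>
      psi_class (pt f i) (pt f (Suc i)) f = psi_class (pt g i) (pt g (Suc i)) g))" (is "?L \<longleftrightarrow> ?R")
proof -
  have 1: "Sigma1 k = map (\<lambda>i. eps k ((pt k i + pt k (Suc i)) / 2)) [0..<npts k]" if "k \<in> thompson_F" for k
    by (simp add: Sigma1_def intervals_pt[OF thompson_props(2)[OF that]])
  have 2: "Sigma2 k = map (\<lambda>i. initial_slope (pt k i) (pt k (Suc i)) k) (filter (is_bump k) [0..<npts k])"
    "Sigma3 k = map (\<lambda>i. psi_class (pt k i) (pt k (Suc i)) k) (filter (is_bump k) [0..<npts k])" if "k \<in> thompson_F" for k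
    by (simp_all add: Sigma2_def Sigma3_def bump_domains_eq[OF that])
  show ?thesis
  proof
    assume ?L
    then have S: "Sigma1 f = Sigma1 g" "Sigma2 f = Sigma2 g" "Sigma3 f = Sigma3 g" by (auto simp: Sigma_inv_def)
    have n: "npts f = npts g" using arg_cong[OF S(1), of length] by (simp add: 1[OF f] 1[OF g])
    have e: "eps f ((pt f i + pt f (Suc i)) / 2) = eps g ((pt g i + pt g (Suc i)) / 2)" if "i < npts f" for i
      using S(1) that unfolding 1[OF f] 1[OF g] n by (simp add: map_eq_conv)
    have b: "is_bump f i \<longleftrightarrow> is_bump g i" if "i < npts f" for i
      using e[OF that] eps_midpoint[OF f that] eps_midpoint[OF g, of i] that n by (auto split: if_splits)
    then have fl: "filter (is_bump f) [0..<npts f] = filter (is_bump g) [0..<npts g]"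
      unfolding n by (intro filter_cong) (auto simp: n)
    have "\<forall>i\<in>set (filter (is_bump g) [0..<npts g]).
      initial_slope (pt f i) (pt f (Suc i)) f = initial_slope (pt g i) (pt g (Suc i)) g"
      using S(2) unfolding 2[OF f] 2[OF g] fl by (simp only: map_eq_conv)
    moreover have "\<forall>i\<in>set (filter (is_bump g) [0..<npts g]).
      psi_class (pt f i) (pt f (Suc i)) f = psi_class (pt g i) (pt g (Suc i)) g"
      using S(3) unfolding 2[OF f] 2[OF g] fl by (simp only: map_eq_conv)
    ultimately show ?R using n b by simp
  next
    assume R: ?R
    then have fl: "filter (is_bump f) [0..<npts f] = filter (is_bump g) [0..<npts g]"
      by (intro filter_cong) auto
    have "Sigma1 f = Sigma1 g" unfolding 1[OF f] 1[OF g]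
    proof (rule map_cong)
      fix i assume "i \<in> set [0..<npts g]"
      then have i: "i < npts f" "i < npts g" using R by auto
      show "eps f ((pt f i + pt f (Suc i)) / 2) = eps g ((pt g i + pt g (Suc i)) / 2)"
        unfolding eps_midpoint[OF f i(1)] eps_midpoint[OF g i(2)] using R i by simp
    qed (use R in simp)
    moreover have "Sigma2 f = Sigma2 g" unfolding 2[OF f] 2[OF g] fl by (rule map_cong) (use R in auto)
    moreover have "Sigma3 f = Sigma3 g" unfolding 2[OF f] 2[OF g] fl by (rule map_cong) (use R in auto)
    ultimately show ?L by (simp add: Sigma_inv_def)
  qed
qed

text \<open>The relation defining \<Delta> with the slopes of the roots as parameters, so that the
  relations of two maps can be compared without their intervals.\<close>

definition slope_rel :: "nat \<Rightarrow> (nat \<Rightarrow> real) \<Rightarrow> (nat \<Rightarrow> real) \<Rightarrow> (real list \<times> real list) set" where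
  "slope_rel s l u = {(x, y). length x = s \<and> length y = s \<and>
     (\<exists>(m::int) (n :: nat \<Rightarrow> int). 2 powi m * x ! 0 = l 0 powi n 0 * y ! 0 \<and>
        (\<forall>i \<in> {1..<s}. u (i - 1) powi n (i - 1) * x ! i = l i powi n i * y ! i))}"

lemma slope_rel_iff:
  assumes "length x = s" "length y = s"
  shows "(x, y) \<in> slope_rel s l u \<longleftrightarrow> (\<exists>(m::int) (n :: nat \<Rightarrow> int). 2 powi m * x ! 0 = l 0 powi n 0 * y ! 0 \<and>
        (\<forall>i \<in> {1..<s}. u (i - 1) powi n (i - 1) * x ! i = l i powi n i * y ! i))"
  using assms by (simp add: slope_rel_def)

lemma slope_rel_cong:
  assumes "0 < s" "\<And>i. i < s \<Longrightarrow> l i = l' i" "\<And>i. i < s \<Longrightarrow> u i = u' i" shows "slope_rel s l u = slope_rel s l' u'"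
proof -
  have "(\<forall>i \<in> {1..<s}. u (i - 1) powi n (i - 1) * x ! i = l i powi n i * y ! i) \<longleftrightarrow>
    (\<forall>i \<in> {1..<s}. u' (i - 1) powi n (i - 1) * x ! i = l' i powi n i * y ! i)" for x y :: "real list" and n :: "nat \<Rightarrow> int"
    by (rule ball_cong[OF refl]) (use assms in auto)
  then show ?thesis unfolding slope_rel_def using assms(1) assms(2)[of 0] by simp
qed

text \<open>Since all slopes are nonzero, exponents can be negated for symmetry and added for
  transitivity.\<close>

lemma equiv_slope_rel:
  assumes pos: "0 < s" "\<And>i. i < s \<Longrightarrow> l i > 0" "\<And>i. i < s \<Longrightarrow> u i > 0"
  shows "equiv {x. length x = s} (slope_rel s l u)"
proof (rule equivI)
  show "slope_rel s l u \<subseteq> {x. length x = s} \<times> {x. length x = s}" by (auto simp: slope_rel_def)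
  show "refl_on {x. length x = s} (slope_rel s l u)"
    by (auto simp: refl_on_def slope_rel_def intro!: exI[of _ "0::int"] exI[of _ "\<lambda>_. 0::int"])
  have nz: "l i \<noteq> 0" "u i \<noteq> 0" if "i < s" for i using pos(2,3)[OF that] by auto
  show "sym (slope_rel s l u)"
  proof (rule symI)
    fix x y assume "(x, y) \<in> slope_rel s l u"
    then obtain m n where L: "length x = s" "length y = s" and m: "2 powi m * x ! 0 = l 0 powi n 0 * y ! 0"
      and n: "\<And>i. i \<in> {1..<s} \<Longrightarrow> u (i - 1) powi n (i - 1) * x ! i = l i powi n i * y ! i" by (auto simp: slope_rel_def)
    have flip: "a powi (- p) * v = b powi (- q) * w" if "a powi p * w = b powi q * v" "a \<noteq> 0" "b \<noteq> 0" for a b v w :: real and p q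
    proof -
      have "a powi p \<noteq> 0" "b powi q \<noteq> 0" using that by auto
      then show ?thesis using that(1) by (simp add: power_int_minus field_simps)
    qed
    have "2 powi (- m) * y ! 0 = l 0 powi (- n 0) * x ! 0" by (rule flip[OF m]) (use nz pos in auto)
    moreover have "u (i - 1) powi (- n (i - 1)) * y ! i = l i powi (- n i) * x ! i" if "i \<in> {1..<s}" for i
      by (rule flip[OF n[OF that]]) (use nz that in auto)
    ultimately show "(y, x) \<in> slope_rel s l u" unfolding slope_rel_def using L
      by (auto intro!: exI[of _ "- m"] exI[of _ "\<lambda>i. - n i"])
  qed
  show "trans (slope_rel s l u)"
  proof (rule transI)
    fix x y z assume "(x, y) \<in> slope_rel s l u" "(y, z) \<in> slope_rel s l u"
    then obtain m n m' n' where L: "length x = s" "length y = s" "length z = s"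
      and m: "2 powi m * x ! 0 = l 0 powi n 0 * y ! 0" "2 powi m' * y ! 0 = l 0 powi n' 0 * z ! 0"
      and n: "\<And>i. i \<in> {1..<s} \<Longrightarrow> u (i - 1) powi n (i - 1) * x ! i = l i powi n i * y ! i"
        "\<And>i. i \<in> {1..<s} \<Longrightarrow> u (i - 1) powi n' (i - 1) * y ! i = l i powi n' i * z ! i" by (auto simp: slope_rel_def)
    have step: "a powi (p + p') * v = b powi (q + q') * w" if e: "a powi p * v = b powi q * t" "a powi p' * t = b powi q' * w"
      and nz: "a \<noteq> 0" "b \<noteq> 0" for a b v w t :: real and p q p' q'
    proof -
      have "a powi (p + p') * v = a powi p' * (a powi p * v)" using nz by (simp add: power_int_add mult.commute mult.left_commute)
      also have "\<dots> = b powi q * (a powi p' * t)" unfolding e(1) by (simp add: mult.left_commute)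
      also have "\<dots> = b powi (q + q') * w" unfolding e(2) using nz by (simp add: power_int_add)
      finally show ?thesis .
    qed
    have "2 powi (m + m') * x ! 0 = l 0 powi (n 0 + n' 0) * z ! 0" by (rule step[OF m]) (use nz pos in auto)
    moreover have "u (i - 1) powi (n (i - 1) + n' (i - 1)) * x ! i = l i powi (n i + n' i) * z ! i" if "i \<in> {1..<s}" for i
      by (rule step[OF n(1)[OF that] n(2)[OF that]]) (use nz that in auto)
    ultimately show "(x, z) \<in> slope_rel s l u" unfolding slope_rel_def using L
      by (auto intro!: exI[of _ "m + m'"] exI[of _ "\<lambda>i. n i + n' i"])
  qed
qed

definition root_init where "root_init f i = initial_slope (pt f i) (pt f (Suc i)) (root_gen (pt f i) (pt f (Suc i)) f)"
definition root_final where "root_final f i = final_slope (pt f i) (pt f (Suc i)) (root_gen (pt f i) (pt f (Suc i)) f)"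
definition conj_init where "conj_init f i = initial_slope (pt f i) (pt f (Suc i)) (conjugator (pt f i) (pt f (Suc i)) f)"
definition conj_final where "conj_final f i = final_slope (pt f i) (pt f (Suc i)) (conjugator (pt f i) (pt f (Suc i)) f)"
definition gap where "gap f i = pt f (Suc i) - pt f i"

definition run_vec :: "(real \<Rightarrow> real) \<Rightarrow> nat \<Rightarrow> nat \<Rightarrow> real list" where
  "run_vec f t u = map (\<lambda>i. if i = 0 then conj_init f t / gap f t
     else (conj_init f (t + i) / gap f (t + i)) * (gap f (t + (i - 1)) / conj_final f (t + (i - 1)))) [0..<Suc u - t]"

definition run_rel where
  "run_rel f t u = slope_rel (Suc u - t) (\<lambda>i. root_init f (t + i)) (\<lambda>i. root_final f (t + i))"

lemma Delta_inv_eq: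
  assumes "f \<in> thompson_F" shows "Delta_inv f = map (\<lambda>(t, u). run_rel f t u `` {run_vec f t u}) (bump_runs f)"
proof -
  have "chain_rel f (map (\<lambda>i. (pt f i, pt f (Suc i))) [t..<Suc u]) = run_rel f t u"
    "chain_vec f (map (\<lambda>i. (pt f i, pt f (Suc i))) [t..<Suc u]) = run_vec f t u" if "t \<le> u" for t u
  proof -
    define Ds where "Ds = map (\<lambda>i. (pt f i, pt f (Suc i))) [t..<Suc u]"
    have len: "length Ds = Suc u - t" by (simp add: Ds_def del: upt_Suc)
    have nth: "Ds ! i = (pt f (t + i), pt f (Suc (t + i)))" if "i < Suc u - t" for i
      using that by (simp add: Ds_def del: upt_Suc)
    have "chain_rel f Ds = slope_rel (length Ds) (\<lambda>i. case Ds ! i of (a, b) \<Rightarrow> initial_slope a b (root_gen a b f))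
       (\<lambda>i. case Ds ! i of (a, b) \<Rightarrow> final_slope a b (root_gen a b f))"
      unfolding chain_rel_def slope_rel_def Let_def ..
    also have "\<dots> = run_rel f t u" unfolding run_rel_def len
      by (rule slope_rel_cong) (use \<open>t \<le> u\<close> nth in \<open>auto simp: root_init_def root_final_def\<close>)
    finally show "chain_rel f (map (\<lambda>i. (pt f i, pt f (Suc i))) [t..<Suc u]) = run_rel f t u" by (simp only: Ds_def)
    have "chain_vec f Ds = run_vec f t u" unfolding chain_vec_def run_vec_def Let_def len
    proof (rule map_cong[OF refl])
      fix i assume "i \<in> set [0..<Suc u - t]"
      then have i: "i < Suc u - t" by (simp del: upt_Suc)
      then have i': "0 < Suc u - t" "i - 1 < Suc u - t" by auto
      show "(if i = 0 then (case Ds ! 0 of (a, b) \<Rightarrow> initial_slope a b (conjugator a b f)) / (case Ds ! 0 of (a, b) \<Rightarrow> b - a)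
         else (case Ds ! i of (a, b) \<Rightarrow> initial_slope a b (conjugator a b f)) / (case Ds ! i of (a, b) \<Rightarrow> b - a) *
           ((case Ds ! (i - 1) of (a, b) \<Rightarrow> b - a) / (case Ds ! (i - 1) of (a, b) \<Rightarrow> final_slope a b (conjugator a b f)))) =
        (if i = 0 then conj_init f t / gap f t
         else conj_init f (t + i) / gap f (t + i) * (gap f (t + (i - 1)) / conj_final f (t + (i - 1))))"
        using nth[OF i] nth[OF i'(1)] nth[OF i'(2)] by (simp add: conj_init_def conj_final_def gap_def)
    qed
    then show "chain_vec f (map (\<lambda>i. (pt f i, pt f (Suc i))) [t..<Suc u]) = run_vec f t u" by (simp only: Ds_def)
  qed
  moreover have "t \<le> u" if "(t, u) \<in> set (bump_runs f)" for t u
    using that chain_pairs_set[of t u] by (auto simp: bump_runs_def chain_pair_def)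
  ultimately show ?thesis unfolding Delta_inv_def bump_chains_eq[OF assms] by (auto simp del: upt_Suc)
qed

lemma chain_pairs_cong:
  assumes "\<And>i. i < m \<Longrightarrow> B i \<longleftrightarrow> B' i" "\<And>i. i \<le> m \<Longrightarrow> D i \<longleftrightarrow> D' i"
  shows "chain_pairs m B D = chain_pairs m B' D'"
  unfolding chain_pairs_def
proof (rule filter_cong[OF refl])
  fix p assume "p \<in> set (concat (map (\<lambda>t. map (Pair t) [t..<m]) [0..<m]))"
  then obtain t u where "p = (t, u)" "t \<le> u" "u < m" by auto
  then show "chain_pair B D p \<longleftrightarrow> chain_pair B' D' p" using assms by (auto simp: chain_pair_def)
qed

locale same_sigma =
  fixes f g :: "real \<Rightarrow> real"
  assumes f: "f \<in> thompson_F" and g: "g \<in> thompson_F" and sigma: "Sigma_inv f = Sigma_inv g"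
begin

abbreviation "m \<equiv> npts f"

lemmas F = thompson_props[OF f] and G = thompson_props[OF g]

lemma npts_g: "npts g = m"
  and bump_g: "i < m \<Longrightarrow> is_bump g i \<longleftrightarrow> is_bump f i"
  and slope_g: "i < m \<Longrightarrow> is_bump f i \<Longrightarrow> initial_slope (pt f i) (pt f (Suc i)) f = initial_slope (pt g i) (pt g (Suc i)) g"
  and psi_g: "i < m \<Longrightarrow> is_bump f i \<Longrightarrow> psi_class (pt f i) (pt f (Suc i)) f = psi_class (pt g i) (pt g (Suc i)) g"
  using sigma Sigma_eq_iff[OF f g] by simp_all

lemma bumps:
  assumes "i < m" "is_bump f i"
  shows "bump (pt f i) (pt f (Suc i)) f" "bump (pt g i) (pt g (Suc i)) g"
  using is_bump_bump[OF f assms] is_bump_bump[OF g, of i] assms npts_g bump_g by auto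

text \<open>End slope of a conjugating map over interval \<open>i\<close>, with \<open>n\<close>
  running through the coset of the centralizer. For equal \<open>n\<close>, \<open>init_at\<close>
  and \<open>final_at\<close> belong to the same map.\<close>

definition init_at :: "nat \<Rightarrow> int \<Rightarrow> real" where
  "init_at i n = conj_init f i / conj_init g i * (gap g i / gap f i) * root_init f i powi n"

definition final_at :: "nat \<Rightarrow> int \<Rightarrow> real" where
  "final_at i n = conj_final f i / conj_final g i * (gap g i / gap f i) * root_final f i powi n"

lemma conj_bump_exists:
  assumes i: "i < m" "is_bump f i"
  obtains h where "plmap (pt f i) (pt f (Suc i)) (pt g i) (pt g (Suc i)) h"
    "\<And>x. x \<in> {pt f i<..<pt f (Suc i)} \<Longrightarrow> h (f x) = g (h x)"
    "initial_slope (pt f i) (pt f (Suc i)) h = init_at i n" "final_slope (pt f i) (pt f (Suc i)) h = final_at i n"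
  using bump_conj_exists[OF bumps[OF i] slope_g[OF i] psi_g[OF i], of n]
  unfolding init_at_def final_at_def conj_init_def conj_final_def gap_def root_init_def root_final_def by blast

lemma conj_bump_slopes:
  assumes i: "i < m" "is_bump f i" and h: "plmap (pt f i) (pt f (Suc i)) (pt g i) (pt g (Suc i)) h"
    and conj: "\<And>x. x \<in> {pt f i<..<pt f (Suc i)} \<Longrightarrow> h (f x) = g (h x)"
  shows "\<exists>n. initial_slope (pt f i) (pt f (Suc i)) h = init_at i n \<and> final_slope (pt f i) (pt f (Suc i)) h = final_at i n"
  using bump_conj_slopes[OF bumps[OF i] h conj]
  unfolding init_at_def final_at_def conj_init_def conj_final_def gap_def root_init_def root_final_def .

lemma root_g:
  assumes i: "i < m" "is_bump f i" shows "root_init g i = root_init f i" "root_final g i = root_final f i"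
proof -
  obtain h where "plmap (pt f i) (pt f (Suc i)) (pt g i) (pt g (Suc i)) h"
    "\<And>x. x \<in> {pt f i<..<pt f (Suc i)} \<Longrightarrow> h (f x) = g (h x)" using conj_bump_exists[OF i] by metis
  from root_conj_invariant[OF bumps[OF i] this] show "root_init g i = root_init f i" "root_final g i = root_final f i"
    by (auto simp: root_init_def root_final_def)
qed

lemma pos:
  assumes i: "i < m" "is_bump f i"
  shows "root_init f i > 0" "root_final f i > 0" "conj_init f i > 0" "conj_final f i > 0"
    "conj_init g i > 0" "conj_final g i > 0" "gap f i > 0" "gap g i > 0"
proof -
  note B = bumps[OF i]
  have r: "plmap (pt f i) (pt f (Suc i)) (pt f i) (pt f (Suc i)) (root_gen (pt f i) (pt f (Suc i)) f)"
    using PL_plmap[OF root_gen_props(1)[OF B(1)] bumpD(3)[OF B(1)]] .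
  have k: "plmap (pt f i) (pt f (Suc i)) (pt f i) (pt f (Suc i)) (conjugator (pt f i) (pt f (Suc i)) f)"
    using PL_plmap[OF conjugator_props(1)[OF B(1)] bumpD(3)[OF B(1)]] .
  have k': "plmap (pt g i) (pt g (Suc i)) (pt g i) (pt g (Suc i)) (conjugator (pt g i) (pt g (Suc i)) g)"
    using PL_plmap[OF conjugator_props(1)[OF B(2)] bumpD(3)[OF B(2)]] .
  show "root_init f i > 0" "root_final f i > 0" "conj_init f i > 0" "conj_final f i > 0"
    "conj_init g i > 0" "conj_final g i > 0" "gap f i > 0" "gap g i > 0"
    using initial_slope_pos[OF r] final_slope_pos[OF r] initial_slope_pos[OF k] final_slope_pos[OF k]
      initial_slope_pos[OF k'] final_slope_pos[OF k'] bumpD(3)[OF B(1)] bumpD(3)[OF B(2)]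
    by (auto simp: root_init_def root_final_def conj_init_def conj_final_def gap_def)
qed

lemma init_at_iff:
  assumes i: "i < m" "is_bump f i"
  shows "init_at i n = c \<longleftrightarrow> c * (conj_init g i / gap g i) = root_init f i powi n * (conj_init f i / gap f i)"
  unfolding init_at_def using pos[OF i] by (auto simp: field_simps)

text \<open>Absence of a node at a common end point, with the quantities of \<open>g\<close> moved
  to one side and those of \<open>f\<close> to the other. The result is one equation of the relation
  in \<Delta>.\<close>

lemma final_init_iff:
  assumes i: "Suc i < m" "is_bump f i" "is_bump f (Suc i)"
  shows "final_at i k = init_at (Suc i) n \<longleftrightarrow>
    root_final f i powi k * ((conj_init g (Suc i) / gap g (Suc i)) * (gap g i / conj_final g i)) =
    root_init f (Suc i) powi n * ((conj_init f (Suc i) / gap f (Suc i)) * (gap f i / conj_final f i))"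
proof -
  have "i < m" using i by simp
  define x where "x = root_final f i powi k"
  define y where "y = root_init f (Suc i) powi n"
  show ?thesis
    unfolding init_at_def final_at_def x_def[symmetric] y_def[symmetric]
    using pos[OF \<open>i < m\<close> i(2)] pos[OF i(1,3)] by (auto simp: field_simps)
qed

text \<open>The exponents in the equivalence relation are choices of conjugating maps, one for each
  bump. The first equation makes the initial slope of the chain a power of \<open>2\<close>; the
  others make the slopes match at the points in between.\<close>

lemma run_class_eq_iff:
  assumes tu: "t \<le> u" "u < m" "\<And>i. t \<le> i \<Longrightarrow> i \<le> u \<Longrightarrow> is_bump f i"
  shows "run_rel f t u `` {run_vec f t u} = run_rel g t u `` {run_vec g t u} \<longleftrightarrow>
    (\<exists>M n. init_at t (n t) = 2 powi M \<and> (\<forall>i\<in>{t..<u}. final_at i (n i) = init_at (Suc i) (n (Suc i))))"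
proof -
  define s where "s = Suc u - t"
  have s: "0 < s" "i < s \<Longrightarrow> t + i < m \<and> is_bump f (t + i)" for i using tu by (auto simp: s_def)
  \<comment> \<open>Slopes of roots are conjugacy invariants, so both classes are taken with respect
    to the same relation.\<close>
  have rel: "run_rel g t u = run_rel f t u" unfolding run_rel_def s_def[symmetric]
    by (rule slope_rel_cong) (use s root_g in auto)
  have eq: "equiv {x. length x = s} (run_rel f t u)" unfolding run_rel_def s_def[symmetric]
    by (rule equiv_slope_rel) (use s pos in auto)
  have len: "length (run_vec f t u) = s" "length (run_vec g t u) = s" by (simp_all add: run_vec_def s_def)
  have v0: "run_vec k t u ! 0 = conj_init k t / gap k t" for k using s(1) by (simp add: run_vec_def s_def)
  have vS: "run_vec k t u ! Suc i = (conj_init k (Suc (t + i)) / gap k (Suc (t + i))) * (gap k (t + i) / conj_final k (t + i))"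
    if "Suc i < s" for k i using that by (simp add: run_vec_def s_def del: upt_Suc)
  have "(run_vec g t u, run_vec f t u) \<in> run_rel f t u \<longleftrightarrow>
    (\<exists>M n. 2 powi M * run_vec g t u ! 0 = root_init f (t + 0) powi n 0 * run_vec f t u ! 0 \<and>
      (\<forall>i\<in>{1..<s}. root_final f (t + (i - 1)) powi n (i - 1) * run_vec g t u ! i = root_init f (t + i) powi n i * run_vec f t u ! i))"
    unfolding run_rel_def s_def[symmetric]
    by (rule slope_rel_iff[OF len(2,1), where l = "\<lambda>i. root_init f (t + i)" and u = "\<lambda>i. root_final f (t + i)"])
  also have "\<dots> \<longleftrightarrow> (\<exists>M n. init_at t (n (0::nat)) = 2 powi M \<and> (\<forall>i. Suc i < s \<longrightarrow> final_at (t + i) (n i) = init_at (Suc (t + i)) (n (Suc i))))"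
  proof -
    have tm: "t < m" by (rule le_less_trans[OF tu(1,2)])
    have bt: "is_bump f t" by (rule tu(3)[OF order_refl tu(1)])
    have 1: "2 powi M * run_vec g t u ! 0 = root_init f t powi k * run_vec f t u ! 0 \<longleftrightarrow> init_at t k = 2 powi M" for M k
      unfolding v0 by (rule init_at_iff[OF tm bt, symmetric])
    have 2: "root_final f (t + i) powi k * run_vec g t u ! Suc i = root_init f (t + Suc i) powi l * run_vec f t u ! Suc i \<longleftrightarrow>
      final_at (t + i) k = init_at (Suc (t + i)) l" if "Suc i < s" for i k l
    proof -
      have "Suc (t + i) < m" "is_bump f (t + i)" "is_bump f (Suc (t + i))" using s(2)[of i] s(2)[of "Suc i"] that by auto
      then show ?thesis unfolding vS[OF that] add_Suc_right by (rule final_init_iff[symmetric])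
    qed
    have 3: "(\<forall>i\<in>{1..<s}. P i) \<longleftrightarrow> (\<forall>i. Suc i < s \<longrightarrow> P (Suc i))" for P
    proof safe
      fix i assume "\<forall>i. Suc i < s \<longrightarrow> P (Suc i)" "i \<in> {1..<s}" then show "P i" by (cases i) auto
    qed auto
    have 4: "(\<forall>i\<in>{1..<s}. root_final f (t + (i - 1)) powi n (i - 1) * run_vec g t u ! i = root_init f (t + i) powi n i * run_vec f t u ! i) \<longleftrightarrow>
      (\<forall>i. Suc i < s \<longrightarrow> final_at (t + i) (n i) = init_at (Suc (t + i)) (n (Suc i)))" for n
      unfolding 3 diff_Suc_1
    proof (intro all_cong1 imp_cong refl)
      fix i assume "Suc i < s"
      then show "(root_final f (t + i) powi n i * run_vec g t u ! Suc i = root_init f (t + Suc i) powi n (Suc i) * run_vec f t u ! Suc i) =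
        (final_at (t + i) (n i) = init_at (Suc (t + i)) (n (Suc i)))" by (rule 2)
    qed
    show ?thesis unfolding add_0_right 1 4 ..
  qed
  \<comment> \<open>From positions within the chain to absolute interval indices, shifted by
    \<open>t\<close>.\<close>
  also have "\<dots> \<longleftrightarrow> (\<exists>M n. init_at t (n t) = 2 powi M \<and> (\<forall>i\<in>{t..<u}. final_at i (n i) = init_at (Suc i) (n (Suc i))))"
  proof
    assume "\<exists>M n. init_at t (n (0::nat)) = 2 powi M \<and> (\<forall>i. Suc i < s \<longrightarrow> final_at (t + i) (n i) = init_at (Suc (t + i)) (n (Suc i)))"
    then obtain M n where n: "init_at t (n (0::nat)) = 2 powi M"
      "\<And>i. Suc i < s \<Longrightarrow> final_at (t + i) (n i) = init_at (Suc (t + i)) (n (Suc i))" by blast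
    have "final_at i (n (i - t)) = init_at (Suc i) (n (Suc i - t))" if "i \<in> {t..<u}" for i
    proof -
      have "Suc (i - t) < s" "t + (i - t) = i" "Suc i - t = Suc (i - t)" using that by (auto simp: s_def)
      then show ?thesis using n(2)[of "i - t"] by simp
    qed
    then show "\<exists>M n. init_at t (n t) = 2 powi M \<and> (\<forall>i\<in>{t..<u}. final_at i (n i) = init_at (Suc i) (n (Suc i)))"
      using n(1) by (intro exI[of _ M] exI[of _ "\<lambda>i. n (i - t)"]) simp
  next
    assume "\<exists>M n. init_at t (n t) = 2 powi M \<and> (\<forall>i\<in>{t..<u}. final_at i (n i) = init_at (Suc i) (n (Suc i)))"
    then obtain M n where "init_at t (n t) = 2 powi M" "\<forall>i\<in>{t..<u}. final_at i (n i) = init_at (Suc i) (n (Suc i))" by blast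
    then show "\<exists>M n. init_at t (n (0::nat)) = 2 powi M \<and> (\<forall>i. Suc i < s \<longrightarrow> final_at (t + i) (n i) = init_at (Suc (t + i)) (n (Suc i)))"
      by (intro exI[of _ M] exI[of _ "\<lambda>i. n (t + i)"]) (simp add: s_def)
  qed
  finally have R: "(run_vec g t u, run_vec f t u) \<in> run_rel f t u \<longleftrightarrow>
    (\<exists>M n. init_at t (n t) = 2 powi M \<and> (\<forall>i\<in>{t..<u}. final_at i (n i) = init_at (Suc i) (n (Suc i))))" .
  have "(run_vec g t u, run_vec f t u) \<in> run_rel f t u \<longleftrightarrow> run_rel f t u `` {run_vec g t u} = run_rel f t u `` {run_vec f t u}"
    using equiv_class_eq_iff[OF eq] len by auto
  then show ?thesis unfolding rel using R by (simp only: eq_commute)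
qed

lemma run_bumps:
  assumes "(t, u) \<in> set (bump_runs f)"
  shows "t \<le> u" "u < m" "\<And>i. t \<le> i \<Longrightarrow> i \<le> u \<Longrightarrow> is_bump f i" "pt f t \<in> dyadic" "pt f (Suc u) \<in> dyadic"
    "\<And>i. t < i \<Longrightarrow> i \<le> u \<Longrightarrow> pt f i \<notin> dyadic"
  using assms unfolding bump_runs_def chain_pairs_set chain_pair_def by auto

lemma f_dyadic:
  "i < m \<Longrightarrow> \<not> is_bump f i \<Longrightarrow> pt f i \<in> dyadic \<and> pt f (Suc i) \<in> dyadic" "pt f 0 \<in> dyadic" "pt f m \<in> dyadic"
  using not_bump_dyadic[OF f] pts_props(5,6)[OF F(2)] by auto

lemma g_dyadic:
  "i < m \<Longrightarrow> \<not> is_bump f i \<Longrightarrow> pt g i \<in> dyadic \<and> pt g (Suc i) \<in> dyadic" "pt g 0 \<in> dyadic" "pt g m \<in> dyadic"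
  using not_bump_dyadic[OF g, of i] pts_props(5,6)[OF G(2)] npts_g bump_g[of i] by auto

lemma runs_g: "bump_runs g = chain_pairs m (is_bump f) (\<lambda>i. pt g i \<in> dyadic)"
  unfolding bump_runs_def npts_g by (rule chain_pairs_cong) (use bump_g in auto)

end

section \<open>Assembling a conjugating element of \<open>F\<close>\<close>

text \<open>One conjugating map per interval is chosen, with exponent \<open>N i\<close> over a bump
  and any suitable map between dyadic intervals otherwise. The slope conditions make each joint
  either dyadic or free of a node.\<close>

lemma (in same_sigma) glue:
  assumes D: "\<And>i. i \<le> m \<Longrightarrow> pt f i \<in> dyadic \<longleftrightarrow> pt g i \<in> dyadic"
    and N1: "\<And>i. i < m \<Longrightarrow> is_bump f i \<Longrightarrow> pt f i \<in> dyadic \<Longrightarrow> pow2 (init_at i (N i))"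
    and N2: "\<And>i. Suc i < m \<Longrightarrow> is_bump f i \<Longrightarrow> is_bump f (Suc i) \<Longrightarrow> pt f (Suc i) \<notin> dyadic \<Longrightarrow>
      final_at i (N i) = init_at (Suc i) (N (Suc i))"
  shows "\<exists>h\<in>thompson_F. g = h \<circ> f \<circ> inv h"
proof -
  define I where "I = (\<lambda>i. {pt f i<..<pt f (Suc i)})"
  have lt: "pt f i < pt f (Suc i)" "pt g i < pt g (Suc i)" if "i < m" for i
    using pt_less[OF F(2)] pt_less[OF G(2)] that npts_g by auto
  define Q where "Q = (\<lambda>i h. plmap (pt f i) (pt f (Suc i)) (pt g i) (pt g (Suc i)) h \<and> (\<forall>x\<in>I i. h (f x) = g (h x)) \<and>
    (is_bump f i \<longrightarrow> initial_slope (pt f i) (pt f (Suc i)) h = init_at i (N i) \<and> final_slope (pt f i) (pt f (Suc i)) h = final_at i (N i)) \<and>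
    (\<not> is_bump f i \<longrightarrow> (\<forall>x\<in>I i. F_at h x)))"
  have ex: "\<exists>h. Q i h" if i: "i < m" for i
  proof (cases "is_bump f i")
    case True
    obtain h where "plmap (pt f i) (pt f (Suc i)) (pt g i) (pt g (Suc i)) h"
      "\<And>x. x \<in> {pt f i<..<pt f (Suc i)} \<Longrightarrow> h (f x) = g (h x)"
      "initial_slope (pt f i) (pt f (Suc i)) h = init_at i (N i)" "final_slope (pt f i) (pt f (Suc i)) h = final_at i (N i)"
      using conj_bump_exists[OF i True, of "N i"] by metis
    then show ?thesis using True by (auto simp: I_def Q_def)
  next
    case False
    obtain h where h: "F_map (pt f i) (pt f (Suc i)) (pt g i) (pt g (Suc i)) h"
      using F_map_exists[of "pt f i" "pt f (Suc i)" "pt g i" "pt g (Suc i)"] f_dyadic(1)[OF i False] g_dyadic(1)[OF i False] lt[OF i] by blast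
    have "h (f x) = g (h x)" if "x \<in> I i" for x
    proof -
      have "h x \<in> {pt g i<..<pt g (Suc i)}" using plmap_in[of _ _ _ _ h x] h that by (auto simp: F_map_def I_def)
      then have "g (h x) = h x" using not_bump_fixed[OF g, of i] i npts_g bump_g False by auto
      moreover have "f x = x" using not_bump_fixed[OF f i False] that by (auto simp: I_def)
      ultimately show ?thesis by simp
    qed
    then show ?thesis using False h by (auto simp: F_map_def I_def Q_def)
  qed
  define hh where "hh = (\<lambda>i. SOME h. Q i h)"
  have "Q i (hh i)" if "i < m" for i unfolding hh_def by (rule someI_ex[OF ex[OF that]])
  define hh where "hh = (\<lambda>i. SOME h. Q i h)"
  have "Q i (hh i)" if "i < m" for i unfolding hh_def by (rule someI_ex[OF ex[OF that]])
  then have hh: "\<And>i. i < m \<Longrightarrow> plmap (pt f i) (pt f (Suc i)) (pt g i) (pt g (Suc i)) (hh i)"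
    "\<And>i x. i < m \<Longrightarrow> x \<in> I i \<Longrightarrow> hh i (f x) = g (hh i x)"
    "\<And>i. i < m \<Longrightarrow> is_bump f i \<Longrightarrow> initial_slope (pt f i) (pt f (Suc i)) (hh i) = init_at i (N i)"
    "\<And>i. i < m \<Longrightarrow> is_bump f i \<Longrightarrow> final_slope (pt f i) (pt f (Suc i)) (hh i) = final_at i (N i)"
    "\<And>i x. i < m \<Longrightarrow> \<not> is_bump f i \<Longrightarrow> x \<in> I i \<Longrightarrow> F_at (hh i) x" unfolding Q_def by blast+
  have in01: "x \<in> {0<..<1}" if "i < m" "x \<in> I i" for i x using interval_inside(1)[OF F(2) that(1)] that(2) by (simp add: I_def)
  \<comment> \<open>Arithmetic travels from left to right. At a dyadic left end it is guaranteed by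
    the power of \<open>2\<close>; at a nondyadic one the germ continues that of the preceding
    interval, which must be a bump.\<close>
  have step: "F_at (hh i) x" if i: "i < m" and prev: "\<And>j. i = Suc j \<Longrightarrow> \<forall>x\<in>I j. F_at (hh j) x" and x: "x \<in> I i" for i x
  proof (cases "is_bump f i")
    case True
    define c where "c = init_at i (N i)"
    have r: "rgerm (hh i) (pt f i) (pt g i) c"
      using plmap_initial[OF hh(1)[OF i]] hh(3)[OF i True] by (simp add: c_def)
    have "pow2 c \<and> pt g i - c * pt f i \<in> dyadic"
    proof (cases "pt f i \<in> dyadic")
      case True': True
      then have "pow2 c" using N1[OF i True] by (simp add: c_def)
      then show ?thesis using True' D[of i] i dyadic_diff dyadic_pow2_mult by auto
    next
      case False
      then obtain j where j: "i = Suc j" using f_dyadic(2) by (cases i) auto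
      then have jm: "j < m" using i by simp
      have b: "is_bump f j" using f_dyadic(1)[OF jm] False j by blast
      have "c = final_at j (N j)" using N2[of j] i b True False j by (simp add: c_def)
      then have "lgerm (hh j) (pt f i) (pt g i) c" using plmap_final[OF hh(1)[OF jm]] hh(4)[OF jm b] j by simp
      moreover have "pt f j < pt f i" using lt(1)[OF jm] j by simp
      ultimately show ?thesis using F_at_final[of "hh j" "pt f i" "pt g i" c "pt f j"] prev[OF j] j by (simp add: I_def)
    qed
    then have init: "F_init (hh i) (pt f i) (pt g i)" unfolding F_init_def using r by blast
    show ?thesis
    proof (rule F_propagate[OF bumps[OF i True] hh(1)[OF i] _ _ _ init])
      show "F_at g y" if "y \<in> {pt g i<..<pt g (Suc i)}" for y
        using thompson_F_at[OF g interval_inside(1)[OF G(2) _ that]] i npts_g by simp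
    qed (use x hh(2)[OF i] thompson_F_at[OF f in01[OF i]] in \<open>auto simp: I_def\<close>)
  qed (use hh(5)[OF i _ x] in blast)
  have Fhh: "\<forall>x\<in>I i. F_at (hh i) x" if "i < m" for i
    using that
  proof (induction i)
    case 0 then show ?case using step[of 0] by blast
  next
    case (Suc i) then show ?case using step[of "Suc i"] Suc_lessD by blast
  qed
  \<comment> \<open>The pieces are controlled on open intervals only, so the values at the joints
    are set separately.\<close>
  define H where "H = (\<lambda>x. if x \<in> {0<..<1} then
    (let i = (THE i. i < m \<and> pt f i \<le> x \<and> x < pt f (Suc i)) in if x = pt f i then pt g i else hh i x) else x)"
  have the: "(THE i. i < m \<and> pt f i \<le> x \<and> x < pt f (Suc i)) = i" if i: "i < m" "pt f i \<le> x" "x < pt f (Suc i)" for i x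
  proof (rule the_equality)
    fix j assume j: "j < m \<and> pt f j \<le> x \<and> x < pt f (Suc j)"
    have "\<not> i < j" using pt_le[OF F(2), of "Suc i" j] i j by auto
    moreover have "\<not> j < i" using pt_le[OF F(2), of "Suc j" i] i j by auto
    ultimately show "j = i" by simp
  qed (use i in blast)
  have H_in: "H x = hh i x" if "i < m" "x \<in> I i" for i x
    unfolding H_def Let_def using the[of i x] in01[OF that] that by (auto simp: I_def)
  have H_pt: "H (pt f i) = pt g i" if i: "i \<le> m" for i
  proof -
    consider "i = 0" | "i = m" | "0 < i" "i < m" using i by linarith
    then show ?thesis
    proof cases
      case 3
      have "pt f i \<in> {0<..<1}" using pt_frontier[OF F(2)] 3 frontier_pts_iff[OF F(2)] by blast
      then show ?thesis unfolding H_def Let_def using the[of i "pt f i"] 3 lt[OF 3(2)] by auto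
    qed (use pts_props(5,6)[OF F(2)] pts_props(5,6)[OF G(2)] npts_g in \<open>auto simp: H_def\<close>)
  qed
  have H_out: "H x = x" if "x \<notin> {0<..<1}" for x unfolding H_def using that by (rule if_not_P)
  have Hr: "rgerm H (pt f i) (pt g i) (initial_slope (pt f i) (pt f (Suc i)) (hh i))" if "i < m" for i
    using rgerm_cong_open[of "pt f i" "pt f (Suc i)" H "hh i"] H_in[OF that] lt[OF that] plmap_initial[OF hh(1)[OF that]]
    by (auto simp: I_def)
  have Hl: "lgerm H (pt f (Suc i)) (pt g (Suc i)) (final_slope (pt f i) (pt f (Suc i)) (hh i))" if "i < m" for i
    using lgerm_cong_open[of "pt f i" "pt f (Suc i)" H "hh i"] H_in[OF that] lt[OF that] plmap_final[OF hh(1)[OF that]]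
    by (auto simp: I_def)
  have HF: "F_at H x" if x: "x \<in> {0<..<1}" for x
  proof -
    obtain i where i: "i < m" "pt f i \<le> x" "x < pt f (Suc i)" using point_cases[OF F(2), of x] x by auto
    show ?thesis
    proof (cases "x = pt f i")
      case False
      then have xi: "x \<in> I i" using i by (simp add: I_def)
      have "F_at H x \<longleftrightarrow> F_at (hh i) x" by (rule F_at_cong_open[of "I i"]) (use xi H_in[OF i(1)] in \<open>auto simp: I_def\<close>)
      then show ?thesis using Fhh[OF i(1)] xi by blast
    next
      case True
      have "i \<noteq> 0" using True x pts_props(5)[OF F(2)] by (cases "i = 0") auto
      then obtain j where j: "i = Suc j" by (cases i) auto
      have jm: "j < m" using i j by simp
      define c where "c = final_slope (pt f j) (pt f (Suc j)) (hh j)"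
      define d where "d = initial_slope (pt f i) (pt f (Suc i)) (hh i)"
      have Hx: "H x = pt g i" using H_pt[of i] i True by simp
      have cd: "pl_at H x c d" unfolding pl_at_def Hx using Hl[OF jm] Hr[OF i(1)] by (simp add: True j c_def d_def)
      have cF: "pow2 c \<and> H x - c * x \<in> dyadic" unfolding Hx unfolding True j c_def
        by (rule F_at_final[OF plmap_final[OF hh(1)[OF jm]] _ lt(1)[OF jm]]) (use Fhh[OF jm] in \<open>auto simp: I_def\<close>)
      have dF: "pow2 d" unfolding d_def by (rule pow2_initial_slope[OF hh(1)[OF i(1)]]) (use Fhh[OF i(1)] in \<open>auto simp: I_def\<close>)
      \<comment> \<open>Only a nondyadic joint is in question; then both neighbours are bumps and
        their slopes were matched by \<open>N2\<close>.\<close>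
      have "c = d \<or> x \<in> dyadic"
      proof (rule disjCI)
        assume nd: "x \<notin> dyadic"
        have b: "is_bump f j" "is_bump f (Suc j)" using nd f_dyadic(1)[OF jm] f_dyadic(1)[OF i(1)] True j by auto
        then show "c = d" using N2[of j] nd i(1) hh(4)[OF jm b(1)] hh(3)[OF i(1)] by (simp add: True j c_def d_def)
      qed
      then show ?thesis unfolding F_at_def using cd cF dF by blast
    qed
  qed
  have m: "0 < m" using pts_props(3)[OF F(2)] by simp
  have Hpl: "plmap 0 1 0 1 H" unfolding plmap_def
  proof (intro conjI ballI)
    show "\<exists>c d. pl_at H x c d" if "x \<in> {0<..<1}" for x using HF[OF that] by (auto simp: F_at_def)
    show "\<exists>c. rgerm H 0 0 c" using Hr[OF m] pts_props(5)[OF F(2)] pts_props(5)[OF G(2)] by auto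
    show "\<exists>c. lgerm H 1 1 c" using Hl[of "m - 1"] m pts_props(6)[OF F(2)] pts_props(6)[OF G(2)] npts_g by auto
  qed simp
  have HPL: "H \<in> PL 0 1" using PL_I[OF Hpl H_out] .
  have HT: "H \<in> thompson_F" using thompson_F_I[OF HPL HF] .
  have bH: "bij H" using PL_bij[OF HPL] by simp
  have conj: "H (f x) = g (H x)" for x
  proof (cases "x \<in> {0<..<1}")
    case False
    then show ?thesis using F(6) G(6) H_out by simp
  next
    case True
    obtain i where i: "i < m" "pt f i \<le> x" "x < pt f (Suc i)" using point_cases[OF F(2), of x] True by auto
    show ?thesis
    proof (cases "x = pt f i")
      case True
      then show ?thesis using pt_fixed[OF f, of i] pt_fixed[OF g, of i] i(1) npts_g H_pt[of i] by simp
    next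
      case False
      then have xi: "x \<in> I i" using i by (simp add: I_def)
      have "f x \<in> I i"
      proof (cases "is_bump f i")
        case True
        then show ?thesis using plmap_in[OF bumpD(2)[OF bumps(1)[OF i(1) True]]] xi by (simp add: I_def)
      next
        case False
        then show ?thesis using not_bump_fixed[OF f i(1) False] xi by (simp add: I_def)
      qed
      then show ?thesis using H_in[OF i(1)] xi hh(2)[OF i(1) xi] by simp
    qed
  qed
  have "g = H \<circ> f \<circ> inv H"
  proof
    fix y
    have "g (H (inv H y)) = H (f (inv H y))" using conj by simp
    then show "g y = (H \<circ> f \<circ> inv H) y" using bH by (simp add: bij_is_surj surj_f_inv_f)
  qed
  then show ?thesis using HT by blast
qed

text \<open>Equal classes give exponents for each chain separately. Every bump lies in exactly one
  chain, so these combine to a single choice \<open>N\<close>.\<close>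

lemma (in same_sigma) conjugate_if_Delta_eq:
  assumes delta: "Delta_inv f = Delta_inv g" shows "\<exists>h\<in>thompson_F. g = h \<circ> f \<circ> inv h"
proof -
  let ?E = "\<lambda>k (t, u). run_rel k t u `` {run_vec k t u}"
  have eq: "map (?E f) (bump_runs f) = map (?E g) (bump_runs g)"
    using delta unfolding Delta_inv_eq[OF f] Delta_inv_eq[OF g] .
  have lenE: "length y = Suc u - t" if "y \<in> ?E k (t, u)" for k t u y
    using that by (auto simp: run_rel_def slope_rel_def)
  have selfE: "run_vec k t u \<in> ?E k (t, u)" if "t \<le> u" for k t u
  proof -
    have "length (run_vec k t u) = Suc u - t" by (simp add: run_vec_def)
    then show ?thesis by (auto simp: run_rel_def slope_rel_def intro!: exI[of _ "0::int"] exI[of _ "\<lambda>_. 0::int"])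
  qed
  have le: "t \<le> u" if "(t, u) \<in> set (bump_runs k)" for t u k
    using that chain_pairs_set[of t u] by (auto simp: bump_runs_def chain_pair_def)
  have ll: "length (bump_runs f) = length (bump_runs g)" using eq by (rule map_eq_imp_length_eq)
  \<comment> \<open>Each class is nonempty and consists of lists as long as its chain, so equal
    classes come from chains of equal length.\<close>
  have "map (\<lambda>(t, u). u - t) (bump_runs f) = map (\<lambda>(t, u). u - t) (bump_runs g)"
  proof (rule nth_equalityI)
    fix k assume "k < length (map (\<lambda>(t, u). u - t) (bump_runs f))"
    then have k: "k < length (bump_runs f)" "k < length (bump_runs g)" using ll by auto
    obtain t u where p: "bump_runs f ! k = (t, u)" by (cases "bump_runs f ! k")
    obtain t' u' where q: "bump_runs g ! k = (t', u')" by (cases "bump_runs g ! k")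
    have tu: "t \<le> u" "t' \<le> u'" using le nth_mem[OF k(1)] nth_mem[OF k(2)] p q by metis+
    have "?E f (t, u) = ?E g (t', u')" using arg_cong[OF eq, of "\<lambda>xs. xs ! k"] k p q by simp
    then have "run_vec f t u \<in> ?E g (t', u')" using selfE[OF tu(1), of f] by blast
    from lenE[OF this] lenE[OF selfE[OF tu(1), of f]] have "u - t = u' - t'" using tu by simp
    then show "map (\<lambda>(t, u). u - t) (bump_runs f) ! k = map (\<lambda>(t, u). u - t) (bump_runs g) ! k" using k p q by simp
  qed (simp add: ll)
  \<comment> \<open>From here on the chains of \<open>f\<close> and \<open>g\<close> have the same
    indices, so their classes can be compared one by one.\<close>
  then have det: "bump_runs f = bump_runs g" "\<And>i. i \<le> m \<Longrightarrow> pt f i \<in> dyadic \<longleftrightarrow> pt g i \<in> dyadic"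
    using chain_pairs_determined[of m "is_bump f" "\<lambda>i. pt f i \<in> dyadic" "\<lambda>i. pt g i \<in> dyadic"] f_dyadic g_dyadic
    unfolding runs_g bump_runs_def[of f] by blast+
  have E: "?E f c = ?E g c" if "c \<in> set (bump_runs f)" for c
    using eq that unfolding det(1)[symmetric] map_eq_conv by blast
  have ex: "\<exists>n. (\<exists>M. init_at (fst c) (n (fst c)) = 2 powi M) \<and> (\<forall>i\<in>{fst c..<snd c}. final_at i (n i) = init_at (Suc i) (n (Suc i)))"
    if c: "c \<in> set (bump_runs f)" for c
  proof -
    obtain t u where tu: "c = (t, u)" by (cases c)
    note R = run_bumps[OF c[unfolded tu]]
    show ?thesis using E[OF c] run_class_eq_iff[OF R(1,2,3)] unfolding tu by auto
  qed
  have "\<forall>c\<in>set (bump_runs f). \<exists>n. (\<exists>M. init_at (fst c) (n (fst c)) = 2 powi M) \<and> (\<forall>i\<in>{fst c..<snd c}. final_at i (n i) = init_at (Suc i) (n (Suc i)))"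
    by (rule ballI) (rule ex)
  from bchoice[OF this] obtain nn where nn: "\<And>c. c \<in> set (bump_runs f) \<Longrightarrow> \<exists>M. init_at (fst c) (nn c (fst c)) = 2 powi M"
    "\<And>c i. c \<in> set (bump_runs f) \<Longrightarrow> i \<in> {fst c..<snd c} \<Longrightarrow> final_at i (nn c i) = init_at (Suc i) (nn c (Suc i))" by blast
  define run where "run = (\<lambda>i. SOME c. c \<in> set (bump_runs f) \<and> fst c \<le> i \<and> i \<le> snd c)"
  have run: "run i \<in> set (bump_runs f) \<and> fst (run i) \<le> i \<and> i \<le> snd (run i)" if i: "i < m" "is_bump f i" for i
  proof -
    obtain t u where "(t, u) \<in> set (bump_runs f)" "t \<le> i" "i \<le> u" unfolding bump_runs_def
      by (rule chain_pair_cover[of m "is_bump f" "\<lambda>i. pt f i \<in> dyadic" i]) (use f_dyadic i in auto)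
    then have "\<exists>c. c \<in> set (bump_runs f) \<and> fst c \<le> i \<and> i \<le> snd c" by force
    then show ?thesis unfolding run_def by (rule someI_ex)
  qed
  have run_unique: "c = d" if "c \<in> set (bump_runs f)" "d \<in> set (bump_runs f)" "fst c \<le> i" "i \<le> snd c" "fst d \<le> i" "i \<le> snd d" for c d i
    using that chain_pair_unique[of "is_bump f" "\<lambda>i. pt f i \<in> dyadic" "fst c" "snd c" "fst d" "snd d" i]
      chain_pairs_set[of "fst c" "snd c"] chain_pairs_set[of "fst d" "snd d"] unfolding bump_runs_def by (auto simp: prod_eq_iff)
  define N where "N = (\<lambda>i. nn (run i) i)"
  show ?thesis
  proof (rule glue[OF det(2), of N])
    fix i assume i: "i < m" "is_bump f i" "pt f i \<in> dyadic"
    obtain t u where tu: "run i = (t, u)" by (cases "run i")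
    have r: "(t, u) \<in> set (bump_runs f)" "t \<le> i" "i \<le> u" using run[OF i(1,2)] tu by auto
    \<comment> \<open>A dyadic left end cannot lie strictly inside a chain, so the chain starts here
      and its first equation applies.\<close>
    have "t = i" using run_bumps(6)[OF r(1), of i] i(3) r by (cases "t = i") auto
    then show "pow2 (init_at i (N i))" using nn(1)[OF r(1)] by (auto simp: N_def tu pow2_def)
  next
    fix i assume i: "Suc i < m" "is_bump f i" "is_bump f (Suc i)" "pt f (Suc i) \<notin> dyadic"
    have im: "i < m" using i by simp
    obtain t u where tu: "run i = (t, u)" by (cases "run i")
    have r: "(t, u) \<in> set (bump_runs f)" "t \<le> i" "i \<le> u" using run[OF im i(2)] tu by auto
    \<comment> \<open>A chain ends at a dyadic point, so the next interval still belongs to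
      it.\<close>
    have "i < u" using run_bumps(5)[OF r(1)] i(4) r(3) by (cases "i = u") auto
    have "run (Suc i) = (t, u)"
      using run_unique[of "run (Suc i)" "(t, u)" "Suc i"] run[OF i(1,3)] r \<open>i < u\<close> by simp
    then show "final_at i (N i) = init_at (Suc i) (N (Suc i))"
      using nn(2)[OF r(1), of i] r(2) \<open>i < u\<close> by (simp add: N_def tu)
  qed
qed

text \<open>The restrictions of \<open>h\<close> to the bumps are conjugating maps, so their end
  slopes supply the exponents of the relation in \<Delta>. Membership of \<open>h\<close> in the
  group supplies the power of \<open>2\<close> and the matching of slopes.\<close>

lemma conjugate_invariants:
  assumes f: "f \<in> thompson_F" and g: "g \<in> thompson_F" and h: "h \<in> thompson_F" "g = h \<circ> f \<circ> inv h"
  shows "Sigma_inv f = Sigma_inv g" "Delta_inv f = Delta_inv g"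
proof -
  note F = thompson_props[OF f] and G = thompson_props[OF g] and H = thompson_props[OF h(1)]
  define m where "m = npts f"
  have np: "npts g = m" and pg: "i \<le> m \<Longrightarrow> pt g i = h (pt f i)" for i
    using pt_conj[OF f h(1) g h(2)] by (auto simp: m_def)
  have gh: "h (f x) = g (h x)" for x using H(3) by (simp add: h(2) bij_is_inj)
  have lt: "pt f i < pt f (Suc i)" if "i < m" for i using pt_less[OF F(2)] that by (simp add: m_def)
  have hi: "plmap (pt f i) (pt f (Suc i)) (pt g i) (pt g (Suc i)) h" if "i < m" for i
    using plmap_subinterval01[OF H(2,4,5), of "pt f i" "pt f (Suc i)"] pt_bounds[OF F(2), of i] pt_bounds[OF F(2), of "Suc i"]
      lt[OF that] pg[of i] pg[of "Suc i"] that by (simp add: m_def)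
  have bg: "is_bump g i \<longleftrightarrow> is_bump f i" if i: "i < m" for i
  proof
    assume "is_bump g i"
    then show "is_bump f i" unfolding is_bump_iff using plmap_in[OF hi[OF i]] gh by metis
  next
    assume b: "is_bump f i"
    show "is_bump g i" unfolding is_bump_iff
    proof
      fix y assume "y \<in> {pt g i<..<pt g (Suc i)}"
      then obtain x where x: "x \<in> {pt f i<..<pt f (Suc i)}" "h x = y" using plmap_surj[OF hi[OF i]] by blast
      then show "g y \<noteq> y" using b gh[of x] H(3) unfolding is_bump_iff by (metis bij_is_inj injD)
    qed
  qed
  have bumps: "bump (pt f i) (pt f (Suc i)) f" "bump (pt g i) (pt g (Suc i)) g" if "i < m" "is_bump f i" for i
    using is_bump_bump[OF f] is_bump_bump[OF g, of i] that np bg by (auto simp: m_def)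
  show S: "Sigma_inv f = Sigma_inv g" unfolding Sigma_eq_iff[OF f g]
  proof (intro conjI allI impI)
    show "npts f = npts g" by (simp add: np m_def)
    fix i assume i: "i < npts f"
    then show "is_bump f i \<longleftrightarrow> is_bump g i" using bg by (simp add: m_def)
    assume b: "is_bump f i"
    have im: "i < m" using i by (simp add: m_def)
    show "initial_slope (pt f i) (pt f (Suc i)) f = initial_slope (pt g i) (pt g (Suc i)) g"
      "psi_class (pt f i) (pt f (Suc i)) f = psi_class (pt g i) (pt g (Suc i)) g"
      using bump_conj_invariants[OF bumps[OF im b] hi[OF im] gh] by auto
  qed
  interpret same_sigma f g by unfold_locales (rule f g S)+
  \<comment> \<open>Elements of the group map exactly the dyadic points to dyadic points, so the
    chains of \<open>f\<close> and \<open>g\<close> have the same indices.\<close>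
  have "pt g i \<in> dyadic \<longleftrightarrow> pt f i \<in> dyadic" if i: "i \<le> m" for i
  proof -
    consider "i = 0" | "i = m" | "0 < i" "i < m" using i by linarith
    then show ?thesis
    proof cases
      case 3
      then have "pt f i \<in> {0<..<1}" using pt_frontier[OF F(2)] frontier_pts_iff[OF F(2)] by (auto simp: m_def)
      then show ?thesis using F_at_dyadic[OF thompson_F_at[OF h(1)]] pg[OF i] by simp
    qed (use f_dyadic g_dyadic in \<open>auto simp: m_def\<close>)
  qed
  then have runs: "bump_runs g = bump_runs f" unfolding runs_g bump_runs_def[of f] by (intro chain_pairs_cong) (auto simp: m_def)
  have "run_rel f t u `` {run_vec f t u} = run_rel g t u `` {run_vec g t u}" if tu: "(t, u) \<in> set (bump_runs f)" for t u
  proof -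
    note R = run_bumps[OF tu]
    have "\<exists>n. initial_slope (pt f i) (pt f (Suc i)) h = init_at i n \<and> final_slope (pt f i) (pt f (Suc i)) h = final_at i n"
      if "i < m" "is_bump f i" for i
      by (rule conj_bump_slopes) (use that hi gh in \<open>auto simp: m_def\<close>)
    then obtain n where n: "\<And>i. i < m \<Longrightarrow> is_bump f i \<Longrightarrow> initial_slope (pt f i) (pt f (Suc i)) h = init_at i (n i)"
      "\<And>i. i < m \<Longrightarrow> is_bump f i \<Longrightarrow> final_slope (pt f i) (pt f (Suc i)) h = final_at i (n i)" by metis
    have um: "u < m" using R(2) by (simp add: m_def)
    have "pow2 (initial_slope (pt f t) (pt f (Suc t)) h)"
    proof (rule pow2_initial_slope[OF hi])
      show "t < m" using R(1) um by simp
      fix x assume "x \<in> {pt f t<..<pt f (Suc t)}"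
      then show "F_at h x" using thompson_F_at[OF h(1)] interval_inside(1)[OF F(2), of t x] R(1,2) by simp
    qed
    then obtain M where "init_at t (n t) = 2 powi M" using n(1)[of t] R(1) R(3)[of t] um by (auto simp: pow2_def)
    moreover have "final_at i (n i) = init_at (Suc i) (n (Suc i))" if i: "i \<in> {t..<u}" for i
    proof -
      have im: "i < m" "Suc i < m" using i um by auto
      have b: "is_bump f i" "is_bump f (Suc i)" using R(3) i by auto
      have nd: "pt f (Suc i) \<notin> dyadic" using R(6) i by auto
      have x: "pt f (Suc i) \<in> {0<..<1}" using pt_frontier[OF F(2), of "Suc i"] im frontier_pts_iff[OF F(2)] by (auto simp: m_def)
      \<comment> \<open>A nondyadic point is not a node of \<open>h\<close>: the final slope before
        it and the initial slope after it coincide.\<close>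
      obtain c where c: "pl_at h (pt f (Suc i)) c c" using thompson_F_at[OF h(1) x] nd by (auto simp: F_at_def)
      have "lgerm h (pt f (Suc i)) (pt g (Suc i)) (final_at i (n i))" using plmap_final[OF hi[OF im(1)]] n(2)[OF im(1) b(1)] by simp
      moreover have "rgerm h (pt f (Suc i)) (pt g (Suc i)) (init_at (Suc i) (n (Suc i)))"
        using plmap_initial[OF hi[OF im(2)]] n(1)[OF im(2) b(2)] by simp
      ultimately show ?thesis using c lgerm_unique rgerm_unique unfolding pl_at_def by metis
    qed
    ultimately show ?thesis using run_class_eq_iff[OF R(1,2,3)] by blast
  qed
  then show "Delta_inv f = Delta_inv g" unfolding Delta_inv_eq[OF f] Delta_inv_eq[OF g] runs by (intro map_cong) auto
qed

theorem theorem1p1: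
  fixes f g :: "real \<Rightarrow> real"
  assumes "f \<in> thompson_F" and "g \<in> thompson_F"
  shows "(\<exists>h \<in> thompson_F. g = h \<circ> f \<circ> inv h) \<longleftrightarrow>
         (Sigma_inv f, Delta_inv f) = (Sigma_inv g, Delta_inv g)"
proof
  assume "\<exists>h \<in> thompson_F. g = h \<circ> f \<circ> inv h"
  then show "(Sigma_inv f, Delta_inv f) = (Sigma_inv g, Delta_inv g)"
    using conjugate_invariants[OF assms] by blast
next
  assume eq: "(Sigma_inv f, Delta_inv f) = (Sigma_inv g, Delta_inv g)"
  then interpret same_sigma f g by unfold_locales (use assms in auto)
  show "\<exists>h \<in> thompson_F. g = h \<circ> f \<circ> inv h" by (rule conjugate_if_Delta_eq) (use eq in simp)
qed

end
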